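(* Let $1<p<\infty$, let $Z=(Z,d,\mu)$ be a $p$-PI space and let $\Omega\subset Z$ be a measurable set satisfying the measure-density condition. If $\Omega$ supports a weak $(1,p)$-Poincaré inequality up to scale $r_0$ for some $r_0>0$, then $\Omega$ is a $\mathbb V$-valued $W^{1,p}$-extension set for every Banach space $\mathbb V$.
   Context: Metric measure space: a triple $(Z,d,\mu)$ with $(Z,d)$ a separable metric space and $\mu$ a Borel regular outer measure with $0<\mu(B)<\infty$ for all open balls $B$. $\mu$ is doubling if there is $c_\mu>0$ with $\mu(2B)\le c_\mu\mu(B)$ for every open ball $B$. $L^p(Z;\mathbb V)$: a map $u:Z\to\mathbb V$ is measurable if preimages of open sets are $\mu$-measurable and $u(Z\setminus N)$ is separable for some $\mu$-null set $N$; $L^p(Z;\mathbb V)$ is the space of a.e.-equivalence classes of measurable $u$ with $|u|\in L^p(Z)$. Newton–Sobolev functions: a path is a continuous $\gamma:[a,b]\to Z$. For Borel $\rho:Z\to[0,\infty]$, $\int_\gamma\rho\,ds$ is the usual integral with respect to the length measure of $\gamma$ if $\gamma$ is rectifiable, and $\infty$ otherwise. A family of paths $\Gamma$ is $p$-negligible if there is an $L^p$-integrable Borel $\rho:Z\to[0,\infty]$ with $\int_\gamma\rho\,ds=\infty$ for all $\gamma\in\Gamma$. A Borel $\rho:Z\to[0,\infty]$ is a $p$-weak upper gradient of $u:Z\to\mathbb V$ if $|u(\gamma(a))-u(\gamma(b))|\le\int_\gamma\rho\,ds$ for all paths $\gamma:[a,b]\to Z$ outside a $p$-negligible family. $W^{1,p}(Z;\mathbb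 V)$ is the set of $u\in L^p(Z;\mathbb V)$ having a representative $\widetilde u$ that admits an $L^p$-integrable $p$-weak upper gradient, with norm $\|u\|_{L^p(Z;\mathbb V)}+\inf_\rho\|\rho\|_{L^p(Z)}$, infimum over $L^p$-integrable $p$-weak upper gradients of $\widetilde u$. For measurable $\Omega\subset Z$, all these notions are defined using the restricted distance and measure. Weak $(1,p)$-Poincaré inequality: a space $X$ supports it if there are $C>0$, $\lambda\ge1$ such that $\frac1{\mu(B)}\int_B|u-u_B|\,d\mu\le C\operatorname{diam}(B)\big(\frac1{\mu(\lambda B)}\int_{\lambda B}\rho^p\,d\mu\big)^{1/p}$ for every ball $B\subset X$, every integrable $u:\lambda B\to\mathbb R$ and every $L^p$-integrable $p$-weak upper gradient $\rho:\lambda B\to[0,\infty]$ of $u$, where $u_B$ is the average of $u$ over $B$; $X$ supports it up to scale $r_0$ if this holds for all balls of radius at most $r_0$. For $X=\Omega$, this refers to $\Omega$ with the restricted distance and measure. A $p$-PI space is a complete metric measure space with $\mu$ doubling and supporting a weak $(1,p)$-Poincaré inequality. Measure-density condition: there is $c_\Omega>0$ with $\mu(B(x,r)\cap\Omega)\ge c_\Omega\,\mu(B(x,r))$ for every $x\in\Omega$, $r\in(0,1]$. $\Omega$ is a $\mathbb V$-valued $W^{1,p}$-extension set if there are $C>0$ and a (not necessarily linear) map $E:W^{1,p}(\Omega;\mathbb V)\to W^{1,p}(Z;\mathbb V)$ with $E(u)|_\Omega=u$ a.e. and $\|E(u)\|_{W^{1,p}(Z;\mathbb V)}\le C\|u\|_{W^{1,p}(\Omega;\mathbb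 V)}$ for all $u$. *)

theory Defs
  imports "HOL-Analysis.Analysis"
begin

text \<open>
  A metric measure space is given by a subset \<open>X\<close> of a type of class \<^class>\<open>metric_space\<close> and a set
  function \<open>\<mu>\<close>, of which only the values on subsets of \<open>X\<close> matter. Passing to a subset \<open>Y \<subseteq> X\<close> with the
  restricted distance and the restricted outer measure amounts to replacing \<open>X\<close> by \<open>Y\<close>, keeping \<open>\<mu>\<close>.
  The open balls of \<open>X\<close> are the sets \<open>X \<inter> ball x r\<close> with \<open>x \<in> X\<close> and \<open>0 < r\<close>; a ball is always taken
  together with a centre and a radius, so that its dilations make sense. Likewise, functions on \<open>X\<close>
  are total functions whose values outside \<open>X\<close> are irrelevant.
\<close>

section \<open>Metric measure spaces\<close>

text \<open>The \<open>\<mu>\<close>-measurable sets are those of Caratheodory.\<close>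

definition outer_measure_measure :: "'a set \<Rightarrow> ('a set \<Rightarrow> ennreal) \<Rightarrow> 'a measure" where
  "outer_measure_measure X \<mu> = measure_of X (lambda_system X (Pow X) \<mu>) \<mu>"

definition borel_regular_outer_measure ::
    "'a::topological_space set \<Rightarrow> ('a set \<Rightarrow> ennreal) \<Rightarrow> bool" where
  "borel_regular_outer_measure X \<mu> \<longleftrightarrow>
     outer_measure_space (Pow X) \<mu> \<and>
     sets (restrict_space borel X) \<subseteq> lambda_system X (Pow X) \<mu> \<and>
     (\<forall>A. A \<subseteq> X \<longrightarrow> (\<exists>B \<in> sets (restrict_space borel X). A \<subseteq> B \<and> \<mu> B = \<mu> A))"

definition metric_measure_space :: "'a::metric_space set \<Rightarrow> ('a set \<Rightarrow> ennreal) \<Rightarrow> bool" where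
  "metric_measure_space X \<mu> \<longleftrightarrow>
     separable_space (top_of_set X) \<and>
     borel_regular_outer_measure X \<mu> \<and>
     (\<forall>x\<in>X. \<forall>r>0. 0 < \<mu> (X \<inter> ball x r) \<and> \<mu> (X \<inter> ball x r) < \<infinity>)"

definition doubling :: "'a::metric_space set \<Rightarrow> ('a set \<Rightarrow> ennreal) \<Rightarrow> bool" where
  "doubling X \<mu> \<longleftrightarrow>
     (\<exists>c::real>0. \<forall>x\<in>X. \<forall>r>0. \<mu> (X \<inter> ball x (2 * r)) \<le> ennreal c * \<mu> (X \<inter> ball x r))"

lemma
  assumes "outer_measure_space (Pow X) \<mu>"
  shows space_outer_measure_measure: "space (outer_measure_measure X \<mu>) = X"
    and sets_outer_measure_measure:
      "sets (outer_measure_measure X \<mu>) = lambda_system X (Pow X) \<mu>"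
    and emeasure_outer_measure_measure:
      "A \<in> lambda_system X (Pow X) \<mu> \<Longrightarrow> emeasure (outer_measure_measure X \<mu>) A = \<mu> A"
proof -
  have ms: "measure_space X (lambda_system X (Pow X) \<mu>) \<mu>"
    by (rule sigma_algebra.caratheodory_lemma[OF sigma_algebra_Pow assms])
  then have sa: "sigma_algebra X (lambda_system X (Pow X) \<mu>)"
    by (simp add: measure_space_def)
  have sub: "lambda_system X (Pow X) \<mu> \<subseteq> Pow X"
    by (auto simp: lambda_system_def)
  show "space (outer_measure_measure X \<mu>) = X"
    by (simp add: outer_measure_measure_def space_measure_of[OF sub])
  show "sets (outer_measure_measure X \<mu>) = lambda_system X (Pow X) \<mu>"
    by (simp add: outer_measure_measure_def sigma_algebra.sets_measure_of_eq[OF sa])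
  show "A \<in> lambda_system X (Pow X) \<mu> \<Longrightarrow> emeasure (outer_measure_measure X \<mu>) A = \<mu> A"
    unfolding outer_measure_measure_def using ms sa
    by (intro emeasure_measure_of_sigma) (auto simp: measure_space_def)
qed

section \<open>Lebesgue spaces\<close>

definition ennreal_powr :: "ennreal \<Rightarrow> real \<Rightarrow> ennreal" where
  "ennreal_powr x a = (if x = \<infinity> then \<infinity> else ennreal (enn2real x powr a))"
  \<comment> \<open>used for \<open>a > 0\<close> only\<close>

definition Lp_norm :: "'a set \<Rightarrow> ('a set \<Rightarrow> ennreal) \<Rightarrow> real \<Rightarrow> ('a \<Rightarrow> ennreal) \<Rightarrow> ennreal" where
  "Lp_norm X \<mu> p f =
     ennreal_powr (\<integral>\<^sup>+ x. ennreal_powr (f x) p \<partial>outer_measure_measure X \<mu>) (1 / p)"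

definition measurable_map ::
    "'a set \<Rightarrow> ('a set \<Rightarrow> ennreal) \<Rightarrow> ('a \<Rightarrow> 'v::topological_space) \<Rightarrow> bool" where
  "measurable_map X \<mu> u \<longleftrightarrow>
     u \<in> borel_measurable (outer_measure_measure X \<mu>) \<and>
     (\<exists>N \<in> null_sets (outer_measure_measure X \<mu>). separable_space (top_of_set (u ` (X - N))))"

text \<open>Elements of \<open>L\<^sup>p\<close> are handled through representatives.\<close>

definition ae_eq ::
    "'a set \<Rightarrow> ('a set \<Rightarrow> ennreal) \<Rightarrow> ('a \<Rightarrow> 'v) \<Rightarrow> ('a \<Rightarrow> 'v) \<Rightarrow> bool" where
  "ae_eq X \<mu> u v \<longleftrightarrow> (AE x in outer_measure_measure X \<mu>. u x = v x)"

definition Lp_map ::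
    "'a set \<Rightarrow> ('a set \<Rightarrow> ennreal) \<Rightarrow> real \<Rightarrow> ('a \<Rightarrow> 'v::real_normed_vector) \<Rightarrow> bool" where
  "Lp_map X \<mu> p u \<longleftrightarrow> measurable_map X \<mu> u \<and> Lp_norm X \<mu> p (\<lambda>x. ennreal (norm (u x))) < \<infinity>"

text \<open>The \<open>L\<^sup>p\<close>-integrable Borel functions from \<open>X\<close> to \<open>[0, \<infinity>]\<close>.\<close>

definition Lp_borel ::
    "'a::topological_space set \<Rightarrow> ('a set \<Rightarrow> ennreal) \<Rightarrow> real \<Rightarrow> ('a \<Rightarrow> ennreal) \<Rightarrow> bool" where
  "Lp_borel X \<mu> p \<rho> \<longleftrightarrow>
     \<rho> \<in> borel_measurable (restrict_space borel X) \<and> Lp_norm X \<mu> p \<rho> < \<infinity>"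

section \<open>Paths and line integrals\<close>

text \<open>A triple \<open>(\<gamma>, a, b)\<close> stands for the path \<open>\<gamma> : [a, b] \<rightarrow> X\<close>.\<close>

type_synonym 'a param_path = "(real \<Rightarrow> 'a) \<times> real \<times> real"

definition paths_in :: "'a::topological_space set \<Rightarrow> 'a param_path set" where
  "paths_in X = {(\<gamma>, a, b). a \<le> b \<and> continuous_on {a..b} \<gamma> \<and> \<gamma> ` {a..b} \<subseteq> X}"

definition path_len :: "(real \<Rightarrow> 'a::metric_space) \<Rightarrow> real \<Rightarrow> real \<Rightarrow> ennreal" where
  "path_len \<gamma> a b =
     (SUP ts \<in> {ts. sorted ts \<and> set ts \<subseteq> {a..b}}.
        \<Sum>i<length ts - 1. ennreal (dist (\<gamma> (ts ! i)) (\<gamma> (ts ! Suc i))))"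

text \<open>
  The length measure of a rectifiable path is the Stieltjes measure of its length function
  \<open>t \<mapsto> path_len \<gamma> a t\<close>, extended to the line by \<open>0\<close> on the left of \<open>a\<close> and constantly on the right of \<open>b\<close>.
\<close>

definition length_measure :: "(real \<Rightarrow> 'a::metric_space) \<Rightarrow> real \<Rightarrow> real \<Rightarrow> real measure" where
  "length_measure \<gamma> a b = interval_measure (\<lambda>t. enn2real (path_len \<gamma> a (min t b)))"

fun line_integral :: "('a::metric_space \<Rightarrow> ennreal) \<Rightarrow> 'a param_path \<Rightarrow> ennreal" where
  "line_integral \<rho> (\<gamma>, a, b) =
     (if path_len \<gamma> a b < \<infinity>
      then \<integral>\<^sup>+ t. \<rho> (\<gamma> t) * indicator {a..b} t \<partial>length_measure \<gamma> a b
      else \<infinity>)"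

section \<open>Newton--Sobolev functions\<close>

definition p_negligible ::
    "'a::metric_space set \<Rightarrow> ('a set \<Rightarrow> ennreal) \<Rightarrow> real \<Rightarrow> 'a param_path set \<Rightarrow> bool" where
  "p_negligible X \<mu> p \<Gamma> \<longleftrightarrow>
     \<Gamma> \<subseteq> paths_in X \<and> (\<exists>\<rho>. Lp_borel X \<mu> p \<rho> \<and> (\<forall>c\<in>\<Gamma>. line_integral \<rho> c = \<infinity>))"

definition weak_upper_gradient ::
    "'a::metric_space set \<Rightarrow> ('a set \<Rightarrow> ennreal) \<Rightarrow> real \<Rightarrow>
     ('a \<Rightarrow> 'v::real_normed_vector) \<Rightarrow> ('a \<Rightarrow> ennreal) \<Rightarrow> bool" where
  "weak_upper_gradient X \<mu> p u \<rho> \<longleftrightarrow>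
     \<rho> \<in> borel_measurable (restrict_space borel X) \<and>
     (\<exists>\<Gamma>. p_negligible X \<mu> p \<Gamma> \<and>
        (\<forall>(\<gamma>, a, b) \<in> paths_in X - \<Gamma>.
           ennreal (norm (u (\<gamma> a) - u (\<gamma> b))) \<le> line_integral \<rho> (\<gamma>, a, b)))"

text \<open>
  The \<open>L\<^sup>p\<close>-integrable \<open>p\<close>-weak upper gradients of the representatives of \<open>u\<close>. Any two representatives
  that admit an \<open>L\<^sup>p\<close>-integrable \<open>p\<close>-weak upper gradient have the same ones, so the infimum below is the
  one over the weak upper gradients of a single such representative.
\<close>

definition sobolev_gradients ::
    "'a::metric_space set \<Rightarrow> ('a set \<Rightarrow> ennreal) \<Rightarrow> real \<Rightarrow>
     ('a \<Rightarrow> 'v::real_normed_vector) \<Rightarrow> ('a \<Rightarrow> ennreal) set" where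
  "sobolev_gradients X \<mu> p u =
     {\<rho>. \<exists>u'. ae_eq X \<mu> u' u \<and> weak_upper_gradient X \<mu> p u' \<rho> \<and> Lp_borel X \<mu> p \<rho>}"

definition sobolev ::
    "'a::metric_space set \<Rightarrow> ('a set \<Rightarrow> ennreal) \<Rightarrow> real \<Rightarrow> ('a \<Rightarrow> 'v::real_normed_vector) set" where
  "sobolev X \<mu> p = {u. Lp_map X \<mu> p u \<and> sobolev_gradients X \<mu> p u \<noteq> {}}"

definition sobolev_norm ::
    "'a::metric_space set \<Rightarrow> ('a set \<Rightarrow> ennreal) \<Rightarrow> real \<Rightarrow> ('a \<Rightarrow> 'v::real_normed_vector) \<Rightarrow> ennreal" where
  "sobolev_norm X \<mu> p u =
     Lp_norm X \<mu> p (\<lambda>x. ennreal (norm (u x))) + (INF \<rho> \<in> sobolev_gradients X \<mu> p u. Lp_norm X \<mu> p \<rho>)"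

section \<open>Poincare inequalities\<close>

text \<open>
  The inequality for the ball of centre \<open>x\<close> and radius \<open>r\<close>. Here \<open>u\<close> and \<open>\<rho>\<close> live on the dilated ball, which
  is regarded as a space of its own.
\<close>

definition poincare_on_ball ::
    "'a::metric_space set \<Rightarrow> ('a set \<Rightarrow> ennreal) \<Rightarrow> real \<Rightarrow> real \<Rightarrow> real \<Rightarrow> 'a \<Rightarrow> real \<Rightarrow> bool" where
  "poincare_on_ball X \<mu> p C l x r \<longleftrightarrow>
     (let B = X \<inter> ball x r;
          lB = X \<inter> ball x (l * r)
      in \<forall>(u :: 'a \<Rightarrow> real) \<rho>.
           integrable (outer_measure_measure lB \<mu>) u \<longrightarrow>
           weak_upper_gradient lB \<mu> p u \<rho> \<longrightarrow> Lp_borel lB \<mu> p \<rho> \<longrightarrow>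
           (let uB = (\<integral>y. u y \<partial>outer_measure_measure B \<mu>) / enn2real (\<mu> B)
            in (\<integral>\<^sup>+ y. ennreal \<bar>u y - uB\<bar> \<partial>outer_measure_measure B \<mu>) / \<mu> B
               \<le> ennreal (C * diameter B) *
                 ennreal_powr ((\<integral>\<^sup>+ y. ennreal_powr (\<rho> y) p \<partial>outer_measure_measure lB \<mu>) / \<mu> lB)
                   (1 / p)))"

definition weak_poincare :: "'a::metric_space set \<Rightarrow> ('a set \<Rightarrow> ennreal) \<Rightarrow> real \<Rightarrow> bool" where
  "weak_poincare X \<mu> p \<longleftrightarrow>
     (\<exists>C>0. \<exists>l\<ge>1. \<forall>x\<in>X. \<forall>r>0. poincare_on_ball X \<mu> p C l x r)"

definition weak_poincare_up_to ::
    "'a::metric_space set \<Rightarrow> ('a set \<Rightarrow> ennreal) \<Rightarrow> real \<Rightarrow> real \<Rightarrow> bool" where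
  "weak_poincare_up_to X \<mu> p r0 \<longleftrightarrow>
     (\<exists>C>0. \<exists>l\<ge>1. \<forall>x\<in>X. \<forall>r>0. r \<le> r0 \<longrightarrow> poincare_on_ball X \<mu> p C l x r)"

definition PI_space :: "'a::metric_space set \<Rightarrow> ('a set \<Rightarrow> ennreal) \<Rightarrow> real \<Rightarrow> bool" where
  "PI_space Z \<mu> p \<longleftrightarrow>
     metric_measure_space Z \<mu> \<and> complete Z \<and> doubling Z \<mu> \<and> weak_poincare Z \<mu> p"

section \<open>Measure density and extension sets\<close>

definition measure_density ::
    "'a::metric_space set \<Rightarrow> ('a set \<Rightarrow> ennreal) \<Rightarrow> 'a set \<Rightarrow> bool" where
  "measure_density Z \<mu> \<Omega> \<longleftrightarrow>
     (\<exists>c::real>0. \<forall>x\<in>\<Omega>. \<forall>r\<in>{0<..1}.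
        ennreal c * \<mu> (Z \<inter> ball x r) \<le> \<mu> (Z \<inter> ball x r \<inter> \<Omega>))"

text \<open>
  The extension operator acts on almost-everywhere classes; on representatives this means that it
  preserves \<^const>\<open>ae_eq\<close>. The type argument gives the target Banach space.
\<close>

definition sobolev_extension_set ::
    "'a::metric_space set \<Rightarrow> ('a set \<Rightarrow> ennreal) \<Rightarrow> real \<Rightarrow> 'a set \<Rightarrow> 'v::banach itself \<Rightarrow> bool" where
  "sobolev_extension_set Z \<mu> p \<Omega> (_ :: 'v itself) \<longleftrightarrow>
     (\<exists>C::real>0. \<exists>E :: ('a \<Rightarrow> 'v) \<Rightarrow> 'a \<Rightarrow> 'v.
        (\<forall>u \<in> sobolev \<Omega> \<mu> p. \<forall>v \<in> sobolev \<Omega> \<mu> p. ae_eq \<Omega> \<mu> u v \<longrightarrow> ae_eq Z \<mu> (E u) (E v)) \<and>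
        (\<forall>u \<in> sobolev \<Omega> \<mu> p.
           E u \<in> sobolev Z \<mu> p \<and> ae_eq \<Omega> \<mu> (E u) u \<and>
           sobolev_norm Z \<mu> p (E u) \<le> ennreal C * sobolev_norm \<Omega> \<mu> p u))"

end

theory Submission
  imports Defs
begin

text \<open>
  Let \<open>u\<close> be a Sobolev function on the set \<open>\<Omega>\<close>, with upper gradient \<open>\<rho>\<close>, and let
  \<open>y n\<close> be dense in the essential range of \<open>u\<close>. The real functions \<open>\<bar>u - y n\<bar>\<close> have the common
  upper gradient \<open>\<rho>\<close>. Let \<open>U \<lambda>\<close> be the union of the balls of radius \<open>r\<close> on which one of these functions
  oscillates by more than \<open>\<lambda> r\<close> on a fixed proportion of the mass; off \<open>U \<lambda>\<close> the map \<open>u\<close> is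
  Lipschitz with constant comparable to \<open>\<lambda>\<close>.

  The covering argument with the \<open>p\<close>-Poincare inequality only yields a weak-type bound for the measure of
  \<open>U \<lambda>\<close>. As in the theorem of Keith and Zhong, one applies the inequality instead to an average of \<open>k\<close>
  Lipschitz truncations at consecutive dyadic levels. The gradient of the average is smaller by
  the factor \<open>1/k\<close> on the bad sets, and as \<open>p > 1\<close> the resulting recursive inequality can be absorbed for
  large \<open>k\<close>. This bounds the sum of \<open>2^(ip) \<mu>(U (2^i))\<close> over all integers \<open>i\<close> by the \<open>p\<close>-th power of
  the Sobolev norm; equivalently, \<open>u\<close> has a Hajlasz gradient in \<open>L^p\<close>.

  The Whitney extension takes, near each Whitney centre outside \<open>\<Omega>\<close>, the value of \<open>u\<close> at a nearby point that
  avoids the bad sets of all levels with small density there; the measure density of \<open>\<Omega>\<close> provides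
  such points. So the extension stays Lipschitz at level \<open>2^i\<close> off the set where the maximal function
  of the indicator of the bad set is large, and it has a Hajlasz gradient in \<open>L^p\<close>. Finally, a map with
  such a gradient \<open>G\<close> is Sobolev: along almost every path it has limits through points where \<open>G\<close>
  is finite, and they define a representative with upper gradient \<open>4 G\<close>.
\<close>

section \<open>Metric measure spaces\<close>

text \<open>Oscillation on a ball is measured by the mass of the set where a function is far from a
  constant, for every constant, and not by a mean. A truncation that agrees with the function off a
  set of small mass then inherits the bad ball, so the Poincare inequality may be applied to it. A
  ball is bad as soon as one \<open>f n\<close> is; since all of them share \<open>\<rho>\<close>,
  one covering treats them together and no vector-valued integral occurs. Averaging k truncations
  pays off because their Lipschitz constants are dyadic: the p-th power of a sum of powers of 2 is
  comparable to the sum of the p-th powers. Each level then enters with weight k^(-p), about 2k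
  shifted copies of the sequence 2^(ip) \<mu>(U (2^i)) appear, and k^(1-p) tends to 0 as p > 1.
  Absorption needs finite quantities. The weak-type bound supplies them, uniformly in the level, and
  the sums start at an arbitrary 2^(-m), so the constant covers all integers.\<close>

lemma separable_space_iff:
  "separable_space (top_of_set X) \<longleftrightarrow> (\<exists>C. countable C \<and> C \<subseteq> X \<and> X \<subseteq> closure C)"
  unfolding separable_space_def
proof (intro ex_cong1 conj_cong refl)
  fix C assume "C \<subseteq> X"
  then have "top_of_set X closure_of C = X \<inter> closure C"
    by (simp add: closure_of_subtopology Int_absorb1)
  then show "(top_of_set X closure_of C = topspace (top_of_set X)) = (X \<subseteq> closure C)" by auto
qed simp

section \<open>Covering and regularity tools\<close>

text \<open>Purely combinatorial form. Zorn's lemma is applied to the disjoint subfamilies that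
  already satisfy the conclusion for every index meeting them. If a maximal one missed some indices,
  adding a missed set whose size exceeds half the supremum over the missed ones would enlarge
  it.\<close>

lemma Vitali_covering:
  fixes r :: "'i \<Rightarrow> real" and S :: "'i \<Rightarrow> 'b set"
  assumes r: "\<And>i. i \<in> K \<Longrightarrow> 0 < r i \<and> r i \<le> R" and ne: "\<And>i. i \<in> K \<Longrightarrow> S i \<noteq> {}"
  obtains C where "C \<subseteq> K" "disjoint_family_on S C"
    "\<And>i. i \<in> K \<Longrightarrow> \<exists>j\<in>C. S i \<inter> S j \<noteq> {} \<and> r i \<le> 2 * r j"
proof -
  define P where "P = {G. G \<subseteq> K \<and> disjoint_family_on S G \<and>
    (\<forall>i\<in>K. (\<exists>j\<in>G. S i \<inter> S j \<noteq> {}) \<longrightarrow> (\<exists>j\<in>G. S i \<inter> S j \<noteq> {} \<and> r i \<le> 2 * r j))}"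
  have "\<exists>G\<in>P. \<forall>G'\<in>P. G \<subseteq> G' \<longrightarrow> G' = G"
  proof (rule Zorn_Lemma2, rule ballI)
    fix c assume c: "c \<in> chains P"
    have cP: "c \<subseteq> P" and lin: "\<And>A B. A \<in> c \<Longrightarrow> B \<in> c \<Longrightarrow> A \<subseteq> B \<or> B \<subseteq> A"
      using c by (auto simp: chains_def chain_subset_def)
    have "\<Union>c \<in> P" unfolding P_def
    proof (intro CollectI conjI ballI impI)
      show "\<Union>c \<subseteq> K" using cP unfolding P_def by blast
      show "disjoint_family_on S (\<Union>c)" unfolding disjoint_family_on_def
      proof safe
        fix m n A B x assume "m \<in> A" "A \<in> c" "n \<in> B" "B \<in> c" "m \<noteq> n" and x: "x \<in> S m" "x \<in> S n"
        then obtain D where "D \<in> c" "m \<in> D" "n \<in> D" using lin by blast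
        then have "S m \<inter> S n = {}" using cP \<open>m \<noteq> n\<close> unfolding P_def disjoint_family_on_def by blast
        then show "x \<in> {}" using x by blast
      qed
    next
      fix i assume "i \<in> K" "\<exists>j\<in>\<Union>c. S i \<inter> S j \<noteq> {}"
      then obtain G j where "G \<in> c" "j \<in> G" "S i \<inter> S j \<noteq> {}" by blast
      then show "\<exists>j\<in>\<Union>c. S i \<inter> S j \<noteq> {} \<and> r i \<le> 2 * r j"
        using cP \<open>i \<in> K\<close> unfolding P_def by blast
    qed
    then show "\<exists>y\<in>P. \<forall>x\<in>c. x \<subseteq> y" by blast
  qed
  then obtain G where G: "G \<in> P" and max: "\<And>G'. G' \<in> P \<Longrightarrow> G \<subseteq> G' \<Longrightarrow> G' = G" by blast
  define H where "H = {i\<in>K. \<forall>j\<in>G. S i \<inter> S j = {}}"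
  have "H = {}"
  proof (rule ccontr)
    assume ne': "H \<noteq> {}"
    have bdd: "bdd_above (r ` H)" using r by (auto simp: H_def bdd_above_def)
    obtain h0 where h0: "h0 \<in> H" using ne' by blast
    have "r h0 \<le> Sup (r ` H)" by (rule cSup_upper) (use h0 bdd in auto)
    then have "Sup (r ` H) / 2 < Sup (r ` H)" using r h0 by (force simp: H_def)
    then obtain h where h: "h \<in> H" "Sup (r ` H) / 2 < r h"
      using less_cSup_iff[OF _ bdd, of "Sup (r ` H) / 2"] ne' by blast
    have "insert h G \<in> P" unfolding P_def
    proof (intro CollectI conjI ballI impI)
      show "insert h G \<subseteq> K" using G h unfolding P_def H_def by blast
      show "disjoint_family_on S (insert h G)"
        using G h unfolding P_def H_def disjoint_family_on_def by blast
    next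
      fix i assume i: "i \<in> K" "\<exists>j\<in>insert h G. S i \<inter> S j \<noteq> {}"
      show "\<exists>j\<in>insert h G. S i \<inter> S j \<noteq> {} \<and> r i \<le> 2 * r j"
      proof (cases "i \<in> H")
        case True
        then have "r i \<le> Sup (r ` H)" by (intro cSup_upper bdd) auto
        then have "r i \<le> 2 * r h" using h by linarith
        moreover have "S i \<inter> S h \<noteq> {}" using i True unfolding H_def by blast
        ultimately show ?thesis by blast
      next
        case False
        then show ?thesis using i G unfolding P_def H_def by blast
      qed
    qed
    then have "h \<in> G" using max by blast
    then show False using h ne unfolding H_def by blast
  qed
  show thesis
  proof (rule that)
    show "G \<subseteq> K" "disjoint_family_on S G" using G unfolding P_def by blast+
    show "\<exists>j\<in>G. S i \<inter> S j \<noteq> {} \<and> r i \<le> 2 * r j" if "i \<in> K" for i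
      using G \<open>H = {}\<close> that unfolding P_def H_def by blast
  qed
qed

text \<open>Inner and outer approximation are carried through one induction over the sigma-algebra
  generated by the closed sets: complementation swaps them, and a countable union keeps a closed
  inner set because the union of the inner sets is cut at a finite stage.\<close>

lemma finite_borel_measure_regular:
  fixes N :: "'a::metric_space measure"
  assumes N: "sets N = sets borel" and fin: "emeasure N UNIV < \<infinity>"
    and A: "A \<in> sets borel" and e: "0 < (e::real)"
  shows "\<exists>C T. closed C \<and> open T \<and> C \<subseteq> A \<and> A \<subseteq> T \<and> emeasure N (T - C) < ennreal e"
proof -
  interpret finite_measure N
    by standard (use fin sets_eq_imp_space_eq[OF N] in auto)
  have "sigma_sets UNIV (Collect closed) = sets (borel :: 'a measure)"
    by (simp add: borel_eq_closed)
  then have "A \<in> sigma_sets UNIV (Collect closed)" using A by simp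
  then show ?thesis using e
  proof (induction arbitrary: e rule: sigma_sets.induct)
    case (Basic S)
    then have cl: "closed S" by simp
    \<comment> \<open>\<open>infdist\<close> to the empty set is 0, so the empty set gets its own
      neighbourhoods.\<close>
    define T where "T n = (if S = {} then {} else {x. infdist x S < 1 / real (Suc n)})" for n
    have op: "open (T n)" for n
      unfolding T_def by (auto intro!: open_Collect_less continuous_intros)
    have sub: "S \<subseteq> T n" for n by (auto simp: T_def)
    have int: "\<Inter>(range (\<lambda>n. T n - S)) = {}"
    proof (rule ccontr)
      assume "\<not> ?thesis"
      then obtain x where x: "\<And>n. x \<in> T n" "x \<notin> S" by blast
      then have ne: "S \<noteq> {}" by (auto simp: T_def split: if_splits)
      then have "\<And>n. infdist x S < 1 / real (Suc n)" using x by (simp add: T_def)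
      then have "infdist x S \<le> 0"
        by (metis leI less_asym nat_approx_posE)
      then have "infdist x S = 0" using infdist_nonneg[of x S] by linarith
      then show False using in_closed_iff_infdist_zero[OF cl ne] x by blast
    qed
    have "(\<lambda>n. emeasure N (T n - S)) \<longlonglongrightarrow> emeasure N (\<Inter>(range (\<lambda>n. T n - S)))"
    proof (rule Lim_emeasure_decseq)
      show "range (\<lambda>n. T n - S) \<subseteq> sets N" using N op cl by auto
      show "decseq (\<lambda>n. T n - S)"
      proof (rule decseq_SucI)
        fix n
        have "1 / real (Suc (Suc n)) \<le> 1 / real (Suc n)" by (simp add: frac_le)
        then show "T (Suc n) - S \<subseteq> T n - S" unfolding T_def by auto
      qed
      show "emeasure N (T n - S) \<noteq> \<infinity>" for n by simp
    qed
    then have "(\<lambda>n. emeasure N (T n - S)) \<longlonglongrightarrow> 0" unfolding int by simp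
    then have "eventually (\<lambda>n. emeasure N (T n - S) < ennreal e) sequentially"
      using Basic(2) by (intro order_tendstoD) auto
    then obtain n where "emeasure N (T n - S) < ennreal e"
      by (auto simp: eventually_sequentially)
    then show ?case using cl op sub by blast
  next
    case Empty
    then show ?case by (intro exI[of _ "{}"]) auto
  next
    case (Compl S)
    obtain C T where "closed C" "open T" "C \<subseteq> S" "S \<subseteq> T" "emeasure N (T - C) < ennreal e"
      using Compl.IH[OF Compl.prems] by (elim exE conjE) (rule that)
    moreover have "(UNIV - C) - (UNIV - T) = T - C" by blast
    moreover have "closed (UNIV - T)" "open (UNIV - C)"
      using \<open>closed C\<close> \<open>open T\<close> by (auto intro: closed_Diff open_Diff)
    ultimately show ?case
      by (intro exI[of _ "UNIV - T"] exI[of _ "UNIV - C"]) auto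
  next
    case (Union S)
    \<comment> \<open>These errors add up to \<open>e/2\<close>; the other half pays for cutting the
      union of the closed sets.\<close>
    have "\<forall>i. \<exists>C T. closed C \<and> open T \<and> C \<subseteq> S i \<and> S i \<subseteq> T \<and> emeasure N (T - C) < ennreal (e/4 * (1/2)^i)"
      using Union by (intro allI) (auto intro!: Union(2))
    then obtain C T where CT: "\<And>i. closed (C i)" "\<And>i. open (T i)" "\<And>i. C i \<subseteq> S i" "\<And>i. S i \<subseteq> T i"
      "\<And>i. emeasure N (T i - C i) < ennreal (e/4 * (1/2)^i)" by metis
    define F where "F n = (\<Union>i<n. C i)" for n
    have m[measurable]: "T i \<in> sets N" "C i \<in> sets N" for i using CT N by auto
    have mF[measurable]: "F n \<in> sets N" for n unfolding F_def by measurable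
    have "(\<lambda>n. emeasure N ((\<Union>i. C i) - F n)) \<longlonglongrightarrow> emeasure N (\<Inter>(range (\<lambda>n. (\<Union>i. C i) - F n)))"
    proof (rule Lim_emeasure_decseq)
      show "decseq (\<lambda>n. (\<Union>i. C i) - F n)"
        by (intro decseq_SucI) (auto simp: F_def lessThan_Suc)
    qed auto
    moreover have int: "\<Inter>(range (\<lambda>n. (\<Union>i. C i) - F n)) = {}" unfolding F_def by auto
    ultimately have "(\<lambda>n. emeasure N ((\<Union>i. C i) - F n)) \<longlonglongrightarrow> 0" unfolding int by simp
    then have "eventually (\<lambda>n. emeasure N ((\<Union>i. C i) - F n) < ennreal (e/2)) sequentially"
      using Union(3) by (intro order_tendstoD) auto
    then obtain n where n: "emeasure N ((\<Union>i. C i) - F n) < ennreal (e/2)"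
      by (auto simp: eventually_sequentially)
    have s: "(\<lambda>i. e/4 * (1/2)^i) sums (e/2)"
      using sums_mult[OF geometric_sums[of "1/2::real"], of "e/4"] by simp
    have "emeasure N ((\<Union>i. T i) - F n) \<le> emeasure N ((\<Union>i. T i - C i) \<union> ((\<Union>i. C i) - F n))"
      by (intro emeasure_mono) auto
    also have "\<dots> \<le> emeasure N (\<Union>i. T i - C i) + emeasure N ((\<Union>i. C i) - F n)"
      by (intro emeasure_subadditive) auto
    also have "emeasure N (\<Union>i. T i - C i) \<le> (\<Sum>i. emeasure N (T i - C i))"
      by (intro emeasure_subadditive_countably) auto
    also have "\<dots> \<le> (\<Sum>i. ennreal (e/4 * (1/2)^i))"
      using CT(5) by (intro suminf_le) (auto intro: less_imp_le)
    also have "\<dots> = ennreal (e/2)"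
      using s Union(3) by (subst suminf_ennreal_eq[OF _ s]) auto
    finally have "emeasure N ((\<Union>i. T i) - F n) \<le> ennreal (e/2) + emeasure N ((\<Union>i. C i) - F n)"
      by (simp add: add_right_mono)
    also have "\<dots> < ennreal (e/2) + ennreal (e/2)"
      using n by (simp add: ennreal_add_left_cancel_less)
    also have "\<dots> = ennreal e" using Union(3) by (simp flip: ennreal_plus)
    finally have "emeasure N ((\<Union>i. T i) - F n) < ennreal e" .
    show ?case
    proof (intro exI conjI)
      show "closed (F n)" unfolding F_def using CT(1) by (intro closed_UN) auto
      show "open (\<Union>i. T i)" using CT(2) by auto
      show "F n \<subseteq> (\<Union>i. S i)" unfolding F_def using CT(3) by auto
      show "(\<Union>i. S i) \<subseteq> (\<Union>i. T i)" using CT(4) by (intro UN_mono) auto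
    qed fact
  qed
qed

text \<open>Selected families of balls come as countable sets without an enumeration, hence the sum
  as an integral over counting measure. The sets are made disjoint along
  \<open>to_nat_on\<close>.\<close>

lemma emeasure_UN_le_nn:
  assumes "countable I" "\<And>i. i \<in> I \<Longrightarrow> A i \<in> sets M"
  shows "emeasure M (\<Union>i\<in>I. A i) \<le> (\<integral>\<^sup>+i. emeasure M (A i) \<partial>count_space I)"
proof (cases "I = {}")
  case False
  define B where "B i = A i - (\<Union>j\<in>{j\<in>I. to_nat_on I j < to_nat_on I i}. A j)" for i
  have c: "countable {j\<in>I. to_nat_on I j < to_nat_on I i}" for i using assms(1) by simp
  have B: "B i \<in> sets M" if "i \<in> I" for i
    unfolding B_def using assms c[of i] that by (intro sets.Diff sets.countable_UN'' c) auto
  have "(\<Union>i\<in>I. A i) \<subseteq> (\<Union>i\<in>I. B i)"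
  proof
    fix x assume "x \<in> (\<Union>i\<in>I. A i)"
    then obtain i where i: "i \<in> I" "x \<in> A i" by blast
    define n where "n = (LEAST n. \<exists>i\<in>I. to_nat_on I i = n \<and> x \<in> A i)"
    have "\<exists>i\<in>I. to_nat_on I i = n \<and> x \<in> A i" unfolding n_def by (rule LeastI_ex) (use i in blast)
    then obtain j where j: "j \<in> I" "to_nat_on I j = n" "x \<in> A j" by blast
    have "x \<notin> A k" if "k \<in> I" "to_nat_on I k < n" for k
      using not_less_Least[of "to_nat_on I k" "\<lambda>n. \<exists>i\<in>I. to_nat_on I i = n \<and> x \<in> A i"] that
      unfolding n_def by blast
    then have "x \<in> B j" unfolding B_def using j by auto
    then show "x \<in> (\<Union>i\<in>I. B i)" using j by blast
  qed
  then have "emeasure M (\<Union>i\<in>I. A i) \<le> emeasure M (\<Union>i\<in>I. B i)"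
    using B assms by (intro emeasure_mono sets.countable_UN'') auto
  also have "\<dots> = (\<integral>\<^sup>+i. emeasure M (B i) \<partial>count_space I)"
  proof (rule emeasure_UN_countable[OF B assms(1)])
    show "disjoint_family_on B I" unfolding disjoint_family_on_def
    proof (intro ballI impI)
      fix m n assume "m \<in> I" "n \<in> I" "m \<noteq> n"
      then have "to_nat_on I m \<noteq> to_nat_on I n" using assms(1) by (simp add: inj_on_eq_iff)
      then show "B m \<inter> B n = {}" using \<open>m \<in> I\<close> \<open>n \<in> I\<close> unfolding B_def
        by (cases "to_nat_on I m < to_nat_on I n") auto
    qed
  qed
  also have "\<dots> \<le> (\<integral>\<^sup>+i. emeasure M (A i) \<partial>count_space I)"
    using assms by (intro nn_integral_mono emeasure_mono) (auto simp: B_def)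
  finally show ?thesis .
qed simp

lemma outer_measure_space_Pow_subset:
  assumes "outer_measure_space (Pow X) \<mu>" "Y \<subseteq> X"
  shows "outer_measure_space (Pow Y) \<mu>"
proof -
  have PP: "A \<in> Pow X" if "A \<in> Pow Y" for A using assms that by blast
  have f: "positive (Pow X) \<mu>" "increasing (Pow X) \<mu>" "countably_subadditive (Pow X) \<mu>"
    using assms(1) by (simp_all add: outer_measure_space_def)
  have "increasing (Pow Y) \<mu>"
    unfolding increasing_def using increasingD[OF f(2)] PP by blast
  moreover have "countably_subadditive (Pow Y) \<mu>"
    unfolding countably_subadditive_def
  proof (intro allI impI)
    fix A :: "nat \<Rightarrow> 'a set" assume "range A \<subseteq> Pow Y" "disjoint_family A" "\<Union>(range A) \<in> Pow Y"
    then have "range A \<subseteq> Pow X" "\<Union>(range A) \<in> Pow X" using assms(2) by blast+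
    then show "\<mu> (\<Union>(range A)) \<le> (\<Sum>i. \<mu> (A i))"
      using f(3)[unfolded countably_subadditive_def, THEN spec, of A] \<open>disjoint_family A\<close> by simp
  qed
  ultimately show ?thesis using f(1) by (simp add: outer_measure_space_def positive_def)
qed

section \<open>The Caratheodory measure, its covering bound and its subspaces\<close>

locale metric_measure =
  fixes X :: "'a::metric_space set" and \<mu> :: "'a set \<Rightarrow> ennreal"
  assumes mms: "metric_measure_space X \<mu>"
begin

abbreviation "M \<equiv> outer_measure_measure X \<mu>"
abbreviation "borel_X \<equiv> restrict_space borel X"

lemma oms: "outer_measure_space (Pow X) \<mu>"
  using mms by (simp add: metric_measure_space_def borel_regular_outer_measure_def)

lemma space_M [simp]: "space M = X"
  and sets_M: "sets M = lambda_system X (Pow X) \<mu>"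
  and emeasure_M: "A \<in> sets M \<Longrightarrow> emeasure M A = \<mu> A"
  using space_outer_measure_measure[OF oms] sets_outer_measure_measure[OF oms]
    emeasure_outer_measure_measure[OF oms] by auto

lemma outer_mono: "A \<subseteq> B \<Longrightarrow> B \<subseteq> X \<Longrightarrow> \<mu> A \<le> \<mu> B"
  using oms unfolding outer_measure_space_def increasing_def by (auto dest: order_trans)

lemma borel_X_sets: "A \<in> sets borel_X \<Longrightarrow> A \<in> sets M"
  using mms by (auto simp: metric_measure_space_def borel_regular_outer_measure_def sets_M)

lemma borel_X_Int: "T \<in> sets borel \<Longrightarrow> X \<inter> T \<in> sets borel_X"
  by (auto simp: sets_restrict_space)

lemma Int_ball_sets [measurable, simp, intro]: "X \<inter> ball x r \<in> sets M"
  by (intro borel_X_sets borel_X_Int) simp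

lemma borel_X_measurable: "f \<in> measurable borel_X N \<Longrightarrow> f \<in> measurable M N"
proof -
  assume f: "f \<in> measurable borel_X N"
  show ?thesis
  proof (rule measurableI)
    show "f x \<in> space N" if "x \<in> space M" for x
      using measurable_space[OF f] that by (simp add: space_restrict_space)
    show "f -` A \<inter> space M \<in> sets M" if "A \<in> sets N" for A
      using borel_X_sets[OF measurable_sets[OF f that]] by (simp add: space_restrict_space)
  qed
qed

lemma emeasure_ball: "x \<in> X \<Longrightarrow> 0 < r \<Longrightarrow> 0 < emeasure M (X \<inter> ball x r)"
  and emeasure_ball_finite: "x \<in> X \<Longrightarrow> emeasure M (X \<inter> ball x r) < \<infinity>"
proof -
  have "0 < emeasure M (X \<inter> ball x r) \<and> emeasure M (X \<inter> ball x r) < \<infinity>" if "x \<in> X" "0 < r" for r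
    using mms that by (auto simp: metric_measure_space_def emeasure_M)
  then show "x \<in> X \<Longrightarrow> 0 < r \<Longrightarrow> 0 < emeasure M (X \<inter> ball x r)"
    "x \<in> X \<Longrightarrow> emeasure M (X \<inter> ball x r) < \<infinity>"
    by (cases "0 < r"; auto simp: ball_empty)+
qed

text \<open>Completeness of the Caratheodory measure. It lets exceptional sets be treated by their
  outer measure, before they are known to be measurable.\<close>

lemma outer_null_sets: "A \<subseteq> X \<Longrightarrow> \<mu> A = 0 \<Longrightarrow> A \<in> null_sets M"
proof -
  assume A: "A \<subseteq> X" "\<mu> A = 0"
  have "A \<in> lambda_system X (Pow X) \<mu>"
    unfolding lambda_system_def
  proof (intro CollectI conjI ballI)
    fix x assume x: "x \<in> Pow X"
    have sub: "\<mu> (A \<inter> x) = 0" using outer_mono[of "A \<inter> x" A] A by auto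
    have "\<mu> x \<le> \<mu> (A \<inter> x) + \<mu> ((X - A) \<inter> x)"
    proof -
      have "x = (A \<inter> x) \<union> ((X - A) \<inter> x)" using x by blast
      moreover have "subadditive (Pow X) \<mu>"
        by (rule ring_of_sets.countably_subadditive_subadditive[of X])
          (use oms in \<open>auto simp: outer_measure_space_def ring_of_sets_Pow\<close>)
      ultimately show ?thesis using subadditiveD[of "Pow X" \<mu> "A \<inter> x" "(X - A) \<inter> x"] x by auto
    qed
    moreover have "\<mu> ((X - A) \<inter> x) \<le> \<mu> x" using x by (intro outer_mono) auto
    ultimately show "\<mu> (A \<inter> x) + \<mu> ((X - A) \<inter> x) = \<mu> x" using sub by auto
  qed (use A in auto)
  then have "A \<in> sets M" by (simp add: sets_M)
  then show ?thesis using A emeasure_M by (auto intro: null_setsI)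
qed

lemma null_sets_subset: "N \<in> null_sets M \<Longrightarrow> A \<subseteq> N \<Longrightarrow> A \<in> null_sets M"
proof -
  assume N: "N \<in> null_sets M" "A \<subseteq> N"
  then have "N \<subseteq> X" using sets.sets_into_space[of N M] by auto
  then have "\<mu> A \<le> 0" using N outer_mono[of A N] emeasure_M[of N] by (auto simp: null_sets_def)
  then show ?thesis using outer_null_sets \<open>N \<subseteq> X\<close> N by auto
qed

lemma AE_iff_null: "(AE x in M. P x) \<longleftrightarrow> {x\<in>X. \<not> P x} \<in> null_sets M"
proof
  assume "AE x in M. P x"
  then obtain N where "{x\<in>space M. \<not> P x} \<subseteq> N" "N \<in> null_sets M" by (auto simp: eventually_ae_filter)
  then show "{x\<in>X. \<not> P x} \<in> null_sets M" using null_sets_subset by auto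
next
  assume "{x\<in>X. \<not> P x} \<in> null_sets M"
  then show "AE x in M. P x" by (auto intro!: AE_I')
qed

lemma borel_hull:
  assumes "A \<in> sets M"
  obtains B where "B \<in> sets borel_X" "A \<subseteq> B" "emeasure M B = emeasure M A"
proof -
  have "A \<subseteq> X" using assms sets.sets_into_space[of A M] by auto
  then obtain B where "B \<in> sets borel_X" "A \<subseteq> B" "\<mu> B = \<mu> A"
    using mms unfolding metric_measure_space_def borel_regular_outer_measure_def by meson
  then show thesis using that emeasure_M[OF assms] emeasure_M[OF borel_X_sets] by auto
qed

lemma ae_eq_measurable:
  assumes ae: "AE x in M. f x = g x" and g: "g \<in> measurable M N" and f: "f \<in> X \<rightarrow> space N"
  shows "f \<in> measurable M N"
proof (rule measurableI)
  show "x \<in> space M \<Longrightarrow> f x \<in> space N" for x using f by auto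
next
  fix A assume A: "A \<in> sets N"
  let ?E = "{x\<in>X. f x \<noteq> g x}"
  have E: "?E \<in> null_sets M" using ae AE_iff_null[of "\<lambda>x. f x = g x"] by simp
  have "f -` A \<inter> ?E \<in> null_sets M" by (rule null_sets_subset[OF E]) auto
  moreover have "g -` A \<inter> X - ?E \<in> sets M"
    using measurable_sets[OF g A] E by auto
  moreover have "f -` A \<inter> space M = (g -` A \<inter> X - ?E) \<union> (f -` A \<inter> ?E)" by auto
  ultimately show "f -` A \<inter> space M \<in> sets M" by auto
qed

lemma countable_dense:
  obtains C where "countable C" "C \<subseteq> X" "\<And>x e. x \<in> X \<Longrightarrow> 0 < e \<Longrightarrow> \<exists>c\<in>C. dist c x < e"
proof -
  obtain C where "countable C" "C \<subseteq> X" "X \<subseteq> closure C"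
    using mms by (auto simp: metric_measure_space_def separable_space_iff)
  then show thesis using that[of C] closure_approachable by blast
qed

lemma Int_ball_nonempty: "x \<in> X \<Longrightarrow> 0 < r \<Longrightarrow> X \<inter> ball x r \<noteq> {}"
  by (metis Int_iff centre_in_ball empty_iff)

text \<open>Each ball contains a point of a fixed countable dense set, and disjointness makes these
  points distinct.\<close>

lemma countable_disjoint_balls:
  assumes "disjoint_family_on (\<lambda>i. X \<inter> ball (a i) (r i)) I" "\<And>i. i \<in> I \<Longrightarrow> a i \<in> X \<and> 0 < r i"
  shows "countable I"
proof -
  obtain C where C: "countable C" "C \<subseteq> X" "\<And>x e. x \<in> X \<Longrightarrow> 0 < e \<Longrightarrow> \<exists>c\<in>C. dist c x < e"
    using countable_dense by blast
  have "\<forall>i\<in>I. \<exists>c\<in>C. c \<in> X \<inter> ball (a i) (r i)"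
  proof
    fix i assume "i \<in> I"
    then obtain c where "c \<in> C" "dist c (a i) < r i" using C(3) assms(2) by blast
    then show "\<exists>c\<in>C. c \<in> X \<inter> ball (a i) (r i)" using C(2) by (auto simp: dist_commute)
  qed
  then obtain c where c: "\<And>i. i \<in> I \<Longrightarrow> c i \<in> C \<and> c i \<in> X \<inter> ball (a i) (r i)" by metis
  have "inj_on c I"
    using c assms(1) unfolding inj_on_def disjoint_family_on_def by (metis IntI empty_iff)
  then show ?thesis using c C(1) by (meson countable_image_inj_on countable_subset image_subsetI)
qed

text \<open>Vitali selection gives disjoint balls whose fivefold dilates cover the union; the
  hypothesis bounds each dilate by the weight on the selected ball, and disjointness adds these
  weights up to one integral. This serves for the density theorem, for the bad sets of the Poincare
  inequality and for the maximal function in the extension.\<close>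

lemma covering_bound:
  fixes B :: "('a \<times> real) set" and w :: "'a \<Rightarrow> ennreal"
  assumes B: "\<And>x r. (x, r) \<in> B \<Longrightarrow> x \<in> X \<and> 0 < r \<and> r \<le> R"
    and w[measurable]: "w \<in> borel_measurable M"
    and bound: "\<And>x r. (x, r) \<in> B \<Longrightarrow>
      emeasure M (X \<inter> ball x (5 * r)) \<le> K * (\<integral>\<^sup>+y. w y * indicator (X \<inter> ball x r) y \<partial>M)"
  shows "emeasure M (\<Union>(x, r)\<in>B. X \<inter> ball x r) \<le> K * (\<integral>\<^sup>+y. w y \<partial>M)"
proof -
  let ?S = "\<lambda>i. X \<inter> ball (fst i) (snd i)"
  obtain C where C: "C \<subseteq> B" "disjoint_family_on ?S C"
    "\<And>i. i \<in> B \<Longrightarrow> \<exists>j\<in>C. ?S i \<inter> ?S j \<noteq> {} \<and> snd i \<le> 2 * snd j"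
  proof (rule Vitali_covering)
    show "0 < snd i \<and> snd i \<le> R" if "i \<in> B" for i using B[of "fst i" "snd i"] that by simp
    show "?S i \<noteq> {}" if "i \<in> B" for i
      using B[of "fst i" "snd i"] that Int_ball_nonempty[of "fst i" "snd i"] by simp
  qed (rule that)
  have "countable C"
  proof (rule countable_disjoint_balls[OF C(2)])
    show "fst i \<in> X \<and> 0 < snd i" if "i \<in> C" for i
      using B[of "fst i" "snd i"] that C(1) by auto
  qed
  have sub: "(\<Union>(x, r)\<in>B. X \<inter> ball x r) \<subseteq> (\<Union>i\<in>C. X \<inter> ball (fst i) (5 * snd i))"
  proof
    fix y assume "y \<in> (\<Union>(x, r)\<in>B. X \<inter> ball x r)"
    then obtain x r where y: "(x, r) \<in> B" "y \<in> X" "dist x y < r" by auto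
    then obtain j z where j: "j \<in> C" "dist x z < r" "dist (fst j) z < snd j" "r \<le> 2 * snd j"
      using C(3)[of "(x, r)"] by auto
    \<comment> \<open>The origin of the factor 5: the distance is below
      \<open>snd j + 2 * r\<close>, and \<open>r \<le> 2 * snd j\<close>.\<close>
    have "dist (fst j) y \<le> dist (fst j) z + dist x z + dist x y"
      using dist_triangle[of "fst j" y z] dist_triangle[of z y x] by (simp add: dist_commute)
    then have "dist (fst j) y < 5 * snd j" using j y by linarith
    then show "y \<in> (\<Union>i\<in>C. X \<inter> ball (fst i) (5 * snd i))" using j(1) y(2) by auto
  qed
  have UC: "(\<Union>i\<in>C. X \<inter> ball (fst i) (5 * snd i)) \<in> sets M"
    by (rule sets.countable_UN''[OF \<open>countable C\<close>]) simp
  have "emeasure M (\<Union>(x, r)\<in>B. X \<inter> ball x r) \<le> emeasure M (\<Union>i\<in>C. X \<inter> ball (fst i) (5 * snd i))"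
    by (rule emeasure_mono[OF sub UC])
  also have "\<dots> \<le> (\<integral>\<^sup>+i. emeasure M (X \<inter> ball (fst i) (5 * snd i)) \<partial>count_space C)"
    by (rule emeasure_UN_le_nn[OF \<open>countable C\<close>]) simp
  also have "\<dots> \<le> (\<integral>\<^sup>+i. K * (\<integral>\<^sup>+y. w y * indicator (?S i) y \<partial>M) \<partial>count_space C)"
  proof (rule nn_integral_mono)
    fix i assume "i \<in> space (count_space C)"
    then have "(fst i, snd i) \<in> B" using C(1) by auto
    then show "emeasure M (X \<inter> ball (fst i) (5 * snd i)) \<le> K * (\<integral>\<^sup>+y. w y * indicator (?S i) y \<partial>M)"
      by (rule bound)
  qed
  also have "\<dots> = K * (\<integral>\<^sup>+i. (\<integral>\<^sup>+y. w y * indicator (?S i) y \<partial>M) \<partial>count_space C)"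
    by (intro nn_integral_cmult) auto
  also have "(\<integral>\<^sup>+i. (\<integral>\<^sup>+y. w y * indicator (?S i) y \<partial>M) \<partial>count_space C)
      = (\<integral>\<^sup>+i. emeasure (density M w) (?S i) \<partial>count_space C)"
    by (intro nn_integral_cong) (simp add: emeasure_density)
  also have "\<dots> = emeasure (density M w) (\<Union>i\<in>C. ?S i)"
    by (rule emeasure_UN_countable[OF _ \<open>countable C\<close> C(2), symmetric]) simp
  also have "\<dots> \<le> emeasure (density M w) (space (density M w))"
    by (rule emeasure_space)
  also have "\<dots> = (\<integral>\<^sup>+y. w y \<partial>M)"
    using sets.top[of M] by (subst emeasure_density) (auto intro!: nn_integral_cong)
  finally show ?thesis by (simp add: mult_left_mono)
qed


lemma restrict_sets_iff:
  assumes "Y \<in> sets M"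
  shows "A \<in> sets (restrict_space M Y) \<longleftrightarrow> A \<subseteq> Y \<and> A \<in> sets M"
  using assms sets.sets_into_space[OF assms]
  by (subst sets_restrict_space_iff) (auto simp: Int_absorb2)

text \<open>A Caratheodory measurable \<open>Y\<close> splits every test set, so testing a subset of
  \<open>Y\<close> against all subsets of \<open>X\<close> amounts to testing it against subsets of
  \<open>Y\<close>. Integrals over a subspace thereby become integrals over \<open>X\<close> with an
  indicator.\<close>

lemma outer_measure_measure_restrict:
  assumes Y: "Y \<in> sets M"
  shows "outer_measure_measure Y \<mu> = restrict_space M Y"
proof -
  have YX: "Y \<subseteq> X" using sets.sets_into_space[OF Y] by simp
  have omsY: "outer_measure_space (Pow Y) \<mu>"
    by (rule outer_measure_space_Pow_subset[OF oms YX])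
  have YL: "\<mu> (Y \<inter> x) + \<mu> ((X - Y) \<inter> x) = \<mu> x" if "x \<subseteq> X" for x
    using Y that unfolding sets_M lambda_system_def by blast
  have eq: "A \<in> lambda_system Y (Pow Y) \<mu> \<longleftrightarrow> A \<subseteq> Y \<and> A \<in> sets M" for A
  proof (cases "A \<subseteq> Y")
    case True
    have "(\<forall>x\<subseteq>Y. \<mu> (A \<inter> x) + \<mu> ((Y - A) \<inter> x) = \<mu> x) \<longleftrightarrow> (\<forall>x\<subseteq>X. \<mu> (A \<inter> x) + \<mu> ((X - A) \<inter> x) = \<mu> x)"
    proof safe
      fix x assume *: "\<forall>x\<subseteq>Y. \<mu> (A \<inter> x) + \<mu> ((Y - A) \<inter> x) = \<mu> x" "x \<subseteq> X"
      have "A \<inter> (Y \<inter> x) = A \<inter> x" "(Y - A) \<inter> (Y \<inter> x) = Y \<inter> ((X - A) \<inter> x)"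
        "(X - Y) \<inter> ((X - A) \<inter> x) = (X - Y) \<inter> x" using True YX by auto
      then show "\<mu> (A \<inter> x) + \<mu> ((X - A) \<inter> x) = \<mu> x"
        using *(1)[rule_format, of "Y \<inter> x"] YL[of x] YL[of "(X - A) \<inter> x"] *(2)
        by (metis (no_types, lifting) Diff_subset Int_lower1 ab_semigroup_add_class.add_ac(1) le_infI1)
    next
      fix x assume *: "\<forall>x\<subseteq>X. \<mu> (A \<inter> x) + \<mu> ((X - A) \<inter> x) = \<mu> x" "x \<subseteq> Y"
      then have "(Y - A) \<inter> x = (X - A) \<inter> x" using YX by auto
      then show "\<mu> (A \<inter> x) + \<mu> ((Y - A) \<inter> x) = \<mu> x" using * YX by auto
    qed
    then show ?thesis using True YX unfolding sets_M lambda_system_def by auto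
  qed (auto simp: lambda_system_def)
  show ?thesis
  proof (rule measure_eqI)
    show s: "sets (outer_measure_measure Y \<mu>) = sets (restrict_space M Y)"
      unfolding sets_outer_measure_measure[OF omsY] set_eq_iff restrict_sets_iff[OF Y]
      using eq by blast
    fix A assume A: "A \<in> sets (outer_measure_measure Y \<mu>)"
    then have "A \<in> sets M" "A \<subseteq> Y" using eq by (auto simp: sets_outer_measure_measure[OF omsY])
    moreover have "emeasure (outer_measure_measure Y \<mu>) A = \<mu> A"
      using A emeasure_outer_measure_measure[OF omsY] sets_outer_measure_measure[OF omsY] by simp
    ultimately show "emeasure (outer_measure_measure Y \<mu>) A = emeasure (restrict_space M Y) A"
      using emeasure_M emeasure_restrict_space[of Y M A] sets.Int[OF Y sets.top] by simp
  qed
qed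

lemma nn_integral_outer_measure_restrict:
  assumes "Y \<in> sets M"
  shows "(\<integral>\<^sup>+x. f x \<partial>outer_measure_measure Y \<mu>) = (\<integral>\<^sup>+x. f x * indicator Y x \<partial>M)"
  unfolding outer_measure_measure_restrict[OF assms]
  by (rule nn_integral_restrict_space) (use assms in \<open>auto intro: sets.Int simp del: space_M\<close>)

text \<open>A countable dense set of \<open>X\<close> need not meet \<open>Y\<close>; for each of
  its points \<open>c\<close> and each scale 1/(n+1), one point of \<open>Y\<close> that close to
  \<open>c\<close> is chosen where it exists.\<close>

lemma separable_subset:
  assumes YX: "Y \<subseteq> X"
  shows "separable_space (top_of_set Y)"
proof -
  obtain C where C: "countable C" "C \<subseteq> X" "\<And>x e. x \<in> X \<Longrightarrow> 0 < e \<Longrightarrow> \<exists>c\<in>C. dist c x < e"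
    using countable_dense by blast
  define f where "f = (\<lambda>(c, n::nat). SOME y. y \<in> Y \<and> dist c y < 1 / real (Suc n))"
  define I where "I = {(c, n::nat). c \<in> C \<and> (\<exists>y\<in>Y. dist c y < 1 / real (Suc n))}"
  have fI: "f (c, n) \<in> Y \<and> dist c (f (c, n)) < 1 / real (Suc n)" if "(c, n) \<in> I" for c n
    using that someI_ex[of "\<lambda>y. y \<in> Y \<and> dist c y < 1 / real (Suc n)"]
    unfolding I_def f_def by auto
  show ?thesis
    unfolding separable_space_iff
  proof (intro exI conjI)
    have "I \<subseteq> C \<times> UNIV" by (auto simp: I_def)
    then show "countable (f ` I)"
      by (intro countable_image) (rule countable_subset, use C(1) in auto)
    show "f ` I \<subseteq> Y" using fI by auto
    show "Y \<subseteq> closure (f ` I)"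
    proof
      fix y assume y: "y \<in> Y"
      show "y \<in> closure (f ` I)" unfolding closure_approachable
      proof (intro allI impI)
        fix e :: real assume "0 < e"
        then obtain n where n: "1 / real (Suc n) < e / 2" using nat_approx_posE[of "e/2"] by auto
        obtain c where c: "c \<in> C" "dist c y < 1 / real (Suc n)" using C(3)[of y "1 / real (Suc n)"] y YX by auto
        then have I: "(c, n) \<in> I" using y by (auto simp: I_def)
        have "dist (f (c, n)) y \<le> dist c (f (c, n)) + dist c y"
          using dist_triangle[of "f (c, n)" y c] by (simp add: dist_commute)
        then have "dist (f (c, n)) y < e" using fI[OF I] c n by linarith
        then show "\<exists>z\<in>f ` I. dist z y < e" using I by blast
      qed
    qed
  qed
qed

text \<open>Only the positivity of balls does not pass to a measurable subset by itself. It comes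
  from a smaller inner ball when \<open>Y\<close> is a ball, and from measure density when
  \<open>Y\<close> is the domain.\<close>

lemma metric_measure_subspace:
  assumes Y: "Y \<in> sets M" and pos: "\<And>x r. x \<in> Y \<Longrightarrow> 0 < r \<Longrightarrow> 0 < \<mu> (Y \<inter> ball x r)"
  shows "metric_measure_space Y \<mu>"
proof -
  have YX: "Y \<subseteq> X" using sets.sets_into_space[OF Y] by simp
  have omsY: "outer_measure_space (Pow Y) \<mu>"
    by (rule outer_measure_space_Pow_subset[OF oms YX])
  have setsY: "A \<in> lambda_system Y (Pow Y) \<mu> \<longleftrightarrow> A \<subseteq> Y \<and> A \<in> sets M" for A
    using sets_outer_measure_measure[OF omsY] Y YX
    by (auto simp: outer_measure_measure_restrict[OF Y] restrict_sets_iff[OF Y]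
        simp flip: sets_outer_measure_measure[OF omsY])
  have "separable_space (top_of_set Y)" by (rule separable_subset[OF YX])
  moreover have "borel_regular_outer_measure Y \<mu>"
    unfolding borel_regular_outer_measure_def
  proof (intro conjI omsY allI impI subsetI)
    fix A assume "A \<in> sets (restrict_space borel Y)"
    then obtain T where T: "T \<in> sets borel" "A = Y \<inter> T" by (auto simp: sets_restrict_space)
    have "A = Y \<inter> (X \<inter> T)" using T YX by auto
    then have "A \<in> sets M" using Y borel_X_sets[OF borel_X_Int[OF T(1)]] by auto
    then show "A \<in> lambda_system Y (Pow Y) \<mu>" using T setsY by auto
  next
    fix A assume A: "A \<subseteq> Y"
    then obtain B where B: "B \<in> sets borel_X" "A \<subseteq> B" "\<mu> B = \<mu> A"
      using mms YX unfolding metric_measure_space_def borel_regular_outer_measure_def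
      by (meson order_trans)
    then obtain T where T: "T \<in> sets borel" "B = X \<inter> T" by (auto simp: sets_restrict_space)
    have "\<mu> (Y \<inter> T) \<le> \<mu> B" using T YX by (intro outer_mono) auto
    moreover have "\<mu> A \<le> \<mu> (Y \<inter> T)" using A B T YX by (intro outer_mono) auto
    ultimately have "\<mu> (Y \<inter> T) = \<mu> A" using B by simp
    then show "\<exists>B\<in>sets (restrict_space borel Y). A \<subseteq> B \<and> \<mu> B = \<mu> A"
      using A B T by (intro bexI[of _ "Y \<inter> T"]) (auto simp: sets_restrict_space)
  qed
  moreover have "\<mu> (Y \<inter> ball x r) < \<infinity>" if "x \<in> Y" for x r
  proof -
    have "\<mu> (Y \<inter> ball x r) \<le> \<mu> (X \<inter> ball x r)" using YX by (intro outer_mono) auto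
    also have "\<dots> < \<infinity>" using emeasure_ball_finite[of x r] that YX by (auto simp: emeasure_M)
    finally show ?thesis .
  qed
  ultimately show ?thesis using pos unfolding metric_measure_space_def by blast
qed

text \<open>The measure on the ball is pushed forward to a finite Borel measure on the whole type,
  where regularity applies to a Borel hull of \<open>A\<close> in the ball; the hull exceeds that
  set by a null set only.\<close>

lemma outer_regular_ball:
  assumes A: "A \<in> sets M" and x0: "x0 \<in> X" and e: "0 < (e::real)"
  shows "\<exists>T. open T \<and> A \<inter> ball x0 r \<subseteq> T \<and> emeasure M ((X \<inter> ball x0 r \<inter> T) - A) < ennreal e"
proof -
  let ?B = "X \<inter> ball x0 r"
  define N where "N = distr (restrict_space M ?B) borel (\<lambda>x. x)"
  have meas: "(\<lambda>x. x) \<in> measurable (restrict_space M ?B) borel"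
    by (intro measurable_restrict_space1 borel_X_measurable measurable_restrict_space1) simp
  have N: "emeasure N S = emeasure M (?B \<inter> S)" if "S \<in> sets borel" for S
  proof -
    have "S \<inter> space (restrict_space M ?B) = ?B \<inter> S" by (auto simp: space_restrict_space)
    moreover have "?B \<inter> S \<in> sets M"
      using borel_X_sets[OF borel_X_Int, of "ball x0 r \<inter> S"] that by (simp add: Int_assoc)
    moreover have "?B \<inter> space M \<in> sets M" using sets.Int[OF Int_ball_sets sets.top] .
    moreover from this have "emeasure (restrict_space M ?B) (?B \<inter> S) = emeasure M (?B \<inter> S)"
      by (rule emeasure_restrict_space) (rule Int_lower1)
    ultimately show ?thesis
      unfolding N_def by (simp add: emeasure_distr[OF meas that])
  qed
  obtain S where S: "S \<in> sets borel" "A \<inter> ?B \<subseteq> S" "emeasure M (X \<inter> S) = emeasure M (A \<inter> ?B)"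
  proof -
    obtain H where H: "H \<in> sets borel_X" "A \<inter> ?B \<subseteq> H" "emeasure M H = emeasure M (A \<inter> ?B)"
      using borel_hull[of "A \<inter> ?B"] A by auto
    then obtain S where "S \<in> sets borel" "H = X \<inter> S" by (auto simp: sets_restrict_space)
    then show thesis using that[of S] H by auto
  qed
  have fin: "emeasure M ?B < \<infinity>" by (rule emeasure_ball_finite[OF x0])
  obtain C T where T: "open T" "S \<subseteq> T" "C \<subseteq> S" "closed C" "emeasure N (T - C) < ennreal e"
    using finite_borel_measure_regular[of N S e] S(1) e N[of UNIV] fin by (auto simp: N_def)
  have BS: "X \<inter> S \<in> sets M" "X \<inter> T \<in> sets M" using S(1) T(1) by (auto intro!: borel_X_sets borel_X_Int)
  have "emeasure M ((X \<inter> S) - (A \<inter> ?B)) = 0"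
  proof -
    have AB: "A \<inter> ?B \<in> sets M" using A by auto
    have "emeasure M (A \<inter> ?B) \<le> emeasure M ?B" by (intro emeasure_mono) auto
    then have "emeasure M (A \<inter> ?B) \<noteq> \<infinity>" using fin by auto
    moreover have "A \<inter> ?B \<subseteq> X \<inter> S" using S by auto
    ultimately show ?thesis using S(3) BS AB by (subst emeasure_Diff) auto
  qed
  then have nul: "(X \<inter> S) - (A \<inter> ?B) \<in> null_sets M" using BS A by (auto intro!: null_setsI)
  have "emeasure M ((?B \<inter> T) - A) \<le> emeasure M ((?B \<inter> (T - C)) \<union> ((X \<inter> S) - (A \<inter> ?B)))"
    using T A BS borel_X_sets[OF borel_X_Int, of "ball x0 r \<inter> (T - C)"]
    by (intro emeasure_mono) (auto simp: Int_assoc)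
  also have "\<dots> \<le> emeasure M (?B \<inter> (T - C))"
    using nul borel_X_sets[OF borel_X_Int, of "ball x0 r \<inter> (T - C)"] T
    by (subst emeasure_Un_null_set) (auto simp: Int_assoc)
  finally have "emeasure M ((?B \<inter> T) - A) \<le> emeasure M (?B \<inter> (T - C))" .
  moreover have "emeasure M (?B \<inter> (T - C)) < ennreal e" using T N[of "T - C"] by auto
  moreover have "A \<inter> ball x0 r \<subseteq> T"
    using T(2) S(2) sets.sets_into_space[OF A] by auto
  ultimately show ?thesis using T(1) by (blast intro: order.strict_trans1)
qed

end

section \<open>Density points in doubling spaces\<close>

context metric_measure begin

lemma AE_ball_I:
  assumes "\<And>x0 n. x0 \<in> X \<Longrightarrow> {x\<in>X \<inter> ball x0 (real n). \<not> P x} \<in> null_sets M"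
  shows "AE x in M. P x"
proof (cases "X = {}")
  case True
  then show ?thesis by (simp add: AE_iff_null)
next
  case False
  then obtain x0 where x0: "x0 \<in> X" by blast
  have "{x\<in>X. \<not> P x} = (\<Union>n. {x\<in>X \<inter> ball x0 (real n). \<not> P x})"
    by (auto intro: reals_Archimedean2)
  then show ?thesis unfolding AE_iff_null using assms[OF x0] by (simp add: null_sets_UN)
qed

end

text \<open>Doubling is asked for radii up to \<open>R0\<close>, because a domain with measure
  density inherits it from the ambient space at radii up to 1.\<close>

locale doubling_space = metric_measure +
  fixes D R0 :: real
  assumes R0: "0 < R0" and D1: "1 \<le> D"
    and doubling: "\<And>x r. x \<in> X \<Longrightarrow> 0 < r \<Longrightarrow> r \<le> R0 \<Longrightarrow>
      emeasure M (X \<inter> ball x (2 * r)) \<le> ennreal D * emeasure M (X \<inter> ball x r)"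
begin

lemma doubling_power:
  assumes "x \<in> X" "0 < r" "2 ^ m * r \<le> 2 * R0"
  shows "emeasure M (X \<inter> ball x (2 ^ m * r)) \<le> ennreal (D ^ m) * emeasure M (X \<inter> ball x r)"
  using assms(3)
proof (induction m)
  case (Suc m)
  have "2 ^ m * r \<le> R0" using Suc.prems by simp
  moreover have "0 < 2 ^ m * r" using assms(2) by simp
  ultimately have "emeasure M (X \<inter> ball x (2 * (2 ^ m * r))) \<le> ennreal D * emeasure M (X \<inter> ball x (2 ^ m * r))"
    using doubling assms(1) by blast
  also have "\<dots> \<le> ennreal D * (ennreal (D ^ m) * emeasure M (X \<inter> ball x r))"
    using Suc.IH Suc.prems R0 \<open>2 ^ m * r \<le> R0\<close> by (intro mult_left_mono) auto
  also have "\<dots> = ennreal (D ^ Suc m) * emeasure M (X \<inter> ball x r)"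
    using D1 by (simp add: ennreal_mult mult.assoc)
  finally show ?case by (simp add: mult.assoc)
qed simp

lemma doubling_le:
  assumes "x \<in> X" "0 < r" "2 ^ m * r \<le> 2 * R0" "s \<le> 2 ^ m * r"
  shows "emeasure M (X \<inter> ball x s) \<le> ennreal (D ^ m) * emeasure M (X \<inter> ball x r)"
proof -
  have "emeasure M (X \<inter> ball x s) \<le> emeasure M (X \<inter> ball x (2 ^ m * r))"
    using assms(4) by (intro emeasure_mono) auto
  then show ?thesis using doubling_power[OF assms(1-3)] by (rule order_trans)
qed

text \<open>A point of \<open>A\<close> without the property is the centre of arbitrarily small
  balls in which the complement of \<open>A\<close> has more than the proportion
  \<open>\<kappa>\<close>. By outer regularity these balls fit into an open set whose part outside
  \<open>A\<close> is small, and the covering bound makes their union small.\<close>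

lemma Lebesgue_density:
  assumes A: "A \<in> sets M" and k: "0 < (\<kappa>::real)"
  shows "AE x in M. x \<in> A \<longrightarrow> (\<exists>\<delta>>0. \<forall>r. 0 < r \<and> r < \<delta> \<longrightarrow>
    emeasure M (X \<inter> ball x r - A) \<le> ennreal \<kappa> * emeasure M (X \<inter> ball x r))"
proof (rule AE_ball_I)
  fix x0 n assume x0: "x0 \<in> X"
  let ?good = "\<lambda>x r. emeasure M (X \<inter> ball x r - A) \<le> ennreal \<kappa> * emeasure M (X \<inter> ball x r)"
  let ?E = "{x\<in>X \<inter> ball x0 (real n). \<not> (x \<in> A \<longrightarrow> (\<exists>\<delta>>0. \<forall>r. 0 < r \<and> r < \<delta> \<longrightarrow> ?good x r))}"
  \<comment> \<open>Three doublings reach the fivefold ball; radii up to \<open>R0 / 4\<close> keep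
    them in the doubling range.\<close>
  define K where "K = D ^ 3 / \<kappa>"
  have Kpos: "0 < K" using D1 k by (simp add: K_def)
  \<comment> \<open>The outer measure is used because \<open>?E\<close> is not yet known to be
    measurable; the summand 0 fits \<open>ennreal_le_epsilon\<close>.\<close>
  have "\<mu> ?E \<le> 0 + ennreal e" if e: "0 < e" for e :: real
  proof -
    obtain T where T: "open T" "A \<inter> ball x0 (real n) \<subseteq> T"
      "emeasure M ((X \<inter> ball x0 (real n) \<inter> T) - A) < ennreal (e / K)"
      using outer_regular_ball[OF A x0, of "e / K" "real n"] e Kpos by auto
    let ?O = "X \<inter> (ball x0 (real n) \<inter> T)"
    have O: "?O \<in> sets M" using T(1) by (intro borel_X_sets borel_X_Int) auto
    define B where "B = {(x, r). x \<in> X \<and> 0 < r \<and> r \<le> R0 / 4 \<and> X \<inter> ball x r \<subseteq> ?O \<and> \<not> ?good x r}"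
    have "emeasure M (\<Union>(x, r)\<in>B. X \<inter> ball x r) \<le> ennreal K * (\<integral>\<^sup>+y. indicator (?O - A) y \<partial>M)"
    proof (rule covering_bound)
      show "x \<in> X \<and> 0 < r \<and> r \<le> R0 / 4" if "(x, r) \<in> B" for x r using that by (auto simp: B_def)
      show "indicator (?O - A) \<in> borel_measurable M" using O A by auto
      fix x r assume xr: "(x, r) \<in> B"
      have "emeasure M (X \<inter> ball x (5 * r)) \<le> ennreal (D ^ 3) * emeasure M (X \<inter> ball x r)"
        by (rule doubling_le) (use xr in \<open>auto simp: B_def\<close>)
      also have "\<dots> = ennreal K * (ennreal \<kappa> * emeasure M (X \<inter> ball x r))"
        using k D1 by (simp add: K_def mult.assoc[symmetric] ennreal_mult[symmetric])
      also have "\<dots> \<le> ennreal K * emeasure M (X \<inter> ball x r - A)"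
        using xr by (intro mult_left_mono) (auto simp: B_def not_le)
      also have "emeasure M (X \<inter> ball x r - A)
          = (\<integral>\<^sup>+y. indicator (X \<inter> ball x r - A) y \<partial>M)" using A by simp
      also have "\<dots> \<le> (\<integral>\<^sup>+y. indicator (?O - A) y * indicator (X \<inter> ball x r) y \<partial>M)"
        using xr by (intro nn_integral_mono) (auto simp: B_def indicator_def)
      finally show "emeasure M (X \<inter> ball x (5 * r)) \<le>
          ennreal K * (\<integral>\<^sup>+y. indicator (?O - A) y * indicator (X \<inter> ball x r) y \<partial>M)"
        by (simp add: mult_left_mono)
    qed
    also have "\<dots> = ennreal K * emeasure M ((X \<inter> ball x0 (real n) \<inter> T) - A)"
      using O A by (simp add: Int_assoc)
    also have "\<dots> \<le> ennreal K * ennreal (e / K)" using T(3) by (intro mult_left_mono) auto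
    also have "\<dots> = ennreal e" using Kpos e by (simp add: ennreal_mult[symmetric])
    finally have le: "emeasure M (\<Union>(x, r)\<in>B. X \<inter> ball x r) \<le> ennreal e" .
    have eq: "(\<Union>(x, r)\<in>B. X \<inter> ball x r) = X \<inter> (\<Union>(x, r)\<in>B. ball x r)" by auto
    have "(\<Union>(x, r)\<in>B. X \<inter> ball x r) \<in> sets M"
      unfolding eq by (intro borel_X_sets borel_X_Int borel_open open_UN) auto
    then have "\<mu> (\<Union>(x, r)\<in>B. X \<inter> ball x r) \<le> ennreal e" using le emeasure_M by simp
    moreover have "?E \<subseteq> (\<Union>(x, r)\<in>B. X \<inter> ball x r)"
    proof
      fix x assume x: "x \<in> ?E"
      then have "x \<in> ball x0 (real n) \<inter> T" using T(2) by auto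
      moreover have "open (ball x0 (real n) \<inter> T)" using T(1) by auto
      ultimately obtain \<delta> where \<delta>: "0 < \<delta>" "ball x \<delta> \<subseteq> ball x0 (real n) \<inter> T"
        by (meson openE)
      have "\<not> (\<exists>\<delta>>0. \<forall>r. 0 < r \<and> r < \<delta> \<longrightarrow> ?good x r)" using x by blast
      then have "\<not> (\<forall>r. 0 < r \<and> r < min \<delta> (R0/4) \<longrightarrow> ?good x r)"
        using \<delta>(1) R0 by (metis divide_pos_pos min_less_iff_conj zero_less_numeral)
      then obtain r where r: "0 < r" "r < \<delta>" "r < R0/4" "\<not> ?good x r" by auto
      have "X \<inter> ball x r \<subseteq> ?O" using \<delta>(2) r(2) by auto
      then have "(x, r) \<in> B" using r x by (auto simp: B_def)
      moreover have "x \<in> X \<inter> ball x r" using r x by auto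
      ultimately show "x \<in> (\<Union>(x, r)\<in>B. X \<inter> ball x r)" by blast
    qed
    then have "\<mu> ?E \<le> \<mu> (\<Union>(x, r)\<in>B. X \<inter> ball x r)" by (intro outer_mono) auto
    ultimately show ?thesis by simp
  qed
  then have "\<mu> ?E \<le> 0" by (rule ennreal_le_epsilon)
  then show "?E \<in> null_sets M" by (intro outer_null_sets) auto
qed

end

section \<open>Powers of extended reals\<close>

lemma ennreal_powr_ennreal: "0 \<le> x \<Longrightarrow> ennreal_powr (ennreal x) a = ennreal (x powr a)"
  by (simp add: ennreal_powr_def)

lemma ennreal_powr_top [simp]: "ennreal_powr \<infinity> a = \<infinity>" "ennreal_powr top a = top"
  by (simp_all add: ennreal_powr_def)

lemma ennreal_powr_0 [simp]: "ennreal_powr 0 a = 0"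
  by (simp add: ennreal_powr_def)

lemma ennreal_powr_mono: "x \<le> y \<Longrightarrow> 0 \<le> a \<Longrightarrow> ennreal_powr x a \<le> ennreal_powr y a"
  by (cases x; cases y) (auto simp: ennreal_powr_ennreal top_unique intro!: ennreal_leI powr_mono2)

lemma ennreal_powr_measurable [measurable]:
  assumes [measurable]: "f \<in> borel_measurable N"
  shows "(\<lambda>x. ennreal_powr (f x) a) \<in> borel_measurable N"
  unfolding ennreal_powr_def by measurable

lemma ennreal_powr_inverse:
  assumes "0 < a" shows "ennreal_powr (ennreal_powr x a) (1 / a) = x"
  using assms by (cases x) (auto simp: ennreal_powr_ennreal powr_powr)

lemma ennreal_powr_inverse':
  assumes "0 < a" shows "ennreal_powr (ennreal_powr x (1 / a)) a = x"
  using assms by (cases x) (auto simp: ennreal_powr_ennreal powr_powr)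

lemma ennreal_powr_cmult:
  assumes "0 < a" "0 \<le> c"
  shows "ennreal_powr (ennreal c * x) a = ennreal (c powr a) * ennreal_powr x a"
proof (cases x)
  case (real r)
  then show ?thesis using assms
    by (simp add: ennreal_mult[symmetric] ennreal_powr_ennreal powr_mult)
next
  case top
  then show ?thesis using assms by (cases "c = 0") (auto simp: ennreal_mult_top)
qed

lemma ennreal_powr_less_top: "x < \<infinity> \<Longrightarrow> ennreal_powr x a < \<infinity>"
  by (cases x) (auto simp: ennreal_powr_ennreal)

lemma ennreal_powr_less_top_iff: "ennreal_powr x a < \<infinity> \<longleftrightarrow> x < \<infinity>"
  by (cases x) (auto simp: ennreal_powr_ennreal)

lemma ennreal_powr_max: "0 \<le> a \<Longrightarrow> ennreal_powr (max x y) a = max (ennreal_powr x a) (ennreal_powr y a)"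
  using ennreal_powr_mono[of x y a] ennreal_powr_mono[of y x a]
  by (cases "x \<le> y") (auto simp: max_def intro: antisym)

lemma ennreal_powr_add:
  assumes "0 < a"
  shows "ennreal_powr (x + y) a \<le> ennreal (2 powr a) * (ennreal_powr x a + ennreal_powr y a)"
proof -
  have "x + y \<le> ennreal 2 * max x y"
    using add_mono[of x "max x y" y "max x y"] by (simp add: mult_2)
  then have "ennreal_powr (x + y) a \<le> ennreal (2 powr a) * max (ennreal_powr x a) (ennreal_powr y a)"
    using ennreal_powr_mono[of "x + y" _ a] assms
    by (metis ennreal_powr_cmult ennreal_powr_max less_imp_le zero_le_numeral)
  also have "\<dots> \<le> ennreal (2 powr a) * (ennreal_powr x a + ennreal_powr y a)"
    by (intro mult_left_mono) (auto simp: max_def)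
  finally show ?thesis .
qed

lemma Lp_norm_less_top_iff:
  "Lp_norm X \<mu> p f < \<infinity> \<longleftrightarrow> (\<integral>\<^sup>+ x. ennreal_powr (f x) p \<partial>outer_measure_measure X \<mu>) < \<infinity>"
  unfolding Lp_norm_def by (rule ennreal_powr_less_top_iff)

lemma Lp_norm_mono_AE:
  assumes "AE x in outer_measure_measure X \<mu>. f x \<le> g x" "0 < p"
  shows "Lp_norm X \<mu> p f \<le> Lp_norm X \<mu> p g"
  unfolding Lp_norm_def using assms
  by (intro ennreal_powr_mono nn_integral_mono_AE) (auto elim!: eventually_mono intro: ennreal_powr_mono)

lemma Lp_norm_cmult:
  assumes "0 < p" "0 \<le> c" "f \<in> borel_measurable (outer_measure_measure X \<mu>)"
  shows "Lp_norm X \<mu> p (\<lambda>x. ennreal c * f x) = ennreal c * Lp_norm X \<mu> p f"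
  unfolding Lp_norm_def using assms
  by (simp add: ennreal_powr_cmult nn_integral_cmult powr_powr)

section \<open>Length of paths\<close>

text \<open>A recursive form of the polygonal sum in \<open>path_len\<close>, so that concatenation
  and insertion of a node go by induction on the list.\<close>

fun chain_len :: "(real \<Rightarrow> 'a::metric_space) \<Rightarrow> real list \<Rightarrow> ennreal" where
  "chain_len \<gamma> (x # y # zs) = ennreal (dist (\<gamma> x) (\<gamma> y)) + chain_len \<gamma> (y # zs)"
| "chain_len \<gamma> _ = 0"

lemma chain_len_eq_sum:
  "chain_len \<gamma> ts = (\<Sum>i<length ts - 1. ennreal (dist (\<gamma> (ts ! i)) (\<gamma> (ts ! Suc i))))"
proof (induction \<gamma> ts rule: chain_len.induct)
  case (1 \<gamma> x y zs)
  show ?case using 1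
    by (simp add: sum.lessThan_Suc_shift del: sum.lessThan_Suc)
qed auto

lemma path_len_eq: "path_len \<gamma> a b = (SUP ts \<in> {ts. sorted ts \<and> set ts \<subseteq> {a..b}}. chain_len \<gamma> ts)"
  unfolding path_len_def chain_len_eq_sum ..

lemma chain_len_le: "sorted ts \<Longrightarrow> set ts \<subseteq> {a..b} \<Longrightarrow> chain_len \<gamma> ts \<le> path_len \<gamma> a b"
  unfolding path_len_eq by (rule SUP_upper) simp

lemma dist_le_path_len:
  assumes "a \<le> s" "s \<le> t" "t \<le> b" shows "ennreal (dist (\<gamma> s) (\<gamma> t)) \<le> path_len \<gamma> a b"
  using chain_len_le[of "[s, t]" a b \<gamma>] assms by simp

lemma path_len_mono: "a' \<le> a \<Longrightarrow> b \<le> b' \<Longrightarrow> path_len \<gamma> a b \<le> path_len \<gamma> a' b'"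
  unfolding path_len_eq by (rule SUP_subset_mono) auto

lemma path_len_degenerate: "b \<le> a \<Longrightarrow> path_len \<gamma> a b = 0"
proof -
  assume "b \<le> a"
  have "chain_len \<gamma> ts = 0" if "set ts \<subseteq> {a}" for ts
    using that by (induction \<gamma> ts rule: chain_len.induct) auto
  moreover have "{a..b} \<subseteq> {a}" using \<open>b \<le> a\<close> by auto
  ultimately have "chain_len \<gamma> ts = 0" if "set ts \<subseteq> {a..b}" for ts using that by blast
  then have "path_len \<gamma> a b \<le> 0" unfolding path_len_eq by (intro SUP_least) auto
  then show ?thesis by simp
qed

lemma chain_len_append: "chain_len \<gamma> xs + chain_len \<gamma> ys \<le> chain_len \<gamma> (xs @ ys)"
proof (induction \<gamma> xs rule: chain_len.induct)
  case (1 \<gamma> x y zs)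
  then show ?case by (simp add: add.assoc add_left_mono)
next
  case ("2_2" \<gamma> v)
  then show ?case by (cases ys) auto
qed auto

lemma chain_len_insert: "chain_len \<gamma> (xs @ ys) \<le> chain_len \<gamma> (xs @ [c]) + chain_len \<gamma> (c # ys)"
proof (induction \<gamma> xs rule: chain_len.induct)
  case (1 \<gamma> x y zs)
  then show ?case by (simp add: add.assoc add_left_mono)
next
  case ("2_2" \<gamma> v)
  show ?case
  proof (cases ys)
    case (Cons y zs)
    have "ennreal (dist (\<gamma> v) (\<gamma> y)) \<le> ennreal (dist (\<gamma> v) (\<gamma> c)) + ennreal (dist (\<gamma> c) (\<gamma> y))"
      by (simp flip: ennreal_plus add: dist_triangle)
    then show ?thesis using Cons by (simp add: add.assoc[symmetric] add_right_mono)
  qed simp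
next
  case ("2_1" \<gamma>)
  show ?case by (cases ys) auto
qed

lemma sorted_split_le:
  fixes c :: real
  assumes "sorted ts"
  obtains xs ys where "ts = xs @ ys" "sorted xs" "sorted ys" "\<And>x. x \<in> set xs \<Longrightarrow> x \<le> c"
    "\<And>y. y \<in> set ys \<Longrightarrow> c < y"
proof (rule that)
  let ?xs = "takeWhile (\<lambda>x. x \<le> c) ts" and ?ys = "dropWhile (\<lambda>x. x \<le> c) ts"
  show "ts = ?xs @ ?ys" by simp
  then have s: "sorted (?xs @ ?ys)" using assms by simp
  then show "sorted ?xs" "sorted ?ys" by (auto simp only: sorted_append)
  show "x \<le> c" if "x \<in> set ?xs" for x using that by (rule set_takeWhileD[THEN conjunct2])
  show "c < y" if "y \<in> set ?ys" for y
  proof -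
    have ne: "?ys \<noteq> []" using that by (metis empty_iff list.set(1))
    then have "\<not> hd ?ys \<le> c" by (rule hd_dropWhile)
    then have "c < hd ?ys" by simp
    moreover have "hd ?ys \<le> y" using \<open>sorted ?ys\<close> ne that by (cases ?ys) auto
    ultimately show ?thesis by simp
  qed
qed

text \<open>Inserting the node \<open>c\<close> can only lengthen a polygon, and polygons of the two
  parts concatenate to one of the whole.\<close>

lemma path_len_add:
  assumes "a \<le> c" "c \<le> b" shows "path_len \<gamma> a b = path_len \<gamma> a c + path_len \<gamma> c b"
proof (rule antisym)
  show "path_len \<gamma> a b \<le> path_len \<gamma> a c + path_len \<gamma> c b"
    unfolding path_len_eq[of \<gamma> a b]
  proof (rule SUP_least, clarify)
    fix ts assume ts: "sorted ts" "set ts \<subseteq> {a..b}"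
    obtain xs ys where xy: "ts = xs @ ys" "sorted xs" "sorted ys" "\<And>x. x \<in> set xs \<Longrightarrow> x \<le> c"
      "\<And>y. y \<in> set ys \<Longrightarrow> c < y"
      using sorted_split_le[OF ts(1), of c] by blast
    have "chain_len \<gamma> ts \<le> chain_len \<gamma> (xs @ [c]) + chain_len \<gamma> (c # ys)"
      unfolding xy(1) by (rule chain_len_insert)
    also have "\<dots> \<le> path_len \<gamma> a c + path_len \<gamma> c b"
    proof (intro add_mono chain_len_le)
      show "sorted (xs @ [c])" using xy by (auto simp: sorted_append)
      show "set (xs @ [c]) \<subseteq> {a..c}" using xy(4) ts(2) assms unfolding xy(1) by auto
      show "sorted (c # ys)" using xy by (auto intro: less_imp_le)
      show "set (c # ys) \<subseteq> {c..b}" using xy(5) ts(2) assms unfolding xy(1) by fastforce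
    qed
    finally show "chain_len \<gamma> ts \<le> path_len \<gamma> a c + path_len \<gamma> c b" .
  qed
next
  have *: "chain_len \<gamma> xs + chain_len \<gamma> ys \<le> path_len \<gamma> a b"
    if "sorted xs" "set xs \<subseteq> {a..c}" "sorted ys" "set ys \<subseteq> {c..b}" for xs ys
  proof -
    have "sorted (xs @ ys)" unfolding sorted_append
    proof (intro conjI that ballI)
      fix x y assume "x \<in> set xs" "y \<in> set ys"
      then have "x \<le> c" "c \<le> y" using that by auto
      then show "x \<le> y" by simp
    qed
    moreover have "set (xs @ ys) \<subseteq> {a..b}" using that assms by force
    ultimately show ?thesis using chain_len_append[of \<gamma> xs ys] chain_len_le[of "xs @ ys" a b \<gamma>]
      by (auto intro: order_trans)
  qed
  let ?I = "\<lambda>a b. {ts. sorted ts \<and> set ts \<subseteq> {a..b::real}}"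
  have ne: "?I x y \<noteq> {}" for x y by (auto intro: exI[of _ "[]"])
  have "path_len \<gamma> a c + chain_len \<gamma> ys \<le> path_len \<gamma> a b" if "ys \<in> ?I c b" for ys
  proof -
    have "path_len \<gamma> a c + chain_len \<gamma> ys = (SUP xs\<in>?I a c. chain_len \<gamma> xs + chain_len \<gamma> ys)"
      unfolding path_len_eq[of \<gamma> a c] by (rule ennreal_SUP_add_left[OF ne, symmetric])
    also have "\<dots> \<le> path_len \<gamma> a b" using that by (intro SUP_least *) auto
    finally show ?thesis .
  qed
  then have "(SUP ys\<in>?I c b. path_len \<gamma> a c + chain_len \<gamma> ys) \<le> path_len \<gamma> a b"
    by (rule SUP_least)
  moreover have "(SUP ys\<in>?I c b. path_len \<gamma> a c + chain_len \<gamma> ys) = path_len \<gamma> a c + path_len \<gamma> c b"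
    unfolding path_len_eq[of \<gamma> c b] by (rule ennreal_SUP_add_right[OF ne, symmetric])
  ultimately show "path_len \<gamma> a c + path_len \<gamma> c b \<le> path_len \<gamma> a b" by simp
qed

lemma path_len_approx:
  assumes "path_len \<gamma> a b < \<infinity>" "0 < (e::real)"
  shows "\<exists>ts. sorted ts \<and> set ts \<subseteq> {a..b} \<and> path_len \<gamma> a b < chain_len \<gamma> ts + ennreal e"
proof (rule ccontr)
  let ?I = "{ts. sorted ts \<and> set ts \<subseteq> {a..b}}"
  assume "\<not> ?thesis"
  then have "(SUP ts\<in>?I. chain_len \<gamma> ts + ennreal e) \<le> path_len \<gamma> a b"
    by (intro SUP_least) (auto simp: not_less)
  moreover have "?I \<noteq> {}" by (auto intro: exI[of _ "[]"])
  ultimately have "path_len \<gamma> a b + ennreal e \<le> path_len \<gamma> a b"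
    unfolding path_len_eq by (simp add: ennreal_SUP_add_left)
  then show False using assms by (cases "path_len \<gamma> a b") (auto simp flip: ennreal_plus)
qed

text \<open>Take a nearly optimal partition of the rest of the interval and let \<open>s\<close> be
  its first node after \<open>t\<close>, or an earlier point close to \<open>t\<close>. Up to
  \<open>s\<close> the partition contributes only the chord from \<open>t\<close> to
  \<open>s\<close>, small by continuity, so by additivity the length up to \<open>s\<close> is
  small. With the mirror image below this makes the length function continuous and the length
  measure free of atoms.\<close>

lemma path_len_cont_right:
  assumes cont: "continuous_on {a..b} \<gamma>" and fin: "path_len \<gamma> a b < \<infinity>"
    and t: "a \<le> t" "t < b" and e: "0 < (e::real)"
  shows "\<exists>s. t < s \<and> s \<le> b \<and> path_len \<gamma> t s < ennreal e"
proof -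
  have P: "path_len \<gamma> t b < \<infinity>" using path_len_mono[of a t b b \<gamma>] t fin by (auto intro: le_less_trans)
  obtain ts where ts: "sorted ts" "set ts \<subseteq> {t..b}" "path_len \<gamma> t b < chain_len \<gamma> ts + ennreal (e/2)"
    using path_len_approx[OF P, of "e/2"] e by auto
  have "\<exists>\<delta>>0. \<forall>s\<in>{a..b}. dist s t < \<delta> \<longrightarrow> dist (\<gamma> s) (\<gamma> t) < e/2"
    using cont t e unfolding continuous_on_iff by (metis atLeastAtMost_iff half_gt_zero less_imp_le)
  then obtain \<delta> where \<delta>: "0 < \<delta>" "\<And>s. s \<in> {a..b} \<Longrightarrow> dist s t < \<delta> \<Longrightarrow> dist (\<gamma> s) (\<gamma> t) < e/2" by blast
  \<comment> \<open>\<open>b\<close> keeps \<open>s\<close> in the interval, and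
    \<open>t + \<delta>/2\<close> keeps it within reach of the continuity estimate.\<close>
  define s where "s = Min (insert b (insert (t + \<delta>/2) {x\<in>set ts. t < x}))"
  have s: "t < s" "s \<le> b" "s \<le> t + \<delta>/2" "\<And>x. x \<in> set ts \<Longrightarrow> t < x \<Longrightarrow> s \<le> x"
    using t \<delta>(1) unfolding s_def by (auto simp: Min_gr_iff simp del: Min_insert intro!: Min_le)
  obtain xs ys where xy: "ts = xs @ ys" "sorted xs" "sorted ys" "\<And>x. x \<in> set xs \<Longrightarrow> x \<le> t"
      "\<And>y. y \<in> set ys \<Longrightarrow> t < y"
    using sorted_split_le[OF ts(1), of t] by blast
  have xs: "set xs \<subseteq> {t}" using xy ts by force
  have "chain_len \<gamma> (xs @ [s]) \<le> ennreal (dist (\<gamma> t) (\<gamma> s))"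
    using xs by (induction \<gamma> xs rule: chain_len.induct) auto
  also have "\<dots> \<le> ennreal (e/2)"
    using \<delta>(2)[of s] s t \<delta>(1) by (intro ennreal_leI) (auto simp: dist_commute dist_real_def)
  finally have 1: "chain_len \<gamma> (xs @ [s]) \<le> ennreal (e/2)" .
  have 2: "chain_len \<gamma> (s # ys) \<le> path_len \<gamma> s b"
    using xy ts s by (intro chain_len_le) auto
  have "path_len \<gamma> t s + path_len \<gamma> s b = path_len \<gamma> t b"
    using path_len_add[of t s b \<gamma>] s by simp
  also have "\<dots> < chain_len \<gamma> ts + ennreal (e/2)" by (rule ts)
  also have "\<dots> \<le> (chain_len \<gamma> (xs @ [s]) + chain_len \<gamma> (s # ys)) + ennreal (e/2)"
    unfolding xy(1) by (intro add_right_mono chain_len_insert)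
  also have "\<dots> \<le> (ennreal (e/2) + path_len \<gamma> s b) + ennreal (e/2)"
    by (intro add_right_mono add_mono 1 2)
  also have "\<dots> = ennreal e + path_len \<gamma> s b"
    using e by (simp add: add.assoc add.commute flip: ennreal_plus)
  finally have "path_len \<gamma> t s < ennreal e"
    by (meson add_right_mono linorder_not_less)
  then show ?thesis using s by blast
qed

lemma path_len_cont_left:
  assumes cont: "continuous_on {a..b} \<gamma>" and fin: "path_len \<gamma> a b < \<infinity>"
    and t: "a < t" "t \<le> b" and e: "0 < (e::real)"
  shows "\<exists>s. a \<le> s \<and> s < t \<and> path_len \<gamma> s t < ennreal e"
proof -
  have P: "path_len \<gamma> a t < \<infinity>" using path_len_mono[of a a t b \<gamma>] t fin by (auto intro: le_less_trans)
  obtain ts where ts: "sorted ts" "set ts \<subseteq> {a..t}" "path_len \<gamma> a t < chain_len \<gamma> ts + ennreal (e/2)"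
    using path_len_approx[OF P, of "e/2"] e by auto
  have "\<exists>\<delta>>0. \<forall>s\<in>{a..b}. dist s t < \<delta> \<longrightarrow> dist (\<gamma> s) (\<gamma> t) < e/2"
    using cont t e unfolding continuous_on_iff by (metis atLeastAtMost_iff half_gt_zero less_imp_le)
  then obtain \<delta> where \<delta>: "0 < \<delta>" "\<And>s. s \<in> {a..b} \<Longrightarrow> dist s t < \<delta> \<Longrightarrow> dist (\<gamma> s) (\<gamma> t) < e/2" by blast
  define s where "s = Max (insert a (insert (t - \<delta>/2) {x\<in>set ts. x < t}))"
  have s: "s < t" "a \<le> s" "t - \<delta>/2 \<le> s" "\<And>x. x \<in> set ts \<Longrightarrow> x < t \<Longrightarrow> x \<le> s"
    using t \<delta>(1) unfolding s_def by (auto simp: Max_less_iff simp del: Max_insert intro!: Max_ge)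
  obtain xs ys where xy: "ts = xs @ ys" "sorted xs" "sorted ys" "\<And>x. x \<in> set xs \<Longrightarrow> x \<le> s"
      "\<And>y. y \<in> set ys \<Longrightarrow> s < y"
    using sorted_split_le[OF ts(1), of s] by blast
  have ys: "set ys \<subseteq> {t}" using xy ts s(4) by force
  have c0: "chain_len \<gamma> zs = 0" if "set zs \<subseteq> {t}" for zs
    using that by (induction \<gamma> zs rule: chain_len.induct) auto
  have "chain_len \<gamma> (s # ys) \<le> ennreal (dist (\<gamma> s) (\<gamma> t))"
    using ys c0[OF ys] by (cases ys) auto
  also have "\<dots> \<le> ennreal (e/2)"
    using \<delta>(2)[of s] s t \<delta>(1) by (intro ennreal_leI) (auto simp: dist_real_def)
  finally have 1: "chain_len \<gamma> (s # ys) \<le> ennreal (e/2)" .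
  have 2: "chain_len \<gamma> (xs @ [s]) \<le> path_len \<gamma> a s"
    using xy ts s by (intro chain_len_le) (auto simp: sorted_append)
  have "path_len \<gamma> s t + path_len \<gamma> a s = path_len \<gamma> a t"
    using path_len_add[of a s t \<gamma>] s by (simp add: add.commute)
  also have "\<dots> < chain_len \<gamma> ts + ennreal (e/2)" by (rule ts)
  also have "\<dots> \<le> (chain_len \<gamma> (xs @ [s]) + chain_len \<gamma> (s # ys)) + ennreal (e/2)"
    unfolding xy(1) by (intro add_right_mono chain_len_insert)
  also have "\<dots> \<le> (path_len \<gamma> a s + ennreal (e/2)) + ennreal (e/2)"
    by (intro add_right_mono add_mono 1 2)
  also have "\<dots> = ennreal e + path_len \<gamma> a s"
    using e by (simp add: add.assoc add.commute flip: ennreal_plus)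
  finally have "path_len \<gamma> s t < ennreal e"
    by (meson add_right_mono linorder_not_less)
  then show ?thesis using s by blast
qed

section \<open>The length measure of a rectifiable path\<close>

locale rectifiable_path =
  fixes \<gamma> :: "real \<Rightarrow> 'a::metric_space" and a b :: real
  assumes ab: "a \<le> b" and cont: "continuous_on {a..b} \<gamma>" and fin: "path_len \<gamma> a b < \<infinity>"
begin

definition len :: "real \<Rightarrow> real" where "len t = enn2real (path_len \<gamma> a (min t b))"

abbreviation "m \<equiv> length_measure \<gamma> a b"

lemma m_eq: "m = interval_measure len"
  unfolding length_measure_def len_def ..

lemma path_len_finite: "a \<le> s \<Longrightarrow> t \<le> b \<Longrightarrow> path_len \<gamma> s t < \<infinity>"
  using path_len_mono[of a s t b \<gamma>] fin by (auto intro: le_less_trans)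

lemma len_diff:
  assumes "a \<le> s" "s \<le> t" "t \<le> b"
  shows "len t - len s = enn2real (path_len \<gamma> s t)"
proof -
  have "path_len \<gamma> a t = path_len \<gamma> a s + path_len \<gamma> s t" using path_len_add[of a s t \<gamma>] assms by simp
  moreover have "path_len \<gamma> a s < \<infinity>" "path_len \<gamma> s t < \<infinity>" using path_len_finite assms by auto
  ultimately show ?thesis using assms by (simp add: len_def enn2real_plus)
qed

lemma len_mono: "s \<le> t \<Longrightarrow> len s \<le> len t"
proof -
  assume "s \<le> t"
  have "path_len \<gamma> a (min t b) < \<infinity>"
    using path_len_mono[of a a "min t b" b \<gamma>] fin by (auto intro: le_less_trans)
  moreover have "path_len \<gamma> a (min s b) \<le> path_len \<gamma> a (min t b)"
    using \<open>s \<le> t\<close> by (intro path_len_mono) auto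
  ultimately show ?thesis unfolding len_def by (intro enn2real_mono) auto
qed

lemma len_clamp: "len t = len (max a (min t b))"
proof (cases "a \<le> t")
  case True then show ?thesis using ab by (simp add: len_def max_def min_def)
next
  case False
  then show ?thesis using ab by (simp add: len_def path_len_degenerate)
qed

lemma continuous_on_len: "continuous_on {a..b} len"
  unfolding continuous_on_iff
proof (intro ballI allI impI)
  fix t e :: real assume t: "t \<in> {a..b}" and e: "0 < e"
  have "\<exists>u. t < u \<and> (\<forall>s\<in>{a..b}. t \<le> s \<and> s < u \<longrightarrow> len s - len t < e)"
  proof (cases "t < b")
    case True
    then obtain u where u: "t < u" "u \<le> b" "path_len \<gamma> t u < ennreal e"
      using path_len_cont_right[OF cont fin _ True e] t by auto
    have "len s - len t < e" if "s \<in> {a..b}" "t \<le> s" "s < u" for s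
    proof -
      have "len s \<le> len u" using that by (intro len_mono) auto
      moreover have "len u - len t < e"
        using len_diff[of t u] u t e path_len_finite[of t u]
        by (cases "path_len \<gamma> t u") (auto simp: ennreal_less_iff)
      ultimately show ?thesis by simp
    qed
    then show ?thesis using u by blast
  next
    case False
    then have "len s - len t < e" if "s \<in> {a..b}" "t \<le> s" for s
      using t that e by (cases "s = t") auto
    then show ?thesis by (intro exI[of _ "t + 1"]) simp
  qed
  then obtain u where u: "t < u" "\<And>s. s \<in> {a..b} \<Longrightarrow> t \<le> s \<Longrightarrow> s < u \<Longrightarrow> len s - len t < e" by blast
  have "\<exists>v. v < t \<and> (\<forall>s\<in>{a..b}. s \<le> t \<and> v < s \<longrightarrow> len t - len s < e)"
  proof (cases "a < t")
    case True
    then obtain v where v: "a \<le> v" "v < t" "path_len \<gamma> v t < ennreal e"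
      using path_len_cont_left[OF cont fin True _ e] t by auto
    have "len t - len s < e" if "s \<in> {a..b}" "s \<le> t" "v < s" for s
    proof -
      have "len v \<le> len s" using that by (intro len_mono) auto
      moreover have "len t - len v < e"
        using len_diff[of v t] v t e path_len_finite[of v t]
        by (cases "path_len \<gamma> v t") (auto simp: ennreal_less_iff)
      ultimately show ?thesis by simp
    qed
    then show ?thesis using v by blast
  next
    case False
    then have "len t - len s < e" if "s \<in> {a..b}" "s \<le> t" for s
      using t that e by (cases "s = t") auto
    then show ?thesis by (intro exI[of _ "t - 1"]) simp
  qed
  then obtain v where v: "v < t" "\<And>s. s \<in> {a..b} \<Longrightarrow> s \<le> t \<Longrightarrow> v < s \<Longrightarrow> len t - len s < e" by blast
  show "\<exists>d>0. \<forall>s\<in>{a..b}. dist s t < d \<longrightarrow> dist (len s) (len t) < e"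
  proof (intro exI[of _ "min (u - t) (t - v)"] conjI ballI impI)
    show "0 < min (u - t) (t - v)" using u v by simp
    fix s assume s: "s \<in> {a..b}" "dist s t < min (u - t) (t - v)"
    show "dist (len s) (len t) < e"
    proof (cases "t \<le> s")
      case True
      then show ?thesis using u(2)[of s] s len_mono[of t s] by (auto simp: dist_real_def)
    next
      case False
      then show ?thesis using v(2)[of s] s len_mono[of s t] by (auto simp: dist_real_def)
    qed
  qed
qed

lemma continuous_len: "continuous_on UNIV len"
proof -
  have "continuous_on UNIV (\<lambda>t. len (max a (min t b)))"
    by (rule continuous_on_compose2[OF continuous_on_len]) (use ab in \<open>auto intro!: continuous_intros\<close>)
  then show ?thesis using len_clamp by (simp flip: len_clamp)
qed

lemma right_continuous_len: "continuous (at_right t) len"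
  using continuous_len by (auto simp: continuous_on_eq_continuous_within intro: continuous_within_subset)

lemma sets_m [measurable_cong, simp]: "sets m = sets borel"
  and space_m [simp]: "space m = UNIV"
  by (simp_all add: m_eq)

lemma emeasure_m_Icc: "s \<le> t \<Longrightarrow> emeasure m {s..t} = ennreal (len t - len s)"
  unfolding m_eq using emeasure_interval_measure_Icc[OF _ len_mono continuous_len] by simp

lemma emeasure_m_Icc_path_len:
  assumes "a \<le> s" "s \<le> t" "t \<le> b" shows "emeasure m {s..t} = path_len \<gamma> s t"
  using assms path_len_finite[of s t] by (simp add: emeasure_m_Icc len_diff)

lemma emeasure_m_point [simp]: "emeasure m {t} = 0"
  using emeasure_m_Icc[of t t] by simp

lemma emeasure_m_Ioc: "s \<le> t \<Longrightarrow> emeasure m {s<..t} = ennreal (len t - len s)"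
  unfolding m_eq using emeasure_interval_measure_Ioc[OF _ len_mono right_continuous_len] by simp

lemma emeasure_m_Ioi: "emeasure m {t<..} = ennreal (len b - len t)"
proof -
  have L: "(\<lambda>n. emeasure m {t<..t + real n}) \<longlonglongrightarrow> emeasure m (\<Union>n. {t<..t + real n})"
    by (intro Lim_emeasure_incseq) (auto intro!: incseq_SucI)
  have "(\<Union>n. {t<..t + real n}) = {t<..}"
  proof (intro set_eqI iffI)
    fix x assume "x \<in> {t<..}"
    moreover obtain n where "x - t \<le> real n" using real_arch_simple by blast
    ultimately show "x \<in> (\<Union>n. {t<..t + real n})" by (auto intro!: exI[of _ n])
  qed auto
  moreover have "(\<lambda>n. emeasure m {t<..t + real n}) \<longlonglongrightarrow> ennreal (len b - len t)"
  proof (rule tendsto_eventually, rule eventually_sequentiallyI)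
    fix n assume n: "nat \<lceil>max 0 (b - t)\<rceil> \<le> n"
    then have "b \<le> t + real n" by linarith
    then have "len (t + real n) = len b" using len_clamp[of "t + real n"] ab by (simp add: min_def max_def)
    then show "emeasure m {t<..t + real n} = ennreal (len b - len t)" by (simp add: emeasure_m_Ioc)
  qed
  ultimately show ?thesis using L by (metis LIMSEQ_unique)
qed

lemma emeasure_m_UNIV: "emeasure m UNIV = ennreal (len b - len a)"
proof -
  have L: "(\<lambda>n. emeasure m {a - real n<..}) \<longlonglongrightarrow> emeasure m (\<Union>n. {a - real n<..})"
    by (intro Lim_emeasure_incseq) (auto intro!: incseq_SucI)
  have "(\<Union>n. {a - real n<..}) = UNIV"
  proof (intro set_eqI iffI UNIV_I)
    fix x
    obtain n where "a - x < real n" using reals_Archimedean2 by blast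
    then show "x \<in> (\<Union>n. {a - real n<..})" by (auto intro!: exI[of _ n])
  qed
  moreover have "emeasure m {a - real n<..} = ennreal (len b - len a)" for n
    using len_clamp[of "a - real n"] ab by (simp add: emeasure_m_Ioi)
  ultimately show ?thesis using L by (simp add: LIMSEQ_const_iff)
qed

sublocale m: finite_measure m
  by standard (simp add: emeasure_m_UNIV)

lemma rectifiable_subpath: "a \<le> s \<Longrightarrow> s \<le> t \<Longrightarrow> t \<le> b \<Longrightarrow> rectifiable_path \<gamma> s t"
  using path_len_finite cont by unfold_locales (auto intro: continuous_on_subset)

text \<open>A line integral over a subpath uses the subpath's own length measure. Additivity of
  length identifies it with the restriction of \<open>m\<close>; the two are compared on the rays
  \<open>{x<..}\<close>.\<close>

lemma length_measure_subpath:
  assumes st: "a \<le> s" "s \<le> t" "t \<le> b"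
  shows "length_measure \<gamma> s t = density m (indicator {s..t})"
proof -
  interpret sub: rectifiable_path \<gamma> s t by (rule rectifiable_subpath[OF st])
  show ?thesis
  proof (rule measure_eqI_lessThan)
    fix x
    show "emeasure (length_measure \<gamma> s t) {x<..} < \<infinity>" by (simp add: sub.emeasure_m_Ioi)
    have "emeasure (density m (indicator {s..t})) {x<..} = emeasure m ({s..t} \<inter> {x<..})"
      by (simp add: emeasure_density indicator_inter_arith[symmetric] nn_integral_indicator)
    also have "\<dots> = ennreal (sub.len t - sub.len x)"
    proof -
      consider "x < s" | "s \<le> x" "x \<le> t" | "t < x" by linarith
      then show ?thesis
      proof cases
        case 1
        then have "{s..t} \<inter> {x<..} = {s..t}" by auto
        moreover have "sub.len x = sub.len s" using sub.len_clamp[of x] 1 st by (simp add: max_def min_def)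
        ultimately show ?thesis
          using emeasure_m_Icc_path_len[OF st] sub.emeasure_m_Icc_path_len[of s t] st
          by (simp add: sub.emeasure_m_Icc)
      next
        case 2
        then have "{s..t} \<inter> {x<..} = {x<..t}" by auto
        moreover have "emeasure m {x<..t} = emeasure m {x..t}"
          using 2 by (simp add: emeasure_m_Ioc emeasure_m_Icc)
        ultimately show ?thesis
          using emeasure_m_Icc_path_len[of x t] sub.emeasure_m_Icc_path_len[of x t] st 2
          by (simp add: sub.emeasure_m_Icc)
      next
        case 3
        then have "{s..t} \<inter> {x<..} = {}" by auto
        moreover have "sub.len x = sub.len t" using sub.len_clamp[of x] 3 st by (simp add: max_def min_def)
        ultimately show ?thesis by simp
      qed
    qed
    finally show "emeasure (length_measure \<gamma> s t) {x<..} = emeasure (density m (indicator {s..t})) {x<..}"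
      by (simp add: sub.emeasure_m_Ioi)
  qed auto
qed

lemma borel_measurable_along:
  assumes "\<rho> \<in> borel_measurable (restrict_space borel X)" "\<gamma> ` {a..b} \<subseteq> X"
  shows "(\<lambda>t. \<rho> (\<gamma> t) * indicator {a..b} t :: ennreal) \<in> borel_measurable borel"
proof -
  have "\<gamma> \<in> measurable (restrict_space borel {a..b}) (restrict_space borel X)"
    using assms(2) borel_measurable_continuous_on_restrict[OF cont]
    by (intro measurable_restrict_space2) (auto simp: space_restrict_space)
  then have "(\<lambda>t. \<rho> (\<gamma> t)) \<in> borel_measurable (restrict_space borel {a..b})"
    using assms(1) by (rule measurable_compose)
  then show ?thesis by (subst (asm) borel_measurable_restrict_space_iff_ennreal) auto
qed

lemma line_integral_eq: "line_integral \<rho> (\<gamma>, a, b) = (\<integral>\<^sup>+t. \<rho> (\<gamma> t) * indicator {a..b} t \<partial>m)"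
  using fin by simp

lemma line_integral_subpath:
  assumes st: "a \<le> s" "s \<le> t" "t \<le> b"
    and \<rho>: "\<rho> \<in> borel_measurable (restrict_space borel X)" "\<gamma> ` {a..b} \<subseteq> X"
  shows "line_integral \<rho> (\<gamma>, s, t) = (\<integral>\<^sup>+\<tau>. \<rho> (\<gamma> \<tau>) * indicator {s..t} \<tau> \<partial>m)"
proof -
  interpret sub: rectifiable_path \<gamma> s t by (rule rectifiable_subpath[OF st])
  have "\<gamma> ` {s..t} \<subseteq> X" using \<rho> st by auto
  note [measurable] = sub.borel_measurable_along[OF \<rho>(1) this]
  have "line_integral \<rho> (\<gamma>, s, t) = (\<integral>\<^sup>+\<tau>. \<rho> (\<gamma> \<tau>) * indicator {s..t} \<tau> \<partial>density m (indicator {s..t}))"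
    unfolding sub.line_integral_eq length_measure_subpath[OF st] ..
  also have "\<dots> = (\<integral>\<^sup>+\<tau>. indicator {s..t} \<tau> * (\<rho> (\<gamma> \<tau>) * indicator {s..t} \<tau>) \<partial>m)"
    by (rule nn_integral_density) (auto simp: measurable_cong_sets[OF sets_m refl])
  also have "\<dots> = (\<integral>\<^sup>+\<tau>. \<rho> (\<gamma> \<tau>) * indicator {s..t} \<tau> \<partial>m)"
    by (intro nn_integral_cong) (auto simp: indicator_def)
  finally show ?thesis .
qed

lemma dist_le_m: "a \<le> s \<Longrightarrow> s \<le> t \<Longrightarrow> t \<le> b \<Longrightarrow> dist (\<gamma> s) (\<gamma> t) \<le> measure m {s..t}"
  using dist_le_path_len[of s s t t \<gamma>] emeasure_m_Icc_path_len[of s t]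
    ennreal_le_iff[of "measure m {s..t}" "dist (\<gamma> s) (\<gamma> t)"]
  by (simp add: m.emeasure_eq_measure)

end

section \<open>Two estimates on an interval\<close>

locale finite_atomless = finite_measure m for m :: "real measure" +
  assumes sets_m [measurable_cong, simp]: "sets m = sets borel"
    and point [simp]: "\<And>t. measure m {t} = 0"
begin

lemma space_m [simp]: "space m = UNIV"
  using sets_eq_imp_space_eq[OF sets_m] by simp

lemma measure_Icc_Int:
  assumes "A \<in> sets borel"
  shows "measure m ({s..t} \<inter> A) = measure m ({s<..t} \<inter> A)"
proof (rule measure_eq_AE)
  have "AE x in m. x \<noteq> s"
    using point[of s] by (intro AE_I[of _ _ "{s}"]) (auto simp: emeasure_eq_measure)
  then show "AE x in m. (x \<in> {s..t} \<inter> A) = (x \<in> {s<..t} \<inter> A)" by (auto elim!: eventually_mono)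
qed (use assms in auto)

lemma measure_Icc: "measure m {s..t} = measure m {s<..t}"
  using measure_Icc_Int[of UNIV s t] by simp

end

text \<open>\<open>F\<close> plays a function with an upper gradient along a path, \<open>W\<close>
  a Lipschitz function, and they agree on \<open>T\<close> up to \<open>N\<close>. Let
  \<open>K\<close> be a closed set that nearly exhausts the set of agreement. In each small cell
  meeting \<open>K\<close>, the passage from its first to its last point in \<open>K\<close> is
  estimated by \<open>F\<close>, and the two ends, which miss \<open>K\<close>, by the Lipschitz
  bound. The \<open>F\<close> parts are charged to a neighbourhood of \<open>K\<close> that shrinks
  to \<open>K\<close> with the mesh.\<close>

lemma glue_on_interval:
  fixes F W :: "real \<Rightarrow> 'v::real_normed_vector"
  assumes m: "finite_atomless m" and \<nu>: "finite_atomless \<nu>"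
    and ab: "a \<le> b" and L: "0 \<le> L"
    and F: "\<And>s t. a \<le> s \<Longrightarrow> s \<le> t \<Longrightarrow> t \<le> b \<Longrightarrow> norm (F s - F t) \<le> measure \<nu> {s..t}"
    and W: "\<And>s t. a \<le> s \<Longrightarrow> s \<le> t \<Longrightarrow> t \<le> b \<Longrightarrow> norm (W s - W t) \<le> L * measure m {s..t}"
    and T: "T \<in> sets borel" "T \<subseteq> {a..b}"
    and N: "N \<in> sets borel" "measure m N = 0" "\<And>t. t \<in> T - N \<Longrightarrow> F t = W t"
  shows "norm (W a - W b) \<le> measure \<nu> T + L * measure m ({a..b} - T)"
proof -
  interpret m: finite_atomless m by fact
  interpret \<nu>: finite_atomless \<nu> by fact
  have "norm (W a - W b) \<le> measure \<nu> T + L * measure m ({a..b} - T) + e" if e: "0 < e" for e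
  proof -
    \<comment> \<open>The denominator \<open>L + 1\<close> also covers \<open>L = 0\<close>.\<close>
    obtain e' where e': "0 < e'" "L * e' \<le> e" 
      using e L by (intro that[of "e / (L + 1)"]) (auto simp: field_simps)
    have "emeasure m UNIV < \<infinity>" by (simp add: m.emeasure_eq_measure)
    then obtain K Op where K: "closed K" "open Op" "K \<subseteq> T - N" "T - N \<subseteq> Op" "emeasure m (Op - K) < ennreal e'"
      using finite_borel_measure_regular[of m "T - N" e'] T N e' by auto
    have KF: "F t = W t" if "t \<in> K" for t using K N that by blast
    have Kab: "K \<subseteq> {a..b}" using K T by blast
    have [measurable]: "K \<in> sets borel" "T \<in> sets borel" "N \<in> sets borel" using K T N by auto
    have "measure m ((T - N) - K) \<le> e'"
    proof -
      have "emeasure m ((T - N) - K) \<le> emeasure m (Op - K)"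
        using K by (intro emeasure_mono) auto
      then show ?thesis using K(5) e' by (simp add: m.emeasure_eq_measure ennreal_less_iff)
    qed
    moreover have "measure m (T - K) \<le> measure m ((T - N) - K) + measure m N"
      by (rule order_trans[OF m.finite_measure_mono measure_Un_le]) auto
    ultimately have TK: "measure m (T - K) \<le> e'" using N by simp
    have "measure m ({a..b} - K) \<le> measure m ({a..b} - T) + measure m (T - K)"
      by (rule order_trans[OF m.finite_measure_mono measure_Un_le]) auto
    then have mK: "L * measure m ({a..b} - K) \<le> L * measure m ({a..b} - T) + e"
      using TK e' L mult_left_mono[of "measure m ({a..b} - K)" "measure m ({a..b} - T) + e'" L]
      by (auto simp: algebra_simps)
    \<comment> \<open>The empty set is treated apart because \<open>infdist\<close> to it is
      0.\<close>
    define U where "U \<eta> = (if K = {} then {} else {t. infdist t K \<le> \<eta>})" for \<eta> :: real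
    have U[measurable]: "U \<eta> \<in> sets borel" for \<eta>
    proof -
      have "closed {t. infdist t K \<le> \<eta>}" by (intro closed_Collect_le continuous_intros)
      then show ?thesis unfolding U_def by auto
    qed
    have cell: "norm (W s - W t) \<le> measure \<nu> ({s<..t} \<inter> U \<eta>) + L * measure m ({s<..t} - K)"
      if st: "a \<le> s" "s \<le> t" "t \<le> b" "t - s \<le> \<eta>" for s t \<eta>
    proof (cases "K \<inter> {s..t} = {}")
      case True
      have "measure m {s..t} = measure m ({s..t} \<inter> - K)" using True by (intro arg_cong[of _ _ "measure m"]) auto
      also have "\<dots> = measure m ({s<..t} \<inter> - K)" by (rule m.measure_Icc_Int) simp
      finally have "norm (W s - W t) \<le> L * measure m ({s<..t} - K)"
        using W[of s t] st by (simp add: Diff_eq)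
      then show ?thesis using measure_nonneg[of \<nu>] by (smt (verit))
    next
      case False
      have cpt: "compact (K \<inter> {s..t})" using K by (intro closed_Int_compact) auto
      obtain s' where s': "s' \<in> K \<inter> {s..t}" "\<And>x. x \<in> K \<inter> {s..t} \<Longrightarrow> s' \<le> x"
        using compact_attains_inf[OF cpt False] by blast
      obtain t' where t': "t' \<in> K \<inter> {s..t}" "\<And>x. x \<in> K \<inter> {s..t} \<Longrightarrow> x \<le> t'"
        using compact_attains_sup[OF cpt False] by blast
      have s't': "s' \<le> t'" using s'(2)[OF t'(1)] .
      have "norm (W s - W t) \<le> norm (W s - W s') + norm (W s' - W t') + norm (W t' - W t)"
        using norm_triangle_ineq[of "W s - W s'" "W s' - W t'"]
          norm_triangle_ineq[of "W s - W t'" "W t' - W t"] by simp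
      also have "norm (W s' - W t') = norm (F s' - F t')" using KF s' t' by simp
      also have "norm (F s' - F t') \<le> measure \<nu> {s'..t'}" using F[of s' t'] s' t' s't' st by auto
      also have "norm (W s - W s') \<le> L * measure m {s..s'}" using W[of s s'] s' st by auto
      also have "norm (W t' - W t) \<le> L * measure m {t'..t}" using W[of t' t] t' st by auto
      finally have 1: "norm (W s - W t) \<le> measure \<nu> {s'..t'} + L * (measure m {s..s'} + measure m {t'..t})"
        by (simp add: algebra_simps)
      have "{s'..t'} \<subseteq> {s..t} \<inter> U \<eta>"
      proof
        fix x assume x: "x \<in> {s'..t'}"
        have "infdist x K \<le> dist x s'" using s' by (intro infdist_le) auto
        also have "\<dots> \<le> \<eta>" using x s' t' st by (auto simp: dist_real_def)
        finally show "x \<in> {s..t} \<inter> U \<eta>" using x s' t' by (auto simp: U_def)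
      qed
      then have "measure \<nu> {s'..t'} \<le> measure \<nu> ({s..t} \<inter> U \<eta>)"
        by (intro \<nu>.finite_measure_mono) auto
      then have 2: "measure \<nu> {s'..t'} \<le> measure \<nu> ({s<..t} \<inter> U \<eta>)" by (simp add: \<nu>.measure_Icc_Int)
      have "measure m {s..s'} = measure m ({s..s'} \<inter> - {s'})"
      proof (rule measure_eq_AE)
        have "AE x in m. x \<noteq> s'"
          using m.point[of s'] by (intro AE_I[of _ _ "{s'}"]) (auto simp: m.emeasure_eq_measure)
        then show "AE x in m. (x \<in> {s..s'}) = (x \<in> {s..s'} \<inter> - {s'})" by (auto elim!: eventually_mono)
      qed auto
      moreover have "measure m ({s..s'} \<inter> - {s'}) + measure m {t'<..t} = measure m (({s..s'} \<inter> - {s'}) \<union> {t'<..t})"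
        using s't' by (intro m.finite_measure_Union[symmetric]) auto
      moreover have "\<dots> \<le> measure m ({s..t} \<inter> - K)"
      proof (rule m.finite_measure_mono)
        show "({s..s'} \<inter> - {s'}) \<union> {t'<..t} \<subseteq> {s..t} \<inter> - K"
          using s' t' by (force dest: s'(2) t'(2))
      qed simp
      ultimately have "measure m {s..s'} + measure m {t'..t} \<le> measure m ({s<..t} - K)"
        using m.measure_Icc_Int[of "- K" s t] by (simp add: m.measure_Icc[of t'] Diff_eq)
      then show ?thesis using 1 2 mult_left_mono[OF _ L] by (smt (verit))
    qed
    have mesh: "norm (W a - W b) \<le> measure \<nu> (U (1 / real (Suc n))) + L * measure m ({a..b} - K)" for n
    proof -
      let ?\<eta> = "1 / real (Suc n)"
      \<comment> \<open>Half-open cells make the bounds additive, their missing left end points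
        being null; \<open>min b\<close> clips the last cell.\<close>
      have "norm (W a - W t) \<le> measure \<nu> ({a<..t} \<inter> U ?\<eta>) + L * measure m ({a<..t} - K)"
        if "t = min b (a + real k * ?\<eta>)" for k t using that
      proof (induction k arbitrary: t)
        case 0 then show ?case using ab by simp
      next
        case (Suc k)
        define s where "s = min b (a + real k * ?\<eta>)"
        have st: "a \<le> s" "s \<le> t" "t \<le> b" "t - s \<le> ?\<eta>"
        proof -
          define p where "p = real k * ?\<eta>"
          have "a + real (Suc k) * ?\<eta> = a + p + ?\<eta>" unfolding p_def by (simp add: distrib_right add_divide_distrib)
          then have t: "t = min b (a + p + ?\<eta>)" unfolding Suc.prems by simp
          have s: "s = min b (a + p)" by (simp add: s_def p_def)
          have "0 \<le> p" "0 \<le> ?\<eta>" by (simp_all add: p_def)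
          then show "a \<le> s" "s \<le> t" "t \<le> b" "t - s \<le> ?\<eta>" unfolding s t using ab by linarith+
        qed
        have "norm (W a - W t) \<le> norm (W a - W s) + norm (W s - W t)"
          using norm_triangle_ineq[of "W a - W s" "W s - W t"] by simp
        also have "\<dots> \<le> (measure \<nu> ({a<..s} \<inter> U ?\<eta>) + L * measure m ({a<..s} - K))
            + (measure \<nu> ({s<..t} \<inter> U ?\<eta>) + L * measure m ({s<..t} - K))"
          by (intro add_mono Suc.IH cell st) (simp add: s_def)
        also have "measure \<nu> ({a<..s} \<inter> U ?\<eta>) + measure \<nu> ({s<..t} \<inter> U ?\<eta>)
            = measure \<nu> (({a<..s} \<inter> U ?\<eta>) \<union> ({s<..t} \<inter> U ?\<eta>))"
          by (intro \<nu>.finite_measure_Union[symmetric]) auto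
        moreover have "measure m ({a<..s} - K) + measure m ({s<..t} - K)
            = measure m (({a<..s} - K) \<union> ({s<..t} - K))"
          by (intro m.finite_measure_Union[symmetric]) auto
        moreover have "({a<..s} \<inter> U ?\<eta>) \<union> ({s<..t} \<inter> U ?\<eta>) = {a<..t} \<inter> U ?\<eta>"
          "({a<..s} - K) \<union> ({s<..t} - K) = {a<..t} - K" using st by auto
        ultimately show ?case by (smt (verit) distrib_left)
      qed
      from this[OF refl, of "Suc n * nat \<lceil>b - a\<rceil>"]
      have *: "norm (W a - W t) \<le> measure \<nu> ({a<..t} \<inter> U ?\<eta>) + L * measure m ({a<..t} - K)"
        if "t = min b (a + real (Suc n * nat \<lceil>b - a\<rceil>) * ?\<eta>)" for t using that by simp
      have "a + real (Suc n * nat \<lceil>b - a\<rceil>) * ?\<eta> \<ge> b"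
      proof -
        have "real (Suc n * nat \<lceil>b - a\<rceil>) * ?\<eta> = real (nat \<lceil>b - a\<rceil>)"
          by (simp only: of_nat_mult times_divide_eq_right mult_1_right) (simp del: of_nat_Suc)
        then show ?thesis by linarith
      qed
      then have "norm (W a - W b) \<le> measure \<nu> ({a<..b} \<inter> U ?\<eta>) + L * measure m ({a<..b} - K)"
        by (intro *) simp
      also have "\<dots> \<le> measure \<nu> (U ?\<eta>) + L * measure m ({a..b} - K)"
        by (intro add_mono mult_left_mono L \<nu>.finite_measure_mono m.finite_measure_mono) auto
      finally show ?thesis .
    qed
    have "(\<lambda>n. measure \<nu> (U (1 / real (Suc n)))) \<longlonglongrightarrow> measure \<nu> (\<Inter>n. U (1 / real (Suc n)))"
    proof (rule \<nu>.finite_Lim_measure_decseq)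
      show "decseq (\<lambda>n. U (1 / real (Suc n)))"
      proof (rule decseq_SucI)
        fix n
        have "1 / real (Suc (Suc n)) \<le> 1 / real (Suc n)" by (simp add: frac_le)
        then show "U (1 / real (Suc (Suc n))) \<subseteq> U (1 / real (Suc n))" unfolding U_def by auto
      qed
    qed auto
    moreover have "(\<Inter>n. U (1 / real (Suc n))) \<subseteq> K"
    proof
      fix x assume x: "x \<in> (\<Inter>n. U (1 / real (Suc n)))"
      then have ne: "K \<noteq> {}" by (auto simp: U_def split: if_splits)
      have "infdist x K \<le> 1 / real (Suc n)" for n using x ne by (auto simp: U_def)
      then have "infdist x K \<le> 0"
        by (metis leD leI nat_approx_posE)
      then have "infdist x K = 0" using infdist_nonneg[of x K] by linarith
      then show "x \<in> K" using in_closed_iff_infdist_zero[OF K(1) ne] by blast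
    qed
    ultimately have lim: "(\<lambda>n. measure \<nu> (U (1 / real (Suc n)))) \<longlonglongrightarrow> measure \<nu> (\<Inter>n. U (1 / real (Suc n)))"
      "measure \<nu> (\<Inter>n. U (1 / real (Suc n))) \<le> measure \<nu> T"
      using K by (auto intro!: \<nu>.finite_measure_mono)
    then have "norm (W a - W b) - L * measure m ({a..b} - K) \<le> measure \<nu> T"
    proof -
      have "norm (W a - W b) - L * measure m ({a..b} - K) \<le> measure \<nu> (U (1 / real (Suc n)))" for n
        using mesh[of n] by simp
      then have "norm (W a - W b) - L * measure m ({a..b} - K) \<le> measure \<nu> (\<Inter>n. U (1 / real (Suc n)))"
        by (intro LIMSEQ_le_const[OF lim(1)]) blast
      then show ?thesis using lim(2) by (rule order_trans)
    qed
    then have "norm (W a - W b) \<le> measure \<nu> T + L * measure m ({a..b} - K)" by simp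
    then show ?thesis using mK by simp
  qed
  then show ?thesis by (rule field_le_epsilon)
qed

section \<open>Hajlasz inequalities along a path\<close>

lemma exists_le_average:
  fixes g :: "'b \<Rightarrow> ennreal"
  assumes [measurable]: "A \<in> sets N" "g \<in> borel_measurable N"
    and c: "emeasure N A = ennreal c" "0 < c" and fin: "(\<integral>\<^sup>+x. g x * indicator A x \<partial>N) < \<infinity>"
  obtains x where "x \<in> A" "g x * ennreal c \<le> (\<integral>\<^sup>+x. g x * indicator A x \<partial>N)"
proof -
  define I where "I = (\<integral>\<^sup>+x. g x * indicator A x \<partial>N)"
  have "\<exists>x\<in>A. g x * ennreal c \<le> I"
  proof (rule ccontr)
    assume "\<not> ?thesis"
    then have less: "I < g x * ennreal c" if "x \<in> A" for x using that by (auto simp: not_le)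
    obtain i where i: "I = ennreal i" "0 \<le> i" using fin by (cases I) (auto simp: I_def)
    have q: "ennreal (i / c) < g x" if "x \<in> A" for x
    proof (cases "g x")
      case (real r)
      then show ?thesis using less[OF that] i c
        by (auto simp: ennreal_mult[symmetric] ennreal_less_iff field_simps)
    qed auto
    have eq: "(\<integral>\<^sup>+x. ennreal (i / c) * indicator A x \<partial>N) = I"
      using i c by (simp add: nn_integral_cmult_indicator ennreal_mult[symmetric])
    have "(\<integral>\<^sup>+x. ennreal (i / c) * indicator A x \<partial>N) < (\<integral>\<^sup>+x. g x * indicator A x \<partial>N)"
    proof (rule nn_integral_less)
      show "(\<integral>\<^sup>+x. ennreal (i / c) * indicator A x \<partial>N) \<noteq> \<infinity>" unfolding eq i by simp
      show "AE x in N. ennreal (i / c) * indicator A x \<le> g x * indicator A x"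
        using q by (auto simp: indicator_def intro: less_imp_le)
      show "\<not> (AE x in N. g x * indicator A x \<le> ennreal (i / c) * indicator A x)"
      proof
        assume "AE x in N. g x * indicator A x \<le> ennreal (i / c) * indicator A x"
        then have "AE x in N. x \<notin> A"
        proof (rule eventually_mono)
          fix x assume x: "g x * indicator A x \<le> ennreal (i / c) * indicator A x"
          show "x \<notin> A" using q[of x] x by (cases "x \<in> A") (auto simp: not_le[symmetric])
        qed
        then have "emeasure N A = 0"
          by (subst (asm) AE_iff_measurable[of A]) (use sets.sets_into_space[of A N] in auto)
        then show False using c by simp
      qed
    qed auto
    then show False unfolding eq by (simp add: I_def)
  qed
  then show thesis using that unfolding I_def by blast
qed

text \<open>The distance of the end points is replaced by the length
  \<open>measure m {s..t}\<close>, so the whole argument takes place on an interval.\<close>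

locale hajlasz_on_path = rectifiable_path \<gamma> a b
  for \<gamma> :: "real \<Rightarrow> 'a::metric_space" and a b :: real +
  fixes g :: "real \<Rightarrow> ennreal" and W :: "real \<Rightarrow> 'v::banach"
  assumes g [measurable]: "g \<in> borel_measurable borel"
    and g_fin: "(\<integral>\<^sup>+t. g t * indicator {a..b} t \<partial>m) < \<infinity>"
    and W: "\<And>s t. a \<le> s \<Longrightarrow> s \<le> t \<Longrightarrow> t \<le> b \<Longrightarrow> g s < \<infinity> \<Longrightarrow> g t < \<infinity> \<Longrightarrow>
      norm (W s - W t) \<le> measure m {s..t} * (enn2real (g s) + enn2real (g t))"
begin

definition \<nu> where "\<nu> = density m (\<lambda>t. g t * indicator {a..b} t)"

lemma sets_\<nu> [measurable_cong, simp]: "sets \<nu> = sets borel"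
  by (simp add: \<nu>_def)

sublocale \<nu>: finite_measure \<nu>
proof
  have "emeasure \<nu> (space \<nu>) = (\<integral>\<^sup>+t. g t * indicator {a..b} t \<partial>m)"
    unfolding \<nu>_def by (subst emeasure_density) (auto intro!: nn_integral_cong)
  then show "emeasure \<nu> (space \<nu>) \<noteq> \<infinity>" using g_fin by simp
qed

lemma emeasure_\<nu>: "A \<in> sets borel \<Longrightarrow> A \<subseteq> {a..b} \<Longrightarrow> emeasure \<nu> A = (\<integral>\<^sup>+t. g t * indicator A t \<partial>m)"
  unfolding \<nu>_def by (subst emeasure_density) (auto intro!: nn_integral_cong simp: indicator_def)

lemma exists_le_average_\<nu>:
  assumes A: "A \<in> sets borel" "A \<subseteq> {a..b}" and c: "measure m A = c" "0 < c"
  obtains x where "x \<in> A" "g x < \<infinity>" "enn2real (g x) * c \<le> measure \<nu> A"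
proof -
  have nu: "(\<integral>\<^sup>+t. g t * indicator A t \<partial>m) = ennreal (measure \<nu> A)"
    using emeasure_\<nu>[OF A] by (simp add: \<nu>.emeasure_eq_measure)
  obtain x where x: "x \<in> A" "g x * ennreal c \<le> ennreal (measure \<nu> A)"
  proof (rule exists_le_average)
    show "A \<in> sets m" using A by simp
    show "g \<in> borel_measurable m" using g by (simp add: measurable_cong_sets[OF sets_m refl])
    show "emeasure m A = ennreal c" using c by (simp add: m.emeasure_eq_measure)
    show "(\<integral>\<^sup>+t. g t * indicator A t \<partial>m) < \<infinity>" unfolding nu by simp
  qed (use c(2) nu that in simp_all)
  have "g x < \<infinity>"
  proof (rule ccontr)
    assume "\<not> ?thesis"
    then have "g x = top" by (cases "g x") auto
    then show False using x c by (simp add: ennreal_top_mult top_unique)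
  qed
  moreover from this have "enn2real (g x) * c \<le> measure \<nu> A"
    using x c by (cases "g x") (auto simp: ennreal_mult[symmetric])
  ultimately show thesis using that x by blast
qed

text \<open>Cut the interval into pieces of equal length \<open>h\<close> and choose in each a point
  where \<open>g\<close> is at most its average. Neighbouring points are at most 2 h apart along the
  path, so their increment costs twice the integral of \<open>g\<close> over both pieces; each piece
  is used twice, hence the factor 4. The two end terms are \<open>h\<close> times a finite value and
  vanish with \<open>h\<close>.\<close>

lemma hajlasz_interval:
  assumes st: "a \<le> s" "s \<le> t" "t \<le> b" and gf: "g s < \<infinity>" "g t < \<infinity>"
  shows "norm (W s - W t) \<le> 4 * measure \<nu> {s..t}"
proof (cases "len s = len t")
  case True
  then have "measure m {s..t} = 0" using st by (simp add: measure_def emeasure_m_Icc)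
  then show ?thesis using W[OF st gf] by simp
next
  case False
  define ell where "ell = len t - len s"
  have ell: "0 < ell" using False len_mono[of s t] st by (simp add: ell_def)
  have main: "norm (W s - W t) \<le> 4 * measure \<nu> {s..t} + (ell / real (Suc n)) * (enn2real (g s) + enn2real (g t))" for n
  proof -
    define h where "h = ell / real (Suc n)"
    have h: "0 < h" using ell by (simp add: h_def)
    have "\<forall>i. \<exists>x. i \<le> Suc n \<longrightarrow> s \<le> x \<and> x \<le> t \<and> len x = len s + real i * h"
    proof
      fix i
      show "\<exists>x. i \<le> Suc n \<longrightarrow> s \<le> x \<and> x \<le> t \<and> len x = len s + real i * h"
      proof (cases "i \<le> Suc n")
        case True
        then have "real i * h \<le> ell" using ell unfolding h_def
          by (simp add: divide_simps)
        then have "len s + real i * h \<le> len t" "len s \<le> len s + real i * h" using h by (auto simp: ell_def)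
        then obtain x where "s \<le> x" "x \<le> t" "len x = len s + real i * h"
          using IVT'[of len s "len s + real i * h" t] st continuous_on_subset[OF continuous_on_len, of "{s..t}"]
          by auto
        then show ?thesis by blast
      qed auto
    qed
    then obtain \<tau> where \<tau>: "\<And>i. i \<le> Suc n \<Longrightarrow> s \<le> \<tau> i \<and> \<tau> i \<le> t \<and> len (\<tau> i) = len s + real i * h" by metis
    have \<tau>_less: "\<tau> i < \<tau> (Suc i)" if "i \<le> n" for i
    proof (rule ccontr)
      assume "\<not> ?thesis"
      then have "len (\<tau> (Suc i)) \<le> len (\<tau> i)" by (intro len_mono) auto
      then show False using \<tau>[of i] \<tau>[of "Suc i"] that h by (simp add: algebra_simps)
    qed
    let ?c = "\<lambda>i. {\<tau> i<..\<tau> (Suc i)}"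
    have mc: "measure m (?c i) = h" if "i \<le> n" for i
      using \<tau>[of i] \<tau>[of "Suc i"] \<tau>_less[OF that] that h
      by (simp add: measure_def emeasure_m_Ioc algebra_simps)
    have mle: "measure m {x..y} \<le> len y - len x" if "x \<le> y" for x y
      using that len_mono[of x y] by (simp add: measure_def emeasure_m_Icc)
    have cab: "?c i \<subseteq> {a..b}" if "i \<le> n" for i using \<tau>[of i] \<tau>[of "Suc i"] st that by auto
    \<comment> \<open>The piece of the current point has been charged twice; the next step charges
      it twice more, which gives the factor 4.\<close>
    have P: "\<exists>x\<in>?c i. g x < \<infinity> \<and> enn2real (g x) * h \<le> measure \<nu> (?c i) \<and>
        norm (W s - W x) \<le> h * enn2real (g s) + 4 * measure \<nu> {s<..\<tau> i} + 2 * measure \<nu> (?c i)"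
      if "i \<le> n" for i using that
    proof (induction i)
      case 0
      obtain x where x: "x \<in> ?c 0" "g x < \<infinity>" "enn2real (g x) * h \<le> measure \<nu> (?c 0)"
        by (rule exists_le_average_\<nu>[OF _ cab mc h]) auto
      have sx: "s \<le> x" "x \<le> b" "x \<le> \<tau> (Suc 0)" using x \<tau>[of 0] \<tau>[of 1] st by auto
      have "norm (W s - W x) \<le> measure m {s..x} * (enn2real (g s) + enn2real (g x))"
        using W[of s x] st sx gf x by auto
      also have "\<dots> \<le> h * (enn2real (g s) + enn2real (g x))"
        using mle[OF sx(1)] len_mono[OF sx(3)] \<tau>[of 1] by (intro mult_right_mono) auto
      finally have "norm (W s - W x) \<le> h * (enn2real (g s) + enn2real (g x))" .
      moreover have "0 \<le> measure \<nu> {s<..\<tau> 0}" "0 \<le> measure \<nu> (?c 0)" by simp_all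
      moreover have "h * (enn2real (g s) + enn2real (g x)) = h * enn2real (g s) + enn2real (g x) * h"
        by (simp add: algebra_simps)
      ultimately have "norm (W s - W x) \<le> h * enn2real (g s) + 4 * measure \<nu> {s<..\<tau> 0} + 2 * measure \<nu> (?c 0)"
        using x(3) by linarith
      then show ?case using x by blast
    next
      case (Suc i)
      then obtain x where x: "x \<in> ?c i" "g x < \<infinity>" "enn2real (g x) * h \<le> measure \<nu> (?c i)"
        "norm (W s - W x) \<le> h * enn2real (g s) + 4 * measure \<nu> {s<..\<tau> i} + 2 * measure \<nu> (?c i)" by auto
      obtain y where y: "y \<in> ?c (Suc i)" "g y < \<infinity>" "enn2real (g y) * h \<le> measure \<nu> (?c (Suc i))"
        by (rule exists_le_average_\<nu>[OF _ cab mc h]) (use Suc.prems in auto)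
      have xy: "a \<le> x" "x \<le> y" "y \<le> b" using x y \<tau>[of i] \<tau>[of "Suc (Suc i)"] st Suc.prems by auto
      have "norm (W x - W y) \<le> measure m {x..y} * (enn2real (g x) + enn2real (g y))"
        using W[of x y] xy x y by auto
      also have "\<dots> \<le> (2 * h) * (enn2real (g x) + enn2real (g y))"
      proof (intro mult_right_mono)
        have "len (\<tau> i) \<le> len x" "len y \<le> len (\<tau> (Suc (Suc i)))" using x y by (auto intro!: len_mono)
        then show "measure m {x..y} \<le> 2 * h"
          using mle[OF xy(2)] \<tau>[of i] \<tau>[of "Suc (Suc i)"] Suc.prems by (simp add: algebra_simps)
      qed auto
      also have "\<dots> \<le> 2 * measure \<nu> (?c i) + 2 * measure \<nu> (?c (Suc i))"
        using x(3) y(3) by (simp add: algebra_simps)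
      finally have "norm (W s - W y) \<le> h * enn2real (g s) + 4 * (measure \<nu> {s<..\<tau> i} + measure \<nu> (?c i))
          + 2 * measure \<nu> (?c (Suc i))"
        using x(4) norm_triangle_ineq[of "W s - W x" "W x - W y"] by (simp add: algebra_simps)
      moreover have "measure \<nu> {s<..\<tau> i} + measure \<nu> (?c i) = measure \<nu> ({s<..\<tau> i} \<union> ?c i)"
        by (intro \<nu>.finite_measure_Union[symmetric]) auto
      moreover have "{s<..\<tau> i} \<union> ?c i = {s<..\<tau> (Suc i)}"
        using \<tau>[of i] \<tau>_less[of i] Suc.prems by auto
      ultimately show ?case using y by auto
    qed
    obtain x where x: "x \<in> ?c n" "g x < \<infinity>" "enn2real (g x) * h \<le> measure \<nu> (?c n)"
        "norm (W s - W x) \<le> h * enn2real (g s) + 4 * measure \<nu> {s<..\<tau> n} + 2 * measure \<nu> (?c n)"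
      using P[of n] by auto
    have xt: "x \<le> t" "a \<le> x" "\<tau> n \<le> x" using x \<tau>[of "Suc n"] \<tau>[of n] st by auto
    have "norm (W x - W t) \<le> measure m {x..t} * (enn2real (g x) + enn2real (g t))"
      using W[of x t] xt st gf x by auto
    also have "\<dots> \<le> h * (enn2real (g x) + enn2real (g t))"
    proof (intro mult_right_mono)
      have "len t = len s + real (Suc n) * h" using ell by (simp add: h_def ell_def)
      then show "measure m {x..t} \<le> h"
        using mle[OF xt(1)] len_mono[OF xt(3)] \<tau>[of n] by (simp add: algebra_simps)
    qed auto
    finally have wxt: "norm (W x - W t) \<le> h * (enn2real (g x) + enn2real (g t))" .
    have "norm (W s - W t) \<le> h * (enn2real (g s) + enn2real (g t))
        + 4 * (measure \<nu> {s<..\<tau> n} + measure \<nu> (?c n))"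
    proof -
      have "norm (W s - W t) \<le> norm (W s - W x) + norm (W x - W t)"
        using norm_triangle_ineq[of "W s - W x" "W x - W t"] by simp
      moreover have "norm (W x - W t) \<le> enn2real (g x) * h + h * enn2real (g t)"
        using wxt by (simp add: algebra_simps)
      ultimately show ?thesis
        unfolding distrib_left using x(3,4) measure_nonneg[of \<nu> "?c n"] by linarith
    qed
    also have "measure \<nu> {s<..\<tau> n} + measure \<nu> (?c n) = measure \<nu> ({s<..\<tau> n} \<union> ?c n)"
      by (intro \<nu>.finite_measure_Union[symmetric]) auto
    also have "\<dots> \<le> measure \<nu> {s..t}"
      using \<tau>[of n] \<tau>[of "Suc n"] by (intro \<nu>.finite_measure_mono) auto
    finally show ?thesis unfolding h_def by simp
  qed
  have "(\<lambda>n. 4 * measure \<nu> {s..t} + (ell / real (Suc n)) * (enn2real (g s) + enn2real (g t)))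
      \<longlonglongrightarrow> 4 * measure \<nu> {s..t} + 0 * (enn2real (g s) + enn2real (g t))"
    using tendsto_mult[OF tendsto_const[of ell] LIMSEQ_inverse_real_of_nat]
    by (intro tendsto_intros) (simp add: divide_inverse)
  then show ?thesis using main LIMSEQ_le_const by (metis (no_types, lifting) add.right_neutral mult_zero_left)
qed

text \<open>The sets shrink geometrically towards one end of the path. Where \<open>g\<close> is
  below its average over \<open>A n\<close>, 2^(-n) times \<open>g\<close> is at most
  \<open>measure \<nu> (A n) / c\<close>, which tends to 0. The same measure bounds the increments
  of \<open>W\<close> inside \<open>A n\<close> by \<open>hajlasz_interval\<close>, so the values
  form a Cauchy sequence.\<close>

lemma hajlasz_shrink:
  assumes A: "\<And>n. A n \<in> sets borel" "\<And>n. A n \<subseteq> {a..b}" "\<And>n s t. s \<in> A n \<Longrightarrow> t \<in> A n \<Longrightarrow> {s..t} \<subseteq> A n"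
    and dec: "decseq A" and mA: "\<And>n. measure m (A n) = c * (1/2) ^ n" "0 < c"
  obtains t where "\<And>n. t n \<in> A n" "\<And>n. g (t n) < \<infinity>" "(\<lambda>n. (1/2) ^ n * enn2real (g (t n))) \<longlonglongrightarrow> 0"
    "convergent (\<lambda>n. W (t n))"
proof -
  have "\<exists>x. x \<in> A n \<and> g x < \<infinity> \<and> enn2real (g x) * (c * (1/2) ^ n) \<le> measure \<nu> (A n)" for n
    by (rule exists_le_average_\<nu>[OF A(1,2) mA(1)]) (use mA(2) in auto)
  then obtain t where t: "\<And>n. t n \<in> A n" "\<And>n. g (t n) < \<infinity>"
    "\<And>n. enn2real (g (t n)) * (c * (1/2) ^ n) \<le> measure \<nu> (A n)" by metis
  have "(\<lambda>n. measure \<nu> (A n)) \<longlonglongrightarrow> measure \<nu> (\<Inter>n. A n)"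
    using A(1) dec by (intro \<nu>.finite_Lim_measure_decseq) auto
  moreover have "measure \<nu> (\<Inter>n. A n) = 0"
  proof -
    have "(\<lambda>n. measure m (A n)) \<longlonglongrightarrow> 0"
      unfolding mA using tendsto_mult[OF tendsto_const[of c] LIMSEQ_power_zero[of "1/2::real"]] by simp
    moreover have "(\<lambda>n. measure m (A n)) \<longlonglongrightarrow> measure m (\<Inter>n. A n)"
      using A(1) dec by (intro m.finite_Lim_measure_decseq) auto
    ultimately have "measure m (\<Inter>n. A n) = 0" using LIMSEQ_unique by blast
    then have "(\<Inter>n. A n) \<in> null_sets m"
      using A(1) by (intro null_setsI) (auto simp: m.emeasure_eq_measure)
    then have "emeasure \<nu> (\<Inter>n. A n) = 0"
      using A(1) INT_lower[of 0 UNIV A] A(2)[of 0] by (subst emeasure_\<nu>) (auto intro!: nn_integral_null_set)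
    then show ?thesis by (simp add: measure_def)
  qed
  ultimately have lim: "(\<lambda>n. measure \<nu> (A n)) \<longlonglongrightarrow> 0" by simp
  show thesis
  proof (rule that[OF t(1,2)])
    have "(\<lambda>n. measure \<nu> (A n) / c) \<longlonglongrightarrow> 0" using tendsto_divide[OF lim tendsto_const[of c]] mA by simp
    then show "(\<lambda>n. (1/2) ^ n * enn2real (g (t n))) \<longlonglongrightarrow> 0"
    proof (rule tendsto_sandwich[where f = "\<lambda>_. 0", rotated 3])
      show "\<forall>\<^sub>F n in sequentially. (1/2) ^ n * enn2real (g (t n)) \<le> measure \<nu> (A n) / c"
        using t(3) mA(2) by (auto simp: field_simps)
    qed auto
    have bound: "norm (W (t n) - W (t k)) \<le> 4 * measure \<nu> (A n)" if "n \<le> k" for n k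
    proof -
      have *: "norm (W x - W y) \<le> 4 * measure \<nu> (A n)"
        if "x \<in> A n" "y \<in> A n" "x \<le> y" "g x < \<infinity>" "g y < \<infinity>" for x y
      proof -
        have "norm (W x - W y) \<le> 4 * measure \<nu> {x..y}"
          using A(2)[of n] that by (intro hajlasz_interval) auto
        also have "measure \<nu> {x..y} \<le> measure \<nu> (A n)"
          using A(1) A(3)[OF that(1,2)] by (intro \<nu>.finite_measure_mono) auto
        finally show ?thesis by simp
      qed
      have "t k \<in> A n" using t(1)[of k] decseqD[OF dec \<open>n \<le> k\<close>] by auto
      then show ?thesis
        using *[of "t n" "t k"] *[of "t k" "t n"] t by (cases "t n \<le> t k") (auto simp: norm_minus_commute)
    qed
    have "Cauchy (\<lambda>n. W (t n))"
    proof (rule metric_CauchyI)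
      fix e :: real assume e: "0 < e"
      then have "eventually (\<lambda>n. measure \<nu> (A n) < e / 8) sequentially"
        by (intro order_tendstoD[OF lim]) auto
      then obtain N where N: "measure \<nu> (A N) < e / 8" by (auto simp: eventually_sequentially)
      have "dist (W (t m)) (W (t n)) < e" if "N \<le> m" "N \<le> n" for m n
        using bound[OF that(1)] bound[OF that(2)] N
          dist_triangle2[of "W (t m)" "W (t n)" "W (t N)"]
        by (simp add: dist_norm norm_minus_commute)
      then show "\<exists>M. \<forall>m\<ge>M. \<forall>n\<ge>M. dist (W (t m)) (W (t n)) < e" by blast
    qed
    then show "convergent (\<lambda>n. W (t n))" by (simp add: Cauchy_convergent_iff)
  qed
qed

end

section \<open>Gluing of upper gradients\<close>

declare line_integral.simps [simp del]

context rectifiable_path begin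

lemma finite_atomless_m: "finite_atomless m"
  by unfold_locales (simp_all add: measure_def)

lemma finite_atomless_density:
  assumes f: "f \<in> borel_measurable borel" "(\<integral>\<^sup>+t. f t \<partial>m) < \<infinity>"
  shows "finite_atomless (density m f)"
proof -
  have "f \<in> borel_measurable m" using f(1) by (simp add: measurable_cong_sets[OF sets_m refl])
  then have e: "emeasure (density m f) A = (\<integral>\<^sup>+t. f t * indicator A t \<partial>m)" if "A \<in> sets borel" for A
    using that by (intro emeasure_density) simp_all
  have "emeasure (density m f) (space (density m f)) \<noteq> \<infinity>"
    using f(2) e[of UNIV] by simp
  then interpret d: finite_measure "density m f" by (rule finite_measureI)
  show ?thesis
  proof
    fix t
    have "emeasure (density m f) {t} = 0"
      using e[of "{t}"] by (auto intro!: nn_integral_null_set null_setsI)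
    then show "measure (density m f) {t} = 0" by (simp add: measure_def)
  qed simp
qed

lemma line_integral_mono:
  assumes "\<And>x. x \<in> \<gamma> ` {a..b} \<Longrightarrow> \<rho> x \<le> \<sigma> x"
  shows "line_integral \<rho> (\<gamma>, a, b) \<le> line_integral \<sigma> (\<gamma>, a, b)"
  unfolding line_integral_eq using assms by (intro nn_integral_mono) (auto simp: indicator_def)

lemma line_integral_subpath_le:
  assumes st: "a \<le> s" "s \<le> t" "t \<le> b"
    and \<rho>: "\<rho> \<in> borel_measurable (restrict_space borel X)" "\<gamma> ` {a..b} \<subseteq> X"
  shows "line_integral \<rho> (\<gamma>, s, t) \<le> line_integral \<rho> (\<gamma>, a, b)"
  unfolding line_integral_subpath[OF st \<rho>] line_integral_eq
  using st by (intro nn_integral_mono) (auto simp: indicator_def)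

lemma vimage_borel:
  assumes "A \<in> sets (restrict_space borel X)" "\<gamma> ` {a..b} \<subseteq> X"
  shows "{t\<in>{a..b}. \<gamma> t \<in> A} \<in> sets borel"
proof -
  have "(\<lambda>t. indicator A (\<gamma> t) * indicator {a..b} t :: ennreal) \<in> borel_measurable borel"
    using assms by (intro borel_measurable_along[of _ X]) auto
  then have "{t. indicator A (\<gamma> t) * indicator {a..b} t \<in> {1::ennreal}} \<in> sets borel"
    using measurable_sets[of _ borel borel "{1}"] by (auto simp: vimage_def)
  moreover have "{t. indicator A (\<gamma> t) * indicator {a..b} t \<in> {1::ennreal}} = {t\<in>{a..b}. \<gamma> t \<in> A}"
    by (auto simp: indicator_def split: if_splits)
  ultimately show ?thesis by simp
qed

text \<open>The interval estimate is pulled back along the path. If \<open>\<infinity>\<close> times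
  the indicator of \<open>N\<close> has finite integral, the path spends no length in
  \<open>N\<close>.\<close>

lemma glue_along:
  fixes u v :: "'a \<Rightarrow> 'v::real_normed_vector"
  assumes X: "\<gamma> ` {a..b} \<subseteq> X" and L: "0 \<le> L"
    and \<rho>: "\<rho> \<in> borel_measurable (restrict_space borel X)" and fin_\<rho>: "line_integral \<rho> (\<gamma>, a, b) < \<infinity>"
    and u: "\<And>s t. a \<le> s \<Longrightarrow> s \<le> t \<Longrightarrow> t \<le> b \<Longrightarrow>
        ennreal (norm (u (\<gamma> s) - u (\<gamma> t))) \<le> line_integral \<rho> (\<gamma>, s, t)"
    and v: "\<And>x y. x \<in> X \<Longrightarrow> y \<in> X \<Longrightarrow> norm (v x - v y) \<le> L * dist x y"
    and A: "A \<in> sets (restrict_space borel X)"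
    and N: "N \<in> sets (restrict_space borel X)" "line_integral (\<lambda>x. \<infinity> * indicator N x) (\<gamma>, a, b) < \<infinity>"
    and eq: "\<And>x. x \<in> A - N \<Longrightarrow> u x = v x"
  shows "ennreal (norm (v (\<gamma> a) - v (\<gamma> b))) \<le>
    line_integral (\<lambda>x. \<rho> x * indicator A x + ennreal L * indicator (X - A) x) (\<gamma>, a, b)"
proof -
  let ?r = "\<lambda>t. \<rho> (\<gamma> t) * indicator {a..b} t"
  define \<nu> where "\<nu> = density m ?r"
  have r: "?r \<in> borel_measurable borel" by (rule borel_measurable_along[OF \<rho> X])
  have rm: "?r \<in> borel_measurable m" using r by (simp add: measurable_cong_sets[OF sets_m refl])
  have \<nu>: "finite_atomless \<nu>"
    unfolding \<nu>_def by (rule finite_atomless_density[OF r]) (use fin_\<rho>[unfolded line_integral_eq] in simp)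
  interpret \<nu>: finite_atomless \<nu> by fact
  have e: "emeasure \<nu> B = (\<integral>\<^sup>+t. \<rho> (\<gamma> t) * indicator B t \<partial>m)" if "B \<in> sets borel" "B \<subseteq> {a..b}" for B
    unfolding \<nu>_def using that rm
    by (subst emeasure_density) (auto intro!: nn_integral_cong simp: indicator_def)
  define T where "T = {t\<in>{a..b}. \<gamma> t \<in> A}"
  define N' where "N' = {t\<in>{a..b}. \<gamma> t \<in> N}"
  have Tab: "T \<subseteq> {a..b}" by (auto simp: T_def)
  have T: "T \<in> sets borel" "N' \<in> sets borel"
    unfolding T_def N'_def by (rule vimage_borel[OF A X], rule vimage_borel[OF N(1) X])
  have "measure m N' = 0"
  proof -
    have "line_integral (\<lambda>x. \<infinity> * indicator N x) (\<gamma>, a, b) = (\<integral>\<^sup>+t. \<infinity> * indicator N' t \<partial>m)"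
      unfolding line_integral_eq by (intro nn_integral_cong) (auto simp: N'_def indicator_def)
    also have "\<dots> = \<infinity> * emeasure m N'" using T by (intro nn_integral_cmult_indicator) simp
    finally have "\<infinity> * emeasure m N' < \<infinity>" using N(2) by simp
    then have "emeasure m N' = 0" by (cases "emeasure m N' = 0") (auto simp: ennreal_top_mult)
    then show ?thesis by (simp add: measure_def)
  qed
  have "norm (v (\<gamma> a) - v (\<gamma> b)) \<le> measure \<nu> T + L * measure m ({a..b} - T)"
  proof (rule glue_on_interval[OF finite_atomless_m \<nu> ab L, where F = "\<lambda>t. u (\<gamma> t)" and W = "\<lambda>t. v (\<gamma> t)" and N = N'])
    fix s t assume st: "a \<le> s" "s \<le> t" "t \<le> b"
    have "ennreal (norm (u (\<gamma> s) - u (\<gamma> t))) \<le> emeasure \<nu> {s..t}"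
      using u[OF st] line_integral_subpath[OF st \<rho> X] e[of "{s..t}"] st by auto
    then show "norm (u (\<gamma> s) - u (\<gamma> t)) \<le> measure \<nu> {s..t}" by (simp add: \<nu>.emeasure_eq_measure)
    have "norm (v (\<gamma> s) - v (\<gamma> t)) \<le> L * dist (\<gamma> s) (\<gamma> t)" using X st by (intro v) auto
    also have "\<dots> \<le> L * measure m {s..t}" using dist_le_m[OF st] L by (intro mult_left_mono) auto
    finally show "norm (v (\<gamma> s) - v (\<gamma> t)) \<le> L * measure m {s..t}" .
  next
    show "u (\<gamma> t) = v (\<gamma> t)" if "t \<in> T - N'" for t
      using that by (intro eq) (auto simp: T_def N'_def)
  qed (use T \<open>measure m N' = 0\<close> in \<open>auto simp: T_def\<close>)
  then have "ennreal (norm (v (\<gamma> a) - v (\<gamma> b))) \<le> emeasure \<nu> T + ennreal L * emeasure m ({a..b} - T)"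
    using L by (simp add: \<nu>.emeasure_eq_measure m.emeasure_eq_measure ennreal_mult[symmetric] flip: ennreal_plus)
  also have "\<dots> = (\<integral>\<^sup>+t. \<rho> (\<gamma> t) * indicator T t \<partial>m) + (\<integral>\<^sup>+t. ennreal L * indicator ({a..b} - T) t \<partial>m)"
    using e[OF T(1) Tab] T(1) by (subst nn_integral_cmult_indicator) simp_all
  also have "\<dots> = (\<integral>\<^sup>+t. \<rho> (\<gamma> t) * indicator T t + ennreal L * indicator ({a..b} - T) t \<partial>m)"
  proof (rule nn_integral_add[symmetric])
    have "(\<lambda>t. \<rho> (\<gamma> t) * indicator T t) = (\<lambda>t. ?r t * indicator T t)"
      by (auto simp: T_def indicator_def)
    then show "(\<lambda>t. \<rho> (\<gamma> t) * indicator T t) \<in> borel_measurable m"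
      using rm T by simp
  qed (use T in auto)
  also have "\<dots> = line_integral (\<lambda>x. \<rho> x * indicator A x + ennreal L * indicator (X - A) x) (\<gamma>, a, b)"
    unfolding line_integral_eq using X
    by (intro nn_integral_cong) (auto simp: T_def indicator_def image_subset_iff)
  finally show ?thesis .
qed

end

lemma line_integral_finite_rectifiable:
  assumes "(\<gamma>, a, b) \<in> paths_in X" "line_integral \<rho> (\<gamma>, a, b) < \<infinity>"
  shows "rectifiable_path \<gamma> a b" "\<gamma> ` {a..b} \<subseteq> X"
  using assms by (auto simp: line_integral.simps paths_in_def rectifiable_path_def split: if_splits)

lemma line_integral_mono':
  assumes "(\<gamma>, a, b) \<in> paths_in X" "\<And>x. x \<in> X \<Longrightarrow> \<rho> x \<le> \<sigma> x"
  shows "line_integral \<rho> (\<gamma>, a, b) \<le> line_integral \<sigma> (\<gamma>, a, b)"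
  using assms by (auto simp: line_integral.simps paths_in_def indicator_def image_subset_iff intro!: nn_integral_mono)

context metric_measure begin

lemma Lp_borel_iff:
  "Lp_borel X \<mu> p f \<longleftrightarrow> f \<in> borel_measurable borel_X \<and> (\<integral>\<^sup>+x. ennreal_powr (f x) p \<partial>M) < \<infinity>"
  unfolding Lp_borel_def Lp_norm_less_top_iff ..

lemma Lp_borel_add:
  assumes "Lp_borel X \<mu> p f" "Lp_borel X \<mu> p g" "0 < p"
  shows "Lp_borel X \<mu> p (\<lambda>x. f x + g x)"
proof -
  have [measurable]: "f \<in> borel_measurable M" "g \<in> borel_measurable M"
    using assms by (auto simp: Lp_borel_iff intro: borel_X_measurable)
  have "(\<integral>\<^sup>+x. ennreal_powr (f x + g x) p \<partial>M)
      \<le> (\<integral>\<^sup>+x. ennreal (2 powr p) * (ennreal_powr (f x) p + ennreal_powr (g x) p) \<partial>M)"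
    using assms by (intro nn_integral_mono ennreal_powr_add) auto
  also have "\<dots> = ennreal (2 powr p) * ((\<integral>\<^sup>+x. ennreal_powr (f x) p \<partial>M) + (\<integral>\<^sup>+x. ennreal_powr (g x) p \<partial>M))"
    by (simp add: nn_integral_cmult nn_integral_add)
  also have "\<dots> < \<infinity>"
    using assms by (auto simp: Lp_borel_iff ennreal_mult_less_top)
  finally show ?thesis using assms by (auto simp: Lp_borel_iff)
qed

lemma Lp_borel_top_indicator:
  assumes "N \<in> sets borel_X" "N \<in> null_sets M"
  shows "Lp_borel X \<mu> p (\<lambda>x. \<infinity> * indicator N x)"
proof -
  have "(\<integral>\<^sup>+x. ennreal_powr (\<infinity> * indicator N x) p \<partial>M) = (\<integral>\<^sup>+x. \<infinity> * indicator N x \<partial>M)"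
    by (intro nn_integral_cong) (auto simp: indicator_def)
  also have "\<dots> = 0" using assms(2) by (intro nn_integral_null_set)
  finally show ?thesis using assms by (auto simp: Lp_borel_iff)
qed

lemma p_negligible_infinite:
  "Lp_borel X \<mu> p \<sigma> \<Longrightarrow> p_negligible X \<mu> p {c \<in> paths_in X. line_integral \<sigma> c = \<infinity>}"
  unfolding p_negligible_def by auto

text \<open>The exceptional family is the set of paths with infinite integral of
  \<open>\<sigma>\<close>, which \<open>\<sigma>\<close> itself shows to be negligible.\<close>

lemma weak_upper_gradientI:
  assumes "\<rho> \<in> borel_measurable borel_X" "Lp_borel X \<mu> p \<sigma>"
    and "\<And>\<gamma> a b. (\<gamma>, a, b) \<in> paths_in X \<Longrightarrow> line_integral \<sigma> (\<gamma>, a, b) < \<infinity> \<Longrightarrow>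
      ennreal (norm (u (\<gamma> a) - u (\<gamma> b))) \<le> line_integral \<rho> (\<gamma>, a, b)"
  shows "weak_upper_gradient X \<mu> p u \<rho>"
  unfolding weak_upper_gradient_def
proof (intro conjI assms(1) exI)
  show "p_negligible X \<mu> p {c \<in> paths_in X. line_integral \<sigma> c = \<infinity>}"
    by (rule p_negligible_infinite[OF assms(2)])
  show "\<forall>(\<gamma>, a, b)\<in>paths_in X - {c \<in> paths_in X. line_integral \<sigma> c = \<infinity>}.
      ennreal (norm (u (\<gamma> a) - u (\<gamma> b))) \<le> line_integral \<rho> (\<gamma>, a, b)"
  proof (rule ballI, rule prod_cases3)
    fix c and \<gamma> :: "real \<Rightarrow> 'a" and a b
    assume c: "c \<in> paths_in X - {c \<in> paths_in X. line_integral \<sigma> c = \<infinity>}" "c = (\<gamma>, a, b)"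
    then have path: "(\<gamma>, a, b) \<in> paths_in X" and "line_integral \<sigma> (\<gamma>, a, b) \<noteq> \<infinity>" by auto
    then have "line_integral \<sigma> (\<gamma>, a, b) < \<infinity>" by (cases "line_integral \<sigma> (\<gamma>, a, b)") auto
    then have "ennreal (norm (u (\<gamma> a) - u (\<gamma> b))) \<le> line_integral \<rho> (\<gamma>, a, b)"
      by (rule assms(3)[OF path])
    then show "case c of (\<gamma>, a, b) \<Rightarrow> ennreal (norm (u (\<gamma> a) - u (\<gamma> b))) \<le> line_integral \<rho> (\<gamma>, a, b)"
      using c by simp
  qed
qed

lemma null_set_borel_hull:
  assumes "N \<in> null_sets M"
  obtains N' where "N' \<in> sets borel_X" "N \<subseteq> N'" "N' \<in> null_sets M"
proof -
  obtain B where B: "B \<in> sets borel_X" "N \<subseteq> B" "emeasure M B = emeasure M N"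
    using borel_hull[of N] assms by auto
  then have "B \<in> null_sets M" using assms borel_X_sets by (auto simp: null_sets_def)
  then show thesis using that B by blast
qed

text \<open>The exceptional paths are the same for all Lipschitz functions \<^term>\<open>v\<close>.\<close>

lemma gluing:
  fixes u :: "'a \<Rightarrow> 'v::real_normed_vector"
  assumes wug: "weak_upper_gradient X \<mu> p u \<rho>" and Lp: "Lp_borel X \<mu> p \<rho>"
    and N: "N \<in> null_sets M" and p: "0 < p"
  obtains \<sigma> where "Lp_borel X \<mu> p \<sigma>"
    "\<And>\<gamma> a b v L A. (\<gamma>, a, b) \<in> paths_in X \<Longrightarrow> line_integral \<sigma> (\<gamma>, a, b) < \<infinity> \<Longrightarrow> 0 \<le> L \<Longrightarrow>
      (\<And>x y. x \<in> X \<Longrightarrow> y \<in> X \<Longrightarrow> norm (v x - v y) \<le> L * dist x y) \<Longrightarrow> A \<in> sets borel_X \<Longrightarrow>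
      (\<And>x. x \<in> A - N \<Longrightarrow> u x = v x) \<Longrightarrow>
      ennreal (norm (v (\<gamma> a) - v (\<gamma> b))) \<le>
        line_integral (\<lambda>x. \<rho> x * indicator A x + ennreal L * indicator (X - A) x) (\<gamma>, a, b)"
proof -
  obtain \<Gamma> where \<Gamma>: "p_negligible X \<mu> p \<Gamma>" and "\<forall>(\<gamma>, a, b) \<in> paths_in X - \<Gamma>.
      ennreal (norm (u (\<gamma> a) - u (\<gamma> b))) \<le> line_integral \<rho> (\<gamma>, a, b)"
    using wug unfolding weak_upper_gradient_def by (elim conjE exE) (rule that)
  then have \<Gamma>2: "ennreal (norm (u (\<gamma> a) - u (\<gamma> b))) \<le> line_integral \<rho> (\<gamma>, a, b)"
    if "(\<gamma>, a, b) \<in> paths_in X - \<Gamma>" for \<gamma> a b using that by blast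
  obtain \<sigma>0 where \<sigma>0: "Lp_borel X \<mu> p \<sigma>0" "\<And>c. c \<in> \<Gamma> \<Longrightarrow> line_integral \<sigma>0 c = \<infinity>"
    using \<Gamma> unfolding p_negligible_def by blast
  obtain N' where N': "N' \<in> sets borel_X" "N \<subseteq> N'" "N' \<in> null_sets M"
    using null_set_borel_hull[OF N] by blast
  \<comment> \<open>The summands exclude, in turn, paths exceptional for \<open>u\<close>, paths
    along which \<open>\<rho>\<close> is not integrable, and paths that spend positive length in
    \<open>N'\<close>.\<close>
  let ?\<sigma> = "\<lambda>x. \<sigma>0 x + (\<rho> x + \<infinity> * indicator N' x)"
  show thesis
  proof (rule that[of ?\<sigma>])
    show "Lp_borel X \<mu> p ?\<sigma>"
      by (intro Lp_borel_add \<sigma>0 Lp p Lp_borel_top_indicator N')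
    fix \<gamma> a b and v :: "'a \<Rightarrow> 'v" and L A
    assume path: "(\<gamma>, a, b) \<in> paths_in X" and fin_\<sigma>: "line_integral ?\<sigma> (\<gamma>, a, b) < \<infinity>" and L: "0 \<le> L"
      and v: "\<And>x y. x \<in> X \<Longrightarrow> y \<in> X \<Longrightarrow> norm (v x - v y) \<le> L * dist x y"
      and A: "A \<in> sets borel_X" and eq: "\<And>x. x \<in> A - N \<Longrightarrow> u x = v x"
    interpret rectifiable_path \<gamma> a b by (rule line_integral_finite_rectifiable[OF path fin_\<sigma>])
    have sub: "\<gamma> ` {a..b} \<subseteq> X" by (rule line_integral_finite_rectifiable[OF path fin_\<sigma>])
    have f: "line_integral f (\<gamma>, a, b) < \<infinity>" if "\<And>x. f x \<le> ?\<sigma> x" for f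
      using line_integral_mono'[OF path, of f ?\<sigma>] that fin_\<sigma> by (auto intro: le_less_trans)
    show "ennreal (norm (v (\<gamma> a) - v (\<gamma> b))) \<le>
        line_integral (\<lambda>x. \<rho> x * indicator A x + ennreal L * indicator (X - A) x) (\<gamma>, a, b)"
    proof (rule glue_along[OF sub L _ _ _ v A N'(1)])
      show "\<rho> \<in> borel_measurable borel_X" using Lp by (simp add: Lp_borel_def)
      show "line_integral \<rho> (\<gamma>, a, b) < \<infinity>" by (rule f) (simp add: add_increasing add_increasing2)
      show "line_integral (\<lambda>x. \<infinity> * indicator N' x) (\<gamma>, a, b) < \<infinity>"
        by (rule f) (simp add: add_increasing)
      show "u x = v x" if "x \<in> A - N'" for x using eq that N' by blast
      fix s t assume st: "a \<le> s" "s \<le> t" "t \<le> b"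
      \<comment> \<open>Finiteness of the integral of \<open>\<sigma>0\<close> passes to subpaths,
        so no subpath is exceptional for \<open>u\<close>.\<close>
      have "line_integral \<sigma>0 (\<gamma>, s, t) \<le> line_integral \<sigma>0 (\<gamma>, a, b)"
        using \<sigma>0(1) by (intro line_integral_subpath_le[OF st _ sub]) (simp add: Lp_borel_def)
      also have "\<dots> < \<infinity>" by (rule f) simp
      finally have "(\<gamma>, s, t) \<notin> \<Gamma>" using \<sigma>0(2) by auto
      moreover have "(\<gamma>, s, t) \<in> paths_in X"
        using path st by (auto simp: paths_in_def image_subset_iff intro: continuous_on_subset)
      ultimately show "ennreal (norm (u (\<gamma> s) - u (\<gamma> t))) \<le> line_integral \<rho> (\<gamma>, s, t)"
        using \<Gamma>2 by blast
    qed
  qed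
qed

end

section \<open>Functions with a Hajlasz gradient are Sobolev\<close>

context metric_measure begin

context
  fixes p :: real and G :: "'a \<Rightarrow> ennreal" and w :: "'a \<Rightarrow> 'v::banach"
  assumes p: "0 < p" and G: "Lp_borel X \<mu> p G"
    and w: "\<And>x y. x \<in> X \<Longrightarrow> y \<in> X \<Longrightarrow> G x < \<infinity> \<Longrightarrow> G y < \<infinity> \<Longrightarrow>
      norm (w x - w y) \<le> dist x y * (enn2real (G x) + enn2real (G y))"
    and w_bound: "\<And>x. x \<in> X \<Longrightarrow> G x < \<infinity> \<Longrightarrow> norm (w x) \<le> enn2real (G x)"
begin

lemma G_borel: "G \<in> borel_measurable borel_X"
  using G by (simp add: Lp_borel_def)

lemma G_measurable [measurable]: "G \<in> borel_measurable M"
  using G_borel by (rule borel_X_measurable)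

lemma AE_G_finite: "AE x in M. G x < \<infinity>"
proof -
  have "AE x in M. ennreal_powr (G x) p \<noteq> \<infinity>"
    using G by (intro nn_integral_PInf_AE) (auto simp: Lp_borel_iff)
  then show ?thesis
  proof (rule eventually_mono)
    fix x assume "ennreal_powr (G x) p \<noteq> \<infinity>"
    then show "G x < \<infinity>" by (cases "G x") auto
  qed
qed

text \<open>On each of these sets \<open>w\<close> is Lipschitz, and together they exhaust the space
  up to a null set; this yields measurability of \<open>w\<close> and separability of its essential
  range.\<close>

definition G_sub where "G_sub n = {x\<in>X. G x \<le> ennreal (real n)}"

lemma G_sub_borel: "G_sub n \<in> sets borel_X"
proof -
  have "{x\<in>space borel_X. G x \<le> ennreal (real n)} \<in> sets borel_X" using G_borel by measurable
  then show ?thesis by (simp add: G_sub_def space_restrict_space)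
qed

lemma G_sub_finite: "x \<in> X \<Longrightarrow> G x < \<infinity> \<Longrightarrow> \<exists>n. x \<in> G_sub n"
proof -
  assume x: "x \<in> X" "G x < \<infinity>"
  then obtain r where r: "G x = ennreal r" "0 \<le> r" by (cases "G x") auto
  obtain n where "r \<le> real n" using real_arch_simple by blast
  then show ?thesis using x r by (auto simp: G_sub_def intro!: exI[of _ n])
qed

lemma G_sub_D: "x \<in> G_sub n \<Longrightarrow> x \<in> X \<and> G x < \<infinity> \<and> enn2real (G x) \<le> real n"
  by (cases "G x") (auto simp: G_sub_def top_unique)

lemma w_lipschitz_G_sub: "x \<in> G_sub n \<Longrightarrow> y \<in> G_sub n \<Longrightarrow> dist (w x) (w y) \<le> 2 * real n * dist x y"
proof -
  assume xy: "x \<in> G_sub n" "y \<in> G_sub n"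
  have "dist (w x) (w y) \<le> dist x y * (enn2real (G x) + enn2real (G y))"
    using w[of x y] G_sub_D[OF xy(1)] G_sub_D[OF xy(2)] by (simp add: dist_norm)
  also have "\<dots> \<le> dist x y * (2 * real n)"
    using G_sub_D[OF xy(1)] G_sub_D[OF xy(2)] by (intro mult_left_mono) auto
  finally show ?thesis by (simp add: mult.commute)
qed

lemma continuous_on_G_sub: "continuous_on (G_sub n) w"
proof -
  have "(2 * real n)-lipschitz_on (G_sub n) w"
    by (rule lipschitz_onI) (use w_lipschitz_G_sub in auto)
  then show ?thesis by (rule lipschitz_on_continuous_on)
qed

lemma w_measurable: "w \<in> borel_measurable M"
proof (rule borel_measurableI)
  fix A :: "'v set" assume A: "open A"
  have 1: "w -` A \<inter> G_sub n \<in> sets M" for n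
  proof -
    have "w \<in> borel_measurable (restrict_space borel (G_sub n))"
      by (rule borel_measurable_continuous_on_restrict[OF continuous_on_G_sub])
    then have "w -` A \<inter> space (restrict_space borel (G_sub n)) \<in> sets (restrict_space borel (G_sub n))"
      by (rule measurable_sets) (use A in simp)
    then obtain T where T: "T \<in> sets borel" "w -` A \<inter> G_sub n = G_sub n \<inter> T"
      by (auto simp: sets_restrict_space space_restrict_space)
    have "G_sub n \<inter> T = G_sub n \<inter> (X \<inter> T)" by (auto simp: G_sub_def)
    then show ?thesis
      using borel_X_sets[OF G_sub_borel] borel_X_sets[OF borel_X_Int[OF T(1)]] T(2) by auto
  qed
  have 2: "w -` A \<inter> {x\<in>X. \<not> G x < \<infinity>} \<in> null_sets M"
    by (rule null_sets_subset[OF AE_G_finite[unfolded AE_iff_null]]) (rule Int_lower2)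
  have "w -` A \<inter> space M = (\<Union>n. w -` A \<inter> G_sub n) \<union> (w -` A \<inter> {x\<in>X. \<not> G x < \<infinity>})"
    using G_sub_finite by (auto simp: G_sub_def)
  moreover have "(\<Union>n. w -` A \<inter> G_sub n) \<in> sets M" by (rule sets.countable_nat_UN) (use 1 in blast)
  ultimately show "w -` A \<inter> space M \<in> sets M" using null_setsD2[OF 2] by simp
qed

lemma w_measurable_map: "measurable_map X \<mu> w"
  unfolding measurable_map_def
proof (intro conjI bexI w_measurable)
  let ?N = "{x\<in>X. \<not> G x < \<infinity>}"
  show "?N \<in> null_sets M" using AE_G_finite unfolding AE_iff_null .
  have "\<exists>C. countable C \<and> C \<subseteq> G_sub n \<and> G_sub n \<subseteq> closure C" for n
    using separable_subset[of "G_sub n"] by (auto simp: separable_space_iff G_sub_def)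
  then obtain C where C: "\<And>n. countable (C n)" "\<And>n. C n \<subseteq> G_sub n" "\<And>n. G_sub n \<subseteq> closure (C n)"
    by metis
  show "separable_space (top_of_set (w ` (X - ?N)))"
    unfolding separable_space_iff
  proof (intro exI conjI)
    show "countable (w ` (\<Union>n. C n))" using C(1) by auto
    show "w ` (\<Union>n. C n) \<subseteq> w ` (X - ?N)" using C(2) G_sub_D by blast
    show "w ` (X - ?N) \<subseteq> closure (w ` (\<Union>n. C n))"
    proof
      fix y assume "y \<in> w ` (X - ?N)"
      then obtain x where x: "x \<in> X" "G x < \<infinity>" "y = w x" by auto
      then obtain n where n: "x \<in> G_sub n" using G_sub_finite by blast
      show "y \<in> closure (w ` (\<Union>n. C n))" unfolding closure_approachable
      proof (intro allI impI)
        fix e :: real assume e: "0 < e"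
        have "x \<in> closure (C n)" using C(3) n by blast
        then obtain c where c: "c \<in> C n" "dist c x < e / (2 * real n + 1)"
          using e unfolding closure_approachable by (metis add_nonneg_pos divide_pos_pos mult_nonneg_nonneg of_nat_0_le_iff zero_le_numeral zero_less_one)
        have "dist (w c) (w x) \<le> 2 * real n * dist c x"
          using c C(2) n by (intro w_lipschitz_G_sub) auto
        also have "\<dots> \<le> (2 * real n + 1) * dist c x" by (intro mult_right_mono) auto
        also have "\<dots> < e" using c(2) by (simp add: field_simps)
        finally show "\<exists>z\<in>w ` (\<Union>n. C n). dist z y < e" using c x by blast
      qed
    qed
  qed
qed

text \<open>A candidate value at a point where \<^term>\<open>w\<close> itself may be badly chosen on a null set:
  the Hajlasz inequality makes it independent of the approximating sequence.\<close>

definition path_limit :: "'a \<Rightarrow> 'v \<Rightarrow> bool" where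
  "path_limit x v \<longleftrightarrow> (\<exists>y c. 0 < c \<and> (\<forall>n. y n \<in> X \<and> G (y n) < \<infinity> \<and> dist x (y n) \<le> c * (1/2) ^ n) \<and>
     (\<lambda>n. (1/2) ^ n * enn2real (G (y n))) \<longlonglongrightarrow> 0 \<and> (\<lambda>n. w (y n)) \<longlonglongrightarrow> v)"

text \<open>Two approximating sequences are both within a multiple of 2^(-n) of \<open>x\<close>, so
  the Hajlasz inequality bounds the difference of the values by 2^(-n) times the two gradients,
  which the definition forces to 0.\<close>

lemma path_limit_unique:
  assumes "path_limit x v" "path_limit x v'" shows "v = v'"
proof -
  obtain y c where y: "0 < c" "\<And>n. y n \<in> X" "\<And>n. G (y n) < \<infinity>" "\<And>n. dist x (y n) \<le> c * (1/2) ^ n"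
    "(\<lambda>n. (1/2) ^ n * enn2real (G (y n))) \<longlonglongrightarrow> 0" "(\<lambda>n. w (y n)) \<longlonglongrightarrow> v"
    using assms(1) unfolding path_limit_def by blast
  obtain z d where z: "0 < d" "\<And>n. z n \<in> X" "\<And>n. G (z n) < \<infinity>" "\<And>n. dist x (z n) \<le> d * (1/2) ^ n"
    "(\<lambda>n. (1/2) ^ n * enn2real (G (z n))) \<longlonglongrightarrow> 0" "(\<lambda>n. w (z n)) \<longlonglongrightarrow> v'"
    using assms(2) unfolding path_limit_def by blast
  have "(\<lambda>n. norm (w (y n) - w (z n))) \<longlonglongrightarrow> norm (v - v')"
    by (intro tendsto_intros y z)
  moreover have "(\<lambda>n. norm (w (y n) - w (z n))) \<longlonglongrightarrow> 0"
  proof (rule tendsto_sandwich[where f = "\<lambda>_. 0", rotated 3])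
    show "(\<lambda>n. (c + d) * ((1/2) ^ n * enn2real (G (y n)) + (1/2) ^ n * enn2real (G (z n)))) \<longlonglongrightarrow> 0"
      using tendsto_mult[OF tendsto_const[of "c + d"] tendsto_add[OF y(5) z(5)]] by simp
    show "\<forall>\<^sub>F n in sequentially. norm (w (y n) - w (z n)) \<le>
      (c + d) * ((1/2) ^ n * enn2real (G (y n)) + (1/2) ^ n * enn2real (G (z n)))"
    proof (rule always_eventually, rule allI)
      fix n
      have "dist (y n) (z n) \<le> (c + d) * (1/2) ^ n"
        using y(4)[of n] z(4)[of n] dist_triangle3[of "y n" "z n" x] by (simp add: distrib_right)
      then have "norm (w (y n) - w (z n)) \<le> ((c + d) * (1/2) ^ n) * (enn2real (G (y n)) + enn2real (G (z n)))"
        using w[OF y(2) z(2) y(3) z(3), of n n] by (meson add_nonneg_nonneg enn2real_nonneg mult_right_mono order_trans)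
      then show "norm (w (y n) - w (z n)) \<le>
        (c + d) * ((1/2) ^ n * enn2real (G (y n)) + (1/2) ^ n * enn2real (G (z n)))"
        by (simp add: algebra_simps)
    qed
  qed auto
  ultimately show ?thesis using LIMSEQ_unique by fastforce
qed

lemma path_limit_self: "x \<in> X \<Longrightarrow> G x < \<infinity> \<Longrightarrow> path_limit x (w x)"
  unfolding path_limit_def
  using tendsto_mult[OF LIMSEQ_power_zero[of "1/2::real"] tendsto_const[of "enn2real (G x)"]]
  by (intro exI[of _ "\<lambda>_. x"] exI[of _ 1]) auto

text \<open>Where \<open>G\<close> is finite the constant sequence shows that the limit is
  \<open>w x\<close>, so this is a representative of the class of \<open>w\<close>; points without
  any limit keep the value \<open>w x\<close>.\<close>

definition w_path where "w_path x = (if \<exists>v. path_limit x v then THE v. path_limit x v else w x)"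

lemma w_path_eq: "path_limit x v \<Longrightarrow> w_path x = v"
  unfolding w_path_def using path_limit_unique by (auto intro!: the_equality)

text \<open>Distinct end points force positive length, so initial and final pieces of length
  \<open>c * (1/2) ^ n\<close> exist. The points chosen in them form sequences as
  \<open>path_limit\<close> demands, since distances are at most lengths, and the bound on
  increments passes to the limit.\<close>

lemma path_limits_along:
  assumes path: "(\<gamma>, a, b) \<in> paths_in X" and fin_G: "line_integral G (\<gamma>, a, b) < \<infinity>" and ne: "\<gamma> a \<noteq> \<gamma> b"
  shows "\<exists>v v'. path_limit (\<gamma> a) v \<and> path_limit (\<gamma> b) v' \<and>
    ennreal (norm (v - v')) \<le> line_integral (\<lambda>x. 4 * G x) (\<gamma>, a, b)"
proof -
  have sub: "\<gamma> ` {a..b} \<subseteq> X" and rect: "rectifiable_path \<gamma> a b"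
    by (rule line_integral_finite_rectifiable[OF path fin_G])+
  interpret rectifiable_path \<gamma> a b by fact
  let ?g = "\<lambda>t. G (\<gamma> t) * indicator {a..b} t"
  have gi: "?g t = G (\<gamma> t)" if "a \<le> t" "t \<le> b" for t using that by auto
  interpret h: hajlasz_on_path \<gamma> a b ?g "\<lambda>t. w (\<gamma> t)"
  proof
    show "?g \<in> borel_measurable borel" by (rule borel_measurable_along[OF G_borel sub])
    show "(\<integral>\<^sup>+t. ?g t * indicator {a..b} t \<partial>m) < \<infinity>"
      using fin_G unfolding line_integral_eq by (simp add: mult.assoc flip: indicator_inter_arith)
    fix s t assume st: "a \<le> s" "s \<le> t" "t \<le> b" "?g s < \<infinity>" "?g t < \<infinity>"
    then have "norm (w (\<gamma> s) - w (\<gamma> t)) \<le> dist (\<gamma> s) (\<gamma> t) * (enn2real (G (\<gamma> s)) + enn2real (G (\<gamma> t)))"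
      using sub by (intro w) auto
    also have "\<dots> \<le> measure m {s..t} * (enn2real (G (\<gamma> s)) + enn2real (G (\<gamma> t)))"
      using dist_le_m[OF st(1-3)] by (intro mult_right_mono) auto
    finally show "norm (w (\<gamma> s) - w (\<gamma> t)) \<le> measure m {s..t} * (enn2real (?g s) + enn2real (?g t))"
      using st by simp
  qed
  define c where "c = len b - len a"
  have "0 < dist (\<gamma> a) (\<gamma> b)" using ne by simp
  also have "\<dots> \<le> measure m {a..b}" using ab by (intro dist_le_m) auto
  also have "\<dots> = c" using ab len_mono[OF ab] by (simp add: measure_def emeasure_m_Icc c_def)
  finally have c: "0 < c" .
  have mI: "measure m {x..y} = len y - len x" if "x \<le> y" for x y
    using that len_mono[of x y] by (simp add: measure_def emeasure_m_Icc)
  have le1: "c * (1/2) ^ n \<le> c" "0 < c * (1/2) ^ n" for n using c by (auto simp: power_le_one mult_le_cancel_left1)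
  have less: "c * (1/2) ^ Suc n < c * (1/2) ^ n" for n using c by simp
  have "\<forall>n. \<exists>s. a \<le> s \<and> s \<le> b \<and> len s = len a + c * (1/2) ^ n"
    using IVT'[of len a _ b] ab continuous_on_len le1 by (simp add: c_def) (smt (verit) le1 c_def)
  then obtain s where s: "\<And>n. a \<le> s n \<and> s n \<le> b \<and> len (s n) = len a + c * (1/2) ^ n" by metis
  have "\<forall>n. \<exists>s. a \<le> s \<and> s \<le> b \<and> len s = len b - c * (1/2) ^ n"
    using IVT'[of len a _ b] ab continuous_on_len le1 by (simp add: c_def) (smt (verit) le1 c_def)
  then obtain s' where s': "\<And>n. a \<le> s' n \<and> s' n \<le> b \<and> len (s' n) = len b - c * (1/2) ^ n" by metis
  obtain t where t: "\<And>n. t n \<in> {a..s n}" "\<And>n. ?g (t n) < \<infinity>" "(\<lambda>n. (1/2) ^ n * enn2real (?g (t n))) \<longlonglongrightarrow> 0"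
    "convergent (\<lambda>n. w (\<gamma> (t n)))"
  proof (rule h.hajlasz_shrink[of "\<lambda>n. {a..s n}" c])
    show "decseq (\<lambda>n. {a..s n})"
    proof (rule decseq_SucI)
      fix n
      have "s (Suc n) \<le> s n"
        using s[of n] s[of "Suc n"] less[of n] len_mono[of "s n" "s (Suc n)"] by (cases "s (Suc n) \<le> s n") auto
      then show "{a..s (Suc n)} \<subseteq> {a..s n}" by auto
    qed
    show "measure m {a..s n} = c * (1/2) ^ n" for n using s[of n] by (simp add: mI)
    show "{a..s n} \<subseteq> {a..b}" for n using s[of n] by auto
  qed (use c that in auto)
  obtain t' where t': "\<And>n. t' n \<in> {s' n..b}" "\<And>n. ?g (t' n) < \<infinity>" "(\<lambda>n. (1/2) ^ n * enn2real (?g (t' n))) \<longlonglongrightarrow> 0"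
    "convergent (\<lambda>n. w (\<gamma> (t' n)))"
  proof (rule h.hajlasz_shrink[of "\<lambda>n. {s' n..b}" c])
    show "decseq (\<lambda>n. {s' n..b})"
    proof (rule decseq_SucI)
      fix n
      have "s' n \<le> s' (Suc n)"
        using s'[of n] s'[of "Suc n"] less[of n] len_mono[of "s' (Suc n)" "s' n"] by (cases "s' n \<le> s' (Suc n)") auto
      then show "{s' (Suc n)..b} \<subseteq> {s' n..b}" by auto
    qed
    show "measure m {s' n..b} = c * (1/2) ^ n" for n using s'[of n] by (simp add: mI)
    show "{s' n..b} \<subseteq> {a..b}" for n using s'[of n] by auto
  qed (use c that in auto)
  have tab: "a \<le> t n" "t n \<le> b" "a \<le> t' n" "t' n \<le> b" for n using t(1)[of n] t'(1)[of n] s[of n] s'[of n] by auto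
  obtain v v' where v: "(\<lambda>n. w (\<gamma> (t n))) \<longlonglongrightarrow> v" "(\<lambda>n. w (\<gamma> (t' n))) \<longlonglongrightarrow> v'"
    using t(4) t'(4) by (auto simp: convergent_def)
  have "path_limit (\<gamma> a) v" unfolding path_limit_def
  proof (intro exI conjI allI)
    show "0 < c" by fact
    show "\<gamma> (t n) \<in> X" "G (\<gamma> (t n)) < \<infinity>" for n using sub tab[of n] t(2)[of n] by auto
    have "dist (\<gamma> a) (\<gamma> (t n)) \<le> len (t n) - len a" for n
      using dist_le_m[of a "t n"] tab[of n] by (simp add: mI)
    moreover have "len (t n) - len a \<le> c * (1/2) ^ n" for n
      using len_mono[of "t n" "s n"] s[of n] t(1)[of n] by simp
    ultimately show "dist (\<gamma> a) (\<gamma> (t n)) \<le> c * (1/2) ^ n" for n using order_trans by blast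
    show "(\<lambda>n. (1/2) ^ n * enn2real (G (\<gamma> (t n)))) \<longlonglongrightarrow> 0" using t(3) tab by (simp add: gi)
  qed fact
  moreover have "path_limit (\<gamma> b) v'" unfolding path_limit_def
  proof (intro exI conjI allI)
    show "0 < c" by fact
    show "\<gamma> (t' n) \<in> X" "G (\<gamma> (t' n)) < \<infinity>" for n using sub tab[of n] t'(2)[of n] by auto
    have "dist (\<gamma> b) (\<gamma> (t' n)) \<le> len b - len (t' n)" for n
      using dist_le_m[of "t' n" b] tab[of n] by (simp add: mI dist_commute)
    moreover have "len b - len (t' n) \<le> c * (1/2) ^ n" for n
      using len_mono[of "s' n" "t' n"] s'[of n] t'(1)[of n] by simp
    ultimately show "dist (\<gamma> b) (\<gamma> (t' n)) \<le> c * (1/2) ^ n" for n using order_trans by blast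
    show "(\<lambda>n. (1/2) ^ n * enn2real (G (\<gamma> (t' n)))) \<longlonglongrightarrow> 0" using t'(3) tab by (simp add: gi)
  qed fact
  moreover have "ennreal (norm (v - v')) \<le> line_integral (\<lambda>x. 4 * G x) (\<gamma>, a, b)"
  proof -
    have "norm (w (\<gamma> (t n)) - w (\<gamma> (t' n))) \<le> 4 * measure h.\<nu> {a..b}" for n
    proof -
      have *: "norm (w (\<gamma> x) - w (\<gamma> y)) \<le> 4 * measure h.\<nu> {a..b}"
        if "a \<le> x" "x \<le> y" "y \<le> b" "?g x < \<infinity>" "?g y < \<infinity>" for x y
      proof -
        have "norm (w (\<gamma> x) - w (\<gamma> y)) \<le> 4 * measure h.\<nu> {x..y}" by (rule h.hajlasz_interval[OF that])
        also have "measure h.\<nu> {x..y} \<le> measure h.\<nu> {a..b}"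
          using that by (intro h.\<nu>.finite_measure_mono) auto
        finally show ?thesis by simp
      qed
      show ?thesis
        using *[of "t n" "t' n"] *[of "t' n" "t n"] tab[of n] t(2)[of n] t'(2)[of n]
        by (cases "t n \<le> t' n") (auto simp: norm_minus_commute)
    qed
    moreover have "(\<lambda>n. norm (w (\<gamma> (t n)) - w (\<gamma> (t' n)))) \<longlonglongrightarrow> norm (v - v')"
      by (intro tendsto_intros v)
    ultimately have "norm (v - v') \<le> 4 * measure h.\<nu> {a..b}" by (intro LIMSEQ_le_const2) auto
    then have "ennreal (norm (v - v')) \<le> 4 * emeasure h.\<nu> {a..b}"
      by (simp add: h.\<nu>.emeasure_eq_measure ennreal_mult[symmetric] flip: ennreal_numeral)
    also have "emeasure h.\<nu> {a..b} = (\<integral>\<^sup>+t. ?g t \<partial>m)"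
      by (subst h.emeasure_\<nu>) (auto simp: mult.assoc simp flip: indicator_inter_arith)
    also have "4 * \<dots> = (\<integral>\<^sup>+t. 4 * ?g t \<partial>m)"
      using h.g by (intro nn_integral_cmult[symmetric]) (simp add: measurable_cong_sets[OF sets_m refl])
    also have "\<dots> = line_integral (\<lambda>x. 4 * G x) (\<gamma>, a, b)"
      unfolding line_integral_eq by (simp add: mult.assoc)
    finally show ?thesis .
  qed
  ultimately show ?thesis by blast
qed

lemma w_path_upper_gradient: "weak_upper_gradient X \<mu> p w_path (\<lambda>x. 4 * G x)"
proof (rule weak_upper_gradientI[OF _ G])
  show "(\<lambda>x. 4 * G x) \<in> borel_measurable borel_X" using G_borel by measurable
  fix \<gamma> a b assume *: "(\<gamma>, a, b) \<in> paths_in X" "line_integral G (\<gamma>, a, b) < \<infinity>"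
  show "ennreal (norm (w_path (\<gamma> a) - w_path (\<gamma> b))) \<le> line_integral (\<lambda>x. 4 * G x) (\<gamma>, a, b)"
  \<comment> \<open>A path with equal end points may have length 0, but then the left-hand side is
    0.\<close>
  proof (cases "\<gamma> a = \<gamma> b")
    case False
    then show ?thesis using path_limits_along[OF * False] w_path_eq by metis
  qed simp
qed

text \<open>The constant is 1 + 4: \<open>G\<close> dominates the norm of \<open>w\<close>, and
  \<open>4 * G\<close> is a weak upper gradient of the representative \<open>w_path\<close>.\<close>

lemma hajlasz_sobolev:
  "w \<in> sobolev X \<mu> p \<and> sobolev_norm X \<mu> p w \<le> 5 * Lp_norm X \<mu> p G"
proof -
  have Lp4: "Lp_norm X \<mu> p (\<lambda>x. 4 * G x) = 4 * Lp_norm X \<mu> p G"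
    using Lp_norm_cmult[of p 4 G X \<mu>] p by simp
  have "Lp_norm X \<mu> p G < \<infinity>" using G by (simp add: Lp_borel_def)
  then have "Lp_borel X \<mu> p (\<lambda>x. 4 * G x)"
    using Lp4 G_borel by (auto simp: Lp_borel_def ennreal_mult_less_top)
  moreover have "ae_eq X \<mu> w_path w"
    unfolding ae_eq_def using AE_space AE_G_finite
    by eventually_elim (use path_limit_self w_path_eq in auto)
  ultimately have grad: "(\<lambda>x. 4 * G x) \<in> sobolev_gradients X \<mu> p w"
    using w_path_upper_gradient by (auto simp: sobolev_gradients_def)
  have le: "Lp_norm X \<mu> p (\<lambda>x. ennreal (norm (w x))) \<le> Lp_norm X \<mu> p G"
  proof (rule Lp_norm_mono_AE[OF _ p])
    show "AE x in M. ennreal (norm (w x)) \<le> G x"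
      using AE_space AE_G_finite
    proof eventually_elim
      case (elim x)
      then have "norm (w x) \<le> enn2real (G x)" by (intro w_bound) auto
      then have "ennreal (norm (w x)) \<le> ennreal (enn2real (G x))" by (rule ennreal_leI)
      then show ?case using elim by (cases "G x") auto
    qed
  qed
  have "Lp_map X \<mu> p w"
    using w_measurable_map le \<open>Lp_norm X \<mu> p G < \<infinity>\<close> by (auto simp: Lp_map_def intro: le_less_trans)
  then have "w \<in> sobolev X \<mu> p" using grad by (auto simp: sobolev_def)
  moreover have "sobolev_norm X \<mu> p w \<le> Lp_norm X \<mu> p G + 4 * Lp_norm X \<mu> p G"
    unfolding sobolev_norm_def
    by (intro add_mono le order_trans[OF INF_lower[OF grad]]) (simp add: Lp4)
  moreover have "Lp_norm X \<mu> p G + 4 * Lp_norm X \<mu> p G = 5 * Lp_norm X \<mu> p G"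
    by (cases "Lp_norm X \<mu> p G") (auto simp: ennreal_mult[symmetric] ennreal_mult_top simp flip: ennreal_plus ennreal_numeral)
  ultimately show ?thesis by simp
qed

end

end

section \<open>Subspaces and averages\<close>

text \<open>Builds the truncations: a function that is Lipschitz off a bad set is extended from
  there with the same constant.\<close>

lemma McShane_extension:
  fixes f :: "'a::metric_space \<Rightarrow> real"
  assumes L: "0 \<le> L" and f: "\<And>x y. x \<in> S \<Longrightarrow> y \<in> S \<Longrightarrow> \<bar>f x - f y\<bar> \<le> L * dist x y"
  obtains v where "\<And>x y. \<bar>v x - v y\<bar> \<le> L * dist x y" "\<And>x. x \<in> S \<Longrightarrow> v x = f x"
proof (cases "S = {}")
  case True
  then show thesis using that[of "\<lambda>_. 0"] L by simp
next
  case False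
  then obtain z where z: "z \<in> S" by blast
  define v where "v x = (INF y\<in>S. f y + L * dist x y)" for x
  have lower: "f z - L * dist x z \<le> f y + L * dist x y" if "y \<in> S" for x y
  proof -
    have "f z - f y \<le> L * dist z y" using f[OF z that] by simp
    also have "\<dots> \<le> L * (dist x z + dist x y)" using L dist_triangle3[of z y x] by (intro mult_left_mono) auto
    finally show ?thesis by (simp add: algebra_simps)
  qed
  have bdd: "bdd_below ((\<lambda>y. f y + L * dist x y) ` S)" for x
    using lower by (intro bdd_belowI2) blast
  have v_le: "v x \<le> f y + L * dist x y" if "y \<in> S" for x y
    unfolding v_def using that by (intro cINF_lower bdd)
  have half: "v x \<le> v y + L * dist x y" for x y
  proof -
    have "v x - L * dist x y \<le> v y" unfolding v_def[of y]
    proof (rule cINF_greatest[OF False])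
      fix w assume w: "w \<in> S"
      have "L * dist x w \<le> L * (dist x y + dist y w)"
        using L dist_triangle[of x w y] by (intro mult_left_mono) auto
      then show "v x - L * dist x y \<le> f w + L * dist y w"
        using v_le[OF w, of x] by (simp add: algebra_simps)
    qed
    then show ?thesis by simp
  qed
  show thesis
  proof (rule that)
    show "\<bar>v x - v y\<bar> \<le> L * dist x y" for x y using half[of x y] half[of y x] by (simp add: dist_commute abs_le_iff)
    show "v x = f x" if x: "x \<in> S" for x
    proof (rule antisym)
      show "v x \<le> f x" using v_le[OF x, of x] by simp
      show "f x \<le> v x" unfolding v_def
      proof (rule cINF_greatest[OF False])
        fix y assume "y \<in> S"
        then show "f x \<le> f y + L * dist x y" using f[OF x, of y] by linarith
      qed
    qed
  qed
qed

lemma (in rectifiable_path) line_integral_sum: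
  assumes X: "\<gamma> ` {a..b} \<subseteq> X" and f: "\<And>j. j \<in> J \<Longrightarrow> f j \<in> borel_measurable (restrict_space borel X)"
  shows "line_integral (\<lambda>x. \<Sum>j\<in>J. f j x) (\<gamma>, a, b) = (\<Sum>j\<in>J. line_integral (f j) (\<gamma>, a, b))"
proof -
  have "(\<lambda>t. f j (\<gamma> t) * indicator {a..b} t) \<in> borel_measurable m" if "j \<in> J" for j
    using borel_measurable_along[OF f[OF that] X] by (simp add: measurable_cong_sets[OF sets_m refl])
  then show ?thesis
    unfolding line_integral_eq sum_distrib_right by (rule nn_integral_sum)
qed

lemma (in rectifiable_path) line_integral_cmult:
  assumes X: "\<gamma> ` {a..b} \<subseteq> X" and f: "f \<in> borel_measurable (restrict_space borel X)"
  shows "line_integral (\<lambda>x. c * f x) (\<gamma>, a, b) = c * line_integral f (\<gamma>, a, b)"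
proof -
  have "(\<lambda>t. f (\<gamma> t) * indicator {a..b} t) \<in> borel_measurable m"
    using borel_measurable_along[OF f X] by (simp add: measurable_cong_sets[OF sets_m refl])
  then show ?thesis unfolding line_integral_eq mult.assoc by (rule nn_integral_cmult)
qed

context metric_measure begin

lemma ball_subspace: "x \<in> X \<Longrightarrow> metric_measure_space (X \<inter> ball x r) \<mu>"
proof (rule metric_measure_subspace)
  fix y t assume y: "y \<in> X \<inter> ball x r" "0 < (t::real)"
  define t' where "t' = min t (r - dist x y)"
  have t': "0 < t'" using y by (simp add: t'_def)
  have "X \<inter> ball y t' \<subseteq> X \<inter> ball x r \<inter> ball y t"
  proof
    fix z assume z: "z \<in> X \<inter> ball y t'"
    then have "dist x z < r" "dist y z < t" using dist_triangle[of x z y] by (auto simp: t'_def)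
    then show "z \<in> X \<inter> ball x r \<inter> ball y t" using z by auto
  qed
  then have "\<mu> (X \<inter> ball y t') \<le> \<mu> (X \<inter> ball x r \<inter> ball y t)" by (intro outer_mono) auto
  moreover have "0 < \<mu> (X \<inter> ball y t')" using emeasure_ball[of y t'] y t' by (simp add: emeasure_M)
  ultimately show "0 < \<mu> (X \<inter> ball x r \<inter> ball y t)" by (rule less_le_trans[rotated])
qed simp

lemma Lp_borel_subspace:
  assumes Y: "Y \<in> sets M" and f: "Lp_borel X \<mu> p f"
  shows "Lp_borel Y \<mu> p f"
proof -
  have YX: "Y \<subseteq> X" using sets.sets_into_space[OF Y] by simp
  have "(\<integral>\<^sup>+x. ennreal_powr (f x) p \<partial>outer_measure_measure Y \<mu>) \<le> (\<integral>\<^sup>+x. ennreal_powr (f x) p \<partial>M)"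
    unfolding nn_integral_outer_measure_restrict[OF Y]
    by (intro nn_integral_mono) (auto simp: indicator_def)
  then show ?thesis
    using f measurable_restrict_mono[OF _ YX] unfolding Lp_borel_def Lp_norm_less_top_iff
    by (auto intro: le_less_trans)
qed

lemma weak_upper_gradient_subspace:
  assumes Y: "Y \<in> sets M" and u: "weak_upper_gradient X \<mu> p u \<rho>"
  shows "weak_upper_gradient Y \<mu> p u \<rho>"
proof -
  have YX: "Y \<subseteq> X" using sets.sets_into_space[OF Y] by simp
  obtain \<Gamma> where \<rho>: "\<rho> \<in> borel_measurable borel_X" and \<Gamma>: "p_negligible X \<mu> p \<Gamma>"
    and g: "\<forall>(\<gamma>, a, b) \<in> paths_in X - \<Gamma>. ennreal (norm (u (\<gamma> a) - u (\<gamma> b))) \<le> line_integral \<rho> (\<gamma>, a, b)"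
    using u unfolding weak_upper_gradient_def by blast
  obtain \<sigma> where \<sigma>: "Lp_borel X \<mu> p \<sigma>" "\<forall>c\<in>\<Gamma>. line_integral \<sigma> c = \<infinity>"
    using \<Gamma> unfolding p_negligible_def by blast
  have P: "paths_in Y \<subseteq> paths_in X" using YX by (auto simp: paths_in_def)
  have "p_negligible Y \<mu> p (\<Gamma> \<inter> paths_in Y)"
    unfolding p_negligible_def using Lp_borel_subspace[OF Y \<sigma>(1)] \<sigma>(2) by blast
  moreover have "\<forall>(\<gamma>, a, b) \<in> paths_in Y - (\<Gamma> \<inter> paths_in Y).
      ennreal (norm (u (\<gamma> a) - u (\<gamma> b))) \<le> line_integral \<rho> (\<gamma>, a, b)"
    using g P by blast
  ultimately show ?thesis
    unfolding weak_upper_gradient_def using measurable_restrict_mono[OF \<rho> YX] by blast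
qed

lemma exists_outside:
  assumes E: "E \<in> sets M" "F \<in> sets M" and B: "B \<in> sets M" "0 < emeasure M B" "emeasure M B < \<infinity>"
    and le: "emeasure M E \<le> ennreal a * emeasure M B" "emeasure M F \<le> ennreal b * emeasure M B"
    and ab: "0 \<le> a" "0 \<le> b" "a + b < 1"
  obtains y where "y \<in> B" "y \<notin> E" "y \<notin> F"
proof -
  have "\<exists>y\<in>B. y \<notin> E \<and> y \<notin> F"
  proof (rule ccontr)
    assume "\<not> ?thesis"
    then have "emeasure M B \<le> emeasure M (E \<union> F)" using E by (intro emeasure_mono) auto
    also have "\<dots> \<le> emeasure M E + emeasure M F" using E by (intro emeasure_subadditive)
    also have "\<dots> \<le> ennreal (a + b) * emeasure M B"
      using add_mono[OF le] ab by (simp add: distrib_right)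
    finally have "emeasure M B \<le> ennreal (a + b) * emeasure M B" .
    then show False using B(2,3) ab
      by (cases "emeasure M B") (auto simp: ennreal_mult[symmetric] mult_le_cancel_right1 simp flip: ennreal_plus)
  qed
  then show thesis using that by blast
qed

text \<open>The Poincare inequality read backwards. If \<open>h\<close> is far from every constant,
  hence from its mean, on the proportion \<open>\<sigma>\<close> of the ball, Chebyshev's inequality
  bounds the mean oscillation below by \<open>t * r * \<sigma>\<close>, which forces energy on the
  dilated ball. The 2 in \<open>2 * C\<close> comes from the diameter being at most
  \<open>2 * r\<close>.\<close>

lemma poincare_osc:
  assumes PI: "poincare_on_ball X \<mu> p C l x r" and x: "x \<in> X" and r: "0 < r" and l: "1 \<le> l"
    and p: "1 < p" and C: "0 < C"
    and h [measurable]: "h \<in> borel_measurable M"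
    and hfin: "(\<integral>\<^sup>+y. ennreal \<bar>h y\<bar> * indicator (X \<inter> ball x (l * r)) y \<partial>M) < \<infinity>"
    and wug: "weak_upper_gradient (X \<inter> ball x (l * r)) \<mu> p h g"
    and Lp: "Lp_borel (X \<inter> ball x (l * r)) \<mu> p g"
    and t: "0 \<le> t" and \<sigma>: "0 < \<sigma>"
    and osc: "\<And>c. ennreal \<sigma> * emeasure M (X \<inter> ball x r) \<le> emeasure M {y \<in> X \<inter> ball x r. t * r < \<bar>h y - c\<bar>}"
  shows "ennreal ((\<sigma> * t / (2 * C)) powr p) * emeasure M (X \<inter> ball x (l * r)) \<le>
    (\<integral>\<^sup>+y. ennreal_powr (g y) p * indicator (X \<inter> ball x (l * r)) y \<partial>M)"
proof -
  let ?B = "X \<inter> ball x r" and ?lB = "X \<inter> ball x (l * r)"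
  have lr: "0 < l * r" using l r by simp
  define hB where "hB = (\<integral>y. h y \<partial>outer_measure_measure ?B \<mu>) / enn2real (\<mu> ?B)"
  define J where "J = (\<integral>\<^sup>+y. ennreal_powr (g y) p * indicator ?lB y \<partial>M)"
  have int: "integrable (outer_measure_measure ?lB \<mu>) h"
  proof (rule integrableI_bounded)
    show "h \<in> borel_measurable (outer_measure_measure ?lB \<mu>)"
      unfolding outer_measure_measure_restrict[OF Int_ball_sets] by (intro measurable_restrict_space1) simp
    show "(\<integral>\<^sup>+y. ennreal (norm (h y)) \<partial>outer_measure_measure ?lB \<mu>) < \<infinity>"
      using hfin by (simp add: nn_integral_outer_measure_restrict)
  qed
  have mu: "\<mu> ?B = emeasure M ?B" "\<mu> ?lB = emeasure M ?lB" by (simp_all add: emeasure_M)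
  obtain b where b: "emeasure M ?B = ennreal b" "0 < b"
    using emeasure_ball[OF x r] emeasure_ball_finite[OF x, of r] by (cases "emeasure M ?B") auto
  obtain L where L: "emeasure M ?lB = ennreal L" "0 < L"
    using emeasure_ball[OF x lr] emeasure_ball_finite[OF x, of "l * r"] by (cases "emeasure M ?lB") auto
  have "J < \<infinity>"
    using Lp unfolding Lp_borel_def Lp_norm_less_top_iff J_def by (simp add: nn_integral_outer_measure_restrict)
  then obtain j where j: "J = ennreal j" "0 \<le> j" by (cases J) auto
  have "(\<integral>\<^sup>+y. ennreal \<bar>h y - hB\<bar> \<partial>outer_measure_measure ?B \<mu>) / \<mu> ?B
      \<le> ennreal (C * diameter ?B) * ennreal_powr ((\<integral>\<^sup>+y. ennreal_powr (g y) p \<partial>outer_measure_measure ?lB \<mu>) / \<mu> ?lB) (1 / p)"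
    using PI int wug Lp unfolding poincare_on_ball_def Let_def hB_def by blast
  then have 1: "(\<integral>\<^sup>+y. ennreal \<bar>h y - hB\<bar> * indicator ?B y \<partial>M) / ennreal b
      \<le> ennreal (C * diameter ?B) * ennreal_powr (J / ennreal L) (1 / p)"
    by (simp add: nn_integral_outer_measure_restrict mu b L J_def)
  have "diameter ?B \<le> 2 * r"
  proof -
    have "dist y z \<le> 2 * r" if "y \<in> ?B" "z \<in> ?B" for y z
      using that dist_triangle3[of y z x] by auto
    then show ?thesis
      unfolding diameter_def using Int_ball_nonempty[OF x r]
      by (auto intro!: cSUP_least)
  qed
  then have d: "ennreal (C * diameter ?B) \<le> ennreal (2 * C * r)"
    using C by (intro ennreal_leI) (simp add: mult.assoc mult.left_commute)
  have Q: "ennreal_powr (J / ennreal L) (1 / p) = ennreal ((j / L) powr (1 / p))"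
    using j L by (simp add: divide_ennreal ennreal_powr_ennreal)
  have "ennreal (t * r * \<sigma>) * ennreal b = ennreal (t * r) * (ennreal \<sigma> * emeasure M ?B)"
    using t r \<sigma> b by (simp add: ennreal_mult[symmetric] mult.assoc)
  also have "\<dots> \<le> ennreal (t * r) * emeasure M {y \<in> ?B. t * r < \<bar>h y - hB\<bar>}"
    by (intro mult_left_mono osc) auto
  also have "\<dots> = (\<integral>\<^sup>+y. ennreal (t * r) * indicator {y \<in> ?B. t * r < \<bar>h y - hB\<bar>} y \<partial>M)"
  proof (rule nn_integral_cmult_indicator[symmetric])
    have "{y \<in> ?B. t * r < \<bar>h y - hB\<bar>} = ?B \<inter> {y\<in>space M. t * r < \<bar>h y - hB\<bar>}" by auto
    also have "\<dots> \<in> sets M" by measurable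
    finally show "{y \<in> ?B. t * r < \<bar>h y - hB\<bar>} \<in> sets M" .
  qed
  also have "\<dots> \<le> (\<integral>\<^sup>+y. ennreal \<bar>h y - hB\<bar> * indicator ?B y \<partial>M)"
    by (intro nn_integral_mono) (auto simp: indicator_def intro!: ennreal_leI)
  finally have "ennreal (t * r * \<sigma>) * ennreal b / ennreal b \<le> (\<integral>\<^sup>+y. ennreal \<bar>h y - hB\<bar> * indicator ?B y \<partial>M) / ennreal b"
    by (rule divide_right_mono_ennreal)
  also have "ennreal (t * r * \<sigma>) * ennreal b / ennreal b = ennreal (t * r * \<sigma>)"
    using b t r \<sigma> by (simp add: ennreal_mult[symmetric] divide_ennreal)
  also note 1
  also have "ennreal (C * diameter ?B) * ennreal_powr (J / ennreal L) (1 / p)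
      \<le> ennreal (2 * C * r) * ennreal ((j / L) powr (1 / p))"
    unfolding Q by (intro mult_right_mono d) auto
  also have "\<dots> = ennreal (2 * C * r * (j / L) powr (1 / p))"
    using C r by (simp add: ennreal_mult)
  finally have "t * r * \<sigma> \<le> 2 * C * r * (j / L) powr (1 / p)"
    using C r by (subst (asm) ennreal_le_iff) auto
  then have "\<sigma> * t / (2 * C) \<le> (j / L) powr (1 / p)"
    using C r by (simp add: field_simps)
  then have "(\<sigma> * t / (2 * C)) powr p \<le> ((j / L) powr (1 / p)) powr p"
    using p \<sigma> t C by (intro powr_mono2) auto
  also have "\<dots> = j / L" using p j L by (simp add: powr_powr)
  finally have "(\<sigma> * t / (2 * C)) powr p * L \<le> j" using L by (simp add: field_simps)
  then have "ennreal ((\<sigma> * t / (2 * C)) powr p) * ennreal L \<le> ennreal j"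
    using L by (simp add: ennreal_mult[symmetric] ennreal_leI)
  then show ?thesis unfolding L(1) j(1)[symmetric] J_def .
qed

end

section \<open>Self-improvement of the Poincare inequality\<close>

text \<open>Distinct powers of 2 add up to at most twice the largest. This preserves the gain
  \<open>(1 / real k) powr p\<close> of each level when the gradient of an average is raised to the
  power \<open>p\<close>.\<close>

lemma sum_power2_powr_le:
  assumes "finite J" "1 \<le> p"
  shows "(\<Sum>j\<in>J. (2::real) ^ j) powr p \<le> 2 powr p * (\<Sum>j\<in>J. (2 ^ j) powr p)"
proof (cases "J = {}")
  case False
  define m where "m = Max J"
  have m: "m \<in> J" "\<And>j. j \<in> J \<Longrightarrow> j \<le> m" using assms False by (auto simp: m_def)
  have "(\<Sum>j\<in>J. (2::real) ^ j) \<le> (\<Sum>j<Suc m. 2 ^ j)" using m by (intro sum_mono2) (auto simp: less_Suc_eq_le)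
  also have "\<dots> \<le> 2 * 2 ^ m" using sum_gp_strict[of "2::real" "Suc m"] by simp
  finally have "(\<Sum>j\<in>J. (2::real) ^ j) powr p \<le> (2 * 2 ^ m) powr p"
    using assms by (intro powr_mono2) (auto intro: sum_nonneg)
  also have "\<dots> = 2 powr p * (2 ^ m) powr p" by (simp add: powr_mult)
  also have "\<dots> \<le> 2 powr p * (\<Sum>j\<in>J. (2 ^ j) powr p)"
    using member_le_sum[OF m(1), of "\<lambda>j. (2 ^ j) powr p"] assms by (intro mult_left_mono) auto
  finally show ?thesis .
qed simp

text \<open>The terms grow at least by the factor 2 since \<open>p \<ge> 1\<close>, so those below
  the threshold add up to at most twice the last one. Integrated, this is a dyadic layer-cake
  formula.\<close>

lemma sum_dyadic_le:
  fixes t :: ennreal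
  assumes p: "1 \<le> p" and l0: "0 < (l0::real)" and d: "0 < d"
  shows "(\<Sum>i<n. ennreal ((2 ^ i * l0) powr p) * (if ennreal (d * (2 ^ i * l0)) < t then 1 else 0))
    \<le> ennreal (2 / d powr p) * ennreal_powr t p"
proof (cases t)
  case (real t')
  define J where "J = {i. i < n \<and> d * (2 ^ i * l0) < t'}"
  have "(\<Sum>i<n. ennreal ((2 ^ i * l0) powr p) * (if ennreal (d * (2 ^ i * l0)) < t then 1 else 0))
      = (\<Sum>i<n. if i \<in> J then ennreal ((2 ^ i * l0) powr p) else 0)"
    using real d l0 by (intro sum.cong) (auto simp: J_def ennreal_less_iff)
  also have "\<dots> = (\<Sum>i\<in>J. ennreal ((2 ^ i * l0) powr p))"
  proof -
    have "{..<n} \<inter> J = J" by (auto simp: J_def)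
    then show ?thesis by (subst sum.inter_restrict[symmetric]) simp_all
  qed
  also have "\<dots> = ennreal (\<Sum>i\<in>J. (2 ^ i * l0) powr p)" by simp
  finally have eq: "(\<Sum>i<n. ennreal ((2 ^ i * l0) powr p) * (if ennreal (d * (2 ^ i * l0)) < t then 1 else 0))
      = ennreal (\<Sum>i\<in>J. (2 ^ i * l0) powr p)" .
  have le: "(\<Sum>i\<in>J. (2 ^ i * l0) powr p) \<le> 2 / d powr p * t' powr p"
  proof (cases "J = {}")
    case True
    then show ?thesis by simp
  next
    case False
    have fin: "finite J" by (simp add: J_def)
    define m where "m = Max J"
    have m: "m \<in> J" "\<And>j. j \<in> J \<Longrightarrow> j \<le> m" using fin False by (auto simp: m_def)
    have "(2 ^ i * l0) powr p \<le> (2 ^ m * l0) powr p * (1/2) ^ (m - i)" if "i \<le> m" for i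
    proof -
      have "2 ^ i * l0 = 2 ^ m * l0 * (1/2) ^ (m - i)"
        using that by (simp add: power_divide field_simps flip: power_add)
      then have "(2 ^ i * l0) powr p = (2 ^ m * l0) powr p * ((1/2) ^ (m - i)) powr p"
        using l0 by (simp only: powr_mult)
      also have "((1/2::real) ^ (m - i)) powr p \<le> ((1/2) ^ (m - i)) powr 1"
        using p by (intro powr_mono') (auto simp: power_le_one)
      finally show ?thesis by (simp add: mult_left_mono)
    qed
    then have "(\<Sum>i\<in>J. (2 ^ i * l0) powr p) \<le> (\<Sum>i\<in>J. (2 ^ m * l0) powr p * (1/2) ^ (m - i))"
      using m by (intro sum_mono) auto
    also have "\<dots> \<le> (\<Sum>i<Suc m. (2 ^ m * l0) powr p * (1/2) ^ (m - i))"
      using m by (intro sum_mono2) (auto simp: less_Suc_eq_le)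
    also have "\<dots> = (2 ^ m * l0) powr p * (\<Sum>i<Suc m. (1/2) ^ (m - i))"
      by (rule sum_distrib_left[symmetric])
    also have "(\<Sum>i<Suc m. (1/2::real) ^ (m - i)) = (\<Sum>i<Suc m. (1/2) ^ i)"
      by (rule sum.reindex_bij_witness[of _ "\<lambda>i. m - i" "\<lambda>i. m - i"]) auto
    also have "(2 ^ m * l0) powr p * (\<Sum>i<Suc m. (1/2) ^ i) \<le> (2 ^ m * l0) powr p * 2"
      by (rule mult_left_mono) (unfold sum_gp_strict, simp_all)
    finally have "(\<Sum>i\<in>J. (2 ^ i * l0) powr p) \<le> 2 * (2 ^ m * l0) powr p" by (simp only: mult.commute)
    also have "(2 ^ m * l0) powr p \<le> (t' / d) powr p"
      using m(1) d l0 p by (intro powr_mono2) (auto simp: J_def field_simps)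
    also have "(t' / d) powr p = t' powr p / d powr p" using real d by (simp add: powr_divide)
    finally show ?thesis by simp
  qed
  have "ennreal (\<Sum>i\<in>J. (2 ^ i * l0) powr p) \<le> ennreal (2 / d powr p * t' powr p)"
    by (rule ennreal_leI[OF le])
  also have "\<dots> = ennreal (2 / d powr p) * ennreal_powr t p"
    unfolding real(2) ennreal_powr_ennreal[OF real(1)] by (rule ennreal_mult) simp_all
  finally show ?thesis unfolding eq .
next
  case top
  then show ?thesis using d by (simp add: ennreal_mult_top)
qed

lemma (in metric_measure) sum_dyadic_emeasure_le:
  fixes F :: "'a \<Rightarrow> ennreal"
  assumes p: "1 \<le> p" and l0: "0 < (l0::real)" and d: "0 < d" and F [measurable]: "F \<in> borel_measurable M"
  shows "(\<Sum>i<n. ennreal ((2 ^ i * l0) powr p) * emeasure M {x\<in>X. ennreal (d * (2 ^ i * l0)) < F x})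
    \<le> ennreal (2 / d powr p) * (\<integral>\<^sup>+x. ennreal_powr (F x) p \<partial>M)"
proof -
  have m: "{x\<in>X. ennreal (d * (2 ^ i * l0)) < F x} \<in> sets M" for i
  proof -
    have "{x\<in>space M. ennreal (d * (2 ^ i * l0)) < F x} \<in> sets M" by measurable
    then show ?thesis by simp
  qed
  have "(\<Sum>i<n. ennreal ((2 ^ i * l0) powr p) * emeasure M {x\<in>X. ennreal (d * (2 ^ i * l0)) < F x})
      = (\<Sum>i<n. \<integral>\<^sup>+x. ennreal ((2 ^ i * l0) powr p) * indicator {x\<in>X. ennreal (d * (2 ^ i * l0)) < F x} x \<partial>M)"
    using m by (simp add: nn_integral_cmult_indicator)
  also have "\<dots> = (\<integral>\<^sup>+x. (\<Sum>i<n. ennreal ((2 ^ i * l0) powr p) * indicator {x\<in>X. ennreal (d * (2 ^ i * l0)) < F x} x) \<partial>M)"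
    using m by (intro nn_integral_sum[symmetric]) auto
  also have "\<dots> \<le> (\<integral>\<^sup>+x. ennreal (2 / d powr p) * ennreal_powr (F x) p \<partial>M)"
  proof (rule nn_integral_mono)
    fix x assume "x \<in> space M"
    then have "(\<Sum>i<n. ennreal ((2 ^ i * l0) powr p) * indicator {x\<in>X. ennreal (d * (2 ^ i * l0)) < F x} x)
        = (\<Sum>i<n. ennreal ((2 ^ i * l0) powr p) * (if ennreal (d * (2 ^ i * l0)) < F x then 1 else 0))"
      by (intro sum.cong) (auto simp: indicator_def)
    also have "\<dots> \<le> ennreal (2 / d powr p) * ennreal_powr (F x) p" by (rule sum_dyadic_le[OF p l0 d])
    finally show "(\<Sum>i<n. ennreal ((2 ^ i * l0) powr p) * indicator {x\<in>X. ennreal (d * (2 ^ i * l0)) < F x} x)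
      \<le> ennreal (2 / d powr p) * ennreal_powr (F x) p" .
  qed
  also have "\<dots> = ennreal (2 / d powr p) * (\<integral>\<^sup>+x. ennreal_powr (F x) p \<partial>M)"
    by (intro nn_integral_cmult) measurable
  finally show ?thesis .
qed

text \<open>The recursive inequality gains a factor smaller than one on each sum of \<^term>\<open>k\<close>
  consecutive shifts, so it bounds all partial sums of \<^term>\<open>a\<close>.\<close>

lemma absorb_shifted_sums:
  fixes a b :: "nat \<Rightarrow> real"
  assumes a: "\<And>i. 0 \<le> a i" "\<And>i. a i \<le> A" and b: "\<And>n. (\<Sum>i<n. b i) \<le> Bb"
    and rec: "\<And>i. a i \<le> b i + \<eta> * (\<Sum>j<2 * k. a (i + j))" and \<eta>: "0 \<le> \<eta>" "\<eta> * real (2 * k) \<le> 1/2"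
  shows "(\<Sum>i<n. a i) \<le> 2 * Bb + 2 * real k * A"
proof -
  let ?S = "\<Sum>i<n. a i"
  have A: "0 \<le> A" using a[of 0] by linarith
  \<comment> \<open>A shifted sum leaves the window by fewer than \<open>2 * k\<close> terms, each
    bounded by the a priori constant \<open>A\<close>.\<close>
  have shift: "(\<Sum>i<n. a (i + j)) \<le> ?S + real (2 * k) * A" if "j < 2 * k" for j
  proof -
    have "(\<Sum>i<n. a (i + j)) = (\<Sum>i\<in>{j..<n + j}. a i)"
      using sum.shift_bounds_nat_ivl[of a 0 j n] by (simp add: lessThan_atLeast0)
    also have "\<dots> \<le> (\<Sum>i\<in>{..<n} \<union> {n..<n + j}. a i)" by (intro sum_mono2) (auto simp: a)
    also have "\<dots> = ?S + (\<Sum>i\<in>{n..<n + j}. a i)" by (intro sum.union_disjoint) auto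
    also have "(\<Sum>i\<in>{n..<n + j}. a i) \<le> (\<Sum>i\<in>{n..<n + j}. A)" by (intro sum_mono a)
    also have "\<dots> = real j * A" by simp
    also have "\<dots> \<le> real (2 * k) * A" using that A by (intro mult_right_mono) auto
    finally show ?thesis by simp
  qed
  have "?S \<le> (\<Sum>i<n. b i + \<eta> * (\<Sum>j<2 * k. a (i + j)))" by (intro sum_mono rec)
  also have "\<dots> = (\<Sum>i<n. b i) + \<eta> * (\<Sum>j<2 * k. \<Sum>i<n. a (i + j))"
    by (simp add: sum.distrib sum_distrib_left) (subst sum.swap, rule refl)
  also have "\<dots> \<le> Bb + \<eta> * (\<Sum>j<2 * k. ?S + real (2 * k) * A)"
    using \<eta> by (intro add_mono b mult_left_mono sum_mono shift) auto
  also have "\<dots> = Bb + (\<eta> * real (2 * k)) * (?S + real (2 * k) * A)" by simp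
  also have "\<dots> \<le> Bb + 1/2 * (?S + real (2 * k) * A)"
    using \<eta> A a by (intro add_left_mono mult_right_mono) (auto intro!: add_nonneg_nonneg sum_nonneg)
  finally have *: "?S \<le> Bb + 1/2 * (?S + real (2 * k) * A)" .
  define Y where "Y = real (2 * k) * A"
  have "x \<le> 2 * Bb + Y" if "x \<le> Bb + 1/2 * (x + Y)" for x :: real
    using that by (simp add: field_simps)
  then have "?S \<le> 2 * Bb + Y" using * unfolding Y_def[symmetric] .
  then show ?thesis by (simp add: Y_def)
qed

text \<open>\<open>2 ^ q\<close> dominates the dilation by \<open>l\<close> followed by the factor 5
  of the covering, and \<open>R\<close> is so small that this dilate stays in the doubling
  range.\<close>

locale poincare_space = doubling_space +
  fixes p C l R :: real and q :: nat
  assumes p: "1 < p" and C: "0 < C" and l: "1 \<le> l" and R: "0 < R"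
    and q: "5 * l \<le> 2 ^ q" "2 ^ q * R \<le> 2 * R0"
    and PI: "\<And>x r. x \<in> X \<Longrightarrow> 0 < r \<Longrightarrow> r \<le> R \<Longrightarrow> poincare_on_ball X \<mu> p C l x r"
begin

text \<open>The proportion that makes a ball bad. As \<open>s * D ^ 2 = 1/4\<close>, two exceptional
  sets of proportion \<open>s\<close>, taken in balls of up to four times the radius, cannot fill
  the small ball.\<close>

definition s :: real where "s = 1 / (4 * D ^ 2)"
text \<open>Makes \<open>3 * \<delta> * lam\<close> half of \<open>s * lam / (4 * C)\<close>, the
  size of the gradient that a bad ball forces on a truncation, so the constant part
  \<open>\<delta> * lam\<close> of that gradient can be absorbed.\<close>

definition \<delta> :: real where "\<delta> = s / (24 * C)"

lemma s: "0 < s" "s \<le> 1/4" "s * D + s < 1" "s * D ^ 2 + s * 1 < 1" "s * D ^ 2 = 1/4"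
proof -
  have D2: "1 \<le> D ^ 2" "D \<le> D ^ 2" using D1 by (simp_all add: self_le_power)
  show sp: "0 < s" and s4: "s \<le> 1/4" using D2(1) by (auto simp: s_def divide_simps)
  show e: "s * D ^ 2 = 1/4" using D2 by (auto simp: s_def)
  have "s * D \<le> s * D ^ 2" using sp D2 by (intro mult_left_mono) auto
  then show "s * D + s < 1" "s * D ^ 2 + s * 1 < 1" using e s4 by auto
qed

lemma \<delta>: "0 < \<delta>" using s C by (simp add: \<delta>_def)

lemma l_R: "l * R \<le> R0" "R \<le> R0"
proof -
  have "5 * l * R \<le> 2 ^ q * R" using q R by (intro mult_right_mono) auto
  then have "5 * (l * R) \<le> 2 * R0" using q by (simp add: mult.assoc)
  moreover have "0 \<le> l * R" using l R by simp
  ultimately show 1: "l * R \<le> R0" by linarith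
  have "1 * R \<le> l * R" using l R by (intro mult_right_mono) auto
  then show "R \<le> R0" using 1 by simp
qed

end

section \<open>Bad sets of a family with a common upper gradient\<close>

text \<open>In the application \<open>f n x\<close> is the norm of \<open>u' x - y n\<close>,
  \<open>e\<close> the norm of \<open>u'\<close> and \<open>cc n\<close> the norm of
  \<open>y n\<close>. On a space of infinite measure \<open>f n\<close> may fail to lie in L^p, but
  its deviation from \<open>cc n\<close> is dominated by \<open>e\<close>.\<close>

locale poincare_family = poincare_space +
  fixes \<rho> :: "'a \<Rightarrow> ennreal" and f :: "nat \<Rightarrow> 'a \<Rightarrow> real" and e :: "'a \<Rightarrow> real" and cc :: "nat \<Rightarrow> real"
  assumes \<rho>: "Lp_borel X \<mu> p \<rho>"
    and f_meas [measurable]: "\<And>n. f n \<in> borel_measurable M"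
    and f_wug: "\<And>n. weak_upper_gradient X \<mu> p (f n) \<rho>"
    and e_meas [measurable]: "e \<in> borel_measurable M"
    and e_fin: "(\<integral>\<^sup>+x. ennreal_powr (ennreal (e x)) p \<partial>M) < \<infinity>"
    and fe: "\<And>n x. x \<in> X \<Longrightarrow> \<bar>f n x - cc n\<bar> \<le> e x"
begin

text \<open>Quantifying over \<open>c\<close> avoids means and medians: the negation directly gives
  a constant close to \<open>f n\<close> on most of the ball, and the condition survives, with a
  smaller proportion, a change of \<open>f n\<close> on a set of small mass.\<close>

definition bad :: "nat \<Rightarrow> real \<Rightarrow> 'a \<Rightarrow> real \<Rightarrow> bool" where
  "bad n lam x r \<longleftrightarrow> (\<forall>c. ennreal s * emeasure M (X \<inter> ball x r) \<le>
      emeasure M {y \<in> X \<inter> ball x r. lam * r < \<bar>f n y - c\<bar>})"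

definition bad_balls :: "real \<Rightarrow> ('a \<times> real) set" where
  "bad_balls lam = {(x, r). x \<in> X \<and> 0 < r \<and> r \<le> R \<and> (\<exists>n. bad n lam x r)}"

definition U :: "real \<Rightarrow> 'a set" where
  "U lam = (\<Union>(x, r)\<in>bad_balls lam. X \<inter> ball x r)"

lemma osc_sets [measurable]: "{y \<in> X \<inter> ball x r. t < \<bar>f n y - c\<bar>} \<in> sets M"
proof -
  have "{y \<in> X \<inter> ball x r. t < \<bar>f n y - c\<bar>} = (X \<inter> ball x r) \<inter> {y\<in>space M. t < \<bar>f n y - c\<bar>}" by auto
  also have "\<dots> \<in> sets M" by measurable
  finally show ?thesis .
qed

lemma U_borel: "U lam \<in> sets borel_X"
proof -
  have "U lam = X \<inter> (\<Union>(x, r)\<in>bad_balls lam. ball x r)" by (auto simp: U_def)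
  moreover have "open (\<Union>(x, r)\<in>bad_balls lam. ball x r)" by (intro open_UN) auto
  ultimately show ?thesis by (metis borel_X_Int borel_open)
qed

lemma U_sets [measurable]: "U lam \<in> sets M"
  by (rule borel_X_sets[OF U_borel])

lemma bad_mono: "lam \<le> lam' \<Longrightarrow> 0 < r \<Longrightarrow> bad n lam' x r \<Longrightarrow> bad n lam x r"
  unfolding bad_def
proof (intro allI)
  fix c assume *: "lam \<le> lam'" "0 < r" and bad: "\<forall>c. ennreal s * emeasure M (X \<inter> ball x r) \<le>
      emeasure M {y \<in> X \<inter> ball x r. lam' * r < \<bar>f n y - c\<bar>}"
  have "lam * r \<le> lam' * r" using * by (intro mult_right_mono) auto
  then have "emeasure M {y \<in> X \<inter> ball x r. lam' * r < \<bar>f n y - c\<bar>} \<le>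
      emeasure M {y \<in> X \<inter> ball x r. lam * r < \<bar>f n y - c\<bar>}"
    by (intro emeasure_mono osc_sets) auto
  then show "ennreal s * emeasure M (X \<inter> ball x r) \<le> emeasure M {y \<in> X \<inter> ball x r. lam * r < \<bar>f n y - c\<bar>}"
    using bad order_trans by blast
qed

lemma U_antimono: "lam \<le> lam' \<Longrightarrow> U lam' \<subseteq> U lam"
proof -
  assume "lam \<le> lam'"
  then have "bad_balls lam' \<subseteq> bad_balls lam" using bad_mono by (auto simp: bad_balls_def) blast
  then show ?thesis unfolding U_def by (rule UN_mono) simp
qed

lemma not_bad_median:
  assumes "x \<in> X" "x \<notin> U lam" "0 < r" "r \<le> R"
  obtains c where "emeasure M {y \<in> X \<inter> ball x r. lam * r < \<bar>f n y - c\<bar>} \<le> ennreal s * emeasure M (X \<inter> ball x r)"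
proof -
  have "(x, r) \<notin> bad_balls lam" using assms by (auto simp: U_def)
  then have "\<not> bad n lam x r" using assms by (auto simp: bad_balls_def)
  then show thesis unfolding bad_def using that by (meson linear)
qed

text \<open>A weak approximate continuity: the proportion 1/2, together with
  \<open>s \<le> 1/4\<close>, still leaves a point common to two good sets.\<close>

definition approx_continuous :: "nat \<Rightarrow> 'a \<Rightarrow> bool" where
  "approx_continuous n x \<longleftrightarrow> (\<forall>t>0. \<exists>d>0. \<forall>r. 0 < r \<and> r < d \<longrightarrow>
     emeasure M {y \<in> X \<inter> ball x r. t < \<bar>f n y - f n x\<bar>} \<le> ennreal (1/2) * emeasure M (X \<inter> ball x r))"

text \<open>The density theorem is applied to the preimages of the countably many intervals with
  rational centre \<open>a\<close> and half-width 1/(k+1).\<close>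

lemma AE_approx_continuous: "AE x in M. \<forall>n. approx_continuous n x"
proof -
  define A where "A n a k = {x\<in>X. \<bar>f n x - a\<bar> < 1 / real (Suc k)}" for n a k
  have A: "A n a k \<in> sets M" for n a k
  proof -
    have "{x\<in>space M. \<bar>f n x - a\<bar> < 1 / real (Suc k)} \<in> sets M" by measurable
    then show ?thesis by (simp add: A_def)
  qed
  let ?P = "\<lambda>n a k x. x \<in> A n a k \<longrightarrow> (\<exists>d>0. \<forall>r. 0 < r \<and> r < d \<longrightarrow>
    emeasure M (X \<inter> ball x r - A n a k) \<le> ennreal (1/2) * emeasure M (X \<inter> ball x r))"
  have "AE x in M. \<forall>n k. \<forall>a\<in>\<rat>. ?P n a k x"
    unfolding AE_all_countable
    by (intro allI AE_ball_countable' countable_rat Lebesgue_density A) auto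
  then show ?thesis using AE_space
  proof eventually_elim
    case (elim x)
    have "approx_continuous n x" for n
      unfolding approx_continuous_def
    proof (intro allI impI)
      fix t :: real assume t: "0 < t"
      obtain k where k: "1 / real (Suc k) < t / 2" using nat_approx_posE[of "t/2"] t by auto
      obtain a where a: "a \<in> \<rat>" "f n x < a" "a < f n x + 1 / real (Suc k)"
        using Rats_dense_in_real[of "f n x" "f n x + 1 / real (Suc k)"] by auto
      have "x \<in> A n a k" using elim a by (auto simp: A_def)
      then obtain d where d: "0 < d" "\<And>r. 0 < r \<Longrightarrow> r < d \<Longrightarrow>
          emeasure M (X \<inter> ball x r - A n a k) \<le> ennreal (1/2) * emeasure M (X \<inter> ball x r)"
        using elim a(1) by blast
      have sub: "{y \<in> X \<inter> ball x r. t < \<bar>f n y - f n x\<bar>} \<subseteq> X \<inter> ball x r - A n a k" for r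
        using a k by (auto simp: A_def)
      show "\<exists>d>0. \<forall>r. 0 < r \<and> r < d \<longrightarrow>
          emeasure M {y \<in> X \<inter> ball x r. t < \<bar>f n y - f n x\<bar>} \<le> ennreal (1/2) * emeasure M (X \<inter> ball x r)"
      proof (intro exI[of _ d] conjI allI impI d(1))
        fix r assume "0 < r \<and> r < d"
        then have "emeasure M (X \<inter> ball x r - A n a k) \<le> ennreal (1/2) * emeasure M (X \<inter> ball x r)"
          using d(2) by blast
        moreover have "emeasure M {y \<in> X \<inter> ball x r. t < \<bar>f n y - f n x\<bar>} \<le> emeasure M (X \<inter> ball x r - A n a k)"
          using A by (intro emeasure_mono sub) auto
        ultimately show "emeasure M {y \<in> X \<inter> ball x r. t < \<bar>f n y - f n x\<bar>} \<le> ennreal (1/2) * emeasure M (X \<inter> ball x r)"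
          by (rule order_trans[rotated])
      qed
    qed
    then show ?case by blast
  qed
qed

definition N where "N = {x\<in>X. \<not> (\<forall>n. approx_continuous n x)}"

lemma N: "N \<in> null_sets M"
  using AE_approx_continuous unfolding AE_iff_null N_def .

text \<open>Telescoping over the balls of radius \<open>r * (1/2) ^ i\<close>: consecutive
  near-medians have a common good point in the smaller ball, so they differ by at most
  \<open>lam\<close> times the sum of the two radii, and approximate continuity links a late one to
  \<open>f n x\<close>.\<close>

lemma median_close:
  assumes x: "x \<in> X" "x \<notin> U lam" "x \<notin> N" and r: "0 < r" "r \<le> R" and lam: "0 < lam"
    and c: "emeasure M {y \<in> X \<inter> ball x r. lam * r < \<bar>f n y - c\<bar>} \<le> ennreal s * emeasure M (X \<inter> ball x r)"
  shows "\<bar>f n x - c\<bar> \<le> 3 * lam * r"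
proof -
  define rr where "rr i = r * (1/2) ^ i" for i :: nat
  have rr: "0 < rr i" "rr i \<le> r" "rr i \<le> R" "rr i = 2 * rr (Suc i)" for i
    using r by (auto simp: rr_def power_le_one mult_le_cancel_left1 intro: order_trans[of _ r])
  let ?B = "\<lambda>i. X \<inter> ball x (rr i)"
  let ?E = "\<lambda>i c. {y \<in> X \<inter> ball x (rr i). lam * rr i < \<bar>f n y - c\<bar>}"
  have "\<forall>i. \<exists>c. emeasure M (?E i c) \<le> ennreal s * emeasure M (?B i)"
    using not_bad_median[OF x(1,2) rr(1,3)] by metis
  from choice[OF this] obtain c' where "\<forall>i. emeasure M (?E i (c' i)) \<le> ennreal s * emeasure M (?B i)" ..
  then have c': "\<And>i. emeasure M (?E i (c' i)) \<le> ennreal s * emeasure M (?B i)" ..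
  \<comment> \<open>The chain starts with the given \<open>c\<close>, so the estimate holds for
    every near-median on the first ball.\<close>
  define cs where "cs i = (if i = 0 then c else c' i)" for i
  have cs: "emeasure M (?E i (cs i)) \<le> ennreal s * emeasure M (?B i)" for i
    using c c'[of i] by (cases "i = 0") (auto simp: cs_def rr_def)
  have step: "\<bar>cs i - cs (Suc i)\<bar> \<le> lam * rr i + lam * rr (Suc i)" for i
  proof -
    have "emeasure M (X \<inter> ball x (2 * rr (Suc i))) \<le> ennreal D * emeasure M (?B (Suc i))"
      by (rule doubling[OF x(1) rr(1)]) (use rr(3)[of "Suc i"] l_R in auto)
    then have "ennreal s * emeasure M (?B i) \<le> ennreal s * (ennreal D * emeasure M (?B (Suc i)))"
      unfolding rr(4)[of i] by (rule mult_left_mono) simp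
    with cs[of i] have "emeasure M (?E i (cs i)) \<le> ennreal s * (ennreal D * emeasure M (?B (Suc i)))"
      by (rule order_trans)
    then have "emeasure M (?E i (cs i)) \<le> ennreal (s * D) * emeasure M (?B (Suc i))"
      using s D1 by (simp add: ennreal_mult mult.assoc)
    then obtain y where y: "y \<in> ?B (Suc i)" "y \<notin> ?E i (cs i)" "y \<notin> ?E (Suc i) (cs (Suc i))"
      by (rule exists_outside[OF osc_sets osc_sets Int_ball_sets emeasure_ball[OF x(1) rr(1)]
          emeasure_ball_finite[OF x(1)] _ cs[of "Suc i"]]) (use s D1 in auto)
    have "y \<in> ?B i" using y(1) rr(1)[of "Suc i"] rr(4)[of i] by auto
    then show ?thesis using y by auto
  qed
  \<comment> \<open>Closed form, because
    \<open>rr i + rr (Suc i) = 3 * (rr i - rr (Suc i))\<close>.\<close>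
  have sum: "\<bar>c - cs i\<bar> \<le> 3 * lam * (r - rr i)" for i
  proof (induction i)
    case 0
    then show ?case by (simp add: cs_def rr_def)
  next
    case (Suc i)
    have "\<bar>c - cs (Suc i)\<bar> \<le> \<bar>c - cs i\<bar> + \<bar>cs i - cs (Suc i)\<bar>" by linarith
    also have "\<dots> \<le> 3 * lam * (r - rr i) + (lam * rr i + lam * rr (Suc i))"
      by (intro add_mono Suc.IH step)
    also have "\<dots> = 3 * lam * (r - rr (Suc i))" unfolding rr(4)[of i] by (simp add: algebra_simps)
    finally show ?case .
  qed
  have "\<bar>f n x - c\<bar> \<le> 3 * lam * r + t" if t: "0 < t" for t
  proof -
    have "approx_continuous n x" using x by (auto simp: N_def)
    then obtain d where d: "0 < d" "\<And>r. 0 < r \<Longrightarrow> r < d \<Longrightarrow>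
      emeasure M {y \<in> X \<inter> ball x r. t < \<bar>f n y - f n x\<bar>} \<le> ennreal (1/2) * emeasure M (X \<inter> ball x r)"
      unfolding approx_continuous_def using t by blast
    obtain i where "(1/2) ^ i < d / r" using real_arch_pow_inv[of "d / r" "1/2"] d r by auto
    then have i: "rr i < d" using r by (simp add: rr_def field_simps)
    obtain y where y: "y \<in> ?B i" "y \<notin> {y \<in> ?B i. t < \<bar>f n y - f n x\<bar>}" "y \<notin> ?E i (cs i)"
      by (rule exists_outside[OF osc_sets osc_sets Int_ball_sets emeasure_ball[OF x(1) rr(1)]
          emeasure_ball_finite[OF x(1)] d(2)[OF rr(1) i] cs[of i]]) (use s in auto)
    then have "\<bar>f n x - cs i\<bar> \<le> t + lam * rr i" by auto
    then have "\<bar>f n x - c\<bar> \<le> t + lam * rr i + 3 * lam * (r - rr i)" using sum[of i] by linarith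
    also have "\<dots> \<le> 3 * lam * r + t" using lam rr(1)[of i] by (simp add: algebra_simps)
    finally show ?thesis .
  qed
  then show ?thesis by (rule field_le_epsilon)
qed

text \<open>For \<open>r\<close> twice the distance, the good sets of the near-medians at
  \<open>x\<close> and at \<open>y\<close> each fill at least three quarters of the half ball at
  \<open>x\<close>, so they share a point there. The bounds 3, 2 and 3 times \<open>lam * r\<close>
  add up to \<open>16 * lam * dist x y\<close>.\<close>

lemma lipschitz_off_U:
  assumes x: "x \<in> X" "x \<notin> U lam" "x \<notin> N" and y: "y \<in> X" "y \<notin> U lam" "y \<notin> N"
    and lam: "0 < lam" and d: "2 * dist x y \<le> R"
  shows "\<bar>f n x - f n y\<bar> \<le> 16 * lam * dist x y"
proof (cases "x = y")
  case False
  define r where "r = 2 * dist x y"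
  have r: "0 < r" "r \<le> R" using False d by (auto simp: r_def)
  obtain c where c: "emeasure M {z \<in> X \<inter> ball x r. lam * r < \<bar>f n z - c\<bar>} \<le> ennreal s * emeasure M (X \<inter> ball x r)"
    using not_bad_median[OF x(1,2) r] by blast
  obtain c' where c': "emeasure M {z \<in> X \<inter> ball y r. lam * r < \<bar>f n z - c'\<bar>} \<le> ennreal s * emeasure M (X \<inter> ball y r)"
    using not_bad_median[OF y(1,2) r] by blast
  let ?B = "X \<inter> ball x (r / 2)"
  have r2: "0 < r / 2" using r by simp
  have 1: "emeasure M {z \<in> X \<inter> ball x r. lam * r < \<bar>f n z - c\<bar>} \<le> ennreal (s * D ^ 2) * emeasure M ?B"
  proof -
    have "emeasure M (X \<inter> ball x r) \<le> ennreal (D ^ 2) * emeasure M ?B"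
      by (rule doubling_le[OF x(1) r2]) (use r l_R in auto)
    then have "ennreal s * emeasure M (X \<inter> ball x r) \<le> ennreal s * (ennreal (D ^ 2) * emeasure M ?B)"
      by (rule mult_left_mono) simp
    with c show ?thesis using s D1 by (simp add: ennreal_mult mult.assoc)
  qed
  have 2: "emeasure M {z \<in> X \<inter> ball y r. lam * r < \<bar>f n z - c'\<bar>} \<le> ennreal (s * D ^ 2) * emeasure M ?B"
  proof -
    have "X \<inter> ball y r \<subseteq> X \<inter> ball x (2 * r)"
    proof
      fix z assume z: "z \<in> X \<inter> ball y r"
      then have "dist x z < dist x y + r" using dist_triangle[of x z y] by auto
      then have "dist x z < 2 * r" using r unfolding r_def by linarith
      then show "z \<in> X \<inter> ball x (2 * r)" using z by auto
    qed
    then have "emeasure M (X \<inter> ball y r) \<le> emeasure M (X \<inter> ball x (2 * r))"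
      by (intro emeasure_mono) auto
    also have "\<dots> \<le> ennreal (D ^ 2) * emeasure M ?B"
      by (rule doubling_le[OF x(1) r2]) (use r l_R in auto)
    finally have "ennreal s * emeasure M (X \<inter> ball y r) \<le> ennreal s * (ennreal (D ^ 2) * emeasure M ?B)"
      by (rule mult_left_mono) simp
    with c' show ?thesis using s D1 by (simp add: ennreal_mult mult.assoc)
  qed
  obtain z where z: "z \<in> ?B" "z \<notin> {z \<in> X \<inter> ball x r. lam * r < \<bar>f n z - c\<bar>}"
    "z \<notin> {z \<in> X \<inter> ball y r. lam * r < \<bar>f n z - c'\<bar>}"
    by (rule exists_outside[OF osc_sets osc_sets Int_ball_sets emeasure_ball[OF x(1) r2]
        emeasure_ball_finite[OF x(1)] 1 2]) (use s in auto)
  have "dist y z < r" using z(1) dist_triangle3[of y z x] by (auto simp: r_def dist_commute)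
  then have "\<bar>c - c'\<bar> \<le> 2 * (lam * r)" using z r by auto
  moreover have "\<bar>f n x - c\<bar> \<le> 3 * lam * r" by (rule median_close[OF x r lam c])
  moreover have "\<bar>f n y - c'\<bar> \<le> 3 * lam * r" by (rule median_close[OF y r lam c'])
  ultimately have "\<bar>f n x - f n y\<bar> \<le> 8 * lam * r" by linarith
  then show ?thesis by (simp add: r_def)
qed simp

end

lemma (in metric_measure) borel_subspace: "S \<in> sets borel_X \<Longrightarrow> Y \<subseteq> X \<Longrightarrow> Y \<inter> S \<in> sets (restrict_space borel Y)"
  by (auto simp: sets_restrict_space)

context poincare_family begin

lemma \<rho>_borel: "\<rho> \<in> borel_measurable borel_X"
  using \<rho> by (simp add: Lp_borel_def)

lemma \<rho>_measurable [measurable]: "\<rho> \<in> borel_measurable M"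
  by (rule borel_X_measurable[OF \<rho>_borel])

lemma e_nonneg: "x \<in> X \<Longrightarrow> 0 \<le> e x"
  using fe[of x 0] by linarith

lemma f_ball_integrable:
  assumes x: "x \<in> X"
  shows "(\<integral>\<^sup>+y. ennreal \<bar>f n y\<bar> * indicator (X \<inter> ball x r) y \<partial>M) < \<infinity>"
proof -
  have "(\<integral>\<^sup>+y. ennreal \<bar>f n y\<bar> * indicator (X \<inter> ball x r) y \<partial>M)
      \<le> (\<integral>\<^sup>+y. ennreal (\<bar>cc n\<bar> + 1) * indicator (X \<inter> ball x r) y + ennreal_powr (ennreal (e y)) p \<partial>M)"
  proof (rule nn_integral_mono)
    fix y assume "y \<in> space M"
    then have y: "y \<in> X" by simp
    have "e y \<le> 1 + e y powr p"
    proof (cases "e y \<le> 1")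
      case False
      then have "e y powr 1 \<le> e y powr p" using p by (intro powr_mono) auto
      then show ?thesis using False by simp
    qed (simp add: add_increasing2)
    then have "\<bar>f n y\<bar> \<le> (\<bar>cc n\<bar> + 1) + e y powr p" using fe[OF y, of n] by linarith
    then have "ennreal \<bar>f n y\<bar> \<le> ennreal (\<bar>cc n\<bar> + 1) + ennreal (e y powr p)"
      by (simp add: ennreal_leI flip: ennreal_plus)
    then show "ennreal \<bar>f n y\<bar> * indicator (X \<inter> ball x r) y
        \<le> ennreal (\<bar>cc n\<bar> + 1) * indicator (X \<inter> ball x r) y + ennreal_powr (ennreal (e y)) p"
      using e_nonneg[OF y] by (simp add: indicator_def ennreal_powr_ennreal)
  qed
  also have "\<dots> = ennreal (\<bar>cc n\<bar> + 1) * emeasure M (X \<inter> ball x r) + (\<integral>\<^sup>+y. ennreal_powr (ennreal (e y)) p \<partial>M)"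
    by (simp add: nn_integral_add nn_integral_cmult_indicator)
  also have "\<dots> < \<infinity>"
    using e_fin emeasure_ball_finite[OF x, of r] by (simp add: ennreal_mult_less_top)
  finally show ?thesis .
qed

lemma bad_ball_weak_bound:
  assumes xr: "(x, r) \<in> bad_balls lam" and lam: "0 \<le> lam"
  shows "ennreal ((s * lam / (2 * C)) powr p) * emeasure M (X \<inter> ball x (l * r))
    \<le> (\<integral>\<^sup>+y. ennreal_powr (\<rho> y) p * indicator (X \<inter> ball x (l * r)) y \<partial>M)"
proof -
  obtain n where n: "x \<in> X" "0 < r" "r \<le> R" "bad n lam x r" using xr by (auto simp: bad_balls_def)
  show ?thesis
  proof (rule poincare_osc[OF PI[OF n(1-3)] n(1,2) l p C f_meas[of n] f_ball_integrable[OF n(1)] _ _ lam s(1)])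
    show "weak_upper_gradient (X \<inter> ball x (l * r)) \<mu> p (f n) \<rho>"
      by (rule weak_upper_gradient_subspace[OF Int_ball_sets f_wug])
    show "Lp_borel (X \<inter> ball x (l * r)) \<mu> p \<rho>" by (rule Lp_borel_subspace[OF Int_ball_sets \<rho>])
  qed (use n(4) in \<open>simp add: bad_def\<close>)
qed

text \<open>The covering is run on the balls dilated by \<open>l\<close>, where the energy of the
  Poincare inequality lives; \<open>D ^ q\<close> leads from five times the dilated ball back to the
  original one.\<close>

lemma U_covering:
  assumes w: "w \<in> borel_measurable M"
    and bound: "\<And>x r. (x, r) \<in> bad_balls lam \<Longrightarrow>
      emeasure M (X \<inter> ball x (l * r)) \<le> K * (\<integral>\<^sup>+y. w y * indicator (X \<inter> ball x (l * r)) y \<partial>M)"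
  shows "emeasure M (U lam) \<le> ennreal (D ^ q) * K * (\<integral>\<^sup>+y. w y \<partial>M)"
proof -
  define B where "B = (\<lambda>(x, r). (x, l * r)) ` bad_balls lam"
  have "emeasure M (\<Union>(x, r)\<in>B. X \<inter> ball x r) \<le> ennreal (D ^ q) * K * (\<integral>\<^sup>+y. w y \<partial>M)"
  proof (rule covering_bound[where R = "l * R"])
    fix x t assume "(x, t) \<in> B"
    then obtain r where r: "(x, r) \<in> bad_balls lam" "t = l * r" by (auto simp: B_def)
    then have xr: "x \<in> X" "0 < r" "r \<le> R" by (auto simp: bad_balls_def)
    show "x \<in> X \<and> 0 < t \<and> t \<le> l * R" using xr r l by auto
    have "5 * t \<le> 2 ^ q * r" using q(1) xr r by (simp add: mult.assoc[symmetric])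
    moreover have "2 ^ q * r \<le> 2 * R0"
      using xr by (intro order_trans[OF _ q(2)] mult_left_mono) auto
    ultimately have "emeasure M (X \<inter> ball x (5 * t)) \<le> ennreal (D ^ q) * emeasure M (X \<inter> ball x r)"
      using xr by (intro doubling_le) auto
    also have "emeasure M (X \<inter> ball x r) \<le> emeasure M (X \<inter> ball x t)"
    proof (rule emeasure_mono)
      have "r \<le> t" using l xr r by (simp add: mult_le_cancel_right1)
      then show "X \<inter> ball x r \<subseteq> X \<inter> ball x t" by auto
    qed simp
    also have "\<dots> \<le> K * (\<integral>\<^sup>+y. w y * indicator (X \<inter> ball x t) y \<partial>M)" using bound[OF r(1)] r(2) by simp
    finally show "emeasure M (X \<inter> ball x (5 * t)) \<le>
        ennreal (D ^ q) * K * (\<integral>\<^sup>+y. w y * indicator (X \<inter> ball x t) y \<partial>M)"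
      by (simp add: mult_left_mono mult.assoc)
  qed (rule w)
  moreover have "U lam \<subseteq> (\<Union>(x, r)\<in>B. X \<inter> ball x r)"
  proof
    fix y assume "y \<in> U lam"
    then obtain x r where xr: "(x, r) \<in> bad_balls lam" "y \<in> X \<inter> ball x r" by (auto simp: U_def)
    have "r \<le> l * r" using xr l by (auto simp: bad_balls_def mult_le_cancel_right1)
    then have "y \<in> X \<inter> ball x (l * r)" using xr by auto
    moreover have "(x, l * r) \<in> B" using xr by (force simp: B_def)
    ultimately show "y \<in> (\<Union>(x, r)\<in>B. X \<inter> ball x r)" by blast
  qed
  moreover have "(\<Union>(x, r)\<in>B. X \<inter> ball x r) \<in> sets M"
  proof -
    have "(\<Union>(x, r)\<in>B. X \<inter> ball x r) = X \<inter> (\<Union>(x, r)\<in>B. ball x r)" by auto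
    moreover have "open (\<Union>(x, r)\<in>B. ball x r)" by (intro open_UN) auto
    ultimately show ?thesis by (metis borel_X_Int borel_X_sets borel_open)
  qed
  ultimately show ?thesis using emeasure_mono order_trans by blast
qed

text \<open>Poincare for \<open>f n\<close> itself. The bound is of weak type and cannot be summed
  over dyadic levels, but it is uniform in \<open>lam\<close> and gives the a priori bound from
  which the absorption starts.\<close>

lemma U_weak_bound:
  assumes lam: "0 < lam"
  shows "ennreal (lam powr p) * emeasure M (U lam) \<le> ennreal (D ^ q * (2 * C / s) powr p) * (\<integral>\<^sup>+y. ennreal_powr (\<rho> y) p \<partial>M)"
proof -
  define a where "a = (s * lam / (2 * C)) powr p"
  have a: "0 < a" using lam s C by (simp add: a_def)
  have "emeasure M (U lam) \<le> ennreal (D ^ q) * ennreal (1 / a) * (\<integral>\<^sup>+y. ennreal_powr (\<rho> y) p \<partial>M)"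
  proof (rule U_covering)
    show "(\<lambda>y. ennreal_powr (\<rho> y) p) \<in> borel_measurable M"
      by measurable
    fix x r assume xr: "(x, r) \<in> bad_balls lam"
    have b: "ennreal a * emeasure M (X \<inter> ball x (l * r))
        \<le> (\<integral>\<^sup>+y. ennreal_powr (\<rho> y) p * indicator (X \<inter> ball x (l * r)) y \<partial>M)"
      unfolding a_def by (rule bad_ball_weak_bound[OF xr less_imp_le[OF lam]])
    have "emeasure M (X \<inter> ball x (l * r)) = ennreal (1 / a) * (ennreal a * emeasure M (X \<inter> ball x (l * r)))"
      using a by (simp add: mult.assoc[symmetric] ennreal_mult[symmetric])
    also have "\<dots> \<le> ennreal (1 / a) * (\<integral>\<^sup>+y. ennreal_powr (\<rho> y) p * indicator (X \<inter> ball x (l * r)) y \<partial>M)"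
      by (rule mult_left_mono[OF b]) simp
    finally show "emeasure M (X \<inter> ball x (l * r))
        \<le> ennreal (1 / a) * (\<integral>\<^sup>+y. ennreal_powr (\<rho> y) p * indicator (X \<inter> ball x (l * r)) y \<partial>M)" .
  qed
  then have "ennreal (lam powr p) * emeasure M (U lam)
      \<le> ennreal (lam powr p) * (ennreal (D ^ q) * ennreal (1 / a) * (\<integral>\<^sup>+y. ennreal_powr (\<rho> y) p \<partial>M))"
    by (rule mult_left_mono) simp
  also have "\<dots> = ennreal (lam powr p * (D ^ q * (1 / a))) * (\<integral>\<^sup>+y. ennreal_powr (\<rho> y) p \<partial>M)"
  proof -
    have "ennreal (D ^ q * (1 / a)) = ennreal (D ^ q) * ennreal (1 / a)"
      by (rule ennreal_mult) (use D1 a in auto)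
    moreover have "ennreal (lam powr p * (D ^ q * (1 / a))) = ennreal (lam powr p) * ennreal (D ^ q * (1 / a))"
      by (rule ennreal_mult) (use D1 a in auto)
    ultimately show ?thesis by (simp only: mult.assoc)
  qed
  also have "lam powr p * (D ^ q * (1 / a)) = D ^ q * (2 * C / s) powr p"
    using lam s C by (simp add: a_def powr_divide powr_mult field_simps)
  finally show ?thesis .
qed

section \<open>Averaged truncations and the recursive inequality\<close>

definition high :: "real \<Rightarrow> 'a set" where "high lam = {y\<in>X. ennreal (\<delta> * lam) < \<rho> y}"

lemma high_borel: "high lam \<in> sets borel_X"
proof -
  have [measurable]: "\<rho> \<in> borel_measurable borel_X" using \<rho> by (simp add: Lp_borel_def)
  have "{y\<in>space borel_X. ennreal (\<delta> * lam) < \<rho> y} \<in> sets borel_X" by measurable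
  then show ?thesis by (simp add: high_def space_restrict_space)
qed

text \<open>The average over j of what gluing gives for one truncation: \<open>\<rho>\<close>, hence
  at most \<open>\<delta> * lam\<close>, on the good set of level j outside \<open>high lam\<close>;
  the Lipschitz constant \<open>16 * 2 ^ j * lam\<close> on the bad set; and on
  \<open>high lam\<close> a common bound for these constants, as
  \<open>2 ^ j \<le> 4 ^ k\<close>.\<close>

definition trunc_grad :: "real \<Rightarrow> nat \<Rightarrow> 'a \<Rightarrow> real" where
  "trunc_grad lam k y = \<delta> * lam + 16 * lam / real k * (\<Sum>j=k..<2 * k. 2 ^ j * indicator (U (2 ^ j * lam)) y)
     + 16 * 4 ^ k * lam * indicator (high lam) y"

text \<open>The average over the truncation levels \<^term>\<open>{k..<2 * k}\<close> is what makes the gradient small: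
  each level contributes only a fraction \<^term>\<open>1 / real k\<close> of its Lipschitz constant.\<close>

lemma truncation:
  assumes x: "x \<in> X" and r: "0 < r" "4 * (l * r) \<le> R" and lam: "0 < lam" and k: "1 \<le> k"
  obtains h where "h \<in> borel_measurable M"
    "(\<integral>\<^sup>+y. ennreal \<bar>h y\<bar> * indicator (X \<inter> ball x (l * r)) y \<partial>M) < \<infinity>"
    "\<And>y. y \<in> X \<inter> ball x (l * r) \<Longrightarrow> y \<notin> U (2 ^ k * lam) \<Longrightarrow> y \<notin> N \<Longrightarrow> h y = f n y"
    "weak_upper_gradient (X \<inter> ball x (l * r)) \<mu> p h (\<lambda>y. ennreal (trunc_grad lam k y))"
    "Lp_borel (X \<inter> ball x (l * r)) \<mu> p (\<lambda>y. ennreal (trunc_grad lam k y))"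
proof -
  define Y where "Y = X \<inter> ball x (l * r)"
  have YX: "Y \<subseteq> X" and Ysets: "Y \<in> sets M" by (auto simp: Y_def)
  have lr: "0 < l * r" using l r by simp
  have xY: "x \<in> Y" using x lr by (simp add: Y_def)
  interpret Y: metric_measure Y \<mu> using ball_subspace[OF x] by unfold_locales (simp add: Y_def)
  let ?J = "{k..<2 * k}"
  define Lc where "Lc j = 16 * (2 ^ j * lam)" for j :: nat
  have Lc: "0 \<le> Lc j" for j using lam by (simp add: Lc_def)
  have dY: "2 * dist y z \<le> R" if "y \<in> Y" "z \<in> Y" for y z
    using that dist_triangle3[of y z x] r by (auto simp: Y_def)
  \<comment> \<open>The truncation at level j extends \<open>f n\<close> from the complement of
    \<open>U (2 ^ j * lam)\<close>; the restriction on \<open>r\<close> keeps all pairs in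
    \<open>Y\<close> within the range of \<open>lipschitz_off_U\<close>.\<close>
  have "\<exists>v. (\<forall>y z. \<bar>v y - v z\<bar> \<le> Lc j * dist y z) \<and> (\<forall>y\<in>Y - U (2 ^ j * lam) - N. v y = f n y)" for j
  proof (rule McShane_extension[OF Lc[of j], of "Y - U (2 ^ j * lam) - N" "f n"])
    fix y z assume "y \<in> Y - U (2 ^ j * lam) - N" "z \<in> Y - U (2 ^ j * lam) - N"
    then show "\<bar>f n y - f n z\<bar> \<le> Lc j * dist y z"
      using lipschitz_off_U[of y "2 ^ j * lam" z n] dY[of y z] YX lam by (auto simp: Lc_def)
  qed blast
  then obtain v where v: "\<And>j y z. \<bar>v j y - v j z\<bar> \<le> Lc j * dist y z"
    and vf: "\<And>j y. y \<in> Y - U (2 ^ j * lam) - N \<Longrightarrow> v j y = f n y" by metis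
  define h where "h y = (\<Sum>j\<in>?J. v j y) / real k" for y
  have cardJ: "card ?J = k" by simp
  define Lh where "Lh = (\<Sum>j\<in>?J. Lc j) / real k"
  have h_lip: "\<bar>h y - h z\<bar> \<le> Lh * dist y z" for y z
  proof -
    have "\<bar>(\<Sum>j\<in>?J. v j y) - (\<Sum>j\<in>?J. v j z)\<bar> \<le> (\<Sum>j\<in>?J. \<bar>v j y - v j z\<bar>)"
      unfolding sum_subtractf[symmetric] by (rule sum_abs)
    also have "\<dots> \<le> (\<Sum>j\<in>?J. Lc j * dist y z)" by (intro sum_mono v)
    finally have "\<bar>(\<Sum>j\<in>?J. v j y) - (\<Sum>j\<in>?J. v j z)\<bar> \<le> (\<Sum>j\<in>?J. Lc j) * dist y z"
      by (simp add: sum_distrib_right)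
    then have "\<bar>(\<Sum>j\<in>?J. v j y) - (\<Sum>j\<in>?J. v j z)\<bar> / real k \<le> (\<Sum>j\<in>?J. Lc j) * dist y z / real k"
      by (rule divide_right_mono) simp
    then show ?thesis unfolding h_def Lh_def by (simp add: diff_divide_distrib[symmetric])
  qed
  have Lh: "0 \<le> Lh" unfolding Lh_def using Lc by (intro divide_nonneg_nonneg sum_nonneg) auto
  have h_meas: "h \<in> borel_measurable M"
  proof -
    have "Lh-lipschitz_on UNIV h" using h_lip Lh by (intro lipschitz_onI) (auto simp: dist_real_def)
    then have "h \<in> borel_measurable borel" by (intro borel_measurable_continuous_onI lipschitz_on_continuous_on)
    then show ?thesis by (intro borel_X_measurable measurable_restrict_space1)
  qed
  have g0: "0 \<le> trunc_grad lam k y" for y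
    using lam less_imp_le[OF \<delta>] unfolding trunc_grad_def by (intro add_nonneg_nonneg mult_nonneg_nonneg sum_nonneg) auto
  define c where "c = \<delta> * lam + 16 * lam / real k * (\<Sum>j\<in>?J. 2 ^ j) + 16 * 4 ^ k * lam"
  have gc: "trunc_grad lam k y \<le> c" for y
    unfolding trunc_grad_def c_def using lam less_imp_le[OF \<delta>]
    by (intro add_mono mult_left_mono sum_mono) (auto simp: indicator_def)
  have g_borel: "(\<lambda>y. ennreal (trunc_grad lam k y)) \<in> borel_measurable borel_X"
    unfolding trunc_grad_def using U_borel high_borel by measurable
  have wY: "weak_upper_gradient Y \<mu> p (f n) \<rho>" and \<rho>Y: "Lp_borel Y \<mu> p \<rho>"
    by (rule weak_upper_gradient_subspace[OF Ysets f_wug], rule Lp_borel_subspace[OF Ysets \<rho>])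
  have NY: "N \<inter> Y \<in> null_sets Y.M"
  proof (rule Y.outer_null_sets)
    have "N \<inter> Y \<in> null_sets M" by (rule null_sets_subset[OF N]) auto
    then show "\<mu> (N \<inter> Y) = 0" using emeasure_M[of "N \<inter> Y"] by (simp add: null_setsD1 null_setsD2)
  qed auto
  have p0: "0 < p" using p by simp
  \<comment> \<open>One \<open>\<sigma>\<close> serves all levels, so the exceptional paths are
    fixed before the truncations are averaged.\<close>
  obtain \<sigma> where \<sigma>: "Lp_borel Y \<mu> p \<sigma>"
    and glue: "\<And>\<gamma> a b v L A. (\<gamma>, a, b) \<in> paths_in Y \<Longrightarrow> line_integral \<sigma> (\<gamma>, a, b) < \<infinity> \<Longrightarrow> 0 \<le> L \<Longrightarrow>
      (\<And>x y. x \<in> Y \<Longrightarrow> y \<in> Y \<Longrightarrow> norm (v x - v y) \<le> L * dist x y) \<Longrightarrow> A \<in> sets (restrict_space borel Y) \<Longrightarrow>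
      (\<And>x. x \<in> A - (N \<inter> Y) \<Longrightarrow> f n x = v x) \<Longrightarrow>
      ennreal (norm (v (\<gamma> a) - v (\<gamma> b))) \<le>
        line_integral (\<lambda>x. \<rho> x * indicator A x + ennreal L * indicator (Y - A) x) (\<gamma>, a, b)"
  proof (rule Y.gluing[OF wY \<rho>Y NY p0], goal_cases)
    case (1 \<sigma>)
    show ?case by (rule that[OF 1(2,3)])
  qed
  define G where "G j y = ennreal (\<delta> * lam + 16 * lam * (2 ^ j * indicator (U (2 ^ j * lam)) y)
    + 16 * 4 ^ k * lam * indicator (high lam) y)" for j y
  have G_borel: "G j \<in> borel_measurable borel_X" for j
    unfolding G_def using U_borel[of "2 ^ j * lam"] high_borel by measurable
  have "weak_upper_gradient Y \<mu> p h (\<lambda>y. ennreal (trunc_grad lam k y))"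
  proof (rule Y.weak_upper_gradientI[OF _ \<sigma>])
    show "(\<lambda>y. ennreal (trunc_grad lam k y)) \<in> borel_measurable (restrict_space borel Y)"
      by (rule measurable_restrict_mono[OF g_borel YX])
    fix \<gamma> a b assume path: "(\<gamma>, a, b) \<in> paths_in Y" and fin: "line_integral \<sigma> (\<gamma>, a, b) < \<infinity>"
    have sub: "\<gamma> ` {a..b} \<subseteq> Y" and rect: "rectifiable_path \<gamma> a b"
      by (rule line_integral_finite_rectifiable[OF path fin])+
    interpret \<gamma>: rectifiable_path \<gamma> a b by fact
    have vj: "ennreal \<bar>v j (\<gamma> a) - v j (\<gamma> b)\<bar> \<le> line_integral (G j) (\<gamma>, a, b)" if j: "j \<in> ?J" for j
    proof -
      \<comment> \<open>Removing \<open>high lam\<close> from the set of agreement ensures that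
        \<open>\<rho>\<close> is at most \<open>\<delta> * lam\<close> on it.\<close>
      let ?A = "Y - U (2 ^ j * lam) - high lam"
      have "?A = Y \<inter> (X - U (2 ^ j * lam) - high lam)" using YX by auto
      moreover have "X - U (2 ^ j * lam) - high lam \<in> sets borel_X"
        using U_borel high_borel sets.top[of borel_X] by (auto simp: space_restrict_space)
      ultimately have A: "?A \<in> sets (restrict_space borel Y)" using borel_subspace YX by metis
      have "ennreal (norm (v j (\<gamma> a) - v j (\<gamma> b))) \<le>
          line_integral (\<lambda>x. \<rho> x * indicator ?A x + ennreal (Lc j) * indicator (Y - ?A) x) (\<gamma>, a, b)"
        by (rule glue[OF path fin Lc _ A]) (use v vf in auto)
      also have "\<dots> \<le> line_integral (G j) (\<gamma>, a, b)"
      proof (rule \<gamma>.line_integral_mono)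
        fix y assume "y \<in> \<gamma> ` {a..b}"
        then have y: "y \<in> Y" using sub by auto
        have pos: "0 < \<delta> * lam" using \<delta> lam by simp
        have "2 ^ j \<le> (4::real) ^ k"
        proof -
          have "(2::real) ^ j \<le> 2 ^ (2 * k)" using j by (intro power_increasing) auto
          then show ?thesis by (simp add: power_mult)
        qed
        then have Lc4: "Lc j \<le> 16 * 4 ^ k * lam" using lam by (simp add: Lc_def)
        consider "y \<in> high lam" | "y \<notin> high lam" "y \<in> U (2 ^ j * lam)" | "y \<notin> high lam" "y \<notin> U (2 ^ j * lam)" by blast
        then show "\<rho> y * indicator ?A y + ennreal (Lc j) * indicator (Y - ?A) y \<le> G j y"
        proof cases
          case 1
          then show ?thesis using y Lc4 pos lam
            by (auto simp: G_def indicator_def intro!: ennreal_leI add_increasing)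
        next
          case 2
          have "Lc j \<le> \<delta> * lam + 16 * lam * 2 ^ j" using pos by (simp add: Lc_def)
          then have "ennreal (Lc j) \<le> ennreal (\<delta> * lam + 16 * lam * 2 ^ j)" by (rule ennreal_leI)
          then show ?thesis using 2 y by (simp add: G_def)
        next
          case 3
          then show ?thesis using y YX by (auto simp: G_def indicator_def high_def)
        qed
      qed
      finally show ?thesis by simp
    qed
    have Gsum: "ennreal (trunc_grad lam k y) = ennreal (1 / real k) * (\<Sum>j\<in>?J. G j y)" for y
    proof -
      let ?t = "\<lambda>j. \<delta> * lam + 16 * lam * (2 ^ j * indicator (U (2 ^ j * lam)) y) + 16 * 4 ^ k * lam * indicator (high lam) y"
      have "0 \<le> ?t j" for j using lam less_imp_le[OF \<delta>] by (intro add_nonneg_nonneg mult_nonneg_nonneg) auto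
      then have "(\<Sum>j\<in>?J. G j y) = ennreal (\<Sum>j\<in>?J. ?t j)" unfolding G_def by (rule sum_ennreal)
      moreover have "(\<Sum>j\<in>?J. ?t j) = real k * trunc_grad lam k y"
      proof -
        define S where "S = (\<Sum>j\<in>?J. 2 ^ j * indicator (U (2 ^ j * lam)) y :: real)"
        define H where "H = 16 * 4 ^ k * lam * (indicator (high lam) y :: real)"
        have "(\<Sum>j\<in>?J. ?t j) = real k * (\<delta> * lam) + 16 * lam * S + real k * H"
          unfolding sum.distrib sum_distrib_left[symmetric] sum_constant cardJ S_def H_def by simp
        moreover have "trunc_grad lam k y = \<delta> * lam + 16 * lam / real k * S + H"
          by (simp add: trunc_grad_def S_def H_def)
        ultimately show ?thesis using k by (simp add: field_simps)
      qed
      ultimately show ?thesis using k g0 by (simp add: ennreal_mult[symmetric])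
    qed
    have "\<bar>h (\<gamma> a) - h (\<gamma> b)\<bar> \<le> 1 / real k * (\<Sum>j\<in>?J. \<bar>v j (\<gamma> a) - v j (\<gamma> b)\<bar>)"
    proof -
      have "\<bar>(\<Sum>j\<in>?J. v j (\<gamma> a)) - (\<Sum>j\<in>?J. v j (\<gamma> b))\<bar> \<le> (\<Sum>j\<in>?J. \<bar>v j (\<gamma> a) - v j (\<gamma> b)\<bar>)"
        unfolding sum_subtractf[symmetric] by (rule sum_abs)
      then show ?thesis unfolding h_def
        by (simp add: diff_divide_distrib[symmetric] divide_right_mono)
    qed
    then have "ennreal \<bar>h (\<gamma> a) - h (\<gamma> b)\<bar> \<le> ennreal (1 / real k * (\<Sum>j\<in>?J. \<bar>v j (\<gamma> a) - v j (\<gamma> b)\<bar>))"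
      by (rule ennreal_leI)
    also have "\<dots> = ennreal (1 / real k) * (\<Sum>j\<in>?J. ennreal \<bar>v j (\<gamma> a) - v j (\<gamma> b)\<bar>)"
      by (subst ennreal_mult) (auto intro: sum_nonneg)
    also have "\<dots> \<le> ennreal (1 / real k) * (\<Sum>j\<in>?J. line_integral (G j) (\<gamma>, a, b))"
      by (intro mult_left_mono sum_mono vj) auto
    also have "(\<Sum>j\<in>?J. line_integral (G j) (\<gamma>, a, b)) = line_integral (\<lambda>y. \<Sum>j\<in>?J. G j y) (\<gamma>, a, b)"
      using sub YX by (intro \<gamma>.line_integral_sum[symmetric, of X] G_borel) auto
    also have "ennreal (1 / real k) * \<dots> = line_integral (\<lambda>y. ennreal (1 / real k) * (\<Sum>j\<in>?J. G j y)) (\<gamma>, a, b)"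
      using sub YX G_borel by (intro \<gamma>.line_integral_cmult[symmetric, of X] borel_measurable_sum) auto
    also have "\<dots> = line_integral (\<lambda>y. ennreal (trunc_grad lam k y)) (\<gamma>, a, b)" unfolding Gsum ..
    finally show "ennreal (norm (h (\<gamma> a) - h (\<gamma> b))) \<le> line_integral (\<lambda>y. ennreal (trunc_grad lam k y)) (\<gamma>, a, b)"
      by simp
  qed
  moreover have "Lp_borel Y \<mu> p (\<lambda>y. ennreal (trunc_grad lam k y))"
    unfolding Lp_borel_def Lp_norm_less_top_iff
  proof
    show "(\<lambda>y. ennreal (trunc_grad lam k y)) \<in> borel_measurable (restrict_space borel Y)"
      by (rule measurable_restrict_mono[OF g_borel YX])
    have "(\<integral>\<^sup>+y. ennreal_powr (ennreal (trunc_grad lam k y)) p \<partial>outer_measure_measure Y \<mu>)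
        \<le> (\<integral>\<^sup>+y. ennreal (c powr p) * indicator Y y \<partial>M)"
      unfolding nn_integral_outer_measure_restrict[OF Ysets] using gc g0 p
      by (intro nn_integral_mono mult_right_mono) (auto simp: ennreal_powr_ennreal intro!: ennreal_leI powr_mono2)
    also have "\<dots> = ennreal (c powr p) * emeasure M Y" using Ysets by (rule nn_integral_cmult_indicator)
    also have "\<dots> < \<infinity>" using emeasure_ball_finite[OF x, of "l * r"] by (simp add: Y_def ennreal_mult_less_top)
    finally show "(\<integral>\<^sup>+y. ennreal_powr (ennreal (trunc_grad lam k y)) p \<partial>outer_measure_measure Y \<mu>) < \<infinity>" .
  qed
  moreover have "(\<integral>\<^sup>+y. ennreal \<bar>h y\<bar> * indicator Y y \<partial>M) < \<infinity>"
  proof -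
    have "(\<integral>\<^sup>+y. ennreal \<bar>h y\<bar> * indicator Y y \<partial>M) \<le> (\<integral>\<^sup>+y. ennreal (\<bar>h x\<bar> + Lh * R) * indicator Y y \<partial>M)"
    proof (intro nn_integral_mono)
      fix y
      show "ennreal \<bar>h y\<bar> * indicator Y y \<le> ennreal (\<bar>h x\<bar> + Lh * R) * indicator Y y"
      proof (cases "y \<in> Y")
        case True
        have "Lh * dist y x \<le> Lh * R" using dY[OF True xY] Lh R by (intro mult_left_mono) (auto intro: order_trans[of _ "2 * dist y x"])
        then have "\<bar>h y\<bar> \<le> \<bar>h x\<bar> + Lh * R" using h_lip[of y x] by linarith
        then show ?thesis using True by (simp add: ennreal_leI)
      qed simp
    qed
    also have "\<dots> = ennreal (\<bar>h x\<bar> + Lh * R) * emeasure M Y" using Ysets by (rule nn_integral_cmult_indicator)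
    also have "\<dots> < \<infinity>" using emeasure_ball_finite[OF x, of "l * r"] by (simp add: Y_def ennreal_mult_less_top)
    finally show ?thesis .
  qed
  \<comment> \<open>Bad sets decrease with the level, so off the largest of them all truncations
    equal \<open>f n\<close>.\<close>
  moreover have "h y = f n y" if y: "y \<in> Y" "y \<notin> U (2 ^ k * lam)" "y \<notin> N" for y
  proof -
    have "v j y = f n y" if j: "j \<in> ?J" for j
    proof (rule vf)
      have "(2::real) ^ k \<le> 2 ^ j" using j by (intro power_increasing) auto
      then have "U (2 ^ j * lam) \<subseteq> U (2 ^ k * lam)" using lam by (intro U_antimono) simp
      then show "y \<in> Y - U (2 ^ j * lam) - N" using y by blast
    qed
    then show ?thesis using k by (simp add: h_def)
  qed
  ultimately show thesis using that[OF h_meas] unfolding Y_def by blast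
qed

end

context poincare_space begin

text \<open>A common constant for the alternatives distinguished in
  \<open>bad_ball_bound\<close>.\<close>

definition C1 :: real where "C1 = D ^ q * (2 / s) + 2 * (384 * C / s) powr p"
definition K2 :: real where "K2 = D ^ q * C1"
text \<open>Chosen so that \<open>real kk powr (p - 1) \<ge> 8 * K2\<close>, which brings the total
  weight of the later terms in the recursion down to 1/2. The exponent \<open>1 / (p - 1)\<close> is
  where \<open>p > 1\<close> enters.\<close>

definition kk :: nat where "kk = nat \<lceil>(8 * K2) powr (1 / (p - 1))\<rceil> + 1"
text \<open>Balls too large for truncation have radius above \<open>R / (4 * l)\<close>, so an
  oscillation of \<open>lam * r\<close> on them exceeds \<open>ce * lam\<close>.\<close>

definition ce :: real where "ce = R / (4 * l)"
text \<open>Read off from \<open>absorb_shifted_sums\<close>: the first summand comes from the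
  superlevel sets of \<open>\<rho>\<close> and \<open>e\<close>, the second is
  \<open>2 * real kk\<close> times the weak-type constant.\<close>

definition Kfin :: real where
  "Kfin = 2 * K2 * ((4 ^ kk) powr p * (2 / \<delta> powr p) + 2 / ce powr p) + 2 * real kk * (D ^ q * (2 * C / s) powr p)"

lemma C1: "0 < C1" "D ^ q * (2 / s) \<le> C1" "2 * (384 * C / s) powr p \<le> C1"
  using D1 s C by (auto simp: C1_def intro!: add_pos_pos)

lemma K2: "0 < K2" using C1 D1 by (simp add: K2_def)

lemma ce: "0 < ce" using R l by (simp add: ce_def)

lemma kk: "1 \<le> kk" "2 * K2 * (1 / real kk) powr p * real (2 * kk) \<le> 1 / 2"
proof -
  show k1: "1 \<le> kk" by (simp add: kk_def)
  have "(8 * K2) powr (1 / (p - 1)) \<le> real kk" unfolding kk_def by linarith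
  then have "((8 * K2) powr (1 / (p - 1))) powr (p - 1) \<le> real kk powr (p - 1)"
    using p by (intro powr_mono2) auto
  then have "8 * K2 \<le> real kk powr (p - 1)" using p K2 by (simp add: powr_powr)
  moreover have "real kk powr (p - 1) = real kk powr p / real kk" using k1 by (simp add: powr_diff)
  ultimately have "8 * K2 * real kk \<le> real kk powr p" using k1 by (simp add: field_simps)
  then show "2 * K2 * (1 / real kk) powr p * real (2 * kk) \<le> 1 / 2"
    using k1 by (simp add: powr_divide field_simps)
qed

end

lemma powr_add3_le:
  fixes a b c :: real
  assumes "0 \<le> a" "0 \<le> b" "0 \<le> c" "0 \<le> p"
  shows "(a + b + c) powr p \<le> 3 powr p * (a powr p + b powr p + c powr p)"
proof -
  define m where "m = max a (max b c)"
  have "(a + b + c) powr p \<le> (3 * m) powr p"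
    using assms by (intro powr_mono2) (auto simp: m_def)
  also have "\<dots> = 3 powr p * m powr p" using assms by (simp add: powr_mult m_def)
  also have "m powr p \<le> a powr p + b powr p + c powr p"
    unfolding m_def by (auto simp: max_def add_increasing add_increasing2)
  finally show ?thesis by (simp add: mult_left_mono)
qed

lemma ennreal_half_le:
  assumes "0 \<le> s" "0 \<le> b" "ennreal s * ennreal b \<le> ennreal (s / 2) * ennreal b + z"
  shows "ennreal (s / 2) * ennreal b \<le> z"
proof (cases z)
  case (real z')
  have "ennreal (s * b) \<le> ennreal (s / 2 * b + z')"
  proof -
    have e1: "ennreal (s * b) = ennreal s * ennreal b" "ennreal (s / 2 * b) = ennreal (s / 2) * ennreal b"
      by (rule ennreal_mult; use assms in simp)+
    have "ennreal (s / 2 * b + z') = ennreal (s / 2 * b) + ennreal z'"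
      by (rule ennreal_plus) (use assms real in auto)
    then show ?thesis using assms(3) unfolding e1 real(2) by simp
  qed
  then have "s * b \<le> s / 2 * b + z'" using assms real by (subst (asm) ennreal_le_iff) auto
  then have "s / 2 * b \<le> z'" by simp
  then show ?thesis using assms real by (simp add: ennreal_mult[symmetric] ennreal_leI)
qed simp

context poincare_family begin

definition ehigh :: "real \<Rightarrow> 'a set" where "ehigh lam = {y\<in>X. ennreal (ce * lam) < ennreal (e y)}"

lemma ehigh_sets [measurable]: "ehigh lam \<in> sets M"
proof -
  have "{y\<in>space M. ennreal (ce * lam) < ennreal (e y)} \<in> sets M" by measurable
  then show ?thesis by (simp add: ehigh_def)
qed

lemma high_sets [measurable]: "high lam \<in> sets M"
  by (rule borel_X_sets[OF high_borel])

text \<open>One density for all alternatives on a bad ball: \<open>U (2 ^ k * lam)\<close> or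
  \<open>ehigh lam\<close> takes a fixed proportion of it, or the truncated gradient has large
  energy, whose variable part the two middle terms dominate.\<close>

definition wt :: "real \<Rightarrow> nat \<Rightarrow> 'a \<Rightarrow> ennreal" where
  "wt lam k y = indicator (U (2 ^ k * lam)) y + ennreal ((4 ^ k) powr p) * indicator (high lam) y
     + ennreal ((1 / real k) powr p) * (\<Sum>j=k..<2 * k. ennreal ((2 ^ j) powr p) * indicator (U (2 ^ j * lam)) y)
     + indicator (ehigh lam) y"

lemma wt_measurable [measurable]: "wt lam k \<in> borel_measurable M"
  unfolding wt_def by measurable

lemma wt_ge: "indicator (U (2 ^ k * lam)) y \<le> wt lam k y" "indicator (ehigh lam) y \<le> wt lam k y"
  unfolding wt_def by (simp_all add: add_increasing2 add_increasing add.assoc)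

text \<open>The factor \<open>(1 / real k) powr p\<close> survives the power because a sum of
  distinct powers of 2 is comparable to its largest term. Constants: 32 = 16 * 2 with the 2 from
  that comparison, and 96 = 3 * 32 with the 3 from the three summands.\<close>

lemma trunc_grad_powr:
  assumes lam: "0 < lam" and k: "1 \<le> k"
  shows "ennreal (trunc_grad lam k y powr p) \<le> ennreal ((3 * \<delta> * lam) powr p) + ennreal ((96 * lam) powr p) * wt lam k y"
proof -
  define J where "J = {j\<in>{k..<2 * k}. y \<in> U (2 ^ j * lam)}"
  define S where "S = (\<Sum>j\<in>J. ((2::real) ^ j) powr p)"
  define h where "h = (indicator (high lam) y :: real)"
  have J: "(\<Sum>j=k..<2 * k. 2 ^ j * indicator (U (2 ^ j * lam)) y) = (\<Sum>j\<in>J. (2::real) ^ j)"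
    unfolding J_def by (rule sum.mono_neutral_cong_right) auto
  have J': "(\<Sum>j=k..<2 * k. ennreal ((2 ^ j) powr p) * indicator (U (2 ^ j * lam)) y) = ennreal S"
  proof -
    have "(\<Sum>j=k..<2 * k. ennreal ((2 ^ j) powr p) * indicator (U (2 ^ j * lam)) y) = (\<Sum>j\<in>J. ennreal ((2 ^ j) powr p))"
      unfolding J_def by (rule sum.mono_neutral_cong_right) auto
    then show ?thesis by (simp add: S_def)
  qed
  have S0: "0 \<le> S" unfolding S_def by (intro sum_nonneg) auto
  have h0: "0 \<le> h" "h = 0 \<or> h = 1" by (auto simp: h_def indicator_def)
  have p0: "0 \<le> p" using p by simp
  have "trunc_grad lam k y powr p = (\<delta> * lam + 16 * lam / real k * (\<Sum>j\<in>J. 2 ^ j) + 16 * 4 ^ k * lam * h) powr p"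
    unfolding trunc_grad_def J h_def ..
  also have "\<dots> \<le> 3 powr p * ((\<delta> * lam) powr p + (16 * lam / real k * (\<Sum>j\<in>J. 2 ^ j)) powr p + (16 * 4 ^ k * lam * h) powr p)"
    using lam less_imp_le[OF \<delta>] h0 p0 by (intro powr_add3_le mult_nonneg_nonneg sum_nonneg) auto
  also have "(16 * lam / real k * (\<Sum>j\<in>J. 2 ^ j)) powr p \<le> (32 * lam) powr p * ((1 / real k) powr p * S)"
  proof -
    have "(16 * lam / real k * (\<Sum>j\<in>J. 2 ^ j)) powr p = (16 * lam / real k) powr p * (\<Sum>j\<in>J. 2 ^ j) powr p"
      using lam by (intro powr_mult)
    also have "\<dots> \<le> (16 * lam / real k) powr p * (2 powr p * S)"
      unfolding S_def using p by (intro mult_left_mono sum_power2_powr_le) (auto simp: J_def)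
    also have "\<dots> = (32 * lam) powr p * ((1 / real k) powr p * S)"
    proof -
      have "16 * lam / real k * 2 = 32 * lam * (1 / real k)" by simp
      then have "(16 * lam / real k) powr p * 2 powr p = (32 * lam) powr p * (1 / real k) powr p"
        by (metis powr_mult)
      then show ?thesis by (simp add: mult.assoc[symmetric])
    qed
    finally show ?thesis .
  qed
  also have "(16 * 4 ^ k * lam * h) powr p \<le> (32 * lam) powr p * ((4 ^ k) powr p * h)"
  proof -
    have "(16 * 4 ^ k * lam) powr p = (16 * lam) powr p * (4 ^ k) powr p"
      by (simp add: powr_mult mult.commute mult.left_commute)
    also have "\<dots> \<le> (32 * lam) powr p * (4 ^ k) powr p"
      using lam p by (intro mult_right_mono powr_mono2) auto
    finally show ?thesis using h0(2) by auto
  qed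
  finally have "trunc_grad lam k y powr p \<le> 3 powr p * ((\<delta> * lam) powr p + (32 * lam) powr p * ((1 / real k) powr p * S)
      + (32 * lam) powr p * ((4 ^ k) powr p * h))" by (simp add: mult_left_mono)
  also have "\<dots> = (3 * (\<delta> * lam)) powr p + (3 * (32 * lam)) powr p * ((4 ^ k) powr p * h + (1 / real k) powr p * S)"
    unfolding powr_mult[of 3] by (simp only: distrib_left mult.assoc add.assoc add.commute[of "3 powr p * ((32 * lam) powr p * ((1 / real k) powr p * S))"])
  also have "\<dots> = (3 * \<delta> * lam) powr p + (96 * lam) powr p * ((4 ^ k) powr p * h + (1 / real k) powr p * S)"
    by (simp add: mult.assoc)
  finally have "ennreal (trunc_grad lam k y powr p)
      \<le> ennreal ((3 * \<delta> * lam) powr p + (96 * lam) powr p * ((4 ^ k) powr p * h + (1 / real k) powr p * S))"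
    by (rule ennreal_leI)
  also have "\<dots> = ennreal ((3 * \<delta> * lam) powr p) + ennreal ((96 * lam) powr p) * ennreal ((4 ^ k) powr p * h + (1 / real k) powr p * S)"
    using h0 S0 by (subst ennreal_plus) (auto intro!: mult_nonneg_nonneg add_nonneg_nonneg simp: ennreal_mult)
  also have "ennreal ((4 ^ k) powr p * h + (1 / real k) powr p * S)
      = ennreal ((4 ^ k) powr p) * ennreal h + ennreal ((1 / real k) powr p) * ennreal S"
    using h0 S0 by (subst ennreal_plus) (auto simp: ennreal_mult)
  also have "ennreal h = indicator (high lam) y" by (simp add: h_def indicator_def)
  also have "ennreal ((4 ^ k) powr p) * indicator (high lam) y + ennreal ((1 / real k) powr p) * ennreal S \<le> wt lam k y"
    unfolding wt_def J' by (simp add: add_increasing add_increasing2 add.assoc)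
  finally show ?thesis by (simp add: mult_left_mono)
qed

lemma bad_ball_bound_set:
  assumes x: "x \<in> X" and r: "0 < r" "r \<le> R" and S: "S \<in> sets M" "\<And>y. indicator S y \<le> wt lam k y"
    and le: "ennreal (s / 2) * emeasure M (X \<inter> ball x r) \<le> emeasure M (S \<inter> (X \<inter> ball x r))"
  shows "emeasure M (X \<inter> ball x (l * r)) \<le> ennreal C1 * (\<integral>\<^sup>+y. wt lam k y * indicator (X \<inter> ball x (l * r)) y \<partial>M)"
proof -
  have "5 * (l * r) \<le> 2 ^ q * r" using q(1) r by (simp add: mult.assoc[symmetric])
  moreover have "0 < l * r" using l r by simp
  ultimately have lr: "l * r \<le> 2 ^ q * r" by simp
  have lr': "r \<le> l * r" using l r by (simp add: mult_le_cancel_right1)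
  have "2 ^ q * r \<le> 2 * R0" using r by (intro order_trans[OF _ q(2)] mult_left_mono) auto
  then have "emeasure M (X \<inter> ball x (l * r)) \<le> ennreal (D ^ q) * emeasure M (X \<inter> ball x r)"
    by (rule doubling_le[OF x r(1) _ lr])
  also have "emeasure M (X \<inter> ball x r) = ennreal (2 / s) * (ennreal (s / 2) * emeasure M (X \<inter> ball x r))"
    using s by (simp add: mult.assoc[symmetric] ennreal_mult[symmetric])
  also have "\<dots> \<le> ennreal (2 / s) * emeasure M (S \<inter> (X \<inter> ball x r))" by (rule mult_left_mono[OF le]) simp
  also have "emeasure M (S \<inter> (X \<inter> ball x r)) = (\<integral>\<^sup>+y. indicator S y * indicator (X \<inter> ball x r) y \<partial>M)"
  proof -
    have "S \<inter> (X \<inter> ball x r) \<in> sets M" using S by auto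
    then have "emeasure M (S \<inter> (X \<inter> ball x r)) = (\<integral>\<^sup>+y. indicator (S \<inter> (X \<inter> ball x r)) y \<partial>M)"
      by (rule nn_integral_indicator[symmetric])
    then show ?thesis by (simp only: indicator_inter_arith)
  qed
  also have "\<dots> \<le> (\<integral>\<^sup>+y. wt lam k y * indicator (X \<inter> ball x (l * r)) y \<partial>M)"
    using S(2) lr' by (intro nn_integral_mono mult_mono) (auto simp: indicator_def)
  finally have "emeasure M (X \<inter> ball x (l * r))
      \<le> ennreal (D ^ q) * (ennreal (2 / s) * (\<integral>\<^sup>+y. wt lam k y * indicator (X \<inter> ball x (l * r)) y \<partial>M))"
    by (simp add: mult_left_mono)
  also have "\<dots> = ennreal (D ^ q * (2 / s)) * (\<integral>\<^sup>+y. wt lam k y * indicator (X \<inter> ball x (l * r)) y \<partial>M)"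
  proof -
    have "ennreal (D ^ q * (2 / s)) = ennreal (D ^ q) * ennreal (2 / s)"
      by (rule ennreal_mult) (use D1 s in auto)
    then show ?thesis by (simp only: mult.assoc)
  qed
  also have "\<dots> \<le> ennreal C1 * (\<integral>\<^sup>+y. wt lam k y * indicator (X \<inter> ball x (l * r)) y \<partial>M)"
    using C1(2) by (intro mult_right_mono ennreal_leI) auto
  finally show ?thesis .
qed

text \<open>On a large ball the deviation of \<open>f n\<close> from \<open>cc n\<close> makes
  \<open>e\<close> large on a fixed proportion. On a small ball either
  \<open>U (2 ^ k * lam)\<close> takes the proportion \<open>s / 2\<close>, or the averaged
  truncation \<open>h\<close>, equal to \<open>f n\<close> on the rest, still oscillates with
  proportion \<open>s / 2\<close>; then Poincare for \<open>h\<close> gives the bound after the term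
  with \<open>\<delta>\<close> is absorbed.\<close>

lemma bad_ball_bound:
  assumes xr: "(x, r) \<in> bad_balls lam" and lam: "0 < lam" and k: "1 \<le> k"
  shows "emeasure M (X \<inter> ball x (l * r)) \<le> ennreal C1 * (\<integral>\<^sup>+y. wt lam k y * indicator (X \<inter> ball x (l * r)) y \<partial>M)"
proof -
  obtain n where n: "x \<in> X" "0 < r" "r \<le> R" "bad n lam x r" using xr by (auto simp: bad_balls_def)
  let ?B = "X \<inter> ball x r" and ?lB = "X \<inter> ball x (l * r)"
  let ?W = "\<integral>\<^sup>+y. wt lam k y * indicator ?lB y \<partial>M"
  have half: "ennreal (s / 2) * emeasure M ?B \<le> ennreal s * emeasure M ?B"
    using s by (intro mult_right_mono ennreal_leI) auto
  show ?thesis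
  proof (cases "4 * (l * r) \<le> R")
    case False
    show ?thesis
    proof (rule bad_ball_bound_set[OF n(1-3) ehigh_sets wt_ge(2)])
      have "ennreal s * emeasure M ?B \<le> emeasure M {y \<in> ?B. lam * r < \<bar>f n y - cc n\<bar>}"
        using n(4) by (auto simp: bad_def)
      also have "\<dots> \<le> emeasure M (ehigh lam \<inter> ?B)"
      proof (intro emeasure_mono subsetI)
        fix y assume y: "y \<in> {y \<in> ?B. lam * r < \<bar>f n y - cc n\<bar>}"
        have "ce < r" using False l by (simp add: ce_def field_simps)
        then have "ce * lam < lam * r" using lam by simp
        also have "lam * r < e y" using y fe[of y n] by auto
        finally have "ennreal (ce * lam) < ennreal (e y)" using ce lam by (simp add: ennreal_less_iff)
        then show "y \<in> ehigh lam \<inter> ?B" using y by (auto simp: ehigh_def)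
      qed auto
      finally show "ennreal (s / 2) * emeasure M ?B \<le> emeasure M (ehigh lam \<inter> ?B)" using half by (rule order_trans[rotated])
    qed
  next
    case True
    show ?thesis
    proof (cases "ennreal (s / 2) * emeasure M ?B \<le> emeasure M (U (2 ^ k * lam) \<inter> ?B)")
      case True
      then show ?thesis by (rule bad_ball_bound_set[OF n(1-3) U_sets wt_ge(1)])
    next
      case False
      obtain h where h: "h \<in> borel_measurable M" "(\<integral>\<^sup>+y. ennreal \<bar>h y\<bar> * indicator ?lB y \<partial>M) < \<infinity>"
        "\<And>y. y \<in> ?lB \<Longrightarrow> y \<notin> U (2 ^ k * lam) \<Longrightarrow> y \<notin> N \<Longrightarrow> h y = f n y"
        "weak_upper_gradient ?lB \<mu> p h (\<lambda>y. ennreal (trunc_grad lam k y))"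
        "Lp_borel ?lB \<mu> p (\<lambda>y. ennreal (trunc_grad lam k y))"
        using truncation[OF n(1,2) \<open>4 * (l * r) \<le> R\<close> lam k, of n] by blast
      note [measurable] = h(1)
      have "r \<le> l * r" using l n(2) by (simp add: mult_le_cancel_right1)
      then have sub: "?B \<subseteq> ?lB" by auto
      have "ennreal (s / 2) * emeasure M ?B \<le> emeasure M {y \<in> ?B. lam * r < \<bar>h y - c\<bar>}" for c
      proof -
        have hs: "{y \<in> ?B. lam * r < \<bar>h y - c\<bar>} \<in> sets M"
        proof -
          have "{y \<in> ?B. lam * r < \<bar>h y - c\<bar>} = ?B \<inter> {y\<in>space M. lam * r < \<bar>h y - c\<bar>}" by auto
          also have "\<dots> \<in> sets M" by measurable
          finally show ?thesis .
        qed
        have "ennreal s * emeasure M ?B \<le> emeasure M {y \<in> ?B. lam * r < \<bar>f n y - c\<bar>}"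
          using n(4) by (auto simp: bad_def)
        also have "\<dots> \<le> emeasure M ((U (2 ^ k * lam) \<inter> ?B) \<union> {y \<in> ?B. lam * r < \<bar>h y - c\<bar>} \<union> N)"
        proof (intro emeasure_mono subsetI)
          fix y assume y: "y \<in> {y \<in> ?B. lam * r < \<bar>f n y - c\<bar>}"
          show "y \<in> (U (2 ^ k * lam) \<inter> ?B) \<union> {y \<in> ?B. lam * r < \<bar>h y - c\<bar>} \<union> N"
          proof (cases "y \<in> U (2 ^ k * lam) \<or> y \<in> N")
            case False
            then have "h y = f n y" using y sub by (intro h(3)) auto
            then show ?thesis using y by auto
          qed (use y in auto)
        qed (use hs N in auto)
        also have "\<dots> = emeasure M ((U (2 ^ k * lam) \<inter> ?B) \<union> {y \<in> ?B. lam * r < \<bar>h y - c\<bar>})"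
          using hs N by (intro emeasure_Un_null_set) auto
        also have "\<dots> \<le> emeasure M (U (2 ^ k * lam) \<inter> ?B) + emeasure M {y \<in> ?B. lam * r < \<bar>h y - c\<bar>}"
          using hs by (intro emeasure_subadditive) auto
        finally have "ennreal s * emeasure M ?B
            \<le> ennreal (s / 2) * emeasure M ?B + emeasure M {y \<in> ?B. lam * r < \<bar>h y - c\<bar>}"
          using False by (meson add_right_mono linear order_trans)
        moreover obtain b where b: "emeasure M ?B = ennreal b" "0 \<le> b"
          using emeasure_ball_finite[OF n(1), of r] by (cases "emeasure M ?B") auto
        ultimately show ?thesis
          unfolding b(1) by (intro ennreal_half_le) (use s b(2) in auto)
      qed
      from poincare_osc[OF PI[OF n(1-3)] n(1,2) l p C h(1,2,4,5) _ _ this]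
      have "ennreal ((s / 2 * lam / (2 * C)) powr p) * emeasure M ?lB
          \<le> (\<integral>\<^sup>+y. ennreal_powr (ennreal (trunc_grad lam k y)) p * indicator ?lB y \<partial>M)"
        using s lam by simp
      also have "\<dots> \<le> (\<integral>\<^sup>+y. ennreal ((3 * \<delta> * lam) powr p) * indicator ?lB y
          + ennreal ((96 * lam) powr p) * (wt lam k y * indicator ?lB y) \<partial>M)"
      proof (rule nn_integral_mono)
        fix y
        have "0 \<le> trunc_grad lam k y"
          using lam less_imp_le[OF \<delta>] unfolding trunc_grad_def
          by (intro add_nonneg_nonneg mult_nonneg_nonneg sum_nonneg) auto
        then show "ennreal_powr (ennreal (trunc_grad lam k y)) p * indicator ?lB y
          \<le> ennreal ((3 * \<delta> * lam) powr p) * indicator ?lB y + ennreal ((96 * lam) powr p) * (wt lam k y * indicator ?lB y)"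
          using trunc_grad_powr[OF lam k, of y] by (simp add: ennreal_powr_ennreal indicator_def)
      qed
      also have "\<dots> = ennreal ((3 * \<delta> * lam) powr p) * emeasure M ?lB + ennreal ((96 * lam) powr p) * ?W"
        by (simp add: nn_integral_add nn_integral_cmult nn_integral_cmult_indicator)
      finally have main: "ennreal ((s / 2 * lam / (2 * C)) powr p) * emeasure M ?lB
        \<le> ennreal ((3 * \<delta> * lam) powr p) * emeasure M ?lB + ennreal ((96 * lam) powr p) * ?W" .
      define Q where "Q = (s * lam / (4 * C)) powr p"
      have Q: "0 < Q" using s lam C by (simp add: Q_def)
      have Q1: "(s / 2 * lam / (2 * C)) powr p = Q" by (simp add: Q_def field_simps)
      \<comment> \<open>Here the choice of \<open>\<delta>\<close> pays: the constant part of the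
        gradient uses up at most half of the forced energy \<open>Q\<close>.\<close>
      have Q2: "(3 * \<delta> * lam) powr p \<le> Q / 2"
      proof -
        have "3 * \<delta> * lam = s * lam / (4 * C) * (1/2)" using C by (simp add: \<delta>_def field_simps)
        then have "(3 * \<delta> * lam) powr p = Q * (1/2) powr p" unfolding Q_def by (simp only: powr_mult)
        also have "(1/2::real) powr p \<le> (1/2) powr 1" using p by (intro powr_mono') auto
        finally show ?thesis using Q by (simp add: mult_left_mono)
      qed
      have Q3: "(96 * lam) powr p / Q = (384 * C / s) powr p"
      proof -
        have "96 * lam / (s * lam / (4 * C)) = 384 * C / s" using s lam C by (simp add: field_simps)
        then show ?thesis unfolding Q_def using s lam C by (simp add: powr_divide[symmetric])
      qed
      obtain L where L: "emeasure M ?lB = ennreal L" "0 \<le> L"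
        using emeasure_ball_finite[OF n(1), of "l * r"] by (cases "emeasure M ?lB") auto
      show ?thesis
      proof (cases ?W)
        case (real w)
        have "ennreal (Q * L) \<le> ennreal ((3 * \<delta> * lam) powr p * L + (96 * lam) powr p * w)"
          using main unfolding Q1 L(1) real(2) using Q L real
          by (simp add: ennreal_mult[symmetric] flip: ennreal_plus)
        then have "Q * L \<le> (3 * \<delta> * lam) powr p * L + (96 * lam) powr p * w"
          using L real by (subst (asm) ennreal_le_iff) auto
        moreover have "(3 * \<delta> * lam) powr p * L \<le> Q / 2 * L" using Q2 L by (intro mult_right_mono) auto
        ultimately have "Q * L \<le> Q * (2 * ((96 * lam) powr p / Q) * w)" using Q by (simp add: field_simps)
        then have "L \<le> 2 * ((96 * lam) powr p / Q) * w" using Q by (simp only: mult_le_cancel_left_pos)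
        also have "\<dots> \<le> C1 * w" unfolding Q3 using C1(3) real by (intro mult_right_mono) auto
        finally show ?thesis unfolding L(1) real(2) using C1 real
          by (simp add: ennreal_mult[symmetric] ennreal_leI)
      next
        case top
        then show ?thesis using C1 by (simp add: ennreal_mult_top)
      qed
    qed
  qed
qed

lemma U_main:
  assumes lam: "0 < lam" and k: "1 \<le> k"
  shows "emeasure M (U lam) \<le> ennreal K2 *
    (emeasure M (U (2 ^ k * lam)) + ennreal ((4 ^ k) powr p) * emeasure M (high lam)
     + ennreal ((1 / real k) powr p) * (\<Sum>j=k..<2 * k. ennreal ((2 ^ j) powr p) * emeasure M (U (2 ^ j * lam)))
     + emeasure M (ehigh lam))"
proof -
  have "emeasure M (U lam) \<le> ennreal (D ^ q) * ennreal C1 * (\<integral>\<^sup>+y. wt lam k y \<partial>M)"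
    by (rule U_covering[OF wt_measurable bad_ball_bound]) (use lam k in auto)
  also have "ennreal (D ^ q) * ennreal C1 = ennreal K2"
    using D1 C1 by (simp add: K2_def ennreal_mult)
  also have "(\<integral>\<^sup>+y. wt lam k y \<partial>M) = emeasure M (U (2 ^ k * lam)) + ennreal ((4 ^ k) powr p) * emeasure M (high lam)
     + ennreal ((1 / real k) powr p) * (\<Sum>j=k..<2 * k. ennreal ((2 ^ j) powr p) * emeasure M (U (2 ^ j * lam)))
     + emeasure M (ehigh lam)"
  proof -
    have add: "(\<integral>\<^sup>+y. A y + B y + F y + E y \<partial>M) = (\<integral>\<^sup>+y. A y \<partial>M) + (\<integral>\<^sup>+y. B y \<partial>M) + (\<integral>\<^sup>+y. F y \<partial>M) + (\<integral>\<^sup>+y. E y \<partial>M)"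
      if "A \<in> borel_measurable M" "B \<in> borel_measurable M" "F \<in> borel_measurable M" "E \<in> borel_measurable M"
      for A B F E :: "'a \<Rightarrow> ennreal" using that by (simp add: nn_integral_add)
    have ind: "(\<integral>\<^sup>+y. c * indicator S y \<partial>M) = c * emeasure M S" if "S \<in> sets M" for S and c :: ennreal
      using that by (rule nn_integral_cmult_indicator)
    have m: "(\<lambda>y. \<Sum>j=k..<2 * k. ennreal ((2 ^ j) powr p) * indicator (U (2 ^ j * lam)) y) \<in> borel_measurable M"
      by measurable
    have "(\<integral>\<^sup>+y. (\<Sum>j=k..<2 * k. ennreal ((2 ^ j) powr p) * indicator (U (2 ^ j * lam)) y) \<partial>M)
        = (\<Sum>j=k..<2 * k. ennreal ((2 ^ j) powr p) * emeasure M (U (2 ^ j * lam)))"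
      by (subst nn_integral_sum) (simp_all add: ind U_sets)
    note S = nn_integral_cmult[OF m, of "ennreal ((1 / real k) powr p)", unfolded this]
    show ?thesis
      unfolding wt_def
      by (subst add) (measurable, simp_all only: S ind[OF high_sets] nn_integral_indicator[OF U_sets] nn_integral_indicator[OF ehigh_sets])
  qed
  finally show ?thesis .
qed

end

context poincare_family begin

text \<open>Multiplied by the \<open>p\<close>-th power of the level, \<open>U_main\<close> becomes
  a recursion that bounds each term by the data and a small multiple of later terms. The resulting
  constant depends neither on \<open>n\<close> nor on \<open>l0\<close>, so it extends to all
  integer levels.\<close>

lemma U_sum:
  assumes l0: "0 < l0"
  shows "(\<Sum>i<n. ennreal ((2 ^ i * l0) powr p) * emeasure M (U (2 ^ i * l0)))
    \<le> ennreal Kfin * ((\<integral>\<^sup>+x. ennreal_powr (\<rho> x) p \<partial>M) + (\<integral>\<^sup>+x. ennreal_powr (ennreal (e x)) p \<partial>M))"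
proof -
  define lv where "lv i = 2 ^ i * l0" for i :: nat
  have lv: "0 < lv i" for i using l0 by (simp add: lv_def)
  have p1: "1 \<le> p" using p by simp
  have "(\<integral>\<^sup>+x. ennreal_powr (\<rho> x) p \<partial>M) < \<infinity>" using \<rho> by (simp add: Lp_borel_iff)
  then obtain r1 where r1: "(\<integral>\<^sup>+x. ennreal_powr (\<rho> x) p \<partial>M) = ennreal r1" "0 \<le> r1"
    by (cases "\<integral>\<^sup>+x. ennreal_powr (\<rho> x) p \<partial>M") auto
  obtain r2 where r2: "(\<integral>\<^sup>+x. ennreal_powr (ennreal (e x)) p \<partial>M) = ennreal r2" "0 \<le> r2"
    using e_fin by (cases "\<integral>\<^sup>+x. ennreal_powr (ennreal (e x)) p \<partial>M") auto
  \<comment> \<open>The weak-type bound, valid for all terms of the sequence at once.\<close>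
  define A where "A = D ^ q * (2 * C / s) powr p * r1"
  have "emeasure M (U (lv i)) < \<infinity> \<and> ennreal (lv i powr p) * emeasure M (U (lv i)) \<le> ennreal A" for i
  proof -
    have "ennreal (lv i powr p) * emeasure M (U (lv i)) \<le> ennreal (D ^ q * (2 * C / s) powr p) * ennreal r1"
      using U_weak_bound[OF lv] unfolding r1(1) .
    also have "\<dots> = ennreal A" using r1 D1 by (simp add: A_def ennreal_mult)
    finally have le: "ennreal (lv i powr p) * emeasure M (U (lv i)) \<le> ennreal A" .
    have "emeasure M (U (lv i)) \<noteq> top"
    proof
      assume "emeasure M (U (lv i)) = top"
      then show False using le lv[of i] by (simp add: ennreal_mult_top top_unique)
    qed
    then show ?thesis using le by (simp add: less_top)
  qed
  then have Ufin: "\<And>i. emeasure M (U (lv i)) < \<infinity>"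
    and Ule: "\<And>i. ennreal (lv i powr p) * emeasure M (U (lv i)) \<le> ennreal A" by auto
  define u where "u i = enn2real (emeasure M (U (lv i)))" for i
  have u: "emeasure M (U (lv i)) = ennreal (u i)" "0 \<le> u i" for i using Ufin[of i] by (simp_all add: u_def)
  define a where "a i = lv i powr p * u i" for i
  have A0: "0 \<le> A" using r1 D1 by (simp add: A_def)
  have a: "0 \<le> a i" "a i \<le> A" for i
  proof -
    show "0 \<le> a i" using u by (simp add: a_def)
    have "ennreal (a i) \<le> ennreal A" using Ule[of i] u[of i] by (simp add: a_def ennreal_mult)
    then show "a i \<le> A" using A0 by simp
  qed
  have hsum: "(\<Sum>i<n. ennreal (lv i powr p) * emeasure M (high (lv i))) \<le> ennreal (2 / \<delta> powr p) * ennreal r1" for n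
    using sum_dyadic_emeasure_le[OF p1 l0 \<delta> \<rho>_measurable, of n] unfolding r1(1) by (simp add: lv_def high_def)
  have esum: "(\<Sum>i<n. ennreal (lv i powr p) * emeasure M (ehigh (lv i))) \<le> ennreal (2 / ce powr p) * ennreal r2" for n
    using sum_dyadic_emeasure_le[OF p1 l0 ce, of "\<lambda>x. ennreal (e x)" n] unfolding r2(1)
    by (simp add: lv_def ehigh_def)
  have fin: "emeasure M S < \<infinity>"
    if "ennreal (lv i powr p) * emeasure M S \<le> c" "c < \<infinity>" for S i c
  proof (rule ccontr)
    assume "\<not> emeasure M S < \<infinity>"
    then have "emeasure M S = top" by (cases "emeasure M S") auto
    then show False using that lv[of i] by (simp add: ennreal_mult_top top_unique)
  qed
  have hfin: "emeasure M (high (lv i)) < \<infinity>" for i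
  proof (rule fin[of i])
    have "ennreal (lv i powr p) * emeasure M (high (lv i)) \<le> (\<Sum>i<Suc i. ennreal (lv i powr p) * emeasure M (high (lv i)))"
      by (rule member_le_sum) auto
    then show "ennreal (lv i powr p) * emeasure M (high (lv i)) \<le> ennreal (2 / \<delta> powr p) * ennreal r1"
      using hsum[of "Suc i"] by (rule order_trans)
  qed (simp add: ennreal_mult_less_top)
  have efin: "emeasure M (ehigh (lv i)) < \<infinity>" for i
  proof (rule fin[of i])
    have "ennreal (lv i powr p) * emeasure M (ehigh (lv i)) \<le> (\<Sum>i<Suc i. ennreal (lv i powr p) * emeasure M (ehigh (lv i)))"
      by (rule member_le_sum) auto
    then show "ennreal (lv i powr p) * emeasure M (ehigh (lv i)) \<le> ennreal (2 / ce powr p) * ennreal r2"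
      using esum[of "Suc i"] by (rule order_trans)
  qed (simp add: ennreal_mult_less_top)
  define hi where "hi i = enn2real (emeasure M (high (lv i)))" for i
  define eh where "eh i = enn2real (emeasure M (ehigh (lv i)))" for i
  have hi: "emeasure M (high (lv i)) = ennreal (hi i)" "0 \<le> hi i" for i using hfin[of i] by (simp_all add: hi_def)
  have eh: "emeasure M (ehigh (lv i)) = ennreal (eh i)" "0 \<le> eh i" for i using efin[of i] by (simp_all add: eh_def)
  have hreal: "(\<Sum>i<n. lv i powr p * hi i) \<le> 2 / \<delta> powr p * r1" for n
  proof -
    have "ennreal (\<Sum>i<n. lv i powr p * hi i) = (\<Sum>i<n. ennreal (lv i powr p) * emeasure M (high (lv i)))"
      using hi by (simp add: ennreal_mult flip: sum_ennreal)
    also have "\<dots> \<le> ennreal (2 / \<delta> powr p * r1)"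
      using hsum[of n] ennreal_mult[of "2 / \<delta> powr p" r1] r1 by simp
    finally show ?thesis using r1 by (subst (asm) ennreal_le_iff) auto
  qed
  have ereal: "(\<Sum>i<n. lv i powr p * eh i) \<le> 2 / ce powr p * r2" for n
  proof -
    have "ennreal (\<Sum>i<n. lv i powr p * eh i) = (\<Sum>i<n. ennreal (lv i powr p) * emeasure M (ehigh (lv i)))"
      using eh by (simp add: ennreal_mult flip: sum_ennreal)
    also have "\<dots> \<le> ennreal (2 / ce powr p * r2)"
      using esum[of n] ennreal_mult[of "2 / ce powr p" r2] r2 by simp
    finally show ?thesis using r2 by (subst (asm) ennreal_le_iff) auto
  qed
  define \<kappa> where "\<kappa> = (1 / real kk) powr p"
  define b where "b i = K2 * ((4 ^ kk) powr p * (lv i powr p * hi i) + lv i powr p * eh i)" for i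
  define Bb where "Bb = K2 * ((4 ^ kk) powr p * (2 / \<delta> powr p * r1) + 2 / ce powr p * r2)"
  have b: "(\<Sum>i<n. b i) \<le> Bb" for n
  proof -
    have "(\<Sum>i<n. b i) = K2 * ((4 ^ kk) powr p * (\<Sum>i<n. lv i powr p * hi i) + (\<Sum>i<n. lv i powr p * eh i))"
      by (simp only: b_def sum.distrib sum_distrib_left[symmetric])
    also have "\<dots> \<le> Bb" unfolding Bb_def
      using K2 by (intro mult_left_mono add_mono hreal ereal) auto
    finally show ?thesis .
  qed
  have rec: "a i \<le> b i + (2 * K2 * \<kappa>) * (\<Sum>j<2 * kk. a (i + j))" for i
  proof -
    have lvj: "2 ^ j * lv i = lv (i + j)" for j by (simp add: lv_def power_add)
    have shift: "lv i powr p * ((2 ^ j) powr p * u (i + j)) = a (i + j)" for j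
    proof -
      have "lv (i + j) powr p = (2 ^ j) powr p * lv i powr p" unfolding lvj[symmetric] by (rule powr_mult)
      then show ?thesis by (simp add: a_def)
    qed
    have "ennreal (u i) \<le> ennreal K2 * (ennreal (u (i + kk)) + ennreal ((4 ^ kk) powr p) * ennreal (hi i)
        + ennreal \<kappa> * (\<Sum>j=kk..<2 * kk. ennreal ((2 ^ j) powr p) * ennreal (u (i + j))) + ennreal (eh i))"
      using U_main[OF lv kk(1), of i] unfolding lvj u(1) hi(1) eh(1) \<kappa>_def .
    also have "\<dots> = ennreal (K2 * (u (i + kk) + (4 ^ kk) powr p * hi i + \<kappa> * (\<Sum>j=kk..<2 * kk. (2 ^ j) powr p * u (i + j)) + eh i))"
    proof -
      have s: "(\<Sum>j=kk..<2 * kk. ennreal ((2 ^ j) powr p) * ennreal (u (i + j))) = ennreal (\<Sum>j=kk..<2 * kk. (2 ^ j) powr p * u (i + j))"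
        using u(2) by (simp add: ennreal_mult[symmetric])
      have s0: "0 \<le> (\<Sum>j=kk..<2 * kk. (2 ^ j) powr p * u (i + j))" "0 \<le> \<kappa>"
        using u(2) by (auto intro!: sum_nonneg simp: \<kappa>_def)
      have "ennreal (u (i + kk)) + ennreal ((4 ^ kk) powr p) * ennreal (hi i)
        + ennreal \<kappa> * ennreal (\<Sum>j=kk..<2 * kk. (2 ^ j) powr p * u (i + j)) + ennreal (eh i)
        = ennreal (u (i + kk) + (4 ^ kk) powr p * hi i + \<kappa> * (\<Sum>j=kk..<2 * kk. (2 ^ j) powr p * u (i + j)) + eh i)"
        using u(2)[of "i + kk"] hi(2)[of i] eh(2)[of i] s0
        by (simp only: ennreal_mult[symmetric] ennreal_plus[symmetric] add_nonneg_nonneg mult_nonneg_nonneg powr_ge_zero)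
      then show ?thesis unfolding s using K2 u(2)[of "i + kk"] hi(2)[of i] eh(2)[of i] s0
        by (simp only: ennreal_mult add_nonneg_nonneg mult_nonneg_nonneg powr_ge_zero less_imp_le)
    qed
    finally have "u i \<le> K2 * (u (i + kk) + (4 ^ kk) powr p * hi i + \<kappa> * (\<Sum>j=kk..<2 * kk. (2 ^ j) powr p * u (i + j)) + eh i)"
      using K2 u(2) hi(2) eh(2)
      by (subst (asm) ennreal_le_iff) (auto intro!: mult_nonneg_nonneg add_nonneg_nonneg sum_nonneg simp: \<kappa>_def)
    then have "a i \<le> lv i powr p * (K2 * (u (i + kk) + (4 ^ kk) powr p * hi i + \<kappa> * (\<Sum>j=kk..<2 * kk. (2 ^ j) powr p * u (i + j)) + eh i))"
      unfolding a_def by (rule mult_left_mono) simp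
    also have "\<dots> = b i + K2 * (lv i powr p * u (i + kk) + \<kappa> * (\<Sum>j=kk..<2 * kk. lv i powr p * ((2 ^ j) powr p * u (i + j))))"
      unfolding b_def sum_distrib_left[symmetric] by (simp add: algebra_simps)
    \<comment> \<open>This term of \<open>U_main\<close> carries no factor \<open>\<kappa>\<close>.
      Rescaling it to its own level gains the inverse of \<open>(2 ^ kk) powr p\<close>, which is at
      most \<open>\<kappa>\<close> because \<open>kk \<le> 2 ^ kk\<close>.\<close>
    also have "lv i powr p * u (i + kk) \<le> \<kappa> * a (i + kk)"
    proof -
      have "real kk \<le> 2 ^ kk" using of_nat_less_two_power[of kk, where 'a = real] by simp
      then have "real kk powr p \<le> (2 ^ kk) powr p" using p by (intro powr_mono2) auto
      then have "1 \<le> \<kappa> * (2 ^ kk) powr p" using kk(1) by (simp add: \<kappa>_def powr_divide field_simps)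
      then have "1 * (lv i powr p * u (i + kk)) \<le> (\<kappa> * (2 ^ kk) powr p) * (lv i powr p * u (i + kk))"
        using u(2) by (intro mult_right_mono) auto
      then show ?thesis using shift[of kk] by (simp add: mult.assoc mult.left_commute)
    qed
    also have "(\<Sum>j=kk..<2 * kk. lv i powr p * ((2 ^ j) powr p * u (i + j))) = (\<Sum>j=kk..<2 * kk. a (i + j))"
      by (simp add: shift)
    finally have 1: "a i \<le> b i + K2 * (\<kappa> * a (i + kk) + \<kappa> * (\<Sum>j=kk..<2 * kk. a (i + j)))"
      using K2 by (simp add: mult_left_mono)
    have "a (i + kk) \<le> (\<Sum>j<2 * kk. a (i + j))"
      using kk(1) a(1) by (intro member_le_sum[of kk _ "\<lambda>j. a (i + j)"]) auto
    moreover have "(\<Sum>j=kk..<2 * kk. a (i + j)) \<le> (\<Sum>j<2 * kk. a (i + j))"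
      using a(1) by (intro sum_mono2) auto
    ultimately have "\<kappa> * a (i + kk) + \<kappa> * (\<Sum>j=kk..<2 * kk. a (i + j)) \<le> \<kappa> * (\<Sum>j<2 * kk. a (i + j)) + \<kappa> * (\<Sum>j<2 * kk. a (i + j))"
      by (intro add_mono mult_left_mono) (auto simp: \<kappa>_def)
    then have "K2 * (\<kappa> * a (i + kk) + \<kappa> * (\<Sum>j=kk..<2 * kk. a (i + j))) \<le> K2 * (\<kappa> * (\<Sum>j<2 * kk. a (i + j)) + \<kappa> * (\<Sum>j<2 * kk. a (i + j)))"
      using K2 by (intro mult_left_mono) auto
    then show ?thesis using 1 by (simp add: algebra_simps)
  qed
  have S: "(\<Sum>i<n. a i) \<le> 2 * Bb + 2 * real kk * A"
    by (rule absorb_shifted_sums[OF a b rec]) (use kk(2) K2 in \<open>auto simp: \<kappa>_def\<close>)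
  also have "\<dots> \<le> Kfin * (r1 + r2)"
  proof -
    define \<alpha> where "\<alpha> = (4 ^ kk) powr p * (2 / \<delta> powr p)"
    define \<beta> where "\<beta> = 2 / ce powr p"
    define \<tau> where "\<tau> = D ^ q * (2 * C / s) powr p"
    have nn: "0 \<le> \<alpha>" "0 \<le> \<beta>" "0 \<le> \<tau>" using D1 by (auto simp: \<alpha>_def \<beta>_def \<tau>_def)
    have "2 * Bb + 2 * real kk * A = 2 * K2 * (\<alpha> * r1 + \<beta> * r2) + 2 * real kk * \<tau> * r1"
      by (simp add: Bb_def A_def \<alpha>_def \<beta>_def \<tau>_def)
    also have "\<dots> \<le> 2 * K2 * ((\<alpha> + \<beta>) * (r1 + r2)) + 2 * real kk * \<tau> * (r1 + r2)"
    proof (intro add_mono mult_left_mono)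
      show "\<alpha> * r1 + \<beta> * r2 \<le> (\<alpha> + \<beta>) * (r1 + r2)" using nn r1(2) r2(2) by (simp add: algebra_simps)
    qed (use nn r1(2) r2(2) K2 in auto)
    also have "\<dots> = Kfin * (r1 + r2)" by (simp add: Kfin_def \<alpha>_def \<beta>_def \<tau>_def algebra_simps)
    finally show ?thesis .
  qed
  finally have "ennreal (\<Sum>i<n. a i) \<le> ennreal (Kfin * (r1 + r2))" by (rule ennreal_leI)
  moreover have "ennreal (\<Sum>i<n. a i) = (\<Sum>i<n. ennreal ((2 ^ i * l0) powr p) * emeasure M (U (2 ^ i * l0)))"
    using u a(1) by (simp add: a_def ennreal_mult flip: sum_ennreal lv_def)
  moreover have "ennreal (Kfin * (r1 + r2)) = ennreal Kfin * (ennreal r1 + ennreal r2)"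
  proof -
    have "0 \<le> Kfin" using K2 D1 by (auto simp: Kfin_def intro!: add_nonneg_nonneg mult_nonneg_nonneg)
    then have "ennreal (Kfin * (r1 + r2)) = ennreal Kfin * ennreal (r1 + r2)" using r1 r2 by (intro ennreal_mult) auto
    then show ?thesis using r1 r2 by simp
  qed
  ultimately show ?thesis unfolding r1(1) r2(1) by simp
qed

end

section \<open>Whitney interpolation\<close>

text \<open>Whitney balls far from the set are arbitrarily large, so doubling is taken at all radii
  here.\<close>

locale whitney_space = metric_measure +
  fixes D :: real
  assumes D1: "1 \<le> D"
    and doubling_all: "\<And>x r. x \<in> X \<Longrightarrow> 0 < r \<Longrightarrow>
      emeasure M (X \<inter> ball x (2 * r)) \<le> ennreal D * emeasure M (X \<inter> ball x r)"
begin

lemma doubling_space: "0 < R0 \<Longrightarrow> doubling_space X \<mu> D R0"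
  by unfold_locales (use D1 doubling_all in auto)

lemma doubling_all_le:
  assumes "x \<in> X" "0 < r" "t \<le> 2 ^ m * r"
  shows "emeasure M (X \<inter> ball x t) \<le> ennreal (D ^ m) * emeasure M (X \<inter> ball x r)"
proof -
  have "0 < 2 ^ m * r" using assms by simp
  from doubling_space[OF this] interpret d: doubling_space X \<mu> D "2 ^ m * r" .
  show ?thesis by (rule d.doubling_le[OF assms(1,2) _ assms(3)]) (use assms in simp)
qed

text \<open>The balls of radius \<open>\<epsilon>\<close> about the points are disjoint, lie in the
  ball of radius \<open>2 * t\<close>, and each carries at least the fraction
  \<open>1 / D ^ m\<close> of its mass.\<close>

lemma packing:
  assumes z: "z \<in> X" and J: "J \<subseteq> X \<inter> ball z t" and \<epsilon>: "0 < \<epsilon>" "\<epsilon> \<le> t" "4 * t \<le> 2 ^ m * \<epsilon>"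
    and sep: "\<And>k l. k \<in> J \<Longrightarrow> l \<in> J \<Longrightarrow> k \<noteq> l \<Longrightarrow> 2 * \<epsilon> \<le> dist k l"
  shows "finite J \<and> real (card J) \<le> D ^ m"
proof -
  have bound: "real (card F) \<le> D ^ m" if F: "F \<subseteq> J" "finite F" for F
  proof -
    have t: "0 < t" using \<epsilon> by simp
    obtain b where b: "emeasure M (X \<inter> ball z (2 * t)) = ennreal b" "0 < b"
      using emeasure_ball[OF z, of "2 * t"] emeasure_ball_finite[OF z, of "2 * t"] t
      by (cases "emeasure M (X \<inter> ball z (2 * t))") auto
    have "ennreal b \<le> ennreal (D ^ m) * emeasure M (X \<inter> ball k \<epsilon>)" if k: "k \<in> F" for k
    proof -
      have kX: "k \<in> X" "dist z k < t" using k F J by auto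
      have "X \<inter> ball z (2 * t) \<subseteq> X \<inter> ball k (4 * t)"
      proof
        fix y assume y: "y \<in> X \<inter> ball z (2 * t)"
        then have "dist k y < 4 * t" using kX dist_triangle3[of k y z] t by auto
        then show "y \<in> X \<inter> ball k (4 * t)" using y by auto
      qed
      then have "emeasure M (X \<inter> ball z (2 * t)) \<le> emeasure M (X \<inter> ball k (4 * t))"
        by (intro emeasure_mono) auto
      also have "\<dots> \<le> ennreal (D ^ m) * emeasure M (X \<inter> ball k \<epsilon>)"
        by (rule doubling_all_le[OF kX(1) \<epsilon>(1,3)])
      finally show ?thesis unfolding b(1) .
    qed
    then have "(\<Sum>k\<in>F. ennreal b) \<le> (\<Sum>k\<in>F. ennreal (D ^ m) * emeasure M (X \<inter> ball k \<epsilon>))"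
      by (rule sum_mono)
    also have "\<dots> = ennreal (D ^ m) * (\<Sum>k\<in>F. emeasure M (X \<inter> ball k \<epsilon>))" by (rule sum_distrib_left[symmetric])
    also have "(\<Sum>k\<in>F. emeasure M (X \<inter> ball k \<epsilon>)) = emeasure M (\<Union>k\<in>F. X \<inter> ball k \<epsilon>)"
    proof (rule sum_emeasure)
      show "disjoint_family_on (\<lambda>k. X \<inter> ball k \<epsilon>) F" unfolding disjoint_family_on_def
      proof (intro ballI impI)
        fix k l assume kl: "k \<in> F" "l \<in> F" "k \<noteq> l"
        then have "2 * \<epsilon> \<le> dist k l" using F sep by blast
        then have "\<not> (dist k y < \<epsilon> \<and> dist l y < \<epsilon>)" for y using dist_triangle2[of k l y] by linarith
        then show "(X \<inter> ball k \<epsilon>) \<inter> (X \<inter> ball l \<epsilon>) = {}" by auto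
      qed
    qed (use F in auto)
    also have "\<dots> \<le> emeasure M (X \<inter> ball z (2 * t))"
    proof (rule emeasure_mono)
      show "(\<Union>k\<in>F. X \<inter> ball k \<epsilon>) \<subseteq> X \<inter> ball z (2 * t)"
      proof
        fix y assume "y \<in> (\<Union>k\<in>F. X \<inter> ball k \<epsilon>)"
        then obtain k where k: "k \<in> F" "y \<in> X" "dist k y < \<epsilon>" by auto
        then have "dist z k < t" using F J by auto
        then have "dist z y < 2 * t" using k dist_triangle[of z y k] \<epsilon> by linarith
        then show "y \<in> X \<inter> ball z (2 * t)" using k by auto
      qed
    qed simp
    finally have "ennreal (real (card F) * b) \<le> ennreal (D ^ m * b)"
      using b D1 by (simp add: mult_left_mono ennreal_mult ennreal_of_nat_eq_real_of_nat)
    then have "real (card F) * b \<le> D ^ m * b" using b D1 by (subst (asm) ennreal_le_iff) auto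
    then show ?thesis using b by simp
  qed
  have "finite J \<and> card J \<le> nat \<lfloor>D ^ m\<rfloor>"
  proof (rule finite_if_finite_subsets_card_bdd)
    fix F assume "F \<subseteq> J" "finite F"
    then show "card F \<le> nat \<lfloor>D ^ m\<rfloor>" using bound[of F] by (simp add: le_nat_floor)
  qed
  then show ?thesis using bound by blast
qed

end

section \<open>Whitney centres, partition of unity and interpolation\<close>

locale whitney_partition = whitney_space +
  fixes \<Omega> :: "'a set"
  assumes \<Omega>_ne: "\<Omega> \<noteq> {}"
begin

abbreviation "\<delta> z \<equiv> infdist z \<Omega>"
definition W where "W = X - closure \<Omega>"

lemma W_X: "z \<in> W \<Longrightarrow> z \<in> X" by (simp add: W_def)

lemma \<delta>_pos: "z \<in> W \<Longrightarrow> 0 < \<delta> z"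
  using in_closure_iff_infdist_zero[OF \<Omega>_ne, of z] infdist_nonneg[of z \<Omega>] by (auto simp: W_def)

lemma \<delta>_lip: "\<delta> x \<le> \<delta> y + dist x y"
  by (rule infdist_triangle)

text \<open>The separation is proportional to the distance from \<open>\<Omega>\<close>; a maximal
  such set takes the role of the centres of Euclidean Whitney cubes.\<close>

definition separated where
  "separated S \<longleftrightarrow> S \<subseteq> W \<and> (\<forall>k\<in>S. \<forall>l\<in>S. k \<noteq> l \<longrightarrow> min (\<delta> k) (\<delta> l) / 8 \<le> dist k l)"

lemma ex_net: "\<exists>S. separated S \<and> (\<forall>T. separated T \<longrightarrow> S \<subseteq> T \<longrightarrow> T = S)"
proof -
  have "\<exists>S\<in>{S. separated S}. \<forall>T\<in>{S. separated S}. S \<subseteq> T \<longrightarrow> T = S"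
  proof (rule Zorn_Lemma2, rule ballI)
    fix c assume c: "c \<in> chains {S. separated S}"
    then have sep: "\<And>A. A \<in> c \<Longrightarrow> separated A" and lin: "\<And>A B. A \<in> c \<Longrightarrow> B \<in> c \<Longrightarrow> A \<subseteq> B \<or> B \<subseteq> A"
      by (auto simp: chains_def chain_subset_def)
    have "separated (\<Union>c)" unfolding separated_def
    proof (intro conjI ballI impI)
      show "\<Union>c \<subseteq> W" using sep by (auto simp: separated_def)
      fix k l assume "k \<in> \<Union>c" "l \<in> \<Union>c" "k \<noteq> l"
      then obtain A where "A \<in> c" "k \<in> A" "l \<in> A" using lin by blast
      then show "min (\<delta> k) (\<delta> l) / 8 \<le> dist k l" using sep \<open>k \<noteq> l\<close> by (auto simp: separated_def)
    qed
    then show "\<exists>y\<in>{S. separated S}. \<forall>x\<in>c. x \<subseteq> y" by blast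
  qed
  then show ?thesis by blast
qed

definition Net where "Net = (SOME S. separated S \<and> (\<forall>T. separated T \<longrightarrow> S \<subseteq> T \<longrightarrow> T = S))"

lemma Net: "separated Net" "\<And>T. separated T \<Longrightarrow> Net \<subseteq> T \<Longrightarrow> T = Net"
  using someI_ex[OF ex_net] by (auto simp: Net_def)

lemma Net_W: "k \<in> Net \<Longrightarrow> k \<in> W"
  using Net(1) by (auto simp: separated_def)

lemma Net_cover:
  assumes z: "z \<in> W"
  obtains k where "k \<in> Net" "dist z k < \<delta> k / 8"
proof (cases "z \<in> Net")
  case True
  then show thesis using that[of z] \<delta>_pos[OF z] by simp
next
  case False
  then have nsep: "\<not> separated (insert z Net)" using Net(2)[of "insert z Net"] by blast
  have "separated (insert z Net)" if no: "\<And>k. k \<in> Net \<Longrightarrow> min (\<delta> z) (\<delta> k) / 8 \<le> dist z k"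
    unfolding separated_def
  proof (intro conjI ballI impI)
    show "insert z Net \<subseteq> W" using z Net(1) by (auto simp: separated_def)
    fix k l assume kl: "k \<in> insert z Net" "l \<in> insert z Net" "k \<noteq> l"
    then consider "k = z" "l \<in> Net" | "l = z" "k \<in> Net" | "k \<in> Net" "l \<in> Net" by blast
    then show "min (\<delta> k) (\<delta> l) / 8 \<le> dist k l"
    proof cases
      case 2 then show ?thesis using no[of k] by (simp add: dist_commute min.commute)
    next
      case 3 then show ?thesis using Net(1) kl(3) by (auto simp: separated_def)
    qed (use no in simp)
  qed
  then obtain k where k: "k \<in> Net" "dist z k < min (\<delta> z) (\<delta> k) / 8"
    using nsep by (meson linorder_not_le)
  then show thesis using that[of k] k by simp
qed

text \<open>A bump that is at least 1/2 within \<open>\<delta> k / 8\<close> of its centre, where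
  the net covers, and vanishes beyond \<open>\<delta> k / 4\<close>; its slope is
  \<open>4 / \<delta> k\<close>.\<close>

definition phi :: "'a \<Rightarrow> 'a \<Rightarrow> real" where "phi k z = max 0 (1 - 4 * dist z k / \<delta> k)"
definition J :: "'a \<Rightarrow> 'a set" where "J z = {k\<in>Net. 4 * dist z k < \<delta> k}"
definition Phi :: "'a \<Rightarrow> real" where "Phi z = (\<Sum>k\<in>J z. phi k z)"

text \<open>The distance from \<open>\<Omega>\<close> is 1-Lipschitz and
  \<open>dist z k < \<delta> k / 4\<close>, so it is comparable at \<open>z\<close> and at every
  centre active there.\<close>

lemma J_est:
  assumes "k \<in> J z"
  shows "k \<in> W" "0 < \<delta> k" "dist z k \<le> \<delta> z / 3" "4 / 5 * \<delta> z \<le> \<delta> k" "\<delta> k \<le> 4 / 3 * \<delta> z" "4 * dist z k < \<delta> k"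
proof -
  show W: "k \<in> W" and 4: "4 * dist z k < \<delta> k" using assms Net_W by (auto simp: J_def)
  show "0 < \<delta> k" by (rule \<delta>_pos[OF W])
  show "dist z k \<le> \<delta> z / 3" "4 / 5 * \<delta> z \<le> \<delta> k" "\<delta> k \<le> 4 / 3 * \<delta> z"
    using 4 \<delta>_lip[of z k] \<delta>_lip[of k z] by (auto simp: dist_commute)
qed

lemma J_finite:
  assumes z: "z \<in> W"
  shows "finite (J z)" "real (card (J z)) \<le> D ^ 6"
proof -
  have pos: "0 < \<delta> z" by (rule \<delta>_pos[OF z])
  have "finite (J z) \<and> real (card (J z)) \<le> D ^ 6"
  \<comment> \<open>Active centres are at least \<open>\<delta> z / 10\<close> apart, by the
    separation 1/8 and the lower bound 4/5. The exponent 6 comes from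
    \<open>4 * (\<delta> z / 2) \<le> 2 ^ 6 * (\<delta> z / 20)\<close>.\<close>
  proof (rule packing[OF W_X[OF z], where t = "\<delta> z / 2" and \<epsilon> = "\<delta> z / 20"])
    show "J z \<subseteq> X \<inter> ball z (\<delta> z / 2)"
    proof
      fix k assume k: "k \<in> J z"
      then have "dist z k < \<delta> z / 2" using J_est(3)[OF k] pos by linarith
      then show "k \<in> X \<inter> ball z (\<delta> z / 2)" using W_X[OF J_est(1)[OF k]] by simp
    qed
    fix k l assume kl: "k \<in> J z" "l \<in> J z" "k \<noteq> l"
    then have "min (\<delta> k) (\<delta> l) / 8 \<le> dist k l" using Net(1) by (auto simp: separated_def J_def)
    then show "2 * (\<delta> z / 20) \<le> dist k l"
      using J_est(4)[OF kl(1)] J_est(4)[OF kl(2)] by linarith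
  qed (use pos in auto)
  then show "finite (J z)" "real (card (J z)) \<le> D ^ 6" by auto
qed

lemma phi: "0 \<le> phi k z" "0 < \<delta> k \<Longrightarrow> phi k z \<le> 1"
  by (auto simp: phi_def)

lemma phi_outside: "k \<in> Net \<Longrightarrow> k \<notin> J z \<Longrightarrow> phi k z = 0"
  using \<delta>_pos[OF Net_W, of k] by (auto simp: phi_def J_def field_simps)

lemma phi_lip: "0 < \<delta> k \<Longrightarrow> \<bar>phi k z - phi k z'\<bar> \<le> 4 / \<delta> k * dist z z'"
proof -
  assume k: "0 < \<delta> k"
  have "\<bar>dist z k - dist z' k\<bar> \<le> dist z z'"
    using dist_triangle[of z k z'] dist_triangle3[of z' k z] by (auto simp: dist_commute abs_le_iff)
  then have "\<bar>4 * dist z k / \<delta> k - 4 * dist z' k / \<delta> k\<bar> \<le> 4 / \<delta> k * dist z z'"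
    using k by (simp add: abs_le_iff field_simps)
  then show ?thesis unfolding phi_def by linarith
qed

lemma Phi_ge: "z \<in> W \<Longrightarrow> 1 / 2 \<le> Phi z"
proof -
  assume z: "z \<in> W"
  obtain k where k: "k \<in> Net" "dist z k < \<delta> k / 8" using Net_cover[OF z] .
  have pos: "0 < \<delta> k" by (rule \<delta>_pos[OF Net_W[OF k(1)]])
  have "k \<in> J z" using k pos by (auto simp: J_def)
  then have "phi k z \<le> Phi z" unfolding Phi_def using J_finite[OF z] phi by (intro member_le_sum) auto
  moreover have "1 / 2 \<le> phi k z" using k pos by (auto simp: phi_def field_simps)
  ultimately show ?thesis by simp
qed

lemma Phi_superset: "z \<in> W \<Longrightarrow> finite S \<Longrightarrow> J z \<subseteq> S \<Longrightarrow> S \<subseteq> Net \<Longrightarrow> (\<Sum>k\<in>S. phi k z) = Phi z"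
  unfolding Phi_def by (rule sum.mono_neutral_right) (use phi_outside in auto)

definition interp :: "('a \<Rightarrow> 'v::real_normed_vector) \<Rightarrow> 'a \<Rightarrow> 'v" where
  "interp a z = (\<Sum>k\<in>J z. (phi k z / Phi z) *\<^sub>R a k)"

lemma interp_superset:
  "z \<in> W \<Longrightarrow> finite S \<Longrightarrow> J z \<subseteq> S \<Longrightarrow> S \<subseteq> Net \<Longrightarrow> interp a z = (\<Sum>k\<in>S. (phi k z / Phi z) *\<^sub>R a k)"
  unfolding interp_def by (rule sum.mono_neutral_left) (use phi_outside in auto)

text \<open>The weights add up to 1, and the index set may be enlarged so that two interpolants are
  compared over the same centres.\<close>

lemma interp_diff:
  assumes z: "z \<in> W" and S: "finite S" "J z \<subseteq> S" "S \<subseteq> Net"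
  shows "interp a z - c = (\<Sum>k\<in>S. (phi k z / Phi z) *\<^sub>R (a k - c))"
proof -
  have "(\<Sum>k\<in>S. (phi k z / Phi z) *\<^sub>R c) = ((\<Sum>k\<in>S. phi k z) / Phi z) *\<^sub>R c"
    by (simp add: sum_divide_distrib scaleR_sum_left)
  also have "\<dots> = c" using Phi_superset[OF z S] Phi_ge[OF z] by simp
  finally show ?thesis
    using interp_superset[OF z S] by (simp add: scaleR_diff_right sum_subtractf)
qed

lemma J_Net: "J z \<subseteq> Net" by (auto simp: J_def)

lemma interp_close:
  assumes z: "z \<in> W" and a: "\<And>k. k \<in> J z \<Longrightarrow> norm (a k - c) \<le> \<epsilon>"
  shows "norm (interp a z - c) \<le> \<epsilon>"
proof -
  have P: "0 < Phi z" using Phi_ge[OF z] by simp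
  have "norm (interp a z - c) \<le> (\<Sum>k\<in>J z. norm ((phi k z / Phi z) *\<^sub>R (a k - c)))"
    unfolding interp_diff[OF z J_finite(1)[OF z] order_refl J_Net] by (rule norm_sum)
  also have "\<dots> \<le> (\<Sum>k\<in>J z. (phi k z / Phi z) * \<epsilon>)"
  proof (rule sum_mono)
    fix k assume k: "k \<in> J z"
    have "0 \<le> phi k z / Phi z" using phi(1)[of k z] P by simp
    then show "norm ((phi k z / Phi z) *\<^sub>R (a k - c)) \<le> (phi k z / Phi z) * \<epsilon>"
      using mult_left_mono[OF a[OF k], of "phi k z / Phi z"] by (simp only: norm_scaleR abs_of_nonneg)
  qed
  also have "\<dots> = ((\<Sum>k\<in>J z. phi k z) / Phi z) * \<epsilon>" by (simp add: sum_divide_distrib sum_distrib_right)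
  also have "\<dots> = \<epsilon>" using P by (simp add: Phi_def)
  finally show ?thesis .
qed

text \<open>A bound \<open>2 * D ^ 6\<close> for the number of centres active at two points, times
  the Lipschitz constant of a normalised weight in units of \<open>1 / \<delta> z\<close>.\<close>

definition CN :: real where "CN = 2 * D ^ 6 * (16 + 64 * D ^ 6)"

text \<open>Subtracting one value \<open>a k0\<close> from both interpolants leaves differences of
  weights times differences of values. A weight changes by a multiple of
  \<open>dist z z' / \<delta> z\<close>, and the values differ by at most
  \<open>\<epsilon>\<close>.\<close>

lemma interp_lip:
  assumes z: "z \<in> W" and z': "z' \<in> W" and d: "dist z z' \<le> \<delta> z / 100" and \<epsilon>: "0 \<le> \<epsilon>"
    and a: "\<And>k l. k \<in> J z \<union> J z' \<Longrightarrow> l \<in> J z \<union> J z' \<Longrightarrow> norm (a k - a l) \<le> \<epsilon>"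
  shows "norm (interp a z - interp a z') \<le> CN * dist z z' / \<delta> z * \<epsilon>"
proof -
  let ?S = "J z \<union> J z'"
  let ?d = "dist z z'"
  have pos: "0 < \<delta> z" by (rule \<delta>_pos[OF z])
  have fin: "finite ?S" using J_finite(1)[OF z] J_finite(1)[OF z'] by auto
  have card: "real (card ?S) \<le> 2 * D ^ 6"
    using card_Un_le[of "J z" "J z'"] J_finite(2)[OF z] J_finite(2)[OF z'] by linarith
  have S: "?S \<subseteq> Net" "J z \<subseteq> ?S" "J z' \<subseteq> ?S" using J_Net by auto
  obtain k0 where k0: "k0 \<in> J z"
  proof -
    have "J z \<noteq> {}" using Phi_ge[OF z] by (auto simp: Phi_def)
    then show thesis using that by blast
  qed
  have \<delta>k: "\<delta> z / 2 \<le> \<delta> k" if "k \<in> ?S" for k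
  proof -
    have "4 / 5 * \<delta> z \<le> \<delta> k \<or> 4 / 5 * \<delta> z' \<le> \<delta> k" using that J_est(4) by blast
    then show ?thesis using \<delta>_lip[of z z'] d pos by linarith
  qed
  have phi_lip': "\<bar>phi k z - phi k z'\<bar> \<le> 8 / \<delta> z * ?d" if k: "k \<in> ?S" for k
  proof -
    have "0 < \<delta> k" using \<delta>k[OF k] pos by linarith
    then have "\<bar>phi k z - phi k z'\<bar> \<le> 4 / \<delta> k * ?d" by (rule phi_lip)
    also have "4 / \<delta> k \<le> 8 / \<delta> z" using \<delta>k[OF k] pos \<open>0 < \<delta> k\<close> by (simp add: field_simps)
    finally show ?thesis by (simp add: mult_right_mono)
  qed
  have P: "1 / 2 \<le> Phi z" "1 / 2 \<le> Phi z'" by (rule Phi_ge[OF z], rule Phi_ge[OF z'])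
  have PhiS: "Phi z = (\<Sum>k\<in>?S. phi k z)" "Phi z' = (\<Sum>k\<in>?S. phi k z')"
    using Phi_superset[OF z fin S(2,1)] Phi_superset[OF z' fin S(3,1)] by simp_all
  have Phi_lip: "\<bar>Phi z - Phi z'\<bar> \<le> 2 * D ^ 6 * (8 / \<delta> z * ?d)"
  proof -
    have "\<bar>Phi z - Phi z'\<bar> \<le> (\<Sum>k\<in>?S. \<bar>phi k z - phi k z'\<bar>)"
      unfolding PhiS sum_subtractf[symmetric] by (rule sum_abs)
    also have "\<dots> \<le> (\<Sum>k\<in>?S. 8 / \<delta> z * ?d)" by (intro sum_mono phi_lip')
    also have "\<dots> = real (card ?S) * (8 / \<delta> z * ?d)" by simp
    also have "\<dots> \<le> 2 * D ^ 6 * (8 / \<delta> z * ?d)" using card pos by (intro mult_right_mono) auto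
    finally show ?thesis .
  qed
  have coeff: "\<bar>phi k z / Phi z - phi k z' / Phi z'\<bar> \<le> (16 + 64 * D ^ 6) * ?d / \<delta> z" if k: "k \<in> ?S" for k
  proof -
    have kpos: "0 < \<delta> k" using \<delta>k[OF k] pos by linarith
    have "phi k z / Phi z - phi k z' / Phi z'
        = (phi k z - phi k z') / Phi z + phi k z' * (Phi z' - Phi z) / (Phi z * Phi z')"
      using P by (simp add: field_simps)
    then have "\<bar>phi k z / Phi z - phi k z' / Phi z'\<bar>
        \<le> \<bar>phi k z - phi k z'\<bar> / Phi z + phi k z' * \<bar>Phi z' - Phi z\<bar> / (Phi z * Phi z')"
      using abs_triangle_ineq[of "(phi k z - phi k z') / Phi z" "phi k z' * (Phi z' - Phi z) / (Phi z * Phi z')"]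
        P phi(1)[of k z'] by (simp add: abs_mult)
    also have "\<dots> \<le> (8 / \<delta> z * ?d) / (1/2) + 1 * (2 * D ^ 6 * (8 / \<delta> z * ?d)) / (1/2 * (1/2))"
    proof (intro add_mono frac_le mult_mono)
      show "\<bar>phi k z - phi k z'\<bar> \<le> 8 / \<delta> z * ?d" by (rule phi_lip'[OF k])
      show "phi k z' \<le> 1" by (rule phi(2)[OF kpos])
      show "\<bar>Phi z' - Phi z\<bar> \<le> 2 * D ^ 6 * (8 / \<delta> z * ?d)" using Phi_lip by (simp add: abs_minus_commute)
    qed (use P pos D1 phi(1) in auto)
    also have "\<dots> = (16 + 64 * D ^ 6) * ?d / \<delta> z" using pos by (simp add: field_simps)
    finally show ?thesis .
  qed
  have "interp a z - interp a z' = (interp a z - a k0) - (interp a z' - a k0)" by simp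
  also have "\<dots> = (\<Sum>k\<in>?S. (phi k z / Phi z - phi k z' / Phi z') *\<^sub>R (a k - a k0))"
    unfolding interp_diff[OF z fin S(2,1)] interp_diff[OF z' fin S(3,1)]
    by (simp add: sum_subtractf scaleR_diff_left)
  also have "norm \<dots> \<le> (\<Sum>k\<in>?S. \<bar>phi k z / Phi z - phi k z' / Phi z'\<bar> * norm (a k - a k0))"
    by (rule order_trans[OF norm_sum]) simp
  also have "\<dots> \<le> (\<Sum>k\<in>?S. ((16 + 64 * D ^ 6) * ?d / \<delta> z) * \<epsilon>)"
    using coeff a k0 \<epsilon> pos D1 by (intro sum_mono mult_mono) auto
  also have "\<dots> = real (card ?S) * (((16 + 64 * D ^ 6) * ?d / \<delta> z) * \<epsilon>)" by simp
  also have "\<dots> \<le> (2 * D ^ 6) * (((16 + 64 * D ^ 6) * ?d / \<delta> z) * \<epsilon>)"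
    using card pos D1 \<epsilon> by (intro mult_right_mono) auto
  also have "\<dots> = CN * ?d / \<delta> z * \<epsilon>" by (simp add: CN_def)
  finally show ?thesis .
qed

end

definition lev :: "int \<Rightarrow> real" where "lev i = 2 powr real_of_int i"

lemma lev_pos: "0 < lev i" by (simp add: lev_def)

lemma lev_mono: "i \<le> j \<Longrightarrow> lev i \<le> lev j" by (simp add: lev_def)

lemma ex_lev: "0 < t \<Longrightarrow> \<exists>i. t \<le> lev i \<and> lev i \<le> 2 * t"
proof -
  assume t: "0 < t"
  define i where "i = \<lceil>log 2 t\<rceil>"
  have "t = 2 powr (log 2 t)" using t by simp
  also have "\<dots> \<le> 2 powr real_of_int i" by (intro powr_mono) (auto simp: i_def)
  finally have 1: "t \<le> lev i" by (simp add: lev_def)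
  have "real_of_int i \<le> 1 + log 2 t" unfolding i_def by linarith
  then have "lev i \<le> 2 powr (1 + log 2 t)" unfolding lev_def by (intro powr_mono) auto
  also have "\<dots> = 2 * t" using t by (simp add: powr_add)
  finally show ?thesis using 1 by blast
qed

section \<open>Values at the Whitney centres\<close>

text \<open>\<open>V i\<close> is the bad set at level \<open>lev i\<close>: off it \<open>u\<close>
  is bounded by the level and Lipschitz with a multiple of it. The Sobolev property of
  \<open>u\<close> enters only through these sets.\<close>

locale whitney_extension = whitney_partition +
  fixes c0 p Cu :: real and u :: "'a \<Rightarrow> 'v::banach" and V :: "int \<Rightarrow> 'a set"
  assumes \<Omega>_sets: "\<Omega> \<in> sets M" and c0: "0 < c0" and p: "1 \<le> p" and Cu: "0 \<le> Cu"
    and density: "\<And>x r. x \<in> \<Omega> \<Longrightarrow> 0 < r \<Longrightarrow> r \<le> 1 \<Longrightarrow>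
      ennreal c0 * emeasure M (X \<inter> ball x r) \<le> emeasure M (X \<inter> ball x r \<inter> \<Omega>)"
    and V_sets [measurable]: "\<And>i. V i \<in> sets M" and V_sub: "\<And>i. V i \<subseteq> \<Omega>"
    and V_anti: "\<And>i j. i \<le> j \<Longrightarrow> V j \<subseteq> V i"
    and u_bound: "\<And>x i. x \<in> \<Omega> \<Longrightarrow> x \<notin> V i \<Longrightarrow> norm (u x) \<le> lev i"
    and u_lip: "\<And>x y i. x \<in> \<Omega> \<Longrightarrow> y \<in> \<Omega> \<Longrightarrow> x \<notin> V i \<Longrightarrow> y \<notin> V i \<Longrightarrow>
      norm (u x - u y) \<le> Cu * lev i * dist x y"
begin

lemma \<Omega>_X: "\<Omega> \<subseteq> X" using sets.sets_into_space[OF \<Omega>_sets] by simp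

text \<open>Half the proportion that \<open>\<Omega>\<close> is sure to have in a ball about a point
  near it, so a set of proportion \<open>\<kappa>\<close> cannot cover \<open>\<Omega>\<close>
  there.\<close>

definition \<kappa> where "\<kappa> = c0 / (2 * D ^ 2)"

lemma \<kappa>: "0 < \<kappa>" "2 * \<kappa> * D ^ 2 = c0"
  using c0 D1 by (auto simp: \<kappa>_def)

text \<open>A point \<open>x\<close> of \<open>\<Omega>\<close> within \<open>t\<close> of
  \<open>k\<close> has its \<open>t\<close>-ball inside the given ball and its
  \<open>4 * t\<close>-ball around it; density at \<open>x\<close> and two doublings do the
  rest.\<close>

lemma density_ball:
  assumes k: "k \<in> X" "\<delta> k < t" and t: "0 < t" "t \<le> 1"
  shows "ennreal (2 * \<kappa>) * emeasure M (X \<inter> ball k (2 * t)) \<le> emeasure M (X \<inter> ball k (2 * t) \<inter> \<Omega>)"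
proof -
  obtain x where x: "x \<in> \<Omega>" "dist k x < t" using k(2) unfolding infdist_notempty[OF \<Omega>_ne]
    by (subst (asm) cINF_less_iff[OF \<Omega>_ne]) (auto intro!: bdd_belowI2[where m = 0])
  have xX: "x \<in> X" using x \<Omega>_X by auto
  have sub1: "ball k (2 * t) \<subseteq> ball x (2 ^ 2 * t)"
  proof
    fix y assume "y \<in> ball k (2 * t)"
    then show "y \<in> ball x (2 ^ 2 * t)" using x dist_triangle3[of x y k] t by auto
  qed
  have sub2: "ball x t \<subseteq> ball k (2 * t)"
  proof
    fix y assume "y \<in> ball x t"
    then show "y \<in> ball k (2 * t)" using x dist_triangle[of k y x] by auto
  qed
  have "emeasure M (X \<inter> ball k (2 * t)) \<le> emeasure M (X \<inter> ball x (2 ^ 2 * t))"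
    using sub1 by (intro emeasure_mono) auto
  also have "\<dots> \<le> ennreal (D ^ 2) * emeasure M (X \<inter> ball x t)"
    by (rule doubling_all_le[OF xX t(1)]) simp
  finally have "ennreal (2 * \<kappa>) * emeasure M (X \<inter> ball k (2 * t))
      \<le> ennreal (2 * \<kappa>) * (ennreal (D ^ 2) * emeasure M (X \<inter> ball x t))"
    by (rule mult_left_mono) simp
  also have "\<dots> = ennreal c0 * emeasure M (X \<inter> ball x t)"
    using \<kappa> D1 by (simp add: mult.assoc[symmetric] ennreal_mult[symmetric])
  also have "\<dots> \<le> emeasure M (X \<inter> ball x t \<inter> \<Omega>)" by (rule density[OF x(1) t])
  also have "\<dots> \<le> emeasure M (X \<inter> ball k (2 * t) \<inter> \<Omega>)"
    using sub2 \<Omega>_sets by (intro emeasure_mono) auto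
  finally show ?thesis .
qed

lemma less_two_\<kappa>:
  assumes "k \<in> X" "0 < r" shows "ennreal \<kappa> * emeasure M (X \<inter> ball k r) < ennreal (2 * \<kappa>) * emeasure M (X \<inter> ball k r)"
proof -
  obtain b where "emeasure M (X \<inter> ball k r) = ennreal b" "0 < b"
    using emeasure_ball[OF assms] emeasure_ball_finite[OF assms(1), of r] by (cases "emeasure M (X \<inter> ball k r)") auto
  then show ?thesis using \<kappa> by (simp add: ennreal_mult[symmetric] ennreal_less_iff)
qed

definition bdry where "bdry = X \<inter> closure \<Omega> - \<Omega>"

text \<open>At a density point of \<open>bdry\<close> the complement has proportion at most
  \<open>\<kappa>\<close> in small balls, whereas \<open>\<Omega>\<close>, which misses
  \<open>bdry\<close>, has at least \<open>2 * \<kappa>\<close>. Values therefore matter only off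
  the closure of \<open>\<Omega>\<close>.\<close>

lemma bdry_null: "bdry \<in> null_sets M"
proof -
  have bdry: "bdry \<in> sets M"
    unfolding bdry_def using borel_X_sets[OF borel_X_Int, of "closure \<Omega>"] \<Omega>_sets by auto
  interpret d: doubling_space X \<mu> D 1 by (rule doubling_space) simp
  have "AE x in M. x \<notin> bdry"
    using d.Lebesgue_density[OF bdry \<kappa>(1)]
  proof (rule eventually_mono)
    fix x
    assume *: "x \<in> bdry \<longrightarrow> (\<exists>d>0. \<forall>r. 0 < r \<and> r < d \<longrightarrow>
      emeasure M (X \<inter> ball x r - bdry) \<le> ennreal \<kappa> * emeasure M (X \<inter> ball x r))"
    show "x \<notin> bdry"
    proof
      assume x: "x \<in> bdry"
      then obtain d where d: "0 < d" "\<And>r. 0 < r \<Longrightarrow> r < d \<Longrightarrow>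
        emeasure M (X \<inter> ball x r - bdry) \<le> ennreal \<kappa> * emeasure M (X \<inter> ball x r)" using * by blast
      define t where "t = min (d / 4) 1"
      have t: "0 < t" "t \<le> 1" "2 * t < d" using d(1) by (auto simp: t_def)
      have xX: "x \<in> X" "\<delta> x = 0"
        using x in_closure_iff_infdist_zero[OF \<Omega>_ne, of x] by (auto simp: bdry_def)
      have "ennreal (2 * \<kappa>) * emeasure M (X \<inter> ball x (2 * t)) \<le> emeasure M (X \<inter> ball x (2 * t) \<inter> \<Omega>)"
        using xX t by (intro density_ball) auto
      also have "\<dots> \<le> emeasure M (X \<inter> ball x (2 * t) - bdry)"
        using bdry by (intro emeasure_mono) (auto simp: bdry_def)
      also have "\<dots> \<le> ennreal \<kappa> * emeasure M (X \<inter> ball x (2 * t))" using t by (intro d(2)) auto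
      also have "\<dots> < ennreal (2 * \<kappa>) * emeasure M (X \<inter> ball x (2 * t))"
        using t xX by (intro less_two_\<kappa>) auto
      finally show False by simp
    qed
  qed
  then have "{x\<in>X. \<not> x \<notin> bdry} \<in> null_sets M" unfolding AE_iff_null .
  moreover have "{x\<in>X. \<not> x \<notin> bdry} = bdry" by (auto simp: bdry_def)
  ultimately show ?thesis by simp
qed

text \<open>One point can serve all levels at once because the sets \<^term>\<open>V i\<close> decrease: their union over
  the admissible levels is a monotone limit and still has small density.\<close>

lemma good_point:
  assumes k: "k \<in> W" "\<delta> k \<le> 1 / 2"
  shows "\<exists>z\<in>\<Omega>. dist k z < 4 * \<delta> k \<and>
    (\<forall>i. emeasure M (V i \<inter> (X \<inter> ball k (4 * \<delta> k))) \<le> ennreal \<kappa> * emeasure M (X \<inter> ball k (4 * \<delta> k)) \<longrightarrow> z \<notin> V i)"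
proof -
  have pos: "0 < \<delta> k" by (rule \<delta>_pos[OF k(1)])
  have kX: "k \<in> X" by (rule W_X[OF k(1)])
  let ?B = "X \<inter> ball k (4 * \<delta> k)"
  define S where "S = {i. emeasure M (V i \<inter> ?B) \<le> ennreal \<kappa> * emeasure M ?B}"
  \<comment> \<open>Cutting the levels off at \<open>- int n\<close> gives a least one, whose bad
    set contains the others; then \<open>n\<close> tends to infinity.\<close>
  define A where "A n = (\<Union>i\<in>S \<inter> {- int n..}. V i \<inter> ?B)" for n
  have VB: "V i \<inter> ?B \<in> sets M" for i by auto
  have A_sets: "A n \<in> sets M" for n
    unfolding A_def by (rule sets.countable_UN'') (use VB in auto)
  have A_le: "emeasure M (A n) \<le> ennreal \<kappa> * emeasure M ?B" for n
  proof (cases "S \<inter> {- int n..} = {}")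
    case True
    then show ?thesis unfolding A_def by simp
  next
    case False
    then obtain j where j: "j \<in> S" "- int n \<le> j" by auto
    let ?P = "\<lambda>m::nat. - int n + int m \<in> S"
    have "?P (nat (j + int n))" using j by simp
    then have L: "?P (LEAST m. ?P m)" by (rule LeastI)
    define i0 where "i0 = - int n + int (LEAST m. ?P m)"
    have i0: "i0 \<in> S" using L by (simp add: i0_def)
    have "i0 \<le> i" if "i \<in> S \<inter> {- int n..}" for i
    proof -
      have "?P (nat (i + int n))" using that by simp
      then have "(LEAST m. ?P m) \<le> nat (i + int n)" by (rule Least_le)
      then have "int (LEAST m. ?P m) \<le> int (nat (i + int n))" by (simp only: of_nat_le_iff)
      also have "\<dots> = i + int n" using that by simp
      finally show ?thesis unfolding i0_def by linarith
    qed
    then have "A n \<subseteq> V i0 \<inter> ?B" unfolding A_def using V_anti by blast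
    then have "emeasure M (A n) \<le> emeasure M (V i0 \<inter> ?B)" using VB by (intro emeasure_mono)
    also have "\<dots> \<le> ennreal \<kappa> * emeasure M ?B" using i0 by (simp add: S_def)
    finally show ?thesis .
  qed
  have "emeasure M (\<Union>n. A n) = (SUP n. emeasure M (A n))"
  proof (rule SUP_emeasure_incseq[symmetric])
    show "incseq A"
    proof (rule incseq_SucI)
      fix n show "A n \<subseteq> A (Suc n)" unfolding A_def by (intro UN_mono) auto
    qed
  qed (use A_sets in auto)
  also have "\<dots> \<le> ennreal \<kappa> * emeasure M ?B" by (rule SUP_least) (rule A_le)
  also have "\<dots> < ennreal (2 * \<kappa>) * emeasure M ?B" using pos by (intro less_two_\<kappa> kX) simp
  \<comment> \<open>\<open>density_ball\<close> at scale \<open>2 * \<delta> k\<close>, which must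
    be at most 1: the origin of the threshold 1 / 2.\<close>
  also have "\<dots> \<le> emeasure M (?B \<inter> \<Omega>)"
    using density_ball[OF kX, of "2 * \<delta> k"] pos k(2) by simp
  finally have "\<not> ?B \<inter> \<Omega> \<subseteq> (\<Union>n. A n)"
    using emeasure_mono[of "?B \<inter> \<Omega>" "\<Union>n. A n" M] A_sets by (auto simp: not_le[symmetric])
  then obtain z where z: "z \<in> ?B" "z \<in> \<Omega>" "z \<notin> (\<Union>n. A n)" by blast
  have "z \<notin> V i" if "i \<in> S" for i
  proof
    assume "z \<in> V i"
    then have "z \<in> A (nat (- i))" using z that unfolding A_def by auto
    then show False using z by blast
  qed
  then show ?thesis using z by (intro bexI[of _ z]) (auto simp: S_def)
qed

definition zpt where "zpt k = (SOME z. z \<in> \<Omega> \<and> dist k z < 4 * \<delta> k \<and>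
    (\<forall>i. emeasure M (V i \<inter> (X \<inter> ball k (4 * \<delta> k))) \<le> ennreal \<kappa> * emeasure M (X \<inter> ball k (4 * \<delta> k)) \<longrightarrow> z \<notin> V i))"

lemma zpt:
  assumes "k \<in> W" "\<delta> k \<le> 1 / 2"
  shows "zpt k \<in> \<Omega>" "dist k (zpt k) < 4 * \<delta> k"
    "emeasure M (V i \<inter> (X \<inter> ball k (4 * \<delta> k))) \<le> ennreal \<kappa> * emeasure M (X \<inter> ball k (4 * \<delta> k)) \<Longrightarrow> zpt k \<notin> V i"
proof -
  have "zpt k \<in> \<Omega> \<and> dist k (zpt k) < 4 * \<delta> k \<and>
    (\<forall>i. emeasure M (V i \<inter> (X \<inter> ball k (4 * \<delta> k))) \<le> ennreal \<kappa> * emeasure M (X \<inter> ball k (4 * \<delta> k)) \<longrightarrow> zpt k \<notin> V i)"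
    unfolding zpt_def by (rule someI_ex) (use good_point[OF assms] in blast)
  then show "zpt k \<in> \<Omega>" "dist k (zpt k) < 4 * \<delta> k"
    "emeasure M (V i \<inter> (X \<inter> ball k (4 * \<delta> k))) \<le> ennreal \<kappa> * emeasure M (X \<inter> ball k (4 * \<delta> k)) \<Longrightarrow> zpt k \<notin> V i"
    by blast+
qed

text \<open>Farther than 1/2 from \<open>\<Omega>\<close> the measure density gives no good point
  and the value is 0. At level i the other values are bounded by \<open>lev i\<close>, so this
  cut-off costs only a multiple of the level.\<close>

definition val :: "'a \<Rightarrow> 'v" where "val k = (if \<delta> k \<le> 1 / 2 then u (zpt k) else 0)"

definition adm where "adm i k \<longleftrightarrow> k \<in> W \<and> (\<delta> k \<le> 1 / 2 \<longrightarrow> zpt k \<notin> V i)"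

definition C3 :: real where "C3 = 4 * Cu + 4"

lemma C3: "4 * Cu \<le> C3" "4 \<le> C3" "0 < C3" using Cu by (auto simp: C3_def)

lemma val_bound: "adm i k \<Longrightarrow> norm (val k) \<le> lev i"
  using u_bound zpt(1) lev_pos[of i] by (auto simp: val_def adm_def)

text \<open>If both centres are near \<open>\<Omega>\<close>, compare \<open>u\<close> at the points
  \<open>zpt\<close>, whose distance is controlled. Otherwise the bracket is at least 1/2 and the
  bound \<open>lev i\<close> on both values suffices.\<close>

lemma val_diff:
  assumes "adm i k" "adm i l"
  shows "norm (val k - val l) \<le> C3 * lev i * (dist k l + \<delta> k + \<delta> l)"
proof (cases "\<delta> k \<le> 1 / 2 \<and> \<delta> l \<le> 1 / 2")
  case True
  then have kl: "zpt k \<notin> V i" "zpt l \<notin> V i" "k \<in> W" "l \<in> W" using assms by (auto simp: adm_def)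
  have "norm (val k - val l) \<le> Cu * lev i * dist (zpt k) (zpt l)"
    using True kl u_lip zpt(1) by (simp add: val_def)
  also have "dist (zpt k) (zpt l) \<le> 4 * (dist k l + \<delta> k + \<delta> l)"
  proof -
    have "dist (zpt k) (zpt l) \<le> dist k (zpt k) + dist k l + dist l (zpt l)"
      using dist_triangle3[of "zpt k" "zpt l" k] dist_triangle[of k "zpt l" l] by linarith
    moreover have "0 \<le> dist k l" by simp
    ultimately show ?thesis
      using zpt(2)[OF kl(3)] zpt(2)[OF kl(4)] True unfolding distrib_left by linarith
  qed
  also have "Cu * lev i * (4 * (dist k l + \<delta> k + \<delta> l)) = (4 * Cu) * (lev i * (dist k l + \<delta> k + \<delta> l))" by simp
  also have "\<dots> \<le> C3 * (lev i * (dist k l + \<delta> k + \<delta> l))"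
    using C3(1) lev_pos[of i] infdist_nonneg[of k \<Omega>] infdist_nonneg[of l \<Omega>] by (intro mult_right_mono) auto
  finally show ?thesis using Cu lev_pos[of i] by (simp add: mult_left_mono mult.assoc)
next
  case False
  have "norm (val k - val l) \<le> 2 * lev i"
    using norm_triangle_ineq4[of "val k" "val l"] val_bound[OF assms(1)] val_bound[OF assms(2)] by linarith
  also have "\<dots> \<le> 4 * lev i * (dist k l + \<delta> k + \<delta> l)"
  proof -
    have "1 / 2 \<le> dist k l + \<delta> k + \<delta> l"
      using False infdist_nonneg[of k \<Omega>] infdist_nonneg[of l \<Omega>] zero_le_dist[of k l] by linarith
    then have "4 * lev i * (1 / 2) \<le> 4 * lev i * (dist k l + \<delta> k + \<delta> l)"
      using lev_pos[of i] by (intro mult_left_mono) auto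
    then show ?thesis by simp
  qed
  also have "\<dots> \<le> C3 * lev i * (dist k l + \<delta> k + \<delta> l)"
    using C3(2) lev_pos[of i] infdist_nonneg[of k \<Omega>] infdist_nonneg[of l \<Omega>]
    by (intro mult_right_mono) auto
  finally show ?thesis .
qed

lemma val_u_diff:
  assumes k: "adm i k" and y: "y \<in> \<Omega>" "y \<notin> V i"
  shows "norm (val k - u y) \<le> C3 * lev i * (dist k y + \<delta> k)"
proof (cases "\<delta> k \<le> 1 / 2")
  case True
  then have kl: "zpt k \<notin> V i" "k \<in> W" using k by (auto simp: adm_def)
  have "norm (val k - u y) \<le> Cu * lev i * dist (zpt k) y"
    using True kl u_lip zpt(1) y by (simp add: val_def)
  also have "dist (zpt k) y \<le> 4 * (dist k y + \<delta> k)"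
    using dist_triangle3[of "zpt k" y k] zpt(2)[OF kl(2) True] zero_le_dist[of k y]
    unfolding distrib_left by linarith
  also have "Cu * lev i * (4 * (dist k y + \<delta> k)) = (4 * Cu) * (lev i * (dist k y + \<delta> k))" by simp
  also have "\<dots> \<le> C3 * (lev i * (dist k y + \<delta> k))"
    using C3(1) lev_pos[of i] infdist_nonneg[of k \<Omega>] by (intro mult_right_mono) auto
  finally show ?thesis using Cu lev_pos[of i] by (simp add: mult_left_mono mult.assoc)
next
  case False
  have "norm (val k - u y) \<le> 2 * lev i"
    using norm_triangle_ineq4[of "val k" "u y"] val_bound[OF k] u_bound[OF y] by linarith
  also have "\<dots> \<le> 4 * lev i * (dist k y + \<delta> k)"
  proof -
    have "1 / 2 \<le> dist k y + \<delta> k" using False zero_le_dist[of k y] by linarith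
    then have "4 * lev i * (1 / 2) \<le> 4 * lev i * (dist k y + \<delta> k)"
      using lev_pos[of i] by (intro mult_left_mono) auto
    then show ?thesis by simp
  qed
  also have "\<dots> \<le> C3 * lev i * (dist k y + \<delta> k)"
    using C3(2) lev_pos[of i] infdist_nonneg[of k \<Omega>] by (intro mult_right_mono) auto
  finally show ?thesis .
qed

section \<open>Enlarged bad sets\<close>

text \<open>The union of these balls is where the uncentred maximal function of the indicator of
  \<open>V i\<close> over radii up to 2 reaches \<open>\<kappa>\<close>. The radii used are
  \<open>4 * \<delta> k\<close> with \<open>\<delta> k \<le> 1 / 2\<close>.\<close>

definition max_balls where
  "max_balls i = {(x, r). x \<in> X \<and> 0 < r \<and> r \<le> 2 \<and> ennreal \<kappa> * emeasure M (X \<inter> ball x r) \<le> emeasure M (V i \<inter> (X \<inter> ball x r))}"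

definition maxV where "maxV i = (\<Union>(x, r)\<in>max_balls i. X \<inter> ball x r)"

lemma maxV_sets: "maxV i \<in> sets M"
proof -
  have "maxV i = X \<inter> (\<Union>(x, r)\<in>max_balls i. ball x r)" by (auto simp: maxV_def)
  moreover have "open (\<Union>(x, r)\<in>max_balls i. ball x r)" by (intro open_UN) auto
  ultimately show ?thesis by (metis borel_X_Int borel_X_sets borel_open)
qed

text \<open>The weak-type estimate for that maximal function; three doublings cover the factor
  5.\<close>

lemma emeasure_maxV: "emeasure M (maxV i) \<le> ennreal (D ^ 3 / \<kappa>) * emeasure M (V i)"
proof -
  have "emeasure M (\<Union>(x, r)\<in>max_balls i. X \<inter> ball x r) \<le> ennreal (D ^ 3 / \<kappa>) * (\<integral>\<^sup>+y. indicator (V i) y \<partial>M)"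
  proof (rule covering_bound[where R = 2])
    show "indicator (V i) \<in> borel_measurable M" by simp
    fix x r assume xr: "(x, r) \<in> max_balls i"
    then show "x \<in> X \<and> 0 < r \<and> r \<le> 2" by (auto simp: max_balls_def)
    have "emeasure M (X \<inter> ball x (5 * r)) \<le> ennreal (D ^ 3) * emeasure M (X \<inter> ball x r)"
      by (rule doubling_all_le) (use xr in \<open>auto simp: max_balls_def\<close>)
    also have "\<dots> = ennreal (D ^ 3 / \<kappa>) * (ennreal \<kappa> * emeasure M (X \<inter> ball x r))"
      using \<kappa> D1 by (simp add: mult.assoc[symmetric] ennreal_mult[symmetric])
    also have "\<dots> \<le> ennreal (D ^ 3 / \<kappa>) * emeasure M (V i \<inter> (X \<inter> ball x r))"
      using xr by (intro mult_left_mono) (auto simp: max_balls_def)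
    also have "emeasure M (V i \<inter> (X \<inter> ball x r)) = (\<integral>\<^sup>+y. indicator (V i) y * indicator (X \<inter> ball x r) y \<partial>M)"
    proof -
      have "V i \<inter> (X \<inter> ball x r) \<in> sets M" by auto
      then have "emeasure M (V i \<inter> (X \<inter> ball x r)) = (\<integral>\<^sup>+y. indicator (V i \<inter> (X \<inter> ball x r)) y \<partial>M)"
        by (rule nn_integral_indicator[symmetric])
      then show ?thesis by (simp only: indicator_inter_arith)
    qed
    finally show "emeasure M (X \<inter> ball x (5 * r))
        \<le> ennreal (D ^ 3 / \<kappa>) * (\<integral>\<^sup>+y. indicator (V i) y * indicator (X \<inter> ball x r) y \<partial>M)"
      by (simp add: mult_left_mono)
  qed
  then show ?thesis by (simp add: maxV_def)
qed

text \<open>A Borel hull, because gradients are Borel functions. It also contains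
  \<open>bdry\<close>, so a point off \<open>H i\<close> lies in \<open>\<Omega>\<close> outside
  \<open>V i\<close> or off the closure of \<open>\<Omega>\<close>.\<close>

definition H where
  "H i = (SOME B. B \<in> sets borel_X \<and> maxV i \<union> V i \<union> bdry \<subseteq> B \<and> emeasure M B = emeasure M (maxV i \<union> V i \<union> bdry))"

lemma H: "H i \<in> sets borel_X" "maxV i \<union> V i \<union> bdry \<subseteq> H i" "emeasure M (H i) \<le> ennreal (D ^ 3 / \<kappa> + 1) * emeasure M (V i)"
proof -
  have m: "maxV i \<union> V i \<union> bdry \<in> sets M" using maxV_sets bdry_null by auto
  obtain B where "B \<in> sets borel_X" "maxV i \<union> V i \<union> bdry \<subseteq> B" "emeasure M B = emeasure M (maxV i \<union> V i \<union> bdry)"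
    by (rule borel_hull[OF m])
  then have "H i \<in> sets borel_X \<and> maxV i \<union> V i \<union> bdry \<subseteq> H i \<and> emeasure M (H i) = emeasure M (maxV i \<union> V i \<union> bdry)"
    unfolding H_def by (intro someI_ex[where P = "\<lambda>B. B \<in> sets borel_X \<and> maxV i \<union> V i \<union> bdry \<subseteq> B \<and> emeasure M B = emeasure M (maxV i \<union> V i \<union> bdry)"]) blast
  then show "H i \<in> sets borel_X" "maxV i \<union> V i \<union> bdry \<subseteq> H i"
    and e: "emeasure M (H i) \<le> ennreal (D ^ 3 / \<kappa> + 1) * emeasure M (V i)"
  proof -
    assume H: "H i \<in> sets borel_X \<and> maxV i \<union> V i \<union> bdry \<subseteq> H i \<and> emeasure M (H i) = emeasure M (maxV i \<union> V i \<union> bdry)"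
    then show "H i \<in> sets borel_X" "maxV i \<union> V i \<union> bdry \<subseteq> H i" by auto
    have "emeasure M (maxV i \<union> V i \<union> bdry) = emeasure M (maxV i \<union> V i)"
      by (rule emeasure_Un_null_set) (use maxV_sets bdry_null in auto)
    also have "\<dots> \<le> emeasure M (maxV i) + emeasure M (V i)"
      by (rule emeasure_subadditive) (use maxV_sets in auto)
    also have "\<dots> \<le> ennreal (D ^ 3 / \<kappa>) * emeasure M (V i) + emeasure M (V i)"
      by (intro add_right_mono emeasure_maxV)
    also have "\<dots> = ennreal (D ^ 3 / \<kappa> + 1) * emeasure M (V i)"
      using D1 \<kappa> by (subst ennreal_plus) (auto simp: distrib_right)
    finally show "emeasure M (H i) \<le> ennreal (D ^ 3 / \<kappa> + 1) * emeasure M (V i)" using H by simp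
  qed
qed

end

context whitney_extension begin

definition wext :: "'a \<Rightarrow> 'v" where "wext z = (if z \<in> \<Omega> then u z else interp val z)"

lemma off_H: "z \<in> X \<Longrightarrow> z \<notin> H i \<Longrightarrow> (z \<in> \<Omega> \<and> z \<notin> V i) \<or> (z \<in> W \<and> z \<notin> \<Omega>)"
  using H(2)[of i] closure_subset[of \<Omega>] by (auto simp: W_def bdry_def)

text \<open>\<open>z\<close> lies in the ball of radius \<open>4 * \<delta> k\<close> about each
  active centre. Off \<open>maxV i\<close> the set \<open>V i\<close> has small proportion in that
  ball, which is the condition under which \<open>zpt k\<close> avoids \<open>V i\<close>.\<close>

lemma adm_J:
  assumes z: "z \<in> W" "z \<notin> H i" and k: "k \<in> J z"
  shows "adm i k"
proof -
  have kW: "k \<in> W" and d: "4 * dist z k < \<delta> k" and pos: "0 < \<delta> k" using J_est[OF k] by auto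
  have "zpt k \<notin> V i" if h: "\<delta> k \<le> 1 / 2"
  proof (rule zpt(3)[OF kW h])
    have "z \<in> X \<inter> ball k (4 * \<delta> k)" using W_X[OF z(1)] d pos by (auto simp: dist_commute)
    moreover have "z \<notin> maxV i" using z(2) H(2)[of i] by auto
    ultimately have "(k, 4 * \<delta> k) \<notin> max_balls i" unfolding maxV_def by blast
    then show "emeasure M (V i \<inter> (X \<inter> ball k (4 * \<delta> k))) \<le> ennreal \<kappa> * emeasure M (X \<inter> ball k (4 * \<delta> k))"
      using W_X[OF kW] pos h by (auto simp: max_balls_def)
  qed
  then show ?thesis using kW by (simp add: adm_def)
qed

lemma wext_bound:
  assumes "z \<in> X" "z \<notin> H i" shows "norm (wext z) \<le> lev i"
  using off_H[OF assms]
proof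
  assume "z \<in> \<Omega> \<and> z \<notin> V i"
  then show ?thesis using u_bound by (simp add: wext_def)
next
  assume z: "z \<in> W \<and> z \<notin> \<Omega>"
  have "norm (interp val z - 0) \<le> lev i"
    by (rule interp_close) (use z val_bound adm_J assms in auto)
  then show ?thesis using z by (simp add: wext_def)
qed

lemma J_nonempty: "z \<in> W \<Longrightarrow> \<exists>k. k \<in> J z"
proof (rule ccontr)
  assume z: "z \<in> W" and "\<nexists>k. k \<in> J z"
  then have "J z = {}" by blast
  then show False using Phi_ge[OF z] by (simp add: Phi_def)
qed

lemma val_diff_le:
  assumes "adm i k" "adm i l" "dist k l + \<delta> k + \<delta> l \<le> t"
  shows "norm (val k - val l) \<le> C3 * lev i * t"
  by (rule order_trans[OF val_diff[OF assms(1,2)]])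
    (use assms(3) C3 lev_pos[of i] in \<open>auto intro!: mult_left_mono\<close>)

lemma interp_near_val:
  assumes z: "z \<in> W" "z \<notin> H i" and k0: "k0 \<in> J z"
  shows "norm (interp val z - val k0) \<le> C3 * lev i * (6 * \<delta> z)"
proof (rule interp_close[OF z(1)])
  fix k assume k: "k \<in> J z"
  show "norm (val k - val k0) \<le> C3 * lev i * (6 * \<delta> z)"
  proof (rule val_diff_le[OF adm_J[OF z k] adm_J[OF z k0]])
    show "dist k k0 + \<delta> k + \<delta> k0 \<le> 6 * \<delta> z"
      using J_est(3,5)[OF k] J_est(3,5)[OF k0] dist_triangle3[of k k0 z] \<delta>_pos[OF z(1)] by linarith
  qed
qed

lemma interp_near_u:
  assumes z: "z \<in> W" "z \<notin> H i" and y: "y \<in> \<Omega>" "y \<notin> V i"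
  shows "norm (interp val z - u y) \<le> C3 * lev i * (3 * dist z y)"
proof (rule interp_close[OF z(1)])
  fix k assume k: "k \<in> J z"
  have "\<delta> z \<le> dist z y" by (rule infdist_le[OF y(1)])
  then have "dist k y + \<delta> k \<le> 3 * dist z y"
    using J_est(3,5)[OF k] dist_triangle3[of k y z] \<delta>_pos[OF z(1)] by linarith
  then have "C3 * lev i * (dist k y + \<delta> k) \<le> C3 * lev i * (3 * dist z y)"
    using C3 lev_pos[of i] by (intro mult_left_mono) auto
  then show "norm (val k - u y) \<le> C3 * lev i * (3 * dist z y)"
    using val_u_diff[OF adm_J[OF z k] y] by (rule order_trans[rotated])
qed

text \<open>In \<open>interp_lipschitz\<close>, 1609 arises from pairs far apart relative to
  \<open>\<delta>\<close> and \<open>6 * CN\<close> from close ones.\<close>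

definition CL :: real where "CL = C3 * (1609 + 6 * CN)"

lemma CN: "0 \<le> CN" using D1 by (simp add: CN_def)

lemma CL: "1609 * C3 \<le> CL" "6 * CN * C3 \<le> CL" "Cu \<le> CL" "3 * C3 \<le> CL" "0 < CL"
proof -
  have e: "CL = 1609 * C3 + 6 * CN * C3" by (simp add: CL_def distrib_left mult.commute mult.left_commute)
  have "0 \<le> 6 * CN * C3" using CN C3 by simp
  then show "1609 * C3 \<le> CL" "6 * CN * C3 \<le> CL" "Cu \<le> CL" "3 * C3 \<le> CL" "0 < CL"
    using e C3 Cu by linarith+
qed

text \<open>Points closer than a hundredth of their distance from \<open>\<Omega>\<close> are
  handled by the partition of unity, as the values at active centres vary by a multiple of
  \<open>lev i * \<delta> z\<close>. Otherwise each interpolant is compared with the value at one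
  active centre.\<close>

lemma interp_lipschitz:
  assumes z: "z \<in> W" "z \<notin> H i" and z': "z' \<in> W" "z' \<notin> H i"
  shows "norm (interp val z - interp val z') \<le> CL * lev i * dist z z'"
proof (cases "dist z z' \<le> \<delta> z / 100")
  case True
  have pos: "0 < \<delta> z" by (rule \<delta>_pos[OF z(1)])
  have \<delta>z': "\<delta> z' \<le> \<delta> z + \<delta> z / 100" using \<delta>_lip[of z' z] True by (simp add: dist_commute)
  have est: "adm i k \<and> dist z k \<le> \<delta> z / 2 \<and> \<delta> k \<le> 2 * \<delta> z" if "k \<in> J z \<union> J z'" for k
    using that
  proof
    assume k: "k \<in> J z"
    then show ?thesis using adm_J[OF z k] J_est(3,5)[OF k] pos by auto
  next
    assume k: "k \<in> J z'"
    have "dist z k \<le> \<delta> z / 2"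
      using dist_triangle[of z k z'] J_est(3)[OF k] True \<delta>z' pos by linarith
    moreover have "\<delta> k \<le> 2 * \<delta> z" using J_est(5)[OF k] \<delta>z' pos by linarith
    ultimately show ?thesis using adm_J[OF z' k] by auto
  qed
  have "norm (interp val z - interp val z') \<le> CN * dist z z' / \<delta> z * (C3 * lev i * (6 * \<delta> z))"
  proof (rule interp_lip[OF z(1) z'(1) True])
    show "0 \<le> C3 * lev i * (6 * \<delta> z)" using C3 lev_pos[of i] pos by simp
    fix k l assume kl: "k \<in> J z \<union> J z'" "l \<in> J z \<union> J z'"
    show "norm (val k - val l) \<le> C3 * lev i * (6 * \<delta> z)"
    proof (rule val_diff_le)
      show "dist k l + \<delta> k + \<delta> l \<le> 6 * \<delta> z"
        using est[OF kl(1)] est[OF kl(2)] dist_triangle3[of k l z] pos by linarith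
    qed (use est kl in auto)
  qed
  also have "\<dots> = (6 * CN * C3) * (lev i * dist z z')" using pos by (simp add: field_simps)
  also have "\<dots> \<le> CL * (lev i * dist z z')"
    using CL(2) lev_pos[of i] by (intro mult_right_mono) auto
  finally show ?thesis by (simp add: mult.assoc)
next
  case False
  obtain k0 l0 where k0: "k0 \<in> J z" and l0: "l0 \<in> J z'" using J_nonempty z(1) z'(1) by blast
  have pos: "0 < \<delta> z" "0 < \<delta> z'" using \<delta>_pos z z' by auto
  have \<delta>z': "\<delta> z' \<le> \<delta> z + dist z z'" using \<delta>_lip[of z' z] by (simp add: dist_commute)
  have dk: "dist k0 l0 \<le> dist z k0 + dist z z' + dist z' l0"
    using dist_triangle3[of k0 l0 z] dist_triangle[of z l0 z'] by linarith
  have 3: "norm (val k0 - val l0) \<le> C3 * lev i * (dist z z' + 2 * \<delta> z + 2 * \<delta> z')"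
  proof (rule val_diff_le[OF adm_J[OF z k0] adm_J[OF z' l0]])
    show "dist k0 l0 + \<delta> k0 + \<delta> l0 \<le> dist z z' + 2 * \<delta> z + 2 * \<delta> z'"
      using dk J_est(3,5)[OF k0] J_est(3,5)[OF l0] pos by linarith
  qed
  have "norm (interp val z - interp val z')
      \<le> norm (interp val z - val k0) + norm (val k0 - val l0) + norm (interp val z' - val l0)"
    using norm_triangle_ineq[of "interp val z - val k0" "val k0 - val l0"]
      norm_triangle_ineq4[of "interp val z - val l0" "interp val z' - val l0"] by simp
  also have "\<dots> \<le> C3 * lev i * (6 * \<delta> z) + C3 * lev i * (dist z z' + 2 * \<delta> z + 2 * \<delta> z') + C3 * lev i * (6 * \<delta> z')"
    by (intro add_mono interp_near_val[OF z k0] interp_near_val[OF z' l0] 3)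
  also have "\<dots> = C3 * lev i * (8 * \<delta> z + 8 * \<delta> z' + dist z z')" by (simp add: algebra_simps)
  \<comment> \<open>\<open>\<delta> z < 100 * dist z z'\<close> and
    \<open>\<delta> z' \<le> \<delta> z + dist z z'\<close> give 16 * 100 + 9.\<close>
  also have "\<dots> \<le> C3 * lev i * (1609 * dist z z')"
    using False \<delta>z' C3 lev_pos[of i] by (intro mult_left_mono) auto
  also have "\<dots> = (1609 * C3) * (lev i * dist z z')" by simp
  also have "\<dots> \<le> CL * (lev i * dist z z')"
    using CL(1) lev_pos[of i] by (intro mult_right_mono) auto
  finally show ?thesis by (simp add: mult.assoc)
qed

lemma wext_lip:
  assumes z: "z \<in> X" "z \<notin> H i" and y: "y \<in> X" "y \<notin> H i"
  shows "norm (wext z - wext y) \<le> CL * lev i * dist z y"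
proof -
  have mixed: "norm (interp val z - u y) \<le> CL * lev i * dist z y"
    if "z \<in> W" "z \<notin> H i" "y \<in> \<Omega>" "y \<notin> V i" for z y
  proof -
    have "norm (interp val z - u y) \<le> (3 * C3) * (lev i * dist z y)"
      using interp_near_u[OF that] by (simp add: mult.assoc mult.left_commute)
    also have "\<dots> \<le> CL * (lev i * dist z y)" using CL(4) lev_pos[of i] by (intro mult_right_mono) auto
    finally show ?thesis by (simp add: mult.assoc)
  qed
  have both: "norm (u z - u y) \<le> CL * lev i * dist z y" if "z \<in> \<Omega>" "z \<notin> V i" "y \<in> \<Omega>" "y \<notin> V i"
  proof -
    have "norm (u z - u y) \<le> Cu * (lev i * dist z y)" using u_lip that by (simp add: mult.assoc)
    also have "\<dots> \<le> CL * (lev i * dist z y)" using CL(3) lev_pos[of i] by (intro mult_right_mono) auto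
    finally show ?thesis by (simp add: mult.assoc)
  qed
  show ?thesis
    using off_H[OF z] off_H[OF y]
  proof (elim disjE conjE)
    assume "z \<in> \<Omega>" "z \<notin> V i" "y \<in> \<Omega>" "y \<notin> V i"
    then show ?thesis using both by (simp add: wext_def)
  next
    assume "z \<in> \<Omega>" "z \<notin> V i" "y \<in> W" "y \<notin> \<Omega>"
    then show ?thesis using mixed[of y z] assms by (simp add: wext_def norm_minus_commute dist_commute)
  next
    assume "z \<in> W" "z \<notin> \<Omega>" "y \<in> \<Omega>" "y \<notin> V i"
    then show ?thesis using mixed[of z y] assms by (simp add: wext_def)
  next
    assume "z \<in> W" "z \<notin> \<Omega>" "y \<in> W" "y \<notin> \<Omega>"
    then show ?thesis using interp_lipschitz[of z i y] assms by (simp add: wext_def)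
  qed
qed

text \<open>Up to a constant, the Hajlasz gradient of the extension: \<open>G0 z < lev i\<close>
  keeps \<open>z\<close> off \<open>H i\<close>, where the estimates of level i hold. As a supremum
  over countably many levels it is Borel.\<close>

definition G0 :: "'a \<Rightarrow> ennreal" where "G0 z = (SUP i. ennreal (lev i) * indicator (H i) z)"

lemma G0_borel: "G0 \<in> borel_measurable borel_X"
proof -
  have [measurable]: "H i \<in> sets borel_X" for i by (rule H(1))
  show ?thesis unfolding G0_def by measurable
qed

lemma off_H_G0: "G0 z < ennreal (lev i) \<Longrightarrow> z \<notin> H i"
proof
  assume a: "G0 z < ennreal (lev i)" "z \<in> H i"
  have "ennreal (lev i) * indicator (H i) z \<le> G0 z" unfolding G0_def by (rule SUP_upper) simp
  then show False using a by simp
qed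

lemma enn2real_le_trans:
  assumes x: "G0 x < \<infinity>" and g: "enn2real (G0 x) < t" and i: "t \<le> lev i" shows "x \<notin> H i"
proof (rule off_H_G0)
  have "G0 x = ennreal (enn2real (G0 x))" using x by simp
  also have "\<dots> < ennreal (lev i)" using g i by (intro ennreal_lessI) (auto simp: lev_pos)
  finally show "G0 x < ennreal (lev i)" .
qed

lemma le_of_all_greater:
  fixes A c g :: real
  assumes "0 \<le> c" "\<And>t. g < t \<Longrightarrow> A \<le> c * t" shows "A \<le> c * g"
proof (rule field_le_epsilon)
  fix e :: real assume e: "0 < e"
  have "A \<le> c * (g + e / (c + 1))" using assms(1) e by (intro assms(2)) simp
  also have "\<dots> = c * g + e * (c / (c + 1))" by (simp add: algebra_simps)
  also have "\<dots> \<le> c * g + e * 1" using e assms(1) by (intro add_left_mono mult_left_mono) (auto simp: divide_simps)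
  finally show "A \<le> c * g + e" by simp
qed

text \<open>For any \<open>t\<close> above the sum of the two gradients there is a level between
  \<open>t\<close> and \<open>2 * t\<close>, and both points avoid its bad set; then
  \<open>t\<close> decreases to the sum. The factor \<open>2 * (CL + 1)\<close> is shared with the
  bound on \<open>norm (wext x)\<close>.\<close>

lemma wext_hajlasz:
  assumes x: "x \<in> X" "G0 x < \<infinity>" and y: "y \<in> X" "G0 y < \<infinity>"
  shows "norm (wext x - wext y) \<le> dist x y * (2 * (CL + 1)) * (enn2real (G0 x) + enn2real (G0 y))"
proof -
  let ?g = "enn2real (G0 x) + enn2real (G0 y)"
  have "norm (wext x - wext y) \<le> (2 * CL * dist x y) * ?g"
  proof (rule le_of_all_greater)
    fix t assume t: "?g < t"
    then have t': "enn2real (G0 x) < t" "enn2real (G0 y) < t" "0 < t"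
      using enn2real_nonneg[of "G0 x"] enn2real_nonneg[of "G0 y"] by linarith+
    obtain i where i: "t \<le> lev i" "lev i \<le> 2 * t" using ex_lev[OF t'(3)] by blast
    have "norm (wext x - wext y) \<le> CL * lev i * dist x y"
      by (rule wext_lip) (use x y enn2real_le_trans[OF _ _ i(1)] t' in auto)
    also have "\<dots> \<le> CL * (2 * t) * dist x y" using i CL by (intro mult_right_mono mult_left_mono) auto
    finally show "norm (wext x - wext y) \<le> 2 * CL * dist x y * t" by (simp add: mult.commute mult.left_commute)
  qed (use CL in auto)
  also have "\<dots> \<le> (dist x y * (2 * (CL + 1))) * ?g"
    by (rule mult_right_mono) (simp_all add: algebra_simps)
  finally show ?thesis .
qed

lemma wext_le_G0:
  assumes x: "x \<in> X" "G0 x < \<infinity>"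
  shows "norm (wext x) \<le> 2 * (CL + 1) * enn2real (G0 x)"
proof -
  have "norm (wext x) \<le> 2 * enn2real (G0 x)"
  proof (rule le_of_all_greater)
    fix t assume t: "enn2real (G0 x) < t"
    then have t0: "0 < t" using enn2real_nonneg[of "G0 x"] by linarith
    obtain i where i: "t \<le> lev i" "lev i \<le> 2 * t" using ex_lev[OF t0] by blast
    have "norm (wext x) \<le> lev i" by (rule wext_bound) (use x enn2real_le_trans[OF _ t i(1)] in auto)
    then show "norm (wext x) \<le> 2 * t" using i by simp
  qed simp
  also have "\<dots> \<le> 2 * (CL + 1) * enn2real (G0 x)" using CL by (intro mult_right_mono) auto
  finally show ?thesis .
qed

text \<open>A supremum is at most the l^p norm, so the integral is bounded by a sum over levels;
  \<open>int_decode\<close> writes the sum over the integers as a series.\<close>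

lemma G0_integral:
  assumes K: "(\<Sum>n. ennreal (lev (int_decode n) powr p) * emeasure M (V (int_decode n))) \<le> K"
  shows "(\<integral>\<^sup>+z. ennreal_powr (G0 z) p \<partial>M) \<le> ennreal (D ^ 3 / \<kappa> + 1) * K"
proof -
  have Hs[measurable]: "H i \<in> sets M" for i by (rule borel_X_sets[OF H(1)])
  define T where "T n z = ennreal (lev (int_decode n) powr p) * indicator (H (int_decode n)) z" for n z
  have T[measurable]: "T n \<in> borel_measurable M" for n unfolding T_def by measurable
  have p0: "0 < p" using p by simp
  have le: "ennreal_powr (G0 z) p \<le> (\<Sum>n. T n z)" for z
  proof -
    have "G0 z \<le> ennreal_powr (\<Sum>n. T n z) (1 / p)" unfolding G0_def
    proof (rule SUP_least)
      fix i :: int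
      have "ennreal_powr (ennreal (lev i) * indicator (H i) z) p = T (int_encode i) z"
        using lev_pos[of i] by (cases "z \<in> H i") (auto simp: T_def ennreal_powr_ennreal)
      also have "\<dots> = (\<Sum>n\<in>{int_encode i}. T n z)" by simp
      also have "\<dots> \<le> (\<Sum>n. T n z)" by (rule sum_le_suminf) auto
      finally have "ennreal_powr (ennreal_powr (ennreal (lev i) * indicator (H i) z) p) (1 / p)
          \<le> ennreal_powr (\<Sum>n. T n z) (1 / p)" using p0 by (intro ennreal_powr_mono) auto
      then show "ennreal (lev i) * indicator (H i) z \<le> ennreal_powr (\<Sum>n. T n z) (1 / p)"
        by (simp add: ennreal_powr_inverse[OF p0])
    qed
    then have "ennreal_powr (G0 z) p \<le> ennreal_powr (ennreal_powr (\<Sum>n. T n z) (1 / p)) p"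
      using p0 by (intro ennreal_powr_mono) auto
    then show ?thesis by (simp add: ennreal_powr_inverse'[OF p0])
  qed
  have "(\<integral>\<^sup>+z. ennreal_powr (G0 z) p \<partial>M) \<le> (\<integral>\<^sup>+z. (\<Sum>n. T n z) \<partial>M)" by (intro nn_integral_mono le)
  also have "\<dots> = (\<Sum>n. \<integral>\<^sup>+z. T n z \<partial>M)" by (rule nn_integral_suminf) simp
  also have "\<dots> = (\<Sum>n. ennreal (lev (int_decode n) powr p) * emeasure M (H (int_decode n)))"
    unfolding T_def by (simp add: nn_integral_cmult_indicator)
  also have "\<dots> \<le> (\<Sum>n. ennreal (D ^ 3 / \<kappa> + 1) * (ennreal (lev (int_decode n) powr p) * emeasure M (V (int_decode n))))"
  proof (rule suminf_le)
    fix n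
    have "ennreal (lev (int_decode n) powr p) * emeasure M (H (int_decode n))
        \<le> ennreal (lev (int_decode n) powr p) * (ennreal (D ^ 3 / \<kappa> + 1) * emeasure M (V (int_decode n)))"
      by (rule mult_left_mono[OF H(3)]) simp
    then show "ennreal (lev (int_decode n) powr p) * emeasure M (H (int_decode n))
        \<le> ennreal (D ^ 3 / \<kappa> + 1) * (ennreal (lev (int_decode n) powr p) * emeasure M (V (int_decode n)))"
      by (simp only: mult.left_commute)
  qed auto
  also have "\<dots> = ennreal (D ^ 3 / \<kappa> + 1) * (\<Sum>n. ennreal (lev (int_decode n) powr p) * emeasure M (V (int_decode n)))"
    by simp
  also have "\<dots> \<le> ennreal (D ^ 3 / \<kappa> + 1) * K" by (rule mult_left_mono[OF K]) simp
  finally show ?thesis .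
qed

lemma wext_sobolev:
  assumes K: "(\<Sum>n. ennreal (lev (int_decode n) powr p) * emeasure M (V (int_decode n))) \<le> K" "K < \<infinity>"
  shows "wext \<in> sobolev X \<mu> p \<and>
    sobolev_norm X \<mu> p wext \<le> ennreal (10 * (CL + 1)) * ennreal_powr (ennreal (D ^ 3 / \<kappa> + 1) * K) (1 / p)"
proof -
  have p0: "0 < p" using p by simp
  have G0m: "G0 \<in> borel_measurable M" by (rule borel_X_measurable[OF G0_borel])
  define c where "c = 2 * (CL + 1)"
  have c: "0 < c" using CL by (simp add: c_def)
  have norm_G0: "Lp_norm X \<mu> p G0 \<le> ennreal_powr (ennreal (D ^ 3 / \<kappa> + 1) * K) (1 / p)"
    unfolding Lp_norm_def using p0 by (intro ennreal_powr_mono G0_integral K(1)) auto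
  also have "\<dots> < \<infinity>" using K(2) by (intro ennreal_powr_less_top) (auto simp: ennreal_mult_less_top)
  finally have fin: "Lp_norm X \<mu> p G0 < \<infinity>" .
  have cn: "Lp_norm X \<mu> p (\<lambda>x. ennreal c * G0 x) = ennreal c * Lp_norm X \<mu> p G0"
    using c by (intro Lp_norm_cmult p0 G0m) simp
  have Lp: "Lp_borel X \<mu> p (\<lambda>x. ennreal c * G0 x)"
    unfolding Lp_borel_def cn using fin G0_borel by (auto simp: ennreal_mult_less_top)
  have f: "G0 x < \<infinity> \<and> enn2real (ennreal c * G0 x) = c * enn2real (G0 x)" if "ennreal c * G0 x < \<infinity>" for x
    using that c by (cases "G0 x") (auto simp: ennreal_mult[symmetric] ennreal_mult_top)
  have "wext \<in> sobolev X \<mu> p \<and> sobolev_norm X \<mu> p wext \<le> 5 * Lp_norm X \<mu> p (\<lambda>x. ennreal c * G0 x)"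
  proof (rule hajlasz_sobolev[OF p0 Lp])
    fix x y assume x: "x \<in> X" "ennreal c * G0 x < \<infinity>" and y: "y \<in> X" "ennreal c * G0 y < \<infinity>"
    have "norm (wext x - wext y) \<le> dist x y * c * (enn2real (G0 x) + enn2real (G0 y))"
      unfolding c_def using f[OF x(2)] f[OF y(2)] x y by (intro wext_hajlasz) auto
    then show "norm (wext x - wext y) \<le> dist x y * (enn2real (ennreal c * G0 x) + enn2real (ennreal c * G0 y))"
      using f[OF x(2)] f[OF y(2)] by (simp add: algebra_simps)
  next
    fix x assume x: "x \<in> X" "ennreal c * G0 x < \<infinity>"
    then show "norm (wext x) \<le> enn2real (ennreal c * G0 x)"
      using f[OF x(2)] wext_le_G0[of x] by (simp add: c_def)
  qed
  moreover have "5 * (ennreal c * Lp_norm X \<mu> p G0) \<le> ennreal (10 * (CL + 1)) * ennreal_powr (ennreal (D ^ 3 / \<kappa> + 1) * K) (1 / p)"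
  proof -
    have "5 * (ennreal c * Lp_norm X \<mu> p G0) = (ennreal 5 * ennreal c) * Lp_norm X \<mu> p G0" by (simp add: mult.assoc)
    also have "ennreal 5 * ennreal c = ennreal (10 * (CL + 1))"
      using c by (subst ennreal_mult[symmetric]) (auto simp: c_def)
    also have "ennreal (10 * (CL + 1)) * Lp_norm X \<mu> p G0
        \<le> ennreal (10 * (CL + 1)) * ennreal_powr (ennreal (D ^ 3 / \<kappa> + 1) * K) (1 / p)"
      by (rule mult_left_mono[OF norm_G0]) simp
    finally show ?thesis .
  qed
  ultimately show ?thesis unfolding cn by (auto intro: order_trans)
qed

end

section \<open>The extension\<close>

lemma lev_shift: "2 ^ j * lev (- int m) = lev (int j - int m)"
proof -
  have "2 ^ j * lev (- int m) = 2 powr real j * 2 powr (- real m)"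
    by (simp add: lev_def powr_realpow)
  also have "\<dots> = lev (int j - int m)" by (simp add: lev_def powr_add[symmetric])
  finally show ?thesis .
qed

text \<open>A partial sum involves finitely many integers, all within some window from
  \<open>- m\<close> to \<open>m\<close>, and windows with any lower end are bounded by
  hypothesis.\<close>

lemma suminf_int_le:
  fixes g :: "int \<Rightarrow> ennreal"
  assumes "\<And>n m. (\<Sum>j<n. g (int j - int m)) \<le> K"
  shows "(\<Sum>n. g (int_decode n)) \<le> K"
  unfolding suminf_eq_SUP
proof (rule SUP_least)
  fix N :: nat
  have inj: "inj_on int_decode {..<N}" by (meson inj_int_decode inj_on_subset subset_UNIV)
  define S where "S = int_decode ` {..<N}"
  have fin: "finite S" by (simp add: S_def)
  define m where "m = nat (Max (insert 0 (abs ` S)))"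
  have m: "\<bar>i\<bar> \<le> int m" if "i \<in> S" for i
  proof -
    have "\<bar>i\<bar> \<le> Max (insert 0 (abs ` S))" using fin that by (intro Max_ge) auto
    moreover have "0 \<le> Max (insert 0 (abs ` S))" using fin by (intro Max_ge) auto
    ultimately show ?thesis unfolding m_def by linarith
  qed
  have "(\<Sum>n<N. g (int_decode n)) = (\<Sum>i\<in>S. g i)"
    unfolding S_def by (simp add: sum.reindex[OF inj])
  also have "\<dots> \<le> (\<Sum>i\<in>(\<lambda>j. int j - int m) ` {..<2 * m + 1}. g i)"
  proof (rule sum_mono2)
    show "S \<subseteq> (\<lambda>j. int j - int m) ` {..<2 * m + 1}"
    proof
      fix i assume "i \<in> S"
      then have "- int m \<le> i" "i \<le> int m" using m[of i] by auto
      then have "i = int (nat (i + int m)) - int m" "nat (i + int m) < 2 * m + 1" by auto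
      then show "i \<in> (\<lambda>j. int j - int m) ` {..<2 * m + 1}" by blast
    qed
  qed auto
  also have "\<dots> = (\<Sum>j<2 * m + 1. g (int j - int m))"
    by (subst sum.reindex) (auto simp: inj_on_def)
  also have "\<dots> \<le> K" by (rule assms)
  finally show "(\<Sum>n<N. g (int_decode n)) \<le> K" .
qed

lemma (in poincare_family) level_sum:
  assumes V: "\<And>i. emeasure M (V i) \<le> emeasure M (U (lev i)) + emeasure M {x\<in>X. ennreal (lev i) < ennreal (e x)}"
  shows "(\<Sum>n. ennreal (lev (int_decode n) powr p) * emeasure M (V (int_decode n)))
    \<le> ennreal Kfin * ((\<integral>\<^sup>+x. ennreal_powr (\<rho> x) p \<partial>M) + (\<integral>\<^sup>+x. ennreal_powr (ennreal (e x)) p \<partial>M))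
      + ennreal 2 * (\<integral>\<^sup>+x. ennreal_powr (ennreal (e x)) p \<partial>M)"
proof (rule suminf_int_le)
  fix n m :: nat
  let ?l0 = "lev (- int m)"
  have p1: "1 \<le> p" using p by simp
  have "(\<Sum>j<n. ennreal (lev (int j - int m) powr p) * emeasure M (V (int j - int m)))
      \<le> (\<Sum>j<n. ennreal (lev (int j - int m) powr p) * emeasure M (U (lev (int j - int m)))
        + ennreal (lev (int j - int m) powr p) * emeasure M {x\<in>X. ennreal (lev (int j - int m)) < ennreal (e x)})"
    unfolding distrib_left[symmetric] by (intro sum_mono mult_left_mono V) auto
  \<comment> \<open>The factor 1 matches the parameter \<open>d\<close> of
    \<open>sum_dyadic_emeasure_le\<close>.\<close>
  also have "\<dots> = (\<Sum>j<n. ennreal ((2 ^ j * ?l0) powr p) * emeasure M (U (2 ^ j * ?l0)))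
      + (\<Sum>j<n. ennreal ((2 ^ j * ?l0) powr p) * emeasure M {x\<in>X. ennreal (1 * (2 ^ j * ?l0)) < ennreal (e x)})"
    by (simp only: sum.distrib lev_shift mult_1)
  also have "\<dots> \<le> ennreal Kfin * ((\<integral>\<^sup>+x. ennreal_powr (\<rho> x) p \<partial>M) + (\<integral>\<^sup>+x. ennreal_powr (ennreal (e x)) p \<partial>M))
      + ennreal (2 / 1 powr p) * (\<integral>\<^sup>+x. ennreal_powr (ennreal (e x)) p \<partial>M)"
    by (intro add_mono U_sum sum_dyadic_emeasure_le p1 lev_pos) auto
  finally show "(\<Sum>j<n. ennreal (lev (int j - int m) powr p) * emeasure M (V (int j - int m)))
    \<le> ennreal Kfin * ((\<integral>\<^sup>+x. ennreal_powr (\<rho> x) p \<partial>M) + (\<integral>\<^sup>+x. ennreal_powr (ennreal (e x)) p \<partial>M))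
      + ennreal 2 * (\<integral>\<^sup>+x. ennreal_powr (ennreal (e x)) p \<partial>M)" by simp
qed

lemma zero_sobolev:
  fixes Z :: "'a::metric_space set"
  assumes "metric_measure Z \<mu>" "0 < p"
  shows "(\<lambda>_. 0 :: 'v::banach) \<in> sobolev Z \<mu> p \<and> sobolev_norm Z \<mu> p (\<lambda>_. 0 :: 'v) = 0"
proof -
  interpret metric_measure Z \<mu> by fact
  have Z0: "Lp_norm Z \<mu> p (\<lambda>x. 0) = 0" by (simp add: Lp_norm_def)
  have "Lp_borel Z \<mu> p (\<lambda>_. 0)" by (simp add: Lp_borel_def Z0)
  then have "(\<lambda>_. 0 :: 'v) \<in> sobolev Z \<mu> p \<and> sobolev_norm Z \<mu> p (\<lambda>_. 0 :: 'v) \<le> 5 * Lp_norm Z \<mu> p (\<lambda>_. 0)"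
    by (intro hajlasz_sobolev assms(2)) auto
  then show ?thesis by (simp add: Z0)
qed

section \<open>The given domain as an instance, with constants independent of the function\<close>

locale extension_setting =
  fixes Z \<Omega> :: "'a::metric_space set" and \<mu> :: "'a set \<Rightarrow> ennreal" and p r0 D c0 C l :: real
  assumes p: "1 < p" and mmZ: "metric_measure_space Z \<mu>"
    and \<Omega>: "\<Omega> \<in> sets (outer_measure_measure Z \<mu>)" and \<Omega>_ne: "\<Omega> \<noteq> {}"
    and D: "1 \<le> D" "\<And>x r. x \<in> Z \<Longrightarrow> 0 < r \<Longrightarrow> \<mu> (Z \<inter> ball x (2 * r)) \<le> ennreal D * \<mu> (Z \<inter> ball x r)"
    and c0: "0 < c0" "\<And>x r. x \<in> \<Omega> \<Longrightarrow> 0 < r \<Longrightarrow> r \<le> 1 \<Longrightarrow> ennreal c0 * \<mu> (Z \<inter> ball x r) \<le> \<mu> (Z \<inter> ball x r \<inter> \<Omega>)"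
    and r0: "0 < r0" and C: "0 < C" and l: "1 \<le> l"
    and PI: "\<And>x r. x \<in> \<Omega> \<Longrightarrow> 0 < r \<Longrightarrow> r \<le> r0 \<Longrightarrow> poincare_on_ball \<Omega> \<mu> p C l x r"
begin

sublocale Z: metric_measure Z \<mu> by unfold_locales (rule mmZ)

lemma \<Omega>_Z: "\<Omega> \<subseteq> Z" using sets.sets_into_space[OF \<Omega>] by simp

sublocale ZW: whitney_space Z \<mu> D
proof
  fix x r assume "x \<in> Z" "0 < (r::real)"
  then show "emeasure Z.M (Z \<inter> ball x (2 * r)) \<le> ennreal D * emeasure Z.M (Z \<inter> ball x r)"
    using D(2) by (simp add: Z.emeasure_M)
qed (rule D(1))

sublocale O: metric_measure \<Omega> \<mu>
proof
  show "metric_measure_space \<Omega> \<mu>"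
  proof (rule Z.metric_measure_subspace[OF \<Omega>])
    fix x r assume x: "x \<in> \<Omega>" "0 < (r::real)"
    define t where "t = min r 1"
    have t: "0 < t" "t \<le> 1" "t \<le> r" using x by (auto simp: t_def)
    have "0 < \<mu> (Z \<inter> ball x t)" using Z.emeasure_ball[of x t] x \<Omega>_Z t by (auto simp: Z.emeasure_M)
    then have "0 < ennreal c0 * \<mu> (Z \<inter> ball x t)" using c0(1) by (simp add: ennreal_zero_less_mult_iff)
    also have "\<dots> \<le> \<mu> (Z \<inter> ball x t \<inter> \<Omega>)" by (rule c0(2)[OF x(1) t(1,2)])
    also have "\<dots> \<le> \<mu> (\<Omega> \<inter> ball x r)" using \<Omega>_Z t by (intro Z.outer_mono) auto
    finally show "0 < \<mu> (\<Omega> \<inter> ball x r)" .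
  qed
qed

lemma sets_O_iff: "A \<in> sets O.M \<longleftrightarrow> A \<subseteq> \<Omega> \<and> A \<in> sets Z.M"
  using Z.restrict_sets_iff[OF \<Omega>] Z.outer_measure_measure_restrict[OF \<Omega>] by simp

lemma emeasure_O: "A \<in> sets O.M \<Longrightarrow> emeasure O.M A = emeasure Z.M A"
  using sets_O_iff O.emeasure_M Z.emeasure_M by simp

text \<open>Up to radius 1, measure density transfers doubling to \<open>\<Omega>\<close> at the
  cost of a factor \<open>1 / c0\<close>.\<close>

definition DO where "DO = max 1 (D / c0)"
definition q where "q = nat \<lceil>log 2 (5 * l)\<rceil>"
definition R where "R = min r0 (2 / 2 ^ q)"

sublocale OP: poincare_space \<Omega> \<mu> DO 1 p C l R q
proof
  fix x r assume x: "x \<in> \<Omega>" "0 < (r::real)" "r \<le> 1"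
  have "\<mu> (\<Omega> \<inter> ball x (2 * r)) \<le> \<mu> (Z \<inter> ball x (2 * r))" using \<Omega>_Z by (intro Z.outer_mono) auto
  also have "\<dots> \<le> ennreal D * \<mu> (Z \<inter> ball x r)" using x \<Omega>_Z by (intro D(2)) auto
  also have "\<dots> = ennreal (D / c0) * (ennreal c0 * \<mu> (Z \<inter> ball x r))"
    using D(1) c0(1) by (simp add: mult.assoc[symmetric] ennreal_mult[symmetric])
  also have "\<dots> \<le> ennreal (D / c0) * \<mu> (Z \<inter> ball x r \<inter> \<Omega>)" using x by (intro mult_left_mono c0(2)) auto
  also have "Z \<inter> ball x r \<inter> \<Omega> = \<Omega> \<inter> ball x r" using \<Omega>_Z by auto
  also have "ennreal (D / c0) * \<mu> (\<Omega> \<inter> ball x r) \<le> ennreal DO * \<mu> (\<Omega> \<inter> ball x r)"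
    by (intro mult_right_mono ennreal_leI) (auto simp: DO_def)
  finally show "emeasure O.M (\<Omega> \<inter> ball x (2 * r)) \<le> ennreal DO * emeasure O.M (\<Omega> \<inter> ball x r)"
    by (simp add: O.emeasure_M)
next
  have "5 * l = 2 powr (log 2 (5 * l))" using l by simp
  also have "\<dots> \<le> 2 powr (real q)" by (intro powr_mono) (auto simp: q_def real_nat_ceiling_ge)
  finally show "5 * l \<le> 2 ^ q" by (simp add: powr_realpow)
  show "0 < R" using r0 by (simp add: R_def)
  have "2 ^ q * R \<le> 2 ^ q * (2 / 2 ^ q)" by (intro mult_left_mono) (auto simp: R_def)
  then show "2 ^ q * R \<le> 2 * 1" by simp
  show "poincare_on_ball \<Omega> \<mu> p C l x r" if "x \<in> \<Omega>" "0 < r" "r \<le> R" for x r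
    using that by (intro PI) (auto simp: R_def)
qed (use p C l in \<open>auto simp: DO_def\<close>)

text \<open>16 is the Lipschitz constant off the bad sets for pairs within \<open>R / 2\<close>;
  \<open>4 / R\<close> covers farther pairs through the bound on the values alone.\<close>

definition Cu where "Cu = 16 + 4 / R"
text \<open>\<open>cl\<close> and \<open>Cext\<close> spell out the constants of the extension
  before a function is given: the extension is built in a context that depends on \<open>u\<close>,
  while its bound must not.\<close>

definition cl where "cl = (4 * Cu + 4) * (1609 + 6 * (2 * D ^ 6 * (16 + 64 * D ^ 6)))"
definition Cext where
  "Cext = 10 * (cl + 1) * ((D ^ 3 / (c0 / (2 * D ^ 2)) + 1) * (2 * OP.Kfin + 2)) powr (1 / p)"

lemma Kfin_nonneg: "0 \<le> OP.Kfin"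
  using OP.K2 OP.D1 by (auto simp: OP.Kfin_def intro!: add_nonneg_nonneg mult_nonneg_nonneg)

lemma Cu_pos: "0 < Cu" using OP.R by (simp add: Cu_def add_pos_pos)

lemma cl_pos: "0 < cl" using Cu_pos D(1) by (auto simp: cl_def intro!: mult_pos_pos add_pos_nonneg)

lemma Cext_pos: "0 < Cext"
proof -
  have "0 < D ^ 3 / (c0 / (2 * D ^ 2)) + 1" using D(1) c0 by (auto intro!: add_nonneg_pos)
  then have "0 < (D ^ 3 / (c0 / (2 * D ^ 2)) + 1) * (2 * OP.Kfin + 2)"
    using Kfin_nonneg by (intro mult_pos_pos) auto
  then have "0 < ((D ^ 3 / (c0 / (2 * D ^ 2)) + 1) * (2 * OP.Kfin + 2)) powr (1 / p)"
    by (rule less_imp_neq[THEN not_sym, THEN powr_gt_zero[THEN iffD2]])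
  then show ?thesis unfolding Cext_def using cl_pos by (intro mult_pos_pos) auto
qed

text \<open>The extension is built from the representative \<open>u'\<close> that has the upper
  gradient \<open>\<rho>\<close>; a single bound \<open>S\<close> for both norms keeps the final
  estimate homogeneous.\<close>

lemma extension_with_gradient:
  fixes u u' :: "'a \<Rightarrow> 'v::banach"
  assumes u: "Lp_map \<Omega> \<mu> p u" and ae: "ae_eq \<Omega> \<mu> u' u"
    and wug: "weak_upper_gradient \<Omega> \<mu> p u' \<rho>" and Lp: "Lp_borel \<Omega> \<mu> p \<rho>"
    and S: "S < \<infinity>" "Lp_norm \<Omega> \<mu> p (\<lambda>x. ennreal (norm (u x))) \<le> S" "Lp_norm \<Omega> \<mu> p \<rho> \<le> S"
  shows "\<exists>w\<in>sobolev Z \<mu> p. ae_eq \<Omega> \<mu> w u \<and> sobolev_norm Z \<mu> p w \<le> ennreal Cext * S"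
proof -
  have p0: "0 < p" "1 \<le> p" using p by auto
  have um: "u \<in> borel_measurable O.M" using u by (simp add: Lp_map_def measurable_map_def)
  have AE: "AE x in O.M. u' x = u x" using ae by (simp add: ae_eq_def)
  have u'm: "u' \<in> borel_measurable O.M" by (rule O.ae_eq_measurable[OF AE um]) simp
  obtain N0 where N0: "N0 \<in> null_sets O.M" "separable_space (top_of_set (u ` (\<Omega> - N0)))"
    using u unfolding Lp_map_def measurable_map_def by auto
  obtain Y where Y: "countable Y" "Y \<subseteq> u ` (\<Omega> - N0)" "u ` (\<Omega> - N0) \<subseteq> closure Y"
    using N0(2) unfolding separable_space_iff by blast
  \<comment> \<open>Needed to enumerate \<open>Y\<close>; a null set cannot exhaust
    \<open>\<Omega>\<close>, whose balls have positive measure.\<close>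
  have "\<Omega> - N0 \<noteq> {}"
  proof
    assume "\<Omega> - N0 = {}"
    then have "\<Omega> = N0" using N0(1) sets.sets_into_space[of N0 O.M] by auto
    then have "\<Omega> \<in> null_sets O.M" using N0(1) by simp
    obtain x where x: "x \<in> \<Omega>" using \<Omega>_ne by blast
    have "\<Omega> \<inter> ball x 1 \<in> null_sets O.M" by (rule O.null_sets_subset[OF \<open>\<Omega> \<in> null_sets O.M\<close>]) auto
    then show False using O.emeasure_ball[OF x, of 1] by auto
  qed
  then have Y_ne: "Y \<noteq> {}" using Y(3) by (metis closure_empty image_is_empty subset_empty)
  define y where "y n = from_nat_into Y n" for n
  have y: "range y = Y" using Y(1) Y_ne by (simp add: y_def range_from_nat_into)
  define f where "f n x = norm (u' x - y n)" for n x
  define e where "e x = norm (u' x)" for x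
  have em: "e \<in> borel_measurable O.M" unfolding e_def
    by (rule measurable_compose[OF u'm borel_measurable_continuous_onI]) (intro continuous_intros)
  have fm: "f n \<in> borel_measurable O.M" for n unfolding f_def
    by (rule measurable_compose[OF u'm borel_measurable_continuous_onI]) (intro continuous_intros)
  have Ie: "(\<integral>\<^sup>+x. ennreal_powr (ennreal (e x)) p \<partial>O.M) \<le> ennreal_powr S p"
  proof -
    have "(\<integral>\<^sup>+x. ennreal_powr (ennreal (e x)) p \<partial>O.M) = (\<integral>\<^sup>+x. ennreal_powr (ennreal (norm (u x))) p \<partial>O.M)"
      using AE by (intro nn_integral_cong_AE) (auto simp: e_def elim!: eventually_mono)
    also have "\<dots> = ennreal_powr (Lp_norm \<Omega> \<mu> p (\<lambda>x. ennreal (norm (u x)))) p"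
      unfolding Lp_norm_def by (rule ennreal_powr_inverse'[OF p0(1), symmetric])
    also have "\<dots> \<le> ennreal_powr S p" using S(2) p0 by (intro ennreal_powr_mono) auto
    finally show ?thesis .
  qed
  have Ir: "(\<integral>\<^sup>+x. ennreal_powr (\<rho> x) p \<partial>O.M) \<le> ennreal_powr S p"
  proof -
    have "(\<integral>\<^sup>+x. ennreal_powr (\<rho> x) p \<partial>O.M) = ennreal_powr (Lp_norm \<Omega> \<mu> p \<rho>) p"
      unfolding Lp_norm_def by (rule ennreal_powr_inverse'[OF p0(1), symmetric])
    also have "\<dots> \<le> ennreal_powr S p" using S(3) p0 by (intro ennreal_powr_mono) auto
    finally show ?thesis .
  qed
  have Sp: "ennreal_powr S p < \<infinity>" by (rule ennreal_powr_less_top[OF S(1)])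
  have f_wug: "weak_upper_gradient \<Omega> \<mu> p (f n) \<rho>" for n
  proof -
    obtain \<Gamma> where \<Gamma>: "\<rho> \<in> borel_measurable (restrict_space borel \<Omega>)" "p_negligible \<Omega> \<mu> p \<Gamma>"
      "\<forall>(\<gamma>, a, b) \<in> paths_in \<Omega> - \<Gamma>. ennreal (norm (u' (\<gamma> a) - u' (\<gamma> b))) \<le> line_integral \<rho> (\<gamma>, a, b)"
      using wug unfolding weak_upper_gradient_def by blast
    have le: "ennreal (norm (f n x - f n z)) \<le> ennreal (norm (u' x - u' z))" for x z
      using norm_triangle_ineq3[of "u' x - y n" "u' z - y n"] by (intro ennreal_leI) (simp add: f_def)
    have "\<forall>(\<gamma>, a, b) \<in> paths_in \<Omega> - \<Gamma>. ennreal (norm (f n (\<gamma> a) - f n (\<gamma> b))) \<le> line_integral \<rho> (\<gamma>, a, b)"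
      using \<Gamma>(3) order_trans[OF le] by fast
    then show ?thesis unfolding weak_upper_gradient_def using \<Gamma>(1,2) by blast
  qed
  interpret F: poincare_family \<Omega> \<mu> DO 1 p C l R q \<rho> f e "\<lambda>n. norm (y n)"
  proof
    show "(\<integral>\<^sup>+x. ennreal_powr (ennreal (e x)) p \<partial>O.M) < \<infinity>" using Ie Sp by (rule le_less_trans)
    show "\<bar>f n x - norm (y n)\<bar> \<le> e x" for n x
      using norm_triangle_ineq3[of "u' x - y n" "- y n"] by (simp add: f_def e_def)
  qed (use Lp fm f_wug em in auto)
  \<comment> \<open>Off \<open>N1\<close> the two representatives agree, the value lies in the
    closure of \<open>Y\<close>, and every \<open>f n\<close> is approximately continuous.\<close>
  define N1 where "N1 = {x\<in>\<Omega>. u' x \<noteq> u x} \<union> N0 \<union> F.N"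
  have N1: "N1 \<in> null_sets O.M"
  proof -
    have "{x\<in>\<Omega>. \<not> u' x = u x} \<in> null_sets O.M" using AE unfolding O.AE_iff_null .
    then show ?thesis unfolding N1_def using N0(1) F.N by (intro null_sets.Un) auto
  qed
  \<comment> \<open>The superlevel set of \<open>e\<close> is added so that \<open>u'\<close> is
    bounded by the level off \<open>V i\<close>.\<close>
  define V where "V i = F.U (lev i) \<union> {x\<in>\<Omega>. ennreal (lev i) < ennreal (e x)} \<union> N1" for i
  have es: "{x\<in>\<Omega>. ennreal (lev i) < ennreal (e x)} \<in> sets O.M" for i
  proof -
    have "(\<lambda>x. ennreal (e x)) \<in> borel_measurable O.M" using em by simp
    then have "{x\<in>space O.M. ennreal (lev i) < ennreal (e x)} \<in> sets O.M" by measurable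
    then show ?thesis by simp
  qed
  have VO: "V i \<in> sets O.M" for i unfolding V_def using es F.U_sets N1 by auto
  have V_le: "emeasure O.M (V i) \<le> emeasure O.M (F.U (lev i)) + emeasure O.M {x\<in>\<Omega>. ennreal (lev i) < ennreal (e x)}" for i
  proof -
    have "emeasure O.M (V i) = emeasure O.M (F.U (lev i) \<union> {x\<in>\<Omega>. ennreal (lev i) < ennreal (e x)})"
      unfolding V_def by (rule emeasure_Un_null_set) (use es F.U_sets N1 in auto)
    also have "\<dots> \<le> emeasure O.M (F.U (lev i)) + emeasure O.M {x\<in>\<Omega>. ennreal (lev i) < ennreal (e x)}"
      by (rule emeasure_subadditive) (use es F.U_sets in auto)
    finally show ?thesis .
  qed
  define K where "K = ennreal (2 * OP.Kfin + 2) * ennreal_powr S p"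
  have "(\<Sum>n. ennreal (lev (int_decode n) powr p) * emeasure O.M (V (int_decode n)))
    \<le> ennreal OP.Kfin * ((\<integral>\<^sup>+x. ennreal_powr (\<rho> x) p \<partial>O.M) + (\<integral>\<^sup>+x. ennreal_powr (ennreal (e x)) p \<partial>O.M))
      + ennreal 2 * (\<integral>\<^sup>+x. ennreal_powr (ennreal (e x)) p \<partial>O.M)"
    by (rule F.level_sum[OF V_le])
  also have "\<dots> \<le> ennreal OP.Kfin * (ennreal_powr S p + ennreal_powr S p) + ennreal 2 * ennreal_powr S p"
    by (intro add_mono mult_left_mono Ie Ir) auto
  also have "\<dots> = K"
  proof -
    have Kf: "ennreal (2 * OP.Kfin + 2) = ennreal OP.Kfin * 2 + 2"
      using Kfin_nonneg by (simp add: ennreal_plus ennreal_mult'' mult.commute)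
    show ?thesis unfolding K_def Kf by (simp add: distrib_right mult.assoc mult_2)
  qed
  finally have KO: "(\<Sum>n. ennreal (lev (int_decode n) powr p) * emeasure O.M (V (int_decode n))) \<le> K" .
  then have KZ: "(\<Sum>n. ennreal (lev (int_decode n) powr p) * emeasure Z.M (V (int_decode n))) \<le> K"
    using emeasure_O[OF VO] by simp
  have K_fin: "K < \<infinity>" using Sp by (simp add: K_def ennreal_mult_less_top)
  have bound: "norm (u' x) \<le> lev i" if "x \<in> \<Omega>" "x \<notin> V i" for x i
  proof -
    have "\<not> ennreal (lev i) < ennreal (e x)" using that by (auto simp: V_def)
    then show ?thesis using lev_pos[of i] by (simp add: e_def not_less)
  qed
  have lip: "norm (u' x - u' z) \<le> Cu * lev i * dist x z"
    if x: "x \<in> \<Omega>" "x \<notin> V i" and z: "z \<in> \<Omega>" "z \<notin> V i" for x z i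
  proof (cases "2 * dist x z \<le> R")
    case True
    \<comment> \<open>With \<open>y n\<close> close to \<open>u' z\<close>, the value
      \<open>f n z\<close> is nearly 0 and \<open>f n x\<close> nearly the norm of
      \<open>u' x - u' z\<close>; the scalar Lipschitz bound is uniform in \<open>n\<close>.\<close>
    have "norm (u' x - u' z) \<le> 16 * lev i * dist x z + t" if t: "0 < t" for t
    proof -
      have "u' z = u z" "z \<notin> N0" using z by (auto simp: V_def N1_def)
      then have "u' z \<in> closure Y" using Y(3) z(1) by auto
      then obtain v where "v \<in> Y" "dist v (u' z) < t / 2"
        using t unfolding closure_approachable by (meson half_gt_zero)
      then obtain n where n: "dist (y n) (u' z) < t / 2" using y by blast
      have fz: "f n z < t / 2" using n by (simp add: f_def dist_norm norm_minus_commute)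
      have "\<bar>f n x - f n z\<bar> \<le> 16 * lev i * dist x z"
        by (rule F.lipschitz_off_U) (use x z lev_pos True in \<open>auto simp: V_def N1_def\<close>)
      moreover have "norm (u' x - u' z) \<le> f n x + f n z"
        using norm_triangle_ineq4[of "u' x - y n" "u' z - y n"] by (simp add: f_def)
      ultimately show ?thesis using fz by linarith
    qed
    then have "norm (u' x - u' z) \<le> 16 * lev i * dist x z" by (rule field_le_epsilon)
    also have "\<dots> = 16 * (lev i * dist x z)" by simp
    also have "\<dots> \<le> Cu * (lev i * dist x z)"
      using OP.R lev_pos[of i] by (intro mult_right_mono) (auto simp: Cu_def)
    finally show ?thesis by (simp add: mult.assoc)
  next
    case False
    have "norm (u' x - u' z) \<le> 2 * lev i"
      using norm_triangle_ineq4[of "u' x" "u' z"] bound[OF x] bound[OF z] by linarith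
    also have "\<dots> \<le> 2 * lev i * (2 * dist x z / R)"
      using False OP.R lev_pos[of i] by (simp add: field_simps)
    also have "\<dots> = 4 / R * (lev i * dist x z)" by simp
    also have "\<dots> \<le> Cu * (lev i * dist x z)"
      using OP.R lev_pos[of i] by (intro mult_right_mono) (auto simp: Cu_def)
    finally show ?thesis by (simp add: mult.assoc)
  qed
  interpret E: whitney_extension Z \<mu> D \<Omega> c0 p Cu u' V
  proof
    show "\<Omega> \<noteq> {}" by (rule \<Omega>_ne)
    show "\<Omega> \<in> sets Z.M" by (rule \<Omega>)
    show "0 < c0" by (rule c0(1))
    show "1 \<le> p" by (rule p0(2))
    show "0 \<le> Cu" using Cu_pos by simp
    show "V i \<in> sets Z.M" "V i \<subseteq> \<Omega>" for i using VO[of i] sets_O_iff by auto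
    show "V j \<subseteq> V i" if "i \<le> j" for i j
    proof -
      have "lev i \<le> lev j" by (rule lev_mono[OF that])
      then have "F.U (lev j) \<subseteq> F.U (lev i)" "ennreal (lev i) \<le> ennreal (lev j)"
        by (rule F.U_antimono, rule ennreal_leI)
      then show ?thesis unfolding V_def by (auto intro: le_less_trans)
    qed
    fix x r assume x: "x \<in> \<Omega>" "0 < (r::real)" "r \<le> 1"
    have "Z \<inter> ball x r \<inter> \<Omega> \<in> sets Z.M" using \<Omega> by auto
    then show "ennreal c0 * emeasure Z.M (Z \<inter> ball x r) \<le> emeasure Z.M (Z \<inter> ball x r \<inter> \<Omega>)"
      using c0(2)[OF x] by (simp add: Z.emeasure_M)
  qed (use bound lip in auto)
  have CL: "E.CL = cl" by (simp add: E.CL_def E.C3_def E.CN_def cl_def)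
  have \<kappa>: "E.\<kappa> = c0 / (2 * D ^ 2)" by (simp add: E.\<kappa>_def)
  have w: "E.wext \<in> sobolev Z \<mu> p"
    and wn: "sobolev_norm Z \<mu> p E.wext \<le> ennreal (10 * (cl + 1)) * ennreal_powr (ennreal (D ^ 3 / (c0 / (2 * D ^ 2)) + 1) * K) (1 / p)"
    using E.wext_sobolev[OF KZ K_fin] unfolding CL \<kappa> by auto
  have "ae_eq \<Omega> \<mu> E.wext u" unfolding ae_eq_def
    using AE AE_space by eventually_elim (simp add: E.wext_def)
  moreover have "sobolev_norm Z \<mu> p E.wext \<le> ennreal Cext * S"
  proof -
    define b where "b = (D ^ 3 / (c0 / (2 * D ^ 2)) + 1) * (2 * OP.Kfin + 2)"
    have b1: "0 \<le> D ^ 3 / (c0 / (2 * D ^ 2)) + 1" using D(1) c0 by auto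
    have b2: "0 \<le> 2 * OP.Kfin + 2" using Kfin_nonneg by simp
    have "ennreal (D ^ 3 / (c0 / (2 * D ^ 2)) + 1) * K = ennreal b * ennreal_powr S p"
      unfolding K_def b_def ennreal_mult[OF b1 b2] by (simp only: mult.assoc)
    then have "ennreal_powr (ennreal (D ^ 3 / (c0 / (2 * D ^ 2)) + 1) * K) (1 / p) = ennreal (b powr (1 / p)) * S"
      using p0 b1 b2 by (simp add: ennreal_powr_cmult ennreal_powr_inverse b_def)
    then have "sobolev_norm Z \<mu> p E.wext \<le> ennreal (10 * (cl + 1)) * (ennreal (b powr (1 / p)) * S)"
      using wn by simp
    also have "\<dots> = ennreal Cext * S"
      using cl_pos by (simp add: Cext_def b_def ennreal_mult mult.assoc)
    finally show ?thesis .
  qed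
  ultimately show ?thesis using w by blast
qed

text \<open>The infimum in the norm need not be attained. A positive L^p norm of \<open>u\<close>
  leaves room for a gradient whose norm is below the full Sobolev norm; if the L^p norm is 0, then
  \<open>u\<close> vanishes almost everywhere and 0 extends it.\<close>

lemma extension_exists:
  fixes u :: "'a \<Rightarrow> 'v::banach"
  assumes u: "u \<in> sobolev \<Omega> \<mu> p"
  shows "\<exists>w\<in>sobolev Z \<mu> p. ae_eq \<Omega> \<mu> w u \<and> sobolev_norm Z \<mu> p w \<le> ennreal (2 * Cext) * sobolev_norm \<Omega> \<mu> p u"
proof -
  have p0: "0 < p" using p by simp
  define n1 where "n1 = Lp_norm \<Omega> \<mu> p (\<lambda>x. ennreal (norm (u x)))"
  define n2 where "n2 = (INF \<rho>\<in>sobolev_gradients \<Omega> \<mu> p u. Lp_norm \<Omega> \<mu> p \<rho>)"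
  have Lp: "Lp_map \<Omega> \<mu> p u" and ne: "sobolev_gradients \<Omega> \<mu> p u \<noteq> {}" using u by (auto simp: sobolev_def)
  have n1: "n1 < \<infinity>" using Lp by (simp add: Lp_map_def n1_def)
  have norm: "sobolev_norm \<Omega> \<mu> p u = n1 + n2" by (simp add: sobolev_norm_def n1_def n2_def)
  have n2: "n2 < \<infinity>"
  proof -
    obtain \<rho> where \<rho>: "\<rho> \<in> sobolev_gradients \<Omega> \<mu> p u" using ne by blast
    then have "n2 \<le> Lp_norm \<Omega> \<mu> p \<rho>" unfolding n2_def by (rule INF_lower)
    also have "\<dots> < \<infinity>" using \<rho> by (auto simp: sobolev_gradients_def Lp_borel_def)
    finally show ?thesis .
  qed
  show ?thesis
  proof (cases "n1 = 0")
    case True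
    have um: "(\<lambda>x. ennreal_powr (ennreal (norm (u x))) p) \<in> borel_measurable O.M"
    proof -
      have "u \<in> borel_measurable O.M" using Lp by (simp add: Lp_map_def measurable_map_def)
      then have "(\<lambda>x. norm (u x)) \<in> borel_measurable O.M"
        by (rule measurable_compose[OF _ borel_measurable_continuous_onI]) (intro continuous_intros)
      then show ?thesis by measurable
    qed
    have "(\<integral>\<^sup>+x. ennreal_powr (ennreal (norm (u x))) p \<partial>O.M) = ennreal_powr n1 p"
      unfolding n1_def Lp_norm_def by (rule ennreal_powr_inverse'[OF p0, symmetric])
    then have "(\<integral>\<^sup>+x. ennreal_powr (ennreal (norm (u x))) p \<partial>O.M) = 0" using True by simp
    then have "AE x in O.M. ennreal_powr (ennreal (norm (u x))) p = 0"
      using um by (simp add: nn_integral_0_iff_AE)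
    then have "ae_eq \<Omega> \<mu> (\<lambda>_. 0) u" unfolding ae_eq_def
    proof (rule eventually_mono)
      fix x assume "ennreal_powr (ennreal (norm (u x))) p = 0"
      then show "0 = u x" by (simp add: ennreal_powr_ennreal)
    qed
    moreover have "(\<lambda>_. 0 :: 'v) \<in> sobolev Z \<mu> p" "sobolev_norm Z \<mu> p (\<lambda>_. 0 :: 'v) = 0"
      using zero_sobolev[OF Z.metric_measure_axioms p0] by blast+
    ultimately show ?thesis by (intro bexI[of _ "\<lambda>_. 0"]) auto
  next
    case False
    have "n2 < n2 + n1" using False n2 ennreal_add_left_cancel_less[of n2 0 n1] by (simp add: zero_less_iff_neq_zero)
    then obtain \<rho> where \<rho>: "\<rho> \<in> sobolev_gradients \<Omega> \<mu> p u" "Lp_norm \<Omega> \<mu> p \<rho> < n2 + n1"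
      unfolding n2_def INF_less_iff by blast
    then obtain u' where u': "ae_eq \<Omega> \<mu> u' u" "weak_upper_gradient \<Omega> \<mu> p u' \<rho>" "Lp_borel \<Omega> \<mu> p \<rho>"
      by (auto simp: sobolev_gradients_def)
    have "\<exists>w\<in>sobolev Z \<mu> p. ae_eq \<Omega> \<mu> w u \<and> sobolev_norm Z \<mu> p w \<le> ennreal Cext * (n1 + n2)"
    proof (rule extension_with_gradient[OF Lp u'])
      show "n1 + n2 < \<infinity>" using n1 n2 by simp
      show "Lp_norm \<Omega> \<mu> p (\<lambda>x. ennreal (norm (u x))) \<le> n1 + n2" by (simp add: n1_def add_increasing2)
      show "Lp_norm \<Omega> \<mu> p \<rho> \<le> n1 + n2" using \<rho>(2) by (simp add: add.commute less_imp_le)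
    qed
    moreover have "ennreal Cext * (n1 + n2) \<le> ennreal (2 * Cext) * sobolev_norm \<Omega> \<mu> p u"
      unfolding norm using Cext_pos by (intro mult_right_mono ennreal_leI) auto
    ultimately show ?thesis by (meson order_trans)
  qed
qed

end

text \<open>The operator has to respect almost-everywhere equality, so it first passes to one chosen
  representative of the class; the Sobolev norm depends only on the class and is unchanged.\<close>

lemma sobolev_extension_setI:
  fixes Z \<Omega> :: "'a::metric_space set"
  assumes C: "0 < (C::real)"
    and ex: "\<And>u :: 'a \<Rightarrow> 'v::banach. u \<in> sobolev \<Omega> \<mu> p \<Longrightarrow> \<exists>w\<in>sobolev Z \<mu> p. ae_eq \<Omega> \<mu> w u \<and>
      sobolev_norm Z \<mu> p w \<le> ennreal C * sobolev_norm \<Omega> \<mu> p u"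
  shows "sobolev_extension_set Z \<mu> p \<Omega> TYPE('v)"
proof -
  define rep where "rep u = (SOME v. v \<in> sobolev \<Omega> \<mu> p \<and> ae_eq \<Omega> \<mu> u v)" for u :: "'a \<Rightarrow> 'v"
  define E where "E u = (SOME w. w \<in> sobolev Z \<mu> p \<and> ae_eq \<Omega> \<mu> w (rep u) \<and>
      sobolev_norm Z \<mu> p w \<le> ennreal C * sobolev_norm \<Omega> \<mu> p (rep u))" for u :: "'a \<Rightarrow> 'v"
  have sym: "ae_eq \<Omega> \<mu> u v \<Longrightarrow> ae_eq \<Omega> \<mu> v u" for u v :: "'a \<Rightarrow> 'v"
    unfolding ae_eq_def by (auto elim!: eventually_mono)
  have trans: "ae_eq \<Omega> \<mu> u v \<Longrightarrow> ae_eq \<Omega> \<mu> v w \<Longrightarrow> ae_eq \<Omega> \<mu> u w" for u v w :: "'a \<Rightarrow> 'v"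
    unfolding ae_eq_def
    by (erule (1) eventually_elim2) simp
  have rep: "rep u \<in> sobolev \<Omega> \<mu> p" "ae_eq \<Omega> \<mu> u (rep u)" if "u \<in> sobolev \<Omega> \<mu> p" for u :: "'a \<Rightarrow> 'v"
  proof -
    have "\<exists>v. v \<in> sobolev \<Omega> \<mu> p \<and> ae_eq \<Omega> \<mu> u v" using that by (intro exI[of _ u]) (simp add: ae_eq_def)
    then have "rep u \<in> sobolev \<Omega> \<mu> p \<and> ae_eq \<Omega> \<mu> u (rep u)" unfolding rep_def by (rule someI_ex)
    then show "rep u \<in> sobolev \<Omega> \<mu> p" "ae_eq \<Omega> \<mu> u (rep u)" by auto
  qed
  have E: "E u \<in> sobolev Z \<mu> p \<and> ae_eq \<Omega> \<mu> (E u) (rep u) \<and>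
      sobolev_norm Z \<mu> p (E u) \<le> ennreal C * sobolev_norm \<Omega> \<mu> p (rep u)" if "u \<in> sobolev \<Omega> \<mu> p" for u
  proof -
    have "\<exists>w. w \<in> sobolev Z \<mu> p \<and> ae_eq \<Omega> \<mu> w (rep u) \<and>
      sobolev_norm Z \<mu> p w \<le> ennreal C * sobolev_norm \<Omega> \<mu> p (rep u)"
      using ex[OF rep(1)[OF that]] by blast
    then show ?thesis unfolding E_def by (rule someI_ex)
  qed
  \<comment> \<open>Equivalent functions define the same predicate, so the choice operator returns
    the same representative.\<close>
  have rep_eq: "rep u = rep v" if "ae_eq \<Omega> \<mu> u v" for u v
    unfolding rep_def using that sym trans by metis
  have norm_eq: "sobolev_norm \<Omega> \<mu> p u = sobolev_norm \<Omega> \<mu> p v" if uv: "ae_eq \<Omega> \<mu> u v" for u v :: "'a \<Rightarrow> 'v"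
  proof -
    have "sobolev_gradients \<Omega> \<mu> p u = sobolev_gradients \<Omega> \<mu> p v"
      unfolding sobolev_gradients_def using trans[OF _ uv] trans[OF _ sym[OF uv]] by blast
    moreover have "Lp_norm \<Omega> \<mu> p (\<lambda>x. ennreal (norm (u x))) = Lp_norm \<Omega> \<mu> p (\<lambda>x. ennreal (norm (v x)))"
    proof -
      have "(\<integral>\<^sup>+x. ennreal_powr (ennreal (norm (u x))) p \<partial>outer_measure_measure \<Omega> \<mu>)
          = (\<integral>\<^sup>+x. ennreal_powr (ennreal (norm (v x))) p \<partial>outer_measure_measure \<Omega> \<mu>)"
        using uv unfolding ae_eq_def by (intro nn_integral_cong_AE) (auto elim!: eventually_mono)
      then show ?thesis by (simp add: Lp_norm_def)
    qed
    ultimately show ?thesis by (simp add: sobolev_norm_def)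
  qed
  show ?thesis unfolding sobolev_extension_set_def
  proof (intro exI conjI ballI impI)
    show "0 < C" by fact
    fix u v :: "'a \<Rightarrow> 'v" assume "ae_eq \<Omega> \<mu> u v"
    then have "E u = E v" unfolding E_def by (simp only: rep_eq[of u v])
    then show "ae_eq Z \<mu> (E u) (E v)" by (simp add: ae_eq_def)
  next
    fix u :: "'a \<Rightarrow> 'v" assume u: "u \<in> sobolev \<Omega> \<mu> p"
    show "E u \<in> sobolev Z \<mu> p" using E[OF u] by blast
    show "ae_eq \<Omega> \<mu> (E u) u" using E[OF u] trans sym[OF rep(2)[OF u]] by blast
    show "sobolev_norm Z \<mu> p (E u) \<le> ennreal C * sobolev_norm \<Omega> \<mu> p u"
      using E[OF u] norm_eq[OF rep(2)[OF u]] by simp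
  qed
qed

theorem proposition1p10:
  fixes Z \<Omega> :: "'a::metric_space set"
    and \<mu> :: "'a set \<Rightarrow> ennreal"
    and p r0 :: real
  assumes "1 < p"
    and "PI_space Z \<mu> p"
    and "\<Omega> \<in> sets (outer_measure_measure Z \<mu>)"
    and "measure_density Z \<mu> \<Omega>"
    and "0 < r0"
    and "weak_poincare_up_to \<Omega> \<mu> p r0"
  shows "sobolev_extension_set Z \<mu> p \<Omega> TYPE('v::banach)"
proof (cases "\<Omega> = {}")
  \<comment> \<open>The Whitney construction needs a point of \<open>\<Omega>\<close>. Over the
    empty set all functions agree almost everywhere, so 0 is an extension.\<close>
  case True
  have mm: "metric_measure Z \<mu>" using assms(2) by unfold_locales (simp add: PI_space_def)
  have p0: "0 < p" using assms(1) by simp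
  show ?thesis
  proof (rule sobolev_extension_setI[of 1])
    fix u :: "'a \<Rightarrow> 'v"
    have "space (outer_measure_measure \<Omega> \<mu>) = {}" unfolding outer_measure_measure_def True
      by (simp add: space_measure_of_conv)
    then have "ae_eq \<Omega> \<mu> (\<lambda>_. 0) u" unfolding ae_eq_def using AE_space[of "outer_measure_measure \<Omega> \<mu>"]
      by (auto elim: eventually_mono)
    then show "\<exists>w\<in>sobolev Z \<mu> p. ae_eq \<Omega> \<mu> w u \<and> sobolev_norm Z \<mu> p w \<le> ennreal 1 * sobolev_norm \<Omega> \<mu> p u"
      using zero_sobolev[OF mm p0, where 'v = 'v] by (intro bexI[of _ "\<lambda>_. 0"]) auto
  qed simp
next
  case False
  obtain c where c: "0 < c" "\<And>x r. x \<in> Z \<Longrightarrow> 0 < r \<Longrightarrow> \<mu> (Z \<inter> ball x (2 * r)) \<le> ennreal c * \<mu> (Z \<inter> ball x r)"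
    using assms(2) unfolding PI_space_def doubling_def by blast
  obtain c0 where c0: "0 < c0" "\<And>x r. x \<in> \<Omega> \<Longrightarrow> r \<in> {0<..1} \<Longrightarrow> ennreal c0 * \<mu> (Z \<inter> ball x r) \<le> \<mu> (Z \<inter> ball x r \<inter> \<Omega>)"
    using assms(4) unfolding measure_density_def by blast
  obtain C l where Cl: "0 < C" "1 \<le> l" "\<And>x r. x \<in> \<Omega> \<Longrightarrow> 0 < r \<Longrightarrow> r \<le> r0 \<Longrightarrow> poincare_on_ball \<Omega> \<mu> p C l x r"
    using assms(6) unfolding weak_poincare_up_to_def by blast
  interpret extension_setting Z \<Omega> \<mu> p r0 "max 1 c" c0 C l
  proof
    show "metric_measure_space Z \<mu>" using assms(2) by (simp add: PI_space_def)
    fix x r assume "x \<in> Z" "0 < (r::real)"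
    then have "\<mu> (Z \<inter> ball x (2 * r)) \<le> ennreal c * \<mu> (Z \<inter> ball x r)" by (rule c(2))
    also have "\<dots> \<le> ennreal (max 1 c) * \<mu> (Z \<inter> ball x r)" by (intro mult_right_mono ennreal_leI) auto
    finally show "\<mu> (Z \<inter> ball x (2 * r)) \<le> ennreal (max 1 c) * \<mu> (Z \<inter> ball x r)" .
  qed (use assms False c0 Cl in auto)
  show ?thesis
    by (rule sobolev_extension_setI[where C = "2 * Cext"]) (use Cext_pos extension_exists in auto)
qed

end
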